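(* Let $\mathscr A$ be a profinitary hereditary abelian category. Then the Hall algebra $H_{\mathscr A}$ is a Nichols algebra, in the braided tensor category $\mathscr C_{\chi_{\mathscr A}}$, of the braided space $V_{\mathscr A}$ of its primitive elements; that is, $H_{\mathscr A}\cong\mathcal B(V_{\mathscr A})$.
   Context: All categories are essentially small. $\mathrm{Iso}\,\mathscr A$ is the set of isomorphism classes $[X]$ of objects, an abelian monoid under $\oplus$. $\underline{\mathrm{Ext}}^1_{\mathscr A}(A,B)$ is the set of all $[X]$ such that there is a short exact sequence $B\rightarrowtail X\twoheadrightarrow A$. The Grothendieck monoid $\Gamma_{\mathscr A}$ is the quotient of $\mathrm{Iso}\,\mathscr A$ by the congruence which is the transitive closure of: $[X]\equiv[Y]$ if $[X],[Y]\in\underline{\mathrm{Ext}}^1_{\mathscr A}(M,N)$ for some $M,N$; $|X|$ is the image of $X$ in $\Gamma_{\mathscr A}$. $\mathscr A$ is profinitary if all Hom sets are finite and $\{[X]:|X|=\gamma\}$ is finite for all $\gamma\in\Gamma_{\mathscr A}$. $\mathscr A$ is hereditary if $\mathrm{Ext}^i_{\mathscr A}(M,N)=0$ for all $i>1$ and all $M,N$. (A profinitary abelian category is cofinitary, i.e. for every $[X]$ there are finitely many $([A],[B])$ with $[X]\in\underline{\mathrm{Ext}}^1_{\mathscr A}(A,B)$, so the sums below are finite.) Let $\mathcal E(A,B)_X$ be the set of all short exact sequences $B\rightarrowtail X\twoheadrightarrow A$ and $F_{A,B}^X=\#\mathcal E(A,B)_X/(\#\mathrm{Aut}\,A\cdot\#\mathrm{Aut}\,B)$.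 The Hall algebra $H_{\mathscr A}$ is the $\mathbb Q$-vector space with basis $\mathrm{Iso}\,\mathscr A$, product $[A]\cdot[B]=\sum_{[C]}F_{A,B}^C[C]$, unit $1=[0]$, coproduct $\Delta([C])=\sum_{[A],[B]}F^{A,B}_C\,[A]\otimes[B]$ with $F^{A,B}_C=\frac{\#\mathrm{Aut}\,A\cdot\#\mathrm{Aut}\,B}{\#\mathrm{Aut}\,C}F_{B,A}^C$, and counit $\varepsilon([C])=\delta_{[0],[C]}$. It is $\Gamma_{\mathscr A}$-graded by $[M]\mapsto|M|$. $V_{\mathscr A}=\mathrm{Prim}(H_{\mathscr A})=\{v:\Delta(v)=v\otimes1+1\otimes v\}$. $\mathscr C_{\chi_{\mathscr A}}$ is the tensor category of $\Gamma_{\mathscr A}$-graded $\mathbb Q$-vector spaces with braiding $\Psi_{U,V}(u\otimes v)=\chi_{\mathscr A}(\gamma,\delta)\,v\otimes u$ for $u\in U_\gamma$, $v\in V_\delta$, where $\chi_{\mathscr A}:\Gamma_{\mathscr A}\times\Gamma_{\mathscr A}\to\mathbb Q^\times$ is the (well-defined) bicharacter $\chi_{\mathscr A}(|M|,|N|)=\#\mathrm{Ext}^1_{\mathscr A}(M,N)/\#\mathrm{Hom}_{\mathscr A}(M,N)$. For a braided $\mathbb F$-linear tensor category $(\mathscr C,\Psi)$ and an object $V$, a Nichols algebra $\mathcal B(V)$ of $V$ is a graded unital bialgebra $B=\bigoplus_{n\ge0}B_n$ in $(\mathscr C,\Psi)$ with $B_0=\mathbb F$, $B_1=V$, such that $B_1=\mathrm{Prim}(B)$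 and $B$ is generated as an algebra by $B_1$ (it is unique up to isomorphism). *)

theory Defs
  imports Complex_Main "HOL-Algebra.Group" "HOL-Library.Poly_Mapping"
begin

section \<open>Abelian categories\<close>

text \<open>Arrows carry their domain and codomain; \<open>Comp C g f\<close> is \<open>g\<close> after \<open>f\<close>. The additive
  structure on the Hom sets is part of the data: \<open>Add\<close> is the sum of two parallel arrows and
  \<open>Zer C A B\<close> is the zero arrow from \<open>A\<close> to \<open>B\<close>. Only the values of these operations on objects
  and on arrows with matching ends are ever constrained or used.\<close>

record ('o, 'm) cat =
  Obj :: "'o set"
  Arr :: "'m set"
  Dom :: "'m \<Rightarrow> 'o"
  Cod :: "'m \<Rightarrow> 'o"
  Idt :: "'o \<Rightarrow> 'm"
  Comp :: "'m \<Rightarrow> 'm \<Rightarrow> 'm"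
  Add :: "'m \<Rightarrow> 'm \<Rightarrow> 'm"
  Zer :: "'o \<Rightarrow> 'o \<Rightarrow> 'm"

definition Hom :: "('o, 'm) cat \<Rightarrow> 'o \<Rightarrow> 'o \<Rightarrow> 'm set" where
  "Hom C A B = {f \<in> Arr C. Dom C f = A \<and> Cod C f = B}"

definition Hom_group :: "('o, 'm) cat \<Rightarrow> 'o \<Rightarrow> 'o \<Rightarrow> 'm monoid" where
  "Hom_group C A B = \<lparr>carrier = Hom C A B, mult = Add C, one = Zer C A B\<rparr>"

definition is_mono :: "('o, 'm) cat \<Rightarrow> 'm \<Rightarrow> bool" where
  "is_mono C f \<longleftrightarrow> f \<in> Arr C \<and>
     (\<forall>X\<in>Obj C. \<forall>g\<in>Hom C X (Dom C f). \<forall>h\<in>Hom C X (Dom C f).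
        Comp C f g = Comp C f h \<longrightarrow> g = h)"

definition is_epi :: "('o, 'm) cat \<Rightarrow> 'm \<Rightarrow> bool" where
  "is_epi C f \<longleftrightarrow> f \<in> Arr C \<and>
     (\<forall>X\<in>Obj C. \<forall>g\<in>Hom C (Cod C f) X. \<forall>h\<in>Hom C (Cod C f) X.
        Comp C g f = Comp C h f \<longrightarrow> g = h)"

definition isos :: "('o, 'm) cat \<Rightarrow> 'o \<Rightarrow> 'o \<Rightarrow> 'm set" where
  "isos C A B = {f \<in> Hom C A B. \<exists>g\<in>Hom C B A. Comp C g f = Idt C A \<and> Comp C f g = Idt C B}"

definition is_zero_object :: "('o, 'm) cat \<Rightarrow> 'o \<Rightarrow> bool" where
  "is_zero_object C Z \<longleftrightarrow> Z \<in> Obj C \<and>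
     (\<forall>X\<in>Obj C. (\<exists>!f. f \<in> Hom C Z X) \<and> (\<exists>!f. f \<in> Hom C X Z))"

definition is_biproduct :: "('o, 'm) cat \<Rightarrow> 'o \<Rightarrow> 'o \<Rightarrow> 'o \<Rightarrow> bool" where
  "is_biproduct C A B S \<longleftrightarrow> S \<in> Obj C \<and>
     (\<exists>i\<^sub>1\<in>Hom C A S. \<exists>i\<^sub>2\<in>Hom C B S. \<exists>p\<^sub>1\<in>Hom C S A. \<exists>p\<^sub>2\<in>Hom C S B.
        Comp C p\<^sub>1 i\<^sub>1 = Idt C A \<and> Comp C p\<^sub>2 i\<^sub>2 = Idt C B \<and>
        Comp C p\<^sub>2 i\<^sub>1 = Zer C A B \<and> Comp C p\<^sub>1 i\<^sub>2 = Zer C B A \<and>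
        Add C (Comp C i\<^sub>1 p\<^sub>1) (Comp C i\<^sub>2 p\<^sub>2) = Idt C S)"

definition is_kernel :: "('o, 'm) cat \<Rightarrow> 'm \<Rightarrow> 'm \<Rightarrow> bool" where
  "is_kernel C f k \<longleftrightarrow> f \<in> Arr C \<and> k \<in> Arr C \<and> Cod C k = Dom C f \<and>
     Comp C f k = Zer C (Dom C k) (Cod C f) \<and>
     (\<forall>X\<in>Obj C. \<forall>h\<in>Hom C X (Dom C f). Comp C f h = Zer C X (Cod C f) \<longrightarrow>
        (\<exists>!u. u \<in> Hom C X (Dom C k) \<and> Comp C k u = h))"

definition is_cokernel :: "('o, 'm) cat \<Rightarrow> 'm \<Rightarrow> 'm \<Rightarrow> bool" where
  "is_cokernel C f q \<longleftrightarrow> f \<in> Arr C \<and> q \<in> Arr C \<and> Dom C q = Cod C f \<and>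
     Comp C q f = Zer C (Dom C f) (Cod C q) \<and>
     (\<forall>X\<in>Obj C. \<forall>h\<in>Hom C (Cod C f) X. Comp C h f = Zer C (Dom C f) X \<longrightarrow>
        (\<exists>!u. u \<in> Hom C (Cod C q) X \<and> Comp C u q = h))"

locale category =
  fixes C :: "('o, 'm) cat"
  assumes ends_in_Obj: "f \<in> Arr C \<Longrightarrow> Dom C f \<in> Obj C \<and> Cod C f \<in> Obj C"
    and Idt_in_Hom: "X \<in> Obj C \<Longrightarrow> Idt C X \<in> Hom C X X"
    and Comp_in_Hom: "f \<in> Hom C X Y \<Longrightarrow> g \<in> Hom C Y Z \<Longrightarrow> Comp C g f \<in> Hom C X Z"
    and Comp_assoc: "f \<in> Hom C W X \<Longrightarrow> g \<in> Hom C X Y \<Longrightarrow> h \<in> Hom C Y Z \<Longrightarrow>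
          Comp C h (Comp C g f) = Comp C (Comp C h g) f"
    and Comp_Idt_left: "f \<in> Hom C X Y \<Longrightarrow> Comp C (Idt C Y) f = f"
    and Comp_Idt_right: "f \<in> Hom C X Y \<Longrightarrow> Comp C f (Idt C X) = f"

locale preadditive_category = category +
  assumes Hom_comm_group: "X \<in> Obj C \<Longrightarrow> Y \<in> Obj C \<Longrightarrow> comm_group (Hom_group C X Y)"
    and Comp_Add_right: "f \<in> Hom C X Y \<Longrightarrow> g \<in> Hom C X Y \<Longrightarrow> h \<in> Hom C Y Z \<Longrightarrow>
          Comp C h (Add C f g) = Add C (Comp C h f) (Comp C h g)"
    and Comp_Add_left: "f \<in> Hom C Y Z \<Longrightarrow> g \<in> Hom C Y Z \<Longrightarrow> h \<in> Hom C X Y \<Longrightarrow>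
          Comp C (Add C f g) h = Add C (Comp C f h) (Comp C g h)"

locale abelian_category = preadditive_category +
  assumes ex_zero_object: "\<exists>Z. is_zero_object C Z"
    and ex_biproduct: "X \<in> Obj C \<Longrightarrow> Y \<in> Obj C \<Longrightarrow> \<exists>S. is_biproduct C X Y S"
    and ex_kernel: "f \<in> Arr C \<Longrightarrow> \<exists>k. is_kernel C f k"
    and ex_cokernel: "f \<in> Arr C \<Longrightarrow> \<exists>q. is_cokernel C f q"
    and mono_is_kernel: "is_mono C f \<Longrightarrow> \<exists>g. is_kernel C g f"
    and epi_is_cokernel: "is_epi C f \<Longrightarrow> \<exists>g. is_cokernel C g f"


section \<open>Exact sequences and Yoneda Ext\<close>

text \<open>Exactness of \<open>X \<rightarrow> Y \<rightarrow> Z\<close> at \<open>Y\<close>: the image of \<open>f\<close>, obtained from an epi-mono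
  factorisation of \<open>f\<close>, is the kernel of \<open>g\<close>.\<close>

definition exact_at :: "('o, 'm) cat \<Rightarrow> 'm \<Rightarrow> 'm \<Rightarrow> bool" where
  "exact_at C f g \<longleftrightarrow> f \<in> Arr C \<and> g \<in> Arr C \<and> Cod C f = Dom C g \<and>
     (\<exists>e k. is_epi C e \<and> is_kernel C g k \<and> Dom C e = Dom C f \<and> Cod C e = Dom C k \<and>
        f = Comp C k e)"

text \<open>\<open>short_exact C A B X\<close> is the set of short exact sequences with sub-object \<open>B\<close>, middle
  term \<open>X\<close> and quotient \<open>A\<close>.\<close>

definition short_exact :: "('o, 'm) cat \<Rightarrow> 'o \<Rightarrow> 'o \<Rightarrow> 'o \<Rightarrow> ('m \<times> 'm) set" where
  "short_exact C A B X =
     {(f, g). f \<in> Hom C B X \<and> g \<in> Hom C X A \<and> is_mono C f \<and> is_epi C g \<and> exact_at C f g}"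

text \<open>An \<open>n\<close>-extension of \<open>M\<close> by \<open>N\<close> (\<open>n \<ge> 1\<close>), that is an exact sequence
  \<open>0 \<rightarrow> N \<rightarrow> E\<^sub>1 \<rightarrow> \<dots> \<rightarrow> E\<^sub>n \<rightarrow> M \<rightarrow> 0\<close>, is the list of its \<open>n + 1\<close> arrows between nonzero
  positions. The classes of such sequences under the equivalence relation generated by the maps of
  sequences which are the identity on \<open>N\<close> and \<open>M\<close> form \<open>Ext\<^sup>n(M,N)\<close>.\<close>

definition extensions :: "('o, 'm) cat \<Rightarrow> nat \<Rightarrow> 'o \<Rightarrow> 'o \<Rightarrow> 'm list set" where
  "extensions C n M N = {fs. length fs = Suc n \<and> set fs \<subseteq> Arr C \<and>
     Dom C (fs ! 0) = N \<and> Cod C (fs ! n) = M \<and> is_mono C (fs ! 0) \<and> is_epi C (fs ! n) \<and>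
     (\<forall>i<n. exact_at C (fs ! i) (fs ! Suc i))}"

definition extension_maps :: "('o, 'm) cat \<Rightarrow> nat \<Rightarrow> 'o \<Rightarrow> 'o \<Rightarrow> ('m list \<times> 'm list) set" where
  "extension_maps C n M N = {(fs, gs). fs \<in> extensions C n M N \<and> gs \<in> extensions C n M N \<and>
     (\<exists>h. h 0 = Idt C N \<and> h (Suc n) = Idt C M \<and>
        (\<forall>i\<le>n. h i \<in> Hom C (Dom C (fs ! i)) (Dom C (gs ! i))) \<and>
        (\<forall>i\<le>n. Comp C (h (Suc i)) (fs ! i) = Comp C (gs ! i) (h i)))}"

definition Ext :: "('o, 'm) cat \<Rightarrow> nat \<Rightarrow> 'o \<Rightarrow> 'o \<Rightarrow> 'm list set set" where
  "Ext C n M N = extensions C n M N //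
     (extension_maps C n M N \<union> (extension_maps C n M N)\<inverse>)\<^sup>*"

text \<open>The Baer sum is not needed to express that the group \<open>Ext\<^sup>i(M,N)\<close> vanishes: a group is zero
  iff it has exactly one element.\<close>

definition hereditary :: "('o, 'm) cat \<Rightarrow> bool" where
  "hereditary C \<longleftrightarrow> (\<forall>i>1. \<forall>M\<in>Obj C. \<forall>N\<in>Obj C. is_singleton (Ext C i M N))"


section \<open>Isomorphism classes and the Grothendieck monoid\<close>

definition iso_class :: "('o, 'm) cat \<Rightarrow> 'o \<Rightarrow> 'o set" where
  "iso_class C X = {Y \<in> Obj C. isos C X Y \<noteq> {}}"

definition Iso :: "('o, 'm) cat \<Rightarrow> 'o set set" where
  "Iso C = iso_class C ` Obj C"

definition iso_sum :: "('o, 'm) cat \<Rightarrow> 'o set \<Rightarrow> 'o set \<Rightarrow> 'o set" where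
  "iso_sum C a b = {S. \<exists>A\<in>a. \<exists>B\<in>b. is_biproduct C A B S}"

definition zero_class :: "('o, 'm) cat \<Rightarrow> 'o set" where
  "zero_class C = {Z. is_zero_object C Z}"

definition Ext_classes :: "('o, 'm) cat \<Rightarrow> 'o \<Rightarrow> 'o \<Rightarrow> 'o set set" where
  "Ext_classes C A B = {iso_class C X | X. X \<in> Obj C \<and> short_exact C A B X \<noteq> {}}"

definition groth_rel :: "('o, 'm) cat \<Rightarrow> ('o set \<times> 'o set) set" where
  "groth_rel C =
     {(x, y). \<exists>M\<in>Obj C. \<exists>N\<in>Obj C. x \<in> Ext_classes C M N \<and> y \<in> Ext_classes C M N}\<^sup>+"

definition groth_class :: "('o, 'm) cat \<Rightarrow> 'o \<Rightarrow> 'o set set" where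
  "groth_class C X = groth_rel C `` {iso_class C X}"

text \<open>The product of two congruence classes is the congruence class containing all the sums of
  their elements.\<close>

definition groth_monoid :: "('o, 'm) cat \<Rightarrow> 'o set set monoid" where
  "groth_monoid C =
     \<lparr>carrier = Iso C // groth_rel C,
      mult = (\<lambda>\<gamma> \<delta>. groth_rel C `` {iso_sum C x y | x y. x \<in> \<gamma> \<and> y \<in> \<delta>}),
      one = groth_rel C `` {zero_class C}\<rparr>"

definition profinitary :: "('o, 'm) cat \<Rightarrow> bool" where
  "profinitary C \<longleftrightarrow>
     (\<forall>X\<in>Obj C. \<forall>Y\<in>Obj C. finite (Hom C X Y)) \<and>
     (\<forall>\<gamma>\<in>carrier (groth_monoid C). finite {iso_class C X | X. X \<in> Obj C \<and> groth_class C X = \<gamma>})"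

definition chi :: "('o, 'm) cat \<Rightarrow> 'o set set \<Rightarrow> 'o set set \<Rightarrow> rat" where
  "chi C \<gamma> \<delta> = (THE q. \<exists>M\<in>Obj C. \<exists>N\<in>Obj C. groth_class C M = \<gamma> \<and> groth_class C N = \<delta> \<and>
     q = of_nat (card (Ext C 1 M N)) / of_nat (card (Hom C M N)))"


section \<open>Rational vector spaces and their tensor products\<close>

class rat_vector = ab_group_add +
  fixes scaleQ :: "rat \<Rightarrow> 'a \<Rightarrow> 'a" (infixr \<open>*\<^sub>Q\<close> 75)
  assumes scaleQ_add_right: "c *\<^sub>Q (x + y) = c *\<^sub>Q x + c *\<^sub>Q y"
    and scaleQ_add_left: "(c + d) *\<^sub>Q x = c *\<^sub>Q x + d *\<^sub>Q x"
    and scaleQ_scaleQ: "c *\<^sub>Q d *\<^sub>Q x = (c * d) *\<^sub>Q x"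
    and scaleQ_one: "1 *\<^sub>Q x = x"

global_interpretation Q: vector_space "scaleQ :: rat \<Rightarrow> 'a \<Rightarrow> 'a::rat_vector"
  by unfold_locales
    (simp_all add: scaleQ_add_right scaleQ_add_left scaleQ_scaleQ scaleQ_one)

instantiation rat :: rat_vector
begin
definition scaleQ_rat :: "rat \<Rightarrow> rat \<Rightarrow> rat" where "scaleQ_rat c x = c * x"
instance by standard (simp_all add: scaleQ_rat_def algebra_simps)
end

instantiation poly_mapping :: (type, rat_vector) rat_vector
begin
definition scaleQ_poly_mapping :: "rat \<Rightarrow> ('a \<Rightarrow>\<^sub>0 'b) \<Rightarrow> ('a \<Rightarrow>\<^sub>0 'b)" where
  "scaleQ_poly_mapping c f = Poly_Mapping.map (scaleQ c) f"

lemma lookup_scaleQ: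
  "Poly_Mapping.lookup (c *\<^sub>Q (f :: 'a \<Rightarrow>\<^sub>0 'b)) k = c *\<^sub>Q Poly_Mapping.lookup f k"
  by (simp add: scaleQ_poly_mapping_def Poly_Mapping.map.rep_eq when_def)

instance
  by standard
    (rule poly_mapping_eqI;
     simp add: lookup_scaleQ lookup_add scaleQ_add_right scaleQ_add_left scaleQ_scaleQ scaleQ_one)+
end

text \<open>The tensor product over the rationals of two rational vector spaces: the free vector space
  on pairs modulo the bilinearity relations.\<close>

definition tensor_relations :: "('u::rat_vector \<times> 'v::rat_vector \<Rightarrow>\<^sub>0 rat) set" where
  "tensor_relations =
     {Poly_Mapping.single (u + u', v) 1 - Poly_Mapping.single (u, v) 1
        - Poly_Mapping.single (u', v) 1 | u u' v. True} \<union>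
     {Poly_Mapping.single (u, v + v') 1 - Poly_Mapping.single (u, v) 1
        - Poly_Mapping.single (u, v') 1 | u v v'. True} \<union>
     {Poly_Mapping.single (c *\<^sub>Q u, v) 1 - c *\<^sub>Q Poly_Mapping.single (u, v) 1 | c u v. True} \<union>
     {Poly_Mapping.single (u, c *\<^sub>Q v) 1 - c *\<^sub>Q Poly_Mapping.single (u, v) 1 | c u v. True}"

definition tensor_eq ::
    "('u::rat_vector \<times> 'v::rat_vector \<Rightarrow>\<^sub>0 rat) \<Rightarrow> ('u \<times> 'v \<Rightarrow>\<^sub>0 rat) \<Rightarrow> bool" where
  "tensor_eq s t \<longleftrightarrow> s - t \<in> Q.span tensor_relations"

lemma equivp_tensor_eq: "equivp tensor_eq"
proof (rule equivpI)
  show "reflp tensor_eq"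
    by (simp add: reflp_def tensor_eq_def Q.span_zero)
  show "symp tensor_eq"
    unfolding symp_def tensor_eq_def using Q.span_neg by fastforce
  show "transp tensor_eq"
    unfolding transp_def tensor_eq_def using Q.span_add by fastforce
qed

quotient_type (overloaded) ('u, 'v) tensor =
    "'u::rat_vector \<times> 'v::rat_vector \<Rightarrow>\<^sub>0 rat" / tensor_eq
  by (rule equivp_tensor_eq)

instantiation tensor :: (rat_vector, rat_vector) rat_vector
begin

lift_definition zero_tensor :: "('a, 'b) tensor" is 0 .

lift_definition plus_tensor :: "('a, 'b) tensor \<Rightarrow> ('a, 'b) tensor \<Rightarrow> ('a, 'b) tensor" is "(+)"
  by (simp add: tensor_eq_def add_diff_add Q.span_add)

lift_definition uminus_tensor :: "('a, 'b) tensor \<Rightarrow> ('a, 'b) tensor" is uminus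
  by (simp only: tensor_eq_def minus_diff_minus Q.span_neg)

lift_definition minus_tensor :: "('a, 'b) tensor \<Rightarrow> ('a, 'b) tensor \<Rightarrow> ('a, 'b) tensor" is "(-)"
proof -
  fix s s' t t' :: "'a \<times> 'b \<Rightarrow>\<^sub>0 rat"
  assume "tensor_eq s s'" "tensor_eq t t'"
  moreover have "s - t - (s' - t') = (s - s') - (t - t')"
    by simp
  ultimately show "tensor_eq (s - t) (s' - t')"
    unfolding tensor_eq_def by (simp only: Q.span_diff)
qed

lift_definition scaleQ_tensor :: "rat \<Rightarrow> ('a, 'b) tensor \<Rightarrow> ('a, 'b) tensor" is scaleQ
  by (simp only: tensor_eq_def Q.scale_right_diff_distrib[symmetric] Q.span_scale)

instance
proof
  have eqI: "s = t \<Longrightarrow> tensor_eq s t" for s t :: "'a \<times> 'b \<Rightarrow>\<^sub>0 rat"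
    by (simp add: tensor_eq_def Q.span_zero)
  fix x y z :: "('a, 'b) tensor" and c d :: rat
  show "x + y + z = x + (y + z)" by transfer (rule eqI, rule add.assoc)
  show "x + y = y + x" by transfer (rule eqI, rule add.commute)
  show "0 + x = x" by transfer (rule eqI, simp)
  show "- x + x = 0" by transfer (rule eqI, simp)
  show "x - y = x + - y" by transfer (rule eqI, simp)
  show "c *\<^sub>Q (x + y) = c *\<^sub>Q x + c *\<^sub>Q y" by transfer (rule eqI, rule scaleQ_add_right)
  show "(c + d) *\<^sub>Q x = c *\<^sub>Q x + d *\<^sub>Q x" by transfer (rule eqI, rule scaleQ_add_left)
  show "c *\<^sub>Q d *\<^sub>Q x = (c * d) *\<^sub>Q x" by transfer (rule eqI, rule scaleQ_scaleQ)
  show "1 *\<^sub>Q x = x" by transfer (rule eqI, rule scaleQ_one)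
qed

end

lift_definition pure_tensor :: "'u::rat_vector \<Rightarrow> 'v::rat_vector \<Rightarrow> ('u, 'v) tensor"
    (infixr \<open>\<otimes>\<^sub>Q\<close> 76)
  is "\<lambda>u v. Poly_Mapping.single (u, v) 1" .

text \<open>For subspaces \<open>U\<close> and \<open>V\<close> of the ambient spaces, their tensor product is realised as a
  subspace of the tensor product of the ambient spaces, and \<open>tensor_lift U V \<beta>\<close> is the linear map
  on it induced by a map \<open>\<beta>\<close> that is bilinear on \<open>U \<times> V\<close>.\<close>

definition tensor_space ::
    "'u::rat_vector set \<Rightarrow> 'v::rat_vector set \<Rightarrow> ('u, 'v) tensor set" where
  "tensor_space U V = Q.span {u \<otimes>\<^sub>Q v | u v. u \<in> U \<and> v \<in> V}"

definition tensor_lift ::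
    "'u::rat_vector set \<Rightarrow> 'v::rat_vector set \<Rightarrow> ('u \<Rightarrow> 'v \<Rightarrow> 'w::rat_vector) \<Rightarrow>
     ('u, 'v) tensor \<Rightarrow> 'w" where
  "tensor_lift U V \<beta> t = (THE w. \<exists>ps. set ps \<subseteq> U \<times> V \<and>
     t = (\<Sum>(u, v)\<leftarrow>ps. u \<otimes>\<^sub>Q v) \<and> w = (\<Sum>(u, v)\<leftarrow>ps. \<beta> u v))"

definition tensor_map ::
    "'u::rat_vector set \<Rightarrow> 'v::rat_vector set \<Rightarrow> ('u \<Rightarrow> 'x::rat_vector) \<Rightarrow>
     ('v \<Rightarrow> 'y::rat_vector) \<Rightarrow> ('u, 'v) tensor \<Rightarrow> ('x, 'y) tensor" where
  "tensor_map U V f g = tensor_lift U V (\<lambda>u v. f u \<otimes>\<^sub>Q g v)"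

definition tensor_assoc ::
    "'u::rat_vector set \<Rightarrow> 'v::rat_vector set \<Rightarrow> 'w::rat_vector set \<Rightarrow>
     (('u, 'v) tensor, 'w) tensor \<Rightarrow> ('u, ('v, 'w) tensor) tensor" where
  "tensor_assoc U V W = tensor_lift (tensor_space U V) W
     (\<lambda>t w. tensor_lift U V (\<lambda>u v. u \<otimes>\<^sub>Q (v \<otimes>\<^sub>Q w)) t)"

definition linear_on :: "'u::rat_vector set \<Rightarrow> ('u \<Rightarrow> 'v::rat_vector) \<Rightarrow> bool" where
  "linear_on U f \<longleftrightarrow> (\<forall>x\<in>U. \<forall>y\<in>U. f (x + y) = f x + f y) \<and> (\<forall>c. \<forall>x\<in>U. f (c *\<^sub>Q x) = c *\<^sub>Q f x)"


section \<open>Graded spaces and the braiding\<close>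

text \<open>A space graded by a commutative monoid \<open>G\<close> is the family \<open>U\<close> of its homogeneous components,
  which are subspaces of an ambient space whose sum is direct. Only the \<open>U \<gamma>\<close> with
  \<open>\<gamma> \<in> carrier G\<close> matter.\<close>

definition total_space :: "'g monoid \<Rightarrow> ('g \<Rightarrow> 'u::rat_vector set) \<Rightarrow> 'u set" where
  "total_space G U = Q.span (\<Union>\<gamma>\<in>carrier G. U \<gamma>)"

definition graded_space :: "'g monoid \<Rightarrow> ('g \<Rightarrow> 'u::rat_vector set) \<Rightarrow> bool" where
  "graded_space G U \<longleftrightarrow> (\<forall>\<gamma>\<in>carrier G. Q.subspace (U \<gamma>)) \<and>
     (\<forall>I f. finite I \<longrightarrow> I \<subseteq> carrier G \<longrightarrow> (\<forall>\<gamma>\<in>I. f \<gamma> \<in> U \<gamma>) \<longrightarrow> (\<Sum>\<gamma>\<in>I. f \<gamma>) = 0 \<longrightarrow>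
        (\<forall>\<gamma>\<in>I. f \<gamma> = 0))"

text \<open>The family of homogeneous components of a vector.\<close>

definition components :: "'g monoid \<Rightarrow> ('g \<Rightarrow> 'u::rat_vector set) \<Rightarrow> 'u \<Rightarrow> 'g \<Rightarrow> 'u" where
  "components G U u = (THE f. finite {\<gamma>. f \<gamma> \<noteq> 0} \<and> {\<gamma>. f \<gamma> \<noteq> 0} \<subseteq> carrier G \<and>
     (\<forall>\<gamma>\<in>carrier G. f \<gamma> \<in> U \<gamma>) \<and> u = (\<Sum>\<gamma> | f \<gamma> \<noteq> 0. f \<gamma>))"

definition graded_subspace ::
    "'g monoid \<Rightarrow> ('g \<Rightarrow> 'u::rat_vector set) \<Rightarrow> 'u set \<Rightarrow> bool" where
  "graded_subspace G U W \<longleftrightarrow> Q.subspace W \<and> W = total_space G (\<lambda>\<gamma>. W \<inter> U \<gamma>)"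

definition tensor_grading ::
    "'g monoid \<Rightarrow> ('g \<Rightarrow> 'u::rat_vector set) \<Rightarrow> ('g \<Rightarrow> 'v::rat_vector set) \<Rightarrow>
     'g \<Rightarrow> ('u, 'v) tensor set" where
  "tensor_grading G U V \<gamma> = Q.span {u \<otimes>\<^sub>Q v | u v. \<exists>\<alpha>\<in>carrier G. \<exists>\<beta>\<in>carrier G.
     \<alpha> \<otimes>\<^bsub>G\<^esub> \<beta> = \<gamma> \<and> u \<in> U \<alpha> \<and> v \<in> V \<beta>}"

locale bicharacter = comm_monoid G for G :: "'g monoid" (structure) +
  fixes \<chi> :: "'g \<Rightarrow> 'g \<Rightarrow> rat"
  assumes nonzero: "\<gamma> \<in> carrier G \<Longrightarrow> \<delta> \<in> carrier G \<Longrightarrow> \<chi> \<gamma> \<delta> \<noteq> 0"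
    and mult_left: "\<gamma> \<in> carrier G \<Longrightarrow> \<gamma>' \<in> carrier G \<Longrightarrow> \<delta> \<in> carrier G \<Longrightarrow>
          \<chi> (\<gamma> \<otimes> \<gamma>') \<delta> = \<chi> \<gamma> \<delta> * \<chi> \<gamma>' \<delta>"
    and mult_right: "\<gamma> \<in> carrier G \<Longrightarrow> \<delta> \<in> carrier G \<Longrightarrow> \<delta>' \<in> carrier G \<Longrightarrow>
          \<chi> \<gamma> (\<delta> \<otimes> \<delta>') = \<chi> \<gamma> \<delta> * \<chi> \<gamma> \<delta>'"

definition braiding ::
    "'g monoid \<Rightarrow> ('g \<Rightarrow> 'g \<Rightarrow> rat) \<Rightarrow> ('g \<Rightarrow> 'u::rat_vector set) \<Rightarrow>
     ('g \<Rightarrow> 'v::rat_vector set) \<Rightarrow> ('u, 'v) tensor \<Rightarrow> ('v, 'u) tensor" where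
  "braiding G \<chi> U V = tensor_lift (total_space G U) (total_space G V)
     (\<lambda>u v. \<Sum>\<gamma> | components G U u \<gamma> \<noteq> 0. \<Sum>\<delta> | components G V v \<delta> \<noteq> 0.
        \<chi> \<gamma> \<delta> *\<^sub>Q (components G V v \<delta> \<otimes>\<^sub>Q components G U u \<gamma>))"


section \<open>Braided bialgebras and Nichols algebras\<close>

record (overloaded) ('g, 'b::rat_vector) bialgebra =
  Part :: "'g \<Rightarrow> 'b set"
  Prod :: "'b \<Rightarrow> 'b \<Rightarrow> 'b"
  Unit :: 'b
  Coprod :: "'b \<Rightarrow> ('b, 'b) tensor"
  Counit :: "'b \<Rightarrow> rat"

text \<open>Compatibility of the structure maps with a grading \<open>U\<close> by \<open>G\<close>; the base field sits in the
  degree of the unit of \<open>G\<close>. This is used both for the grading by the monoid that defines the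
  braiding, and for gradings by the natural numbers.\<close>

definition structure_graded ::
    "('h, 'b::rat_vector) bialgebra \<Rightarrow> 'g monoid \<Rightarrow> ('g \<Rightarrow> 'b set) \<Rightarrow> bool" where
  "structure_graded B G U \<longleftrightarrow> graded_space G U \<and>
     (\<forall>\<alpha>\<in>carrier G. \<forall>\<beta>\<in>carrier G. \<forall>x\<in>U \<alpha>. \<forall>y\<in>U \<beta>. Prod B x y \<in> U (\<alpha> \<otimes>\<^bsub>G\<^esub> \<beta>)) \<and>
     Unit B \<in> U \<one>\<^bsub>G\<^esub> \<and>
     (\<forall>\<gamma>\<in>carrier G. \<forall>x\<in>U \<gamma>. Coprod B x \<in> tensor_grading G U U \<gamma>) \<and>
     (\<forall>\<gamma>\<in>carrier G. \<gamma> \<noteq> \<one>\<^bsub>G\<^esub> \<longrightarrow> (\<forall>x\<in>U \<gamma>. Counit B x = 0))"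

text \<open>The product \<open>(m \<otimes> m) \<circ> (id \<otimes> \<Psi> \<otimes> id)\<close> on the tensor square of the algebra \<open>B\<close>: for
  \<open>s = a \<otimes> b\<close> and \<open>t = c \<otimes> d\<close>, the braiding \<open>\<Psi>\<close> is applied to \<open>b \<otimes> c\<close>.\<close>

definition braided_prod ::
    "'g monoid \<Rightarrow> ('g \<Rightarrow> 'g \<Rightarrow> rat) \<Rightarrow> ('g, 'b::rat_vector) bialgebra \<Rightarrow>
     ('b, 'b) tensor \<Rightarrow> ('b, 'b) tensor \<Rightarrow> ('b, 'b) tensor" where
  "braided_prod G \<chi> B s t =
     (let S = total_space G (Part B) in
        tensor_lift S S (\<lambda>a b.
          tensor_lift S S (\<lambda>c d.
            tensor_lift S S (\<lambda>c' b'. Prod B a c' \<otimes>\<^sub>Q Prod B b' d)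
              (braiding G \<chi> (Part B) (Part B) (b \<otimes>\<^sub>Q c))) t) s)"

locale braided_bialgebra = bicharacter G \<chi>
  for G :: "'g monoid" (structure) and \<chi> :: "'g \<Rightarrow> 'g \<Rightarrow> rat" +
  fixes B :: "('g, 'b::rat_vector) bialgebra"
    and S :: "'b set"
  defines "S \<equiv> total_space G (Part B)"
  assumes graded: "structure_graded B G (Part B)"
    and prod_linear_left: "y \<in> S \<Longrightarrow> linear_on S (\<lambda>x. Prod B x y)"
    and prod_linear_right: "x \<in> S \<Longrightarrow> linear_on S (\<lambda>y. Prod B x y)"
    and coprod_linear: "linear_on S (Coprod B)"
    and counit_linear: "linear_on S (Counit B)"
    and prod_assoc: "x \<in> S \<Longrightarrow> y \<in> S \<Longrightarrow> z \<in> S \<Longrightarrow>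
          Prod B (Prod B x y) z = Prod B x (Prod B y z)"
    and unit_left: "x \<in> S \<Longrightarrow> Prod B (Unit B) x = x"
    and unit_right: "x \<in> S \<Longrightarrow> Prod B x (Unit B) = x"
    and coassoc: "x \<in> S \<Longrightarrow>
          tensor_assoc S S S (tensor_map S S (Coprod B) id (Coprod B x)) =
          tensor_map S S id (Coprod B) (Coprod B x)"
    and counit_left: "x \<in> S \<Longrightarrow> tensor_lift S S (\<lambda>u v. Counit B u *\<^sub>Q v) (Coprod B x) = x"
    and counit_right: "x \<in> S \<Longrightarrow> tensor_lift S S (\<lambda>u v. Counit B v *\<^sub>Q u) (Coprod B x) = x"
    and coprod_prod: "x \<in> S \<Longrightarrow> y \<in> S \<Longrightarrow>
          Coprod B (Prod B x y) = braided_prod G \<chi> B (Coprod B x) (Coprod B y)"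
    and coprod_unit: "Coprod B (Unit B) = Unit B \<otimes>\<^sub>Q Unit B"
    and counit_prod: "x \<in> S \<Longrightarrow> y \<in> S \<Longrightarrow> Counit B (Prod B x y) = Counit B x * Counit B y"
    and counit_unit: "Counit B (Unit B) = 1"

definition primitives :: "'g monoid \<Rightarrow> ('g, 'b::rat_vector) bialgebra \<Rightarrow> 'b set" where
  "primitives G B =
     {v \<in> total_space G (Part B). Coprod B v = v \<otimes>\<^sub>Q Unit B + Unit B \<otimes>\<^sub>Q v}"

definition generated_subalgebra :: "('g, 'b::rat_vector) bialgebra \<Rightarrow> 'b set \<Rightarrow> 'b set" where
  "generated_subalgebra B X =
     \<Inter> {T. Q.subspace T \<and> Unit B \<in> T \<and> X \<subseteq> T \<and> (\<forall>x\<in>T. \<forall>y\<in>T. Prod B x y \<in> T)}"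

abbreviation nat_monoid :: "nat monoid" where
  "nat_monoid \<equiv> \<lparr>carrier = UNIV, mult = (+), one = 0\<rparr>"

text \<open>\<open>B\<close> is a Nichols algebra of its graded subspace \<open>V\<close>; the subspaces \<open>N n\<close> are the homogeneous
  components for the grading by the natural numbers, and each of them is itself an object of the
  braided category of \<open>G\<close>-graded spaces.\<close>

definition nichols_algebra ::
    "'g monoid \<Rightarrow> ('g \<Rightarrow> 'g \<Rightarrow> rat) \<Rightarrow> ('g, 'b::rat_vector) bialgebra \<Rightarrow> 'b set \<Rightarrow> bool" where
  "nichols_algebra G \<chi> B V \<longleftrightarrow> braided_bialgebra G \<chi> B \<and>
     (\<exists>N :: nat \<Rightarrow> 'b set.
        structure_graded B nat_monoid N \<and>
        total_space nat_monoid N = total_space G (Part B) \<and>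
        (\<forall>n. graded_subspace G (Part B) (N n)) \<and>
        N 0 = Q.span {Unit B} \<and>
        N 1 = V \<and>
        N 1 = primitives G B \<and>
        generated_subalgebra B (N 1) = total_space G (Part B))"


section \<open>The Hall algebra\<close>

definition hall_number :: "('o, 'm) cat \<Rightarrow> 'o \<Rightarrow> 'o \<Rightarrow> 'o \<Rightarrow> rat" where
  "hall_number C A B X = of_nat (card (short_exact C A B X)) /
     (of_nat (card (isos C A A)) * of_nat (card (isos C B B)))"

definition hall_conumber :: "('o, 'm) cat \<Rightarrow> 'o \<Rightarrow> 'o \<Rightarrow> 'o \<Rightarrow> rat" where
  "hall_conumber C A B X =
     of_nat (card (isos C A A)) * of_nat (card (isos C B B)) / of_nat (card (isos C X X)) *
     hall_number C B A X"

text \<open>The Hall numbers only depend on the isomorphism classes of the objects, so the choice of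
  representatives below does not matter.\<close>

definition rep :: "'o set \<Rightarrow> 'o" where
  "rep a = (SOME X. X \<in> a)"

abbreviation basis :: "'o set \<Rightarrow> ('o set \<Rightarrow>\<^sub>0 rat)" where
  "basis a \<equiv> Poly_Mapping.single a 1"

definition hall_prod ::
    "('o, 'm) cat \<Rightarrow> ('o set \<Rightarrow>\<^sub>0 rat) \<Rightarrow> ('o set \<Rightarrow>\<^sub>0 rat) \<Rightarrow> ('o set \<Rightarrow>\<^sub>0 rat)" where
  "hall_prod C x y = (\<Sum>a\<in>Poly_Mapping.keys x. \<Sum>b\<in>Poly_Mapping.keys y.
     (Poly_Mapping.lookup x a * Poly_Mapping.lookup y b) *\<^sub>Q
     (\<Sum>c | c \<in> Iso C \<and> hall_number C (rep a) (rep b) (rep c) \<noteq> 0.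
        hall_number C (rep a) (rep b) (rep c) *\<^sub>Q basis c))"

definition hall_coprod ::
    "('o, 'm) cat \<Rightarrow> ('o set \<Rightarrow>\<^sub>0 rat) \<Rightarrow> ('o set \<Rightarrow>\<^sub>0 rat, 'o set \<Rightarrow>\<^sub>0 rat) tensor" where
  "hall_coprod C x = (\<Sum>c\<in>Poly_Mapping.keys x. Poly_Mapping.lookup x c *\<^sub>Q
     (\<Sum>(a, b) | a \<in> Iso C \<and> b \<in> Iso C \<and> hall_conumber C (rep a) (rep b) (rep c) \<noteq> 0.
        hall_conumber C (rep a) (rep b) (rep c) *\<^sub>Q (basis a \<otimes>\<^sub>Q basis b)))"

text \<open>The underlying space of the Hall algebra, as the sum of its homogeneous components, consists
  of the finitely supported functions with support in \<open>Iso C\<close>.\<close>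

definition hall_algebra :: "('o, 'm) cat \<Rightarrow> ('o set set, 'o set \<Rightarrow>\<^sub>0 rat) bialgebra" where
  "hall_algebra C =
     \<lparr>Part = (\<lambda>\<gamma>. Q.span {basis (iso_class C M) | M. M \<in> Obj C \<and> groth_class C M = \<gamma>}),
      Prod = hall_prod C,
      Unit = basis (zero_class C),
      Coprod = hall_coprod C,
      Counit = (\<lambda>x. Poly_Mapping.lookup x (zero_class C))\<rparr>"

end

theory Submission
  imports Defs
begin

text \<open>Weight every object by the inverse of the order of its automorphism group. The associativity of
  the Hall product counts filtrations in two ways, and by Riedtmann's formula the extensions of \<open>M\<close> by
  \<open>N\<close> have total mass \<open>#Ext\<^sup>1(M,N) / #Hom(M,N) = \<chi>(|M|,|N|)\<close>. Since \<open>Ext\<^sup>2\<close> vanishes, every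
  frame of four short exact sequences around a \<open>3 \<times> 3\<close> diagram can be filled, and counting
  the fillings yields Green's formula, which says that the coproduct is multiplicative for the
  braiding \<open>\<chi>\<close>.

  The form \<open>([A], [B]) = \<delta>\<^bsub>A,B\<^esub> / #Aut A\<close> is a Hopf pairing that is positive definite over the
  rationals. Hence an element without constant term is primitive iff it is orthogonal to all products
  \<open>[A]\<cdot>[B]\<close> with \<open>A\<close> and \<open>B\<close> nonzero. Orthogonal projection, together with an induction on the
  largest number of endomorphisms of an object of given class, shows that the primitive elements
  generate. The spans of the products of \<open>n\<close> primitive elements are pairwise orthogonal for different
  \<open>n\<close>, so their sum is direct and is the grading of the Nichols algebra.\<close>

section \<open>Abelian categories\<close>

text \<open>Long exact sequences of Ext groups are avoided; weighted counts take their place. The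
  weighted number of extensions is multiplicative in each variable because pairs of an extension and
  its push-forward can be counted in two ways. This shows at once that \<chi> is well defined on the
  Grothendieck monoid and that it is a bicharacter. Vanishing of Ext^2 enters in one form, the
  existence of fillings, and is extracted from the zigzag relation by an invariant: fillability is
  preserved by maps of 2-extensions and holds for the trivial one.

  The coproduct has the sub-object on the left, the product has the quotient on the left, so the
  pairing reverses factors: (uv, w) = (v \<otimes> u, \<Delta> w). The two inner factors exchanged
  by the braiding are the quotient A of M and the sub-object D of N, and the crosses with a given
  frame are counted by the extensions of A by D.

  The induction for generation asks for a height on the Grothendieck monoid that grows strictly
  under sums. The number of endomorphisms, at least doubled by a nonzero summand, provides one
  directly from the finiteness of the Hom sets.\<close>

definition zerop :: "('a \<Rightarrow> 'a \<Rightarrow> 'a) \<Rightarrow> 'a \<Rightarrow> bool" where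
  "zerop add f \<longleftrightarrow> add f f = f"

text \<open>Killing only zero arrows is the additive form of cancellation. The Hom sets, composition
  and addition are explicit arguments, so that epimorphisms, cokernels and pushouts are literally
  the same notions for the opposite operations.\<close>

definition monop where
  "monop hm cmp add A B f \<longleftrightarrow> f \<in> hm A B \<and>
     (\<forall>U z. z \<in> hm U A \<longrightarrow> zerop add (cmp f z) \<longrightarrow> zerop add z)"

definition kernelp where
  "kernelp hm cmp add K X Y k f \<longleftrightarrow> monop hm cmp add K X k \<and> f \<in> hm X Y \<and>
     zerop add (cmp f k) \<and>
     (\<forall>U x. x \<in> hm U X \<longrightarrow> zerop add (cmp f x) \<longrightarrow> (\<exists>z\<in>hm U K. cmp k z = x))"

definition pullbackp where
  "pullbackp hm cmp P X Y W a b f g \<longleftrightarrow> a \<in> hm P X \<and> b \<in> hm P Y \<and> f \<in> hm X W \<and> g \<in> hm Y W \<and>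
     cmp f a = cmp g b \<and>
     (\<forall>U x y. x \<in> hm U X \<longrightarrow> y \<in> hm U Y \<longrightarrow> cmp f x = cmp g y \<longrightarrow>
        (\<exists>h\<in>hm U P. cmp a h = x \<and> cmp b h = y)) \<and>
     (\<forall>U h h'. h \<in> hm U P \<longrightarrow> h' \<in> hm U P \<longrightarrow> cmp a h = cmp a h' \<longrightarrow> cmp b h = cmp b h' \<longrightarrow> h = h')"

text \<open>Composition and addition are taken to be total operations with an absorbing element for the
  undefined results, so that associativity and distributivity hold without side conditions. The zero
  arrows are the defined idempotents of the addition. Opposites of instances are again instances.\<close>

locale ab_cat =
  fixes obj :: "'o set"
    and hm :: "'o \<Rightarrow> 'o \<Rightarrow> 'a set"
    and cmp :: "'a \<Rightarrow> 'a \<Rightarrow> 'a" (infixr \<open>\<cdot>\<close> 70)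
    and idn :: "'o \<Rightarrow> 'a"
    and add :: "'a \<Rightarrow> 'a \<Rightarrow> 'a" (infixl \<open>\<boxplus>\<close> 65)
    and neg :: "'a \<Rightarrow> 'a"
    and zero :: "'o \<Rightarrow> 'o \<Rightarrow> 'a"
  assumes hom_obj: "f \<in> hm A B \<Longrightarrow> A \<in> obj \<and> B \<in> obj"
    and comp_hom: "f \<in> hm A B \<Longrightarrow> g \<in> hm B D \<Longrightarrow> g \<cdot> f \<in> hm A D"
    and assoc: "(h \<cdot> g) \<cdot> f = h \<cdot> (g \<cdot> f)"
    and idn_hom: "A \<in> obj \<Longrightarrow> idn A \<in> hm A A"
    and idn_left: "f \<in> hm A B \<Longrightarrow> idn B \<cdot> f = f"
    and idn_right: "f \<in> hm A B \<Longrightarrow> f \<cdot> idn A = f"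
    and add_hom: "f \<in> hm A B \<Longrightarrow> g \<in> hm A B \<Longrightarrow> f \<boxplus> g \<in> hm A B"
    and neg_hom: "f \<in> hm A B \<Longrightarrow> neg f \<in> hm A B"
    and zero_hom: "A \<in> obj \<Longrightarrow> B \<in> obj \<Longrightarrow> zero A B \<in> hm A B"
    and add_assoc: "(f \<boxplus> g) \<boxplus> h = f \<boxplus> (g \<boxplus> h)"
    and add_comm: "f \<boxplus> g = g \<boxplus> f"
    and zerop_zero: "A \<in> obj \<Longrightarrow> B \<in> obj \<Longrightarrow> zerop add (zero A B)"
    and add_zerop: "f \<in> hm A B \<Longrightarrow> z \<in> hm A B \<Longrightarrow> zerop add z \<Longrightarrow> f \<boxplus> z = f"
    and zerop_add_neg: "zerop add (f \<boxplus> neg f)"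
    and distl: "h \<cdot> (f \<boxplus> g) = h \<cdot> f \<boxplus> h \<cdot> g"
    and distr: "(f \<boxplus> g) \<cdot> h = f \<cdot> h \<boxplus> g \<cdot> h"
    and comp_neg: "h \<cdot> neg f = neg (h \<cdot> f)"
    and neg_comp: "neg f \<cdot> h = neg (f \<cdot> h)"
    and zero_object: "\<exists>N\<in>obj. zerop add (idn N)"
    and biproduct: "A \<in> obj \<Longrightarrow> B \<in> obj \<Longrightarrow> \<exists>S i1 i2 p1 p2. i1 \<in> hm A S \<and> i2 \<in> hm B S \<and>
      p1 \<in> hm S A \<and> p2 \<in> hm S B \<and> p1 \<cdot> i1 = idn A \<and> p2 \<cdot> i2 = idn B \<and>
      zerop add (p2 \<cdot> i1) \<and> zerop add (p1 \<cdot> i2) \<and> i1 \<cdot> p1 \<boxplus> i2 \<cdot> p2 = idn S"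
    and ker_ex: "f \<in> hm X Y \<Longrightarrow> \<exists>K k. kernelp hm cmp add K X Y k f"
    and coker_ex: "f \<in> hm X Y \<Longrightarrow> \<exists>K k. kernelp (\<lambda>A B. hm B A) (\<lambda>g f. f \<cdot> g) add K Y X k f"
    and mono_ker: "monop hm cmp add A B f \<Longrightarrow> \<exists>Y g. kernelp hm cmp add A B Y f g"
    and epi_coker: "monop (\<lambda>A B. hm B A) (\<lambda>g f. f \<cdot> g) add A B f \<Longrightarrow>
      \<exists>Y g. kernelp (\<lambda>A B. hm B A) (\<lambda>g f. f \<cdot> g) add A B Y f g"
begin

text \<open>Dual facts below are instances of a lemma at this one, which replaces a second diagram
  chase.\<close>

lemma op: "ab_cat obj (\<lambda>A B. hm B A) (\<lambda>g f. f \<cdot> g) idn add neg (\<lambda>A B. zero B A)"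
proof
  fix A B assume "A \<in> obj" "B \<in> obj"
  from biproduct[OF this] obtain S i1 i2 p1 p2 where
    "i1 \<in> hm A S \<and> i2 \<in> hm B S \<and>
      p1 \<in> hm S A \<and> p2 \<in> hm S B \<and> p1 \<cdot> i1 = idn A \<and> p2 \<cdot> i2 = idn B \<and>
      zerop add (p2 \<cdot> i1) \<and> zerop add (p1 \<cdot> i2) \<and> i1 \<cdot> p1 \<boxplus> i2 \<cdot> p2 = idn S"
    by blast
  then show "\<exists>S i1 i2 p1 p2. i1 \<in> hm S A \<and> i2 \<in> hm S B \<and>
      p1 \<in> hm A S \<and> p2 \<in> hm B S \<and> i1 \<cdot> p1 = idn A \<and> i2 \<cdot> p2 = idn B \<and>
      zerop add (i1 \<cdot> p2) \<and> zerop add (i2 \<cdot> p1) \<and> p1 \<cdot> i1 \<boxplus> p2 \<cdot> i2 = idn S"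
    by blast
qed (use hom_obj comp_hom assoc idn_hom idn_left idn_right add_hom neg_hom zero_hom add_assoc
    add_comm zerop_zero add_zerop zerop_add_neg distl distr comp_neg neg_comp zero_object ker_ex
    coker_ex mono_ker epi_coker in \<open>(simp; fail | blast)+\<close>)

abbreviation Z where "Z \<equiv> zerop add"
abbreviation mono where "mono A B f \<equiv> monop hm cmp add A B f"
abbreviation epi where "epi A B f \<equiv> monop (\<lambda>A B. hm B A) (\<lambda>g f. f \<cdot> g) add B A f"
abbreviation kernel where "kernel \<equiv> kernelp hm cmp add"
abbreviation pullback where "pullback \<equiv> pullbackp hm cmp"
abbreviation pushout where "pushout \<equiv> pullbackp (\<lambda>A B. hm B A) (\<lambda>g f. f \<cdot> g)"
abbreviation sub (infixl \<open>\<boxminus>\<close> 65) where "f \<boxminus> g \<equiv> f \<boxplus> neg g"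

text \<open>Lets an equation between composites be used inside a longer composite, where
  associativity has moved all brackets to the right.\<close>

lemma ra: "a \<cdot> b = c \<Longrightarrow> a \<cdot> (b \<cdot> x) = c \<cdot> x"
  using assoc by metis

lemma Z_unique: "Z f \<Longrightarrow> Z g \<Longrightarrow> f \<in> hm A B \<Longrightarrow> g \<in> hm A B \<Longrightarrow> f = g"
  by (metis add_zerop add_comm)

lemma Z_left: "Z f \<Longrightarrow> Z (g \<cdot> f)"
  unfolding zerop_def by (metis distl)

lemma Z_right: "Z f \<Longrightarrow> Z (f \<cdot> g)"
  unfolding zerop_def by (metis distr)

lemma Z_comp_zero:
  assumes "a \<in> hm P X" "z \<in> hm U P" "Z (a \<cdot> z)"
  shows "a \<cdot> z = a \<cdot> zero U P"
proof (rule Z_unique[of _ _ U X])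
  have "zero U P \<in> hm U P" "Z (zero U P)" using assms hom_obj by (auto intro: zero_hom zerop_zero)
  then show "Z (a \<cdot> zero U P)" "a \<cdot> zero U P \<in> hm U X" using assms by (auto intro: comp_hom Z_left)
qed (use assms in \<open>auto intro: comp_hom\<close>)

lemmas Z_zero_comp = ab_cat.Z_comp_zero[OF op]

lemma Z_add: "Z f \<Longrightarrow> Z g \<Longrightarrow> Z (f \<boxplus> g)"
  unfolding zerop_def by (metis add_assoc add_comm)

lemma zero_add: "f \<in> hm A B \<Longrightarrow> z \<in> hm A B \<Longrightarrow> Z z \<Longrightarrow> z \<boxplus> f = f"
  by (metis add_zerop add_comm)

lemma Z_sub: "f \<in> hm A B \<Longrightarrow> g \<in> hm A B \<Longrightarrow> Z (f \<boxminus> g) \<longleftrightarrow> f = g"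
proof
  assume f: "f \<in> hm A B" and g: "g \<in> hm A B" and z: "Z (f \<boxminus> g)"
  have "f = f \<boxplus> (g \<boxminus> g)" by (rule add_zerop[symmetric]) (use f g in \<open>auto intro: add_hom neg_hom zerop_add_neg\<close>)
  also have "\<dots> = g \<boxplus> (f \<boxminus> g)" by (metis add_comm add_assoc)
  also have "\<dots> = g" by (rule add_zerop) (use f g z in \<open>auto intro: add_hom neg_hom zerop_add_neg\<close>)
  finally show "f = g" .
qed (simp add: zerop_add_neg)

lemma sub_hom: "f \<in> hm A B \<Longrightarrow> g \<in> hm A B \<Longrightarrow> f \<boxminus> g \<in> hm A B"
  by (intro add_hom neg_hom)

lemma sub_add: "f \<in> hm A B \<Longrightarrow> g \<in> hm A B \<Longrightarrow> (f \<boxminus> g) \<boxplus> g = f"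
proof -
  assume f: "f \<in> hm A B" and g: "g \<in> hm A B"
  have "f = f \<boxplus> (g \<boxminus> g)" by (rule add_zerop[symmetric]) (use f g in \<open>auto intro: add_hom neg_hom zerop_add_neg\<close>)
  also have "\<dots> = (f \<boxminus> g) \<boxplus> g" by (metis add_comm add_assoc)
  finally show ?thesis by simp
qed

lemma add_cancel:
  assumes "f \<in> hm A B" "g \<in> hm A B" "h \<in> hm A B" "f \<boxplus> g = f \<boxplus> h"
  shows "g = h"
proof -
  have "f \<boxplus> x \<boxminus> f = x" if "x \<in> hm A B" for x
  proof -
    have "x = x \<boxplus> (f \<boxminus> f)" by (rule add_zerop[symmetric]) (use assms that in \<open>auto intro: sub_hom zerop_add_neg\<close>)
    also have "\<dots> = (f \<boxplus> x) \<boxminus> f" using add_assoc add_comm by simp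
    finally show ?thesis by simp
  qed
  then show ?thesis using assms by metis
qed

lemma Z_neg:
  assumes "f \<in> hm A B" shows "Z (neg f) \<longleftrightarrow> Z f"
proof
  assume "Z f"
  then show "Z (neg f)" using zero_add[OF neg_hom[OF assms] assms] zerop_add_neg[of f] by simp
next
  assume "Z (neg f)"
  then show "Z f" using add_zerop[OF assms neg_hom[OF assms]] zerop_add_neg[of f] by simp
qed

lemma monoD: "mono A B f \<Longrightarrow> z \<in> hm U A \<Longrightarrow> Z (f \<cdot> z) \<Longrightarrow> Z z"
  unfolding monop_def by blast

lemma epiD: "epi A B f \<Longrightarrow> z \<in> hm B U \<Longrightarrow> Z (z \<cdot> f) \<Longrightarrow> Z z"
  unfolding monop_def by blast

lemma mono_hom: "mono A B f \<Longrightarrow> f \<in> hm A B"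
  unfolding monop_def by blast

lemma epi_hom: "epi A B f \<Longrightarrow> f \<in> hm A B"
  unfolding monop_def by blast

lemma monoI: "f \<in> hm A B \<Longrightarrow> (\<And>U z. z \<in> hm U A \<Longrightarrow> Z (f \<cdot> z) \<Longrightarrow> Z z) \<Longrightarrow> mono A B f"
  unfolding monop_def by blast

lemma epiI: "f \<in> hm A B \<Longrightarrow> (\<And>U z. z \<in> hm B U \<Longrightarrow> Z (z \<cdot> f) \<Longrightarrow> Z z) \<Longrightarrow> epi A B f"
  unfolding monop_def by blast

lemma mono_cancel:
  assumes "mono A B f" "z \<in> hm U A" "z' \<in> hm U A" "f \<cdot> z = f \<cdot> z'"
  shows "z = z'"
proof -
  have "Z (f \<cdot> (z \<boxminus> z'))" using assms(4) by (simp add: distl comp_neg zerop_add_neg)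
  then have "Z (z \<boxminus> z')" using assms by (blast intro: monoD sub_hom)
  then show ?thesis using Z_sub assms by blast
qed

lemmas epi_cancel = ab_cat.mono_cancel[OF op]

lemma mono_comp: "mono A B f \<Longrightarrow> mono B D g \<Longrightarrow> mono A D (g \<cdot> f)"
  unfolding monop_def by (metis assoc comp_hom)

lemmas epi_comp = ab_cat.mono_comp[OF op]

lemma mono_left: "mono A D (g \<cdot> f) \<Longrightarrow> f \<in> hm A B \<Longrightarrow> mono A B f"
  unfolding monop_def by (metis assoc Z_left)

lemmas epi_right = ab_cat.mono_left[OF op]

lemma mono_idn: "A \<in> obj \<Longrightarrow> mono A A (idn A)"
  by (rule monoI) (auto simp: idn_left idn_hom)

lemmas epi_idn = ab_cat.mono_idn[OF op]

lemma kernelD: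
  assumes "kernel K X Y k f"
  shows "mono K X k" "k \<in> hm K X" "f \<in> hm X Y" "Z (f \<cdot> k)"
    "\<And>U x. x \<in> hm U X \<Longrightarrow> Z (f \<cdot> x) \<Longrightarrow> \<exists>z\<in>hm U K. k \<cdot> z = x"
  using assms unfolding kernelp_def monop_def by blast+

lemmas cokernelD = ab_cat.kernelD[OF op]

text \<open>This replaces the choice of preimages when chasing generalised elements.\<close>

lemma refine:
  assumes p: "epi X A p" and z: "z \<in> hm U A"
  obtains P u x where "epi P U u" "x \<in> hm P X" "p \<cdot> x = z \<cdot> u"
proof -
  have ph: "p \<in> hm X A" using p by (rule epi_hom)
  obtain S i1 i2 p1 p2 where b: "i1 \<in> hm U S" "i2 \<in> hm X S" "p1 \<in> hm S U" "p2 \<in> hm S X"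
    "p1 \<cdot> i1 = idn U" "p2 \<cdot> i2 = idn X" "Z (p2 \<cdot> i1)" "Z (p1 \<cdot> i2)"
    using biproduct[of U X] hom_obj z ph by blast
  \<comment> \<open>The arrow from the direct sum of \<open>U\<close> and \<open>X\<close> to
    \<open>A\<close> with components \<open>z\<close> and minus \<open>p\<close>. Its kernel is the
    fibre product of \<open>z\<close> and \<open>p\<close>, with projections
    \<open>p1 \<cdot> k\<close> and \<open>p2 \<cdot> k\<close>.\<close>
  define f where "f = z \<cdot> p1 \<boxminus> p \<cdot> p2"
  have f: "f \<in> hm S A" unfolding f_def using b z ph by (blast intro: add_hom neg_hom comp_hom)
  have fi2: "Z (w \<cdot> p)" if "Z (w \<cdot> f \<cdot> i2)" "w \<in> hm A V" for w V
  proof -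
    have t: "w \<cdot> z \<cdot> p1 \<cdot> i2 \<in> hm X V" "w \<cdot> p \<in> hm X V"
      using that(2) z ph b by (blast intro: comp_hom)+
    have "w \<cdot> f \<cdot> i2 = w \<cdot> z \<cdot> p1 \<cdot> i2 \<boxminus> w \<cdot> p"
      unfolding f_def using b ph by (simp add: distl distr comp_neg neg_comp assoc idn_right)
    moreover have "Z (w \<cdot> z \<cdot> p1 \<cdot> i2)" using b by (simp add: Z_left)
    ultimately show ?thesis using that(1) t Z_sub by metis
  qed
  have ef: "epi S A f"
  proof (rule epiI[OF f])
    fix V y assume y: "y \<in> hm A V" "Z (y \<cdot> f)"
    then have "Z (y \<cdot> f \<cdot> i2)" by (metis Z_right assoc)
    then have "Z (y \<cdot> p)" using fi2 y by blast
    then show "Z y" using epiD[OF p] y by blast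
  qed
  \<comment> \<open>As an epimorphism, \<open>f\<close> is a cokernel of some \<open>g\<close>, and
    \<open>g\<close> factors through the kernel \<open>k\<close>; hence every arrow out of
    \<open>S\<close> that kills \<open>k\<close> factors through \<open>f\<close>.\<close>
  from epi_coker[OF ef] obtain Y g where
    g: "g \<in> hm Y S" "Z (f \<cdot> g)" and cok: "\<And>V y. y \<in> hm S V \<Longrightarrow> Z (y \<cdot> g) \<Longrightarrow> \<exists>w\<in>hm A V. w \<cdot> f = y"
    unfolding kernelp_def by blast
  from ker_ex[OF f] obtain P k where k: "kernel P S A k f" by blast
  note k = kernelD[OF k]
  obtain j where j: "k \<cdot> j = g" using k(5) g by blast
  show thesis
  proof
    show "p2 \<cdot> k \<in> hm P X" using k b by (blast intro: comp_hom)
    have "Z (z \<cdot> p1 \<cdot> k \<boxminus> p \<cdot> p2 \<cdot> k)"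
      using k(4) unfolding f_def by (simp add: distr neg_comp assoc)
    then show "p \<cdot> (p2 \<cdot> k) = z \<cdot> (p1 \<cdot> k)"
      using Z_sub[of "z \<cdot> p1 \<cdot> k" P A "p \<cdot> p2 \<cdot> k"] k b z ph by (metis comp_hom)
    have pk: "p1 \<cdot> k \<in> hm P U" using k b by (blast intro: comp_hom)
    \<comment> \<open>If \<open>y\<close> kills \<open>p1 \<cdot> k\<close>, then
      \<open>y \<cdot> p1 = w \<cdot> f\<close>. Restriction to the summand \<open>X\<close> shows
      that \<open>w \<cdot> p\<close> is zero, so \<open>w\<close> is zero, and restriction to
      \<open>U\<close> then shows that \<open>y\<close> is zero.\<close>
    show "epi P U (p1 \<cdot> k)"
    proof (rule epiI[OF pk])
      fix V y assume y: "y \<in> hm U V" "Z (y \<cdot> p1 \<cdot> k)"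
      have "Z ((y \<cdot> p1) \<cdot> g)" using y j by (metis Z_right assoc)
      then obtain w where w: "w \<in> hm A V" "w \<cdot> f = y \<cdot> p1" using cok y b by (blast intro: comp_hom)
      have "Z (w \<cdot> f \<cdot> i2)" using w b by (metis Z_left assoc)
      then have "Z w" using fi2 w epiD[OF p] by blast
      then have "Z (y \<cdot> p1 \<cdot> i1)" using w by (metis Z_right assoc)
      then show "Z y" using b y by (simp add: idn_right)
    qed
  qed
qed

lemma pullback_ex:
  assumes f: "f \<in> hm X W" and g: "g \<in> hm Y W"
  obtains P a b where "pullback P X Y W a b f g"
proof -
  obtain S i1 i2 p1 p2 where b: "i1 \<in> hm X S" "i2 \<in> hm Y S" "p1 \<in> hm S X" "p2 \<in> hm S Y"
    "p1 \<cdot> i1 = idn X" "p2 \<cdot> i2 = idn Y" "Z (p2 \<cdot> i1)" "Z (p1 \<cdot> i2)" "i1 \<cdot> p1 \<boxplus> i2 \<cdot> p2 = idn S"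
    using biproduct[of X Y] hom_obj f g by blast
  define d where "d = f \<cdot> p1 \<boxminus> g \<cdot> p2"
  have d: "d \<in> hm S W" unfolding d_def using b f g by (blast intro: add_hom neg_hom comp_hom)
  from ker_ex[OF d] obtain P k where k: "kernel P S W k d" by blast
  note k = kernelD[OF k]
  show thesis
  proof
    show "pullback P X Y W (p1 \<cdot> k) (p2 \<cdot> k) f g"
      unfolding pullbackp_def
    proof (intro conjI allI impI)
      show "p1 \<cdot> k \<in> hm P X" "p2 \<cdot> k \<in> hm P Y" using k b by (blast intro: comp_hom)+
      show "f \<in> hm X W" "g \<in> hm Y W" by fact+
      have "Z (f \<cdot> p1 \<cdot> k \<boxminus> g \<cdot> p2 \<cdot> k)"
        using k(4) unfolding d_def by (simp add: distr neg_comp assoc)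
      then show "f \<cdot> p1 \<cdot> k = g \<cdot> p2 \<cdot> k"
        using Z_sub k b f g by (metis comp_hom)
    next
      fix U x y assume xy: "x \<in> hm U X" "y \<in> hm U Y" "f \<cdot> x = g \<cdot> y"
      define v where "v = i1 \<cdot> x \<boxplus> i2 \<cdot> y"
      have v: "v \<in> hm U S" unfolding v_def using xy b by (blast intro: comp_hom add_hom)
      have zz: "p1 \<cdot> i2 \<cdot> y \<in> hm U X" "Z (p1 \<cdot> i2 \<cdot> y)" "p2 \<cdot> i1 \<cdot> x \<in> hm U Y" "Z (p2 \<cdot> i1 \<cdot> x)"
        using xy b by (blast intro: comp_hom) (metis Z_right assoc b, blast intro: comp_hom xy b, metis Z_right assoc b)
      have pv: "p1 \<cdot> v = x" "p2 \<cdot> v = y"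
        unfolding v_def using zz xy b by (simp_all add: distl ra[OF b(5)] ra[OF b(6)] idn_left add_zerop zero_add)
      then have "Z (d \<cdot> v)" unfolding d_def using xy by (simp add: distr neg_comp assoc zerop_add_neg)
      then obtain h where "h \<in> hm U P" "k \<cdot> h = v" using k v by blast
      then show "\<exists>h\<in>hm U P. (p1 \<cdot> k) \<cdot> h = x \<and> (p2 \<cdot> k) \<cdot> h = y" using pv by (auto simp: assoc)
    next
      fix U h h' assume h: "h \<in> hm U P" "h' \<in> hm U P" "(p1 \<cdot> k) \<cdot> h = (p1 \<cdot> k) \<cdot> h'" "(p2 \<cdot> k) \<cdot> h = (p2 \<cdot> k) \<cdot> h'"
      have "v = i1 \<cdot> p1 \<cdot> v \<boxplus> i2 \<cdot> p2 \<cdot> v" if "v \<in> hm U S" for v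
        using b(9) that by (metis assoc distr idn_left)
      then have "k \<cdot> h = k \<cdot> h'" using h k by (metis assoc comp_hom)
      then show "h = h'" using mono_cancel[OF k(1)] h by blast
    qed
  qed
qed

lemmas pushout_ex = ab_cat.pullback_ex[OF op]

lemma pullbackD:
  assumes "pullback P X Y W a b f g"
  shows "a \<in> hm P X" "b \<in> hm P Y" "f \<in> hm X W" "g \<in> hm Y W" "f \<cdot> a = g \<cdot> b"
    "\<And>U x y. x \<in> hm U X \<Longrightarrow> y \<in> hm U Y \<Longrightarrow> f \<cdot> x = g \<cdot> y \<Longrightarrow> \<exists>h\<in>hm U P. a \<cdot> h = x \<and> b \<cdot> h = y"
    "\<And>U h h'. h \<in> hm U P \<Longrightarrow> h' \<in> hm U P \<Longrightarrow> a \<cdot> h = a \<cdot> h' \<Longrightarrow> b \<cdot> h = b \<cdot> h' \<Longrightarrow> h = h'"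
  using assms unfolding pullbackp_def by blast+

lemmas pushoutD = ab_cat.pullbackD[OF op]

lemma pullback_swap: "pullback P X Y W a b f g \<Longrightarrow> pullback P Y X W b a g f"
  unfolding pullbackp_def by metis

lemmas pushout_swap = ab_cat.pullback_swap[OF op]

text \<open>The cover supplied by \<open>refine\<close> maps to the fibre product, so
  \<open>a\<close> is the last factor of an epimorphism.\<close>

lemma pullback_epi:
  assumes pb: "pullback P X Y W a b f g" and g: "epi Y W g"
  shows "epi P X a"
proof -
  note p = pullbackD[OF pb]
  obtain P' u x where u: "epi P' X u" "x \<in> hm P' Y" "g \<cdot> x = f \<cdot> u" using refine[OF g p(3)] .
  then obtain h where h: "h \<in> hm P' P" "a \<cdot> h = u" using p(6) epi_hom by metis
  then show ?thesis using u epi_right p(1) by blast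
qed

lemmas pushout_mono = ab_cat.pullback_epi[OF op]

text \<open>A sub-object is a kernel, so belonging to it can be tested after precomposing with an
  epimorphism. Together with \<open>refine\<close> this makes diagram chases possible: preimages are
  chosen on a cover and the conclusion descends.\<close>

lemma ortho:
  assumes "mono B X i" "epi U' U u" "x \<in> hm U X" "z \<in> hm U' B" "i \<cdot> z = x \<cdot> u"
  shows "\<exists>z'\<in>hm U B. i \<cdot> z' = x"
proof -
  from mono_ker[OF assms(1)] obtain Y g where g: "kernel B X Y i g" by blast
  note g = kernelD[OF g]
  have "Z ((g \<cdot> x) \<cdot> u)" using g(4) assms(5) by (metis Z_right assoc)
  then have "Z (g \<cdot> x)" using epiD[OF assms(2)] g(3) assms(3) comp_hom by metis
  then show ?thesis using g(5) assms(3) by blast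
qed

text \<open>The image is taken to be the coimage, the cokernel of the kernel of
  \<open>f\<close>.\<close>

lemma image:
  assumes f: "f \<in> hm X Y"
  obtains I e m where "epi X I e" "mono I Y m" "m \<cdot> e = f"
proof -
  from ker_ex[OF f] obtain K k where "kernel K X Y k f" by blast
  note k = kernelD[OF this]
  from coker_ex[OF k(2)] obtain I e where "kernelp (\<lambda>A B. hm B A) (\<lambda>g f. f \<cdot> g) add I X K e k" by blast
  note e = cokernelD[OF this]
  obtain m where m: "m \<in> hm I Y" "m \<cdot> e = f" using e(5)[OF f] k(4) by blast
  have "mono I Y m"
  proof (rule monoI[OF m(1)])
    fix U z assume z: "z \<in> hm U I" "Z (m \<cdot> z)"
    obtain P u x where u: "epi P U u" "x \<in> hm P X" "e \<cdot> x = z \<cdot> u" using refine[OF e(1) z(1)] .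
    have "Z (f \<cdot> x)" using m u z by (metis Z_right assoc)
    then obtain y where "k \<cdot> y = x" using k u by blast
    then have "Z (z \<cdot> u)" using e(4) u by (metis Z_right assoc)
    then show "Z z" using epiD[OF u(1)] z by blast
  qed
  then show thesis using e(1) m that by blast
qed

text \<open>Records both the kernel property of \<open>i\<close> and the cokernel property of
  \<open>p\<close>, which makes the notion visibly self-dual; \<open>sesI\<close> and
  \<open>sesI_op\<close> supply each of the two from the other.\<close>

definition ses where
  "ses A B X i p \<longleftrightarrow> mono B X i \<and> epi X A p \<and> Z (p \<cdot> i) \<and>
     (\<forall>U x. x \<in> hm U X \<longrightarrow> Z (p \<cdot> x) \<longrightarrow> (\<exists>z\<in>hm U B. i \<cdot> z = x)) \<and>
     (\<forall>V y. y \<in> hm X V \<longrightarrow> Z (y \<cdot> i) \<longrightarrow> (\<exists>w\<in>hm A V. w \<cdot> p = y))"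

lemma ses_op: "ab_cat.ses (\<lambda>A B. hm B A) (\<lambda>g f. f \<cdot> g) add B A X p i \<longleftrightarrow> ses A B X i p"
  unfolding ab_cat.ses_def[OF op] ses_def by auto

lemma sesD:
  assumes "ses A B X i p"
  shows "mono B X i" "epi X A p" "Z (p \<cdot> i)" "i \<in> hm B X" "p \<in> hm X A"
    "\<And>U x. x \<in> hm U X \<Longrightarrow> Z (p \<cdot> x) \<Longrightarrow> \<exists>z\<in>hm U B. i \<cdot> z = x"
    "\<And>V y. y \<in> hm X V \<Longrightarrow> Z (y \<cdot> i) \<Longrightarrow> \<exists>w\<in>hm A V. w \<cdot> p = y"
    "A \<in> obj" "B \<in> obj" "X \<in> obj"
  using assms hom_obj unfolding ses_def monop_def by blast+

lemma sesI:
  assumes "mono B X i" "epi X A p" "Z (p \<cdot> i)"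
    "\<And>U x. x \<in> hm U X \<Longrightarrow> Z (p \<cdot> x) \<Longrightarrow> \<exists>z\<in>hm U B. i \<cdot> z = x"
  shows "ses A B X i p"
  unfolding ses_def
proof (intro conjI allI impI assms)
  fix V y assume y: "y \<in> hm X V" "Z (y \<cdot> i)"
  from epi_coker[OF assms(2)] obtain Y g where
    g: "g \<in> hm Y X" "Z (p \<cdot> g)" and cok: "\<And>V y. y \<in> hm X V \<Longrightarrow> Z (y \<cdot> g) \<Longrightarrow> \<exists>w\<in>hm A V. w \<cdot> p = y"
    unfolding kernelp_def by blast
  obtain z where "i \<cdot> z = g" using assms(4) g by blast
  then have "Z (y \<cdot> g)" using y by (metis Z_right assoc)
  then show "\<exists>w\<in>hm A V. w \<cdot> p = y" using cok y by blast
qed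

lemma sesI_op:
  assumes "mono B X i" "epi X A p" "Z (p \<cdot> i)"
    "\<And>U x. x \<in> hm X U \<Longrightarrow> Z (x \<cdot> i) \<Longrightarrow> \<exists>z\<in>hm A U. z \<cdot> p = x"
  shows "ses A B X i p"
  using ab_cat.sesI[OF op, of A X p B i] assms ses_op by blast

lemma sesI_refine:
  assumes "mono B X i" "epi X A p" "Z (p \<cdot> i)"
    "\<And>U x. x \<in> hm U X \<Longrightarrow> Z (p \<cdot> x) \<Longrightarrow> \<exists>U' u z. epi U' U u \<and> z \<in> hm U' B \<and> i \<cdot> z = x \<cdot> u"
  shows "ses A B X i p"
  using assms ortho by (intro sesI) metis+

lemma mono_ses:
  assumes "mono B X i" obtains A p where "ses A B X i p"
proof -
  from mono_ker[OF assms] obtain Y g where "kernel B X Y i g" by blast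
  note g = kernelD[OF this]
  from coker_ex[OF g(2)] obtain A p where "kernelp (\<lambda>A B. hm B A) (\<lambda>g f. f \<cdot> g) add A X B p i" by blast
  note p = cokernelD[OF this]
  have "ses A B X i p" by (rule sesI_op[OF assms p(1,4,5)])
  then show thesis by (rule that)
qed

lemma epi_ses:
  assumes "epi X A p" obtains B i where "ses A B X i p"
  using ab_cat.mono_ses[OF op assms] ses_op by metis

text \<open>Isomorphisms are kept together with their inverses, so that structures can be
  transported both ways without a choice. The inverse is unique, hence cardinalities are those of
  the sets of isomorphisms.\<close>

definition isop where
  "isop A B = {(h, k). h \<in> hm A B \<and> k \<in> hm B A \<and> k \<cdot> h = idn A \<and> h \<cdot> k = idn B}"

lemma isopD: "(h, k) \<in> isop A B \<Longrightarrow> h \<in> hm A B" "(h, k) \<in> isop A B \<Longrightarrow> k \<in> hm B A"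
  "(h, k) \<in> isop A B \<Longrightarrow> k \<cdot> h = idn A" "(h, k) \<in> isop A B \<Longrightarrow> h \<cdot> k = idn B"
  by (auto simp: isop_def)

lemma isop_op: "ab_cat.isop (\<lambda>A B. hm B A) (\<lambda>g f. f \<cdot> g) idn A B = {(h, k). (k, h) \<in> isop A B}"
  unfolding ab_cat.isop_def[OF op] isop_def by auto

text \<open>As a monomorphism, \<open>f\<close> is the kernel of some \<open>g\<close>; being epi it
  forces \<open>g\<close> to be zero, and then the identity of \<open>B\<close> factors through
  \<open>f\<close>.\<close>

lemma mono_epi_isop:
  assumes m: "mono A B f" and e: "epi A B f"
  obtains k where "(f, k) \<in> isop A B"
proof -
  from mono_ker[OF m] obtain Y g where "kernel A B Y f g" by blast
  note g = kernelD[OF this]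
  have B: "B \<in> obj" "A \<in> obj" using g(2) hom_obj by blast+
  have "Z g" using epiD[OF e] g by blast
  then have "Z (g \<cdot> idn B)" using Z_right by blast
  then obtain r where r: "r \<in> hm B A" "f \<cdot> r = idn B" using g(5) idn_hom B by blast
  have "f \<cdot> (r \<cdot> f) = f \<cdot> idn A" using r g(2) by (metis assoc idn_left idn_right)
  then have "r \<cdot> f = idn A" using mono_cancel[OF m] r g(2) comp_hom idn_hom B by metis
  then show thesis using that r g(2) by (auto simp: isop_def)
qed

lemma isop_mono: "(h, k) \<in> isop A B \<Longrightarrow> mono A B h"
  by (rule monoI) (auto simp: isop_def, metis Z_left assoc idn_left)

lemma isop_sym: "(h, k) \<in> isop A B \<Longrightarrow> (k, h) \<in> isop B A"
  by (auto simp: isop_def)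

lemma isop_epi: "(h, k) \<in> isop A B \<Longrightarrow> epi A B h"
  using ab_cat.isop_mono[OF op, of h k B A] isop_sym[of h k A B] by (simp add: isop_op)

lemma isop_idn: "A \<in> obj \<Longrightarrow> (idn A, idn A) \<in> isop A A"
  using idn_hom[of A] idn_left by (auto simp: isop_def)

lemma isop_comp: "(h, k) \<in> isop A B \<Longrightarrow> (h', k') \<in> isop B D \<Longrightarrow> (h' \<cdot> h, k \<cdot> k') \<in> isop A D"
  unfolding isop_def by (auto intro: comp_hom) (metis assoc idn_left, metis assoc idn_left)

lemma isop_unique: "(h, k) \<in> isop A B \<Longrightarrow> (h, k') \<in> isop A B \<Longrightarrow> k = k'"
  unfolding isop_def by auto (metis assoc idn_left idn_right)

lemma five_mono:
  assumes s: "ses A B X i p" "ses A B X' i' p'" and h: "h \<in> hm X X'" "h \<cdot> i = i'" "p' \<cdot> h = p"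
  shows "mono X X' h"
proof (rule monoI[OF h(1)])
  fix U x assume x: "x \<in> hm U X" "Z (h \<cdot> x)"
  then have "Z (p \<cdot> x)" using h(3) by (metis Z_left assoc)
  then obtain z where z: "z \<in> hm U B" "i \<cdot> z = x" using sesD[OF s(1)] x by blast
  then have "Z (i' \<cdot> z)" using h x by (metis assoc)
  then have "Z z" using sesD(1)[OF s(2)] monoD z by blast
  then show "Z x" using z Z_left by blast
qed

lemma five_epi:
  assumes s: "ses A B X i p" "ses A B X' i' p'" and h: "h \<in> hm X X'" "h \<cdot> i = i'" "p' \<cdot> h = p"
  shows "epi X X' h"
  using ab_cat.five_mono[OF op, of B A X' p' i' X p i h] s h ses_op by blast

lemma short_five:
  assumes s: "ses A B X i p" "ses A B X' i' p'" and h: "h \<in> hm X X'" "h \<cdot> i = i'" "p' \<cdot> h = p"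
  obtains k where "(h, k) \<in> isop X X'"
  using mono_epi_isop[OF five_mono[OF assms] five_epi[OF assms]] by blast

text \<open>Uniqueness in the universal property makes the map from the direct sum of
  \<open>N\<close> and \<open>Y\<close> to the pushout an epimorphism, and \<open>refine\<close>
  applies to it.\<close>

lemma pushout_refine:
  assumes po: "pushout S N Y D a b f g" and z: "z \<in> hm U S"
  obtains U' u z1 z2 where "epi U' U u" "z1 \<in> hm U' N" "z2 \<in> hm U' Y" "z \<cdot> u = a \<cdot> z1 \<boxplus> b \<cdot> z2"
proof -
  note p = pushoutD[OF po]
  obtain Q i1 i2 p1 p2 where q: "i1 \<in> hm N Q" "i2 \<in> hm Y Q" "p1 \<in> hm Q N" "p2 \<in> hm Q Y"
    "p1 \<cdot> i1 = idn N" "p2 \<cdot> i2 = idn Y" "Z (p2 \<cdot> i1)" "Z (p1 \<cdot> i2)" "i1 \<cdot> p1 \<boxplus> i2 \<cdot> p2 = idn Q"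
    using biproduct[of N Y] hom_obj p(1,2) by metis
  define h where "h = a \<cdot> p1 \<boxplus> b \<cdot> p2"
  have h: "h \<in> hm Q S" unfolding h_def using p q by (blast intro: comp_hom add_hom)
  have "epi Q S h"
  proof (rule epiI[OF h])
    fix V y assume y: "y \<in> hm S V" "Z (y \<cdot> h)"
    have ha: "h \<cdot> i1 = a" "h \<cdot> i2 = b"
    proof -
      have t: "b \<cdot> p2 \<cdot> i1 \<in> hm N S" "a \<cdot> p1 \<cdot> i2 \<in> hm Y S" using p q by (blast intro: comp_hom)+
      have "Z (b \<cdot> p2 \<cdot> i1)" "Z (a \<cdot> p1 \<cdot> i2)" using q by (simp_all add: Z_left)
      then show "h \<cdot> i1 = a" "h \<cdot> i2 = b" unfolding h_def using q p(1,2) t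
        by (simp_all add: distr assoc idn_right add_zerop zero_add)
    qed
    then have za: "Z (y \<cdot> a)" "Z (y \<cdot> b)" using y by (metis Z_right assoc)+
    have o: "S \<in> obj" "V \<in> obj" using y hom_obj by blast+
    have z0: "zero S V \<in> hm S V" "Z (zero S V)" using o by (auto intro: zero_hom zerop_zero)
    have "y \<cdot> a = zero S V \<cdot> a" "y \<cdot> b = zero S V \<cdot> b"
      using Z_zero_comp p(1,2) y za by blast+
    then show "Z y" using p(7)[OF y(1) z0(1)] z0 by simp
  qed
  from refine[OF this z] obtain U' u x where u: "epi U' U u" "x \<in> hm U' Q" "h \<cdot> x = z \<cdot> u" .
  have "z \<cdot> u = a \<cdot> p1 \<cdot> x \<boxplus> b \<cdot> p2 \<cdot> x" using u(3) unfolding h_def by (simp add: distr assoc)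
  then show thesis using that u q comp_hom by metis
qed

lemma ses_iso_mid:
  assumes s: "ses A B X i p" and h: "(h, k) \<in> isop X X'"
  shows "ses A B X' (h \<cdot> i) (p \<cdot> k)"
proof (rule sesI)
  note s' = sesD[OF s] and hh = isopD[OF h]
  show "mono B X' (h \<cdot> i)" using mono_comp[OF s'(1) isop_mono[OF h]] .
  show "epi X' A (p \<cdot> k)" using epi_comp[OF s'(2) isop_epi[OF isop_sym[OF h]]] .
  show "Z ((p \<cdot> k) \<cdot> h \<cdot> i)" using s' hh by (simp add: assoc ra[OF hh(3)] idn_left)
  fix U x assume x: "x \<in> hm U X'" "Z ((p \<cdot> k) \<cdot> x)"
  then have "Z (p \<cdot> k \<cdot> x)" by (simp add: assoc)
  then obtain z where z: "z \<in> hm U B" "i \<cdot> z = k \<cdot> x" using s'(6) comp_hom[OF x(1) hh(2)] by blast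
  then have "(h \<cdot> i) \<cdot> z = x" using hh x by (simp add: assoc ra[OF hh(4)] idn_left)
  then show "\<exists>z\<in>hm U B. (h \<cdot> i) \<cdot> z = x" using z by blast
qed

lemma ses_iso_sub:
  assumes s: "ses A B X i p" and h: "(h, k) \<in> isop B B'"
  shows "ses A B' X (i \<cdot> k) p"
proof (rule sesI)
  note s' = sesD[OF s] and hh = isopD[OF h]
  show "mono B' X (i \<cdot> k)" using mono_comp[OF isop_mono[OF isop_sym[OF h]] s'(1)] .
  show "epi X A p" by fact
  show "Z (p \<cdot> i \<cdot> k)" using s'(3) by (metis assoc Z_right)
  fix U x assume x: "x \<in> hm U X" "Z (p \<cdot> x)"
  then obtain z where z: "z \<in> hm U B" "i \<cdot> z = x" using s'(6) by blast
  then have "(i \<cdot> k) \<cdot> (h \<cdot> z) = x" using hh by (simp add: assoc ra[OF hh(3)] idn_left)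
  then show "\<exists>z\<in>hm U B'. (i \<cdot> k) \<cdot> z = x" using comp_hom z hh(1) by blast
qed

lemma ses_iso_quot:
  assumes s: "ses A B X i p" and h: "(h, k) \<in> isop A A'"
  shows "ses A' B X i (h \<cdot> p)"
  using ab_cat.ses_iso_sub[OF op, of B A X p i k h A'] ses_op s h isop_op by simp

text \<open>Given an extension \<open>E\<close> of \<open>A\<close> by \<open>S\<close>, extensions of \<open>E\<close> by \<open>D\<close> that are
  trivialised over \<open>S\<close> amount to extensions of \<open>A\<close> by \<open>D\<close>.\<close>

lemma descend_ext:
  assumes s: "ses A S E s p" and w: "ses E D W d b" and l: "l \<in> hm S W" "b \<cdot> l = s"
  obtains F i q g where "ses A D F i q" "epi W F g" "Z (g \<cdot> l)" "g \<cdot> d = i" "q \<cdot> g = p \<cdot> b"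
    "\<And>V y. y \<in> hm W V \<Longrightarrow> Z (y \<cdot> l) \<Longrightarrow> \<exists>w\<in>hm F V. w \<cdot> g = y"
proof -
  note s' = sesD[OF s] and w' = sesD[OF w]
  have "mono S W l" using mono_left[of S E b l W] s'(1) l by simp
  \<comment> \<open>The new middle term is \<open>W\<close> modulo the lifted copy of
    \<open>S\<close>.\<close>
  then obtain F g where g: "ses F S W l g" using mono_ses by blast
  note g' = sesD[OF g]
  have pb: "p \<cdot> b \<in> hm W A" using s'(4,5) w'(4,5) comp_hom by blast
  have "Z ((p \<cdot> b) \<cdot> l)" using l s' by (simp add: assoc)
  then obtain q where q: "q \<in> hm F A" "q \<cdot> g = p \<cdot> b" using g'(7) pb by blast
  have gd: "g \<cdot> d \<in> hm D F" using g'(4,5) w'(4,5) comp_hom by blast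
  have "ses A D F (g \<cdot> d) q"
  proof (rule sesI_refine)
    show "mono D F (g \<cdot> d)"
    proof (rule monoI[OF gd])
      fix U z assume z: "z \<in> hm U D" "Z ((g \<cdot> d) \<cdot> z)"
      have "d \<cdot> z \<in> hm U W" "Z (g \<cdot> d \<cdot> z)" using z w'(4,5) by (auto simp: assoc intro: comp_hom)
      then obtain y where y: "y \<in> hm U S" "l \<cdot> y = d \<cdot> z" using g'(6) by blast
      have "Z (b \<cdot> d \<cdot> z)" using w'(3) by (metis Z_right assoc)
      then have "Z (s \<cdot> y)" using y l by (metis assoc)
      then have "Z y" using monoD[OF s'(1)] y by blast
      then have "Z (d \<cdot> z)" using y Z_left by metis
      then show "Z z" using monoD[OF w'(1)] z by blast
    qed
    show "epi F A q" using epi_right[of A W q g F] epi_comp[OF s'(2) w'(2)] q by simp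
    show "Z (q \<cdot> g \<cdot> d)" using q(2) w'(3) by (metis Z_left assoc)
    fix U x assume x: "x \<in> hm U F" "Z (q \<cdot> x)"
    obtain P u v where u: "epi P U u" "v \<in> hm P W" "g \<cdot> v = x \<cdot> u" using refine[OF g'(2) x(1)] .
    have "Z (p \<cdot> b \<cdot> v)" using q u x by (metis Z_right assoc)
    then obtain y where y: "y \<in> hm P S" "s \<cdot> y = b \<cdot> v" using s'(6) u w'(4,5) comp_hom by blast
    \<comment> \<open>Correcting the preimage \<open>v\<close> by the lift of \<open>y\<close> moves
      it into the kernel of \<open>b\<close>, that is into \<open>D\<close>.\<close>
    have v: "v \<boxminus> l \<cdot> y \<in> hm P W" "l \<cdot> y \<in> hm P W" using u y l by (blast intro: comp_hom sub_hom)+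
    have "Z (b \<cdot> (v \<boxminus> l \<cdot> y))"
      using y l by (simp add: distl comp_neg ra[OF l(2)] zerop_add_neg)
    then obtain z where z: "z \<in> hm P D" "d \<cdot> z = v \<boxminus> l \<cdot> y" using w'(6) v by blast
    have "g \<cdot> v = g \<cdot> d \<cdot> z \<boxplus> g \<cdot> l \<cdot> y" using sub_add[OF u(2) v(2)] z distl by metis
    also have "\<dots> = (g \<cdot> d) \<cdot> z"
    proof -
      have "g \<cdot> d \<cdot> z \<in> hm P F" "g \<cdot> l \<cdot> y \<in> hm P F"
        using z(1) v(2) w'(4) g'(5) comp_hom by blast+
      moreover have "Z (g \<cdot> l \<cdot> y)" using Z_right[OF g'(3)] by (simp add: assoc)
      ultimately show ?thesis by (simp add: add_zerop assoc)
    qed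
    finally show "\<exists>U' u z. epi U' U u \<and> z \<in> hm U' D \<and> (g \<cdot> d) \<cdot> z = x \<cdot> u" using u z by metis
  qed
  then show thesis by (rule that[OF _ g'(2,3) refl q(2) g'(7)])
qed

text \<open>Pulls the extension of \<open>A\<close> by \<open>D\<close> back along \<open>p\<close>.
  The composite of \<open>p\<close> with \<open>s\<close> is zero, so \<open>s\<close> lifts to the
  pullback with zero second component.\<close>

lemma ascend_ext:
  assumes s: "ses A S E s p" and f: "ses A D F i q"
  obtains W d b l g where "ses E D W d b" "l \<in> hm S W" "b \<cdot> l = s" "Z (g \<cdot> l)" "g \<cdot> d = i"
    "pullback W E F A b g p q"
proof -
  note s' = sesD[OF s] and f' = sesD[OF f]
  obtain W b g where pb: "pullback W E F A b g p q" using pullback_ex[OF s'(5) f'(5)] .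
  note p' = pullbackD[OF pb]
  have zD: "zero D E \<in> hm D E" "Z (zero D E)" "zero S F \<in> hm S F" "Z (zero S F)" using s' f' by (auto intro: zero_hom zerop_zero)
  have "p \<cdot> zero D E = q \<cdot> i" by (rule Z_unique[of _ _ D A]) (use zD s'(5) f'(3,4,5) in \<open>auto intro: Z_left comp_hom\<close>)
  then obtain d where d: "d \<in> hm D W" "b \<cdot> d = zero D E" "g \<cdot> d = i" using p'(6)[OF zD(1) f'(4)] by blast
  have "p \<cdot> s = q \<cdot> zero S F" by (rule Z_unique[of _ _ S A]) (use zD s'(3,4,5) f'(5) in \<open>auto intro: Z_left comp_hom\<close>)
  then obtain l where l: "l \<in> hm S W" "b \<cdot> l = s" "g \<cdot> l = zero S F" using p'(6)[OF s'(4) zD(3)] by blast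
  have "ses E D W d b"
  proof (rule sesI)
    show "mono D W d" using mono_left[of D F g d W] d f'(1) by simp
    show "epi W E b" using pullback_epi[OF pb f'(2)] .
    show "Z (b \<cdot> d)" using d zD by simp
    fix U x assume x: "x \<in> hm U W" "Z (b \<cdot> x)"
    then have "Z (q \<cdot> g \<cdot> x)" using p'(5) by (metis Z_left assoc)
    then obtain z where z: "z \<in> hm U D" "i \<cdot> z = g \<cdot> x" using f'(6) x(1) p'(2) comp_hom by blast
    have dz: "d \<cdot> z \<in> hm U W" using d z comp_hom by blast
    have "Z (b \<cdot> d \<cdot> z)" using d(2) zD(2) Z_right assoc by metis
    then have "b \<cdot> d \<cdot> z = b \<cdot> x"
      by (rule Z_unique[of _ _ U E]) (use dz x p'(1) in \<open>auto intro: comp_hom\<close>)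
    moreover have "g \<cdot> d \<cdot> z = g \<cdot> x" using z d by (metis assoc)
    ultimately have "d \<cdot> z = x" using p'(7) dz x by blast
    then show "\<exists>z\<in>hm U D. d \<cdot> z = x" using z by blast
  qed
  moreover have "Z (g \<cdot> l)" using l zD by simp
  ultimately show thesis using that[of W d b l g] l(1,2) d(3) pb by blast
qed

text \<open>Let \<open>D \<rightarrow> S \<rightarrow> T \<rightarrow> A\<close> be exact with \<open>I\<close> the image of the middle arrow.\<close>

definition fillings where
  "fillings A S T c q E = {(s, t). s \<in> hm S E \<and> t \<in> hm E T \<and> t \<cdot> s = c \<and> ses A S E s (q \<cdot> t)}"

text \<open>A filling is an object with a filtration whose layers are \<open>D\<close>,
  \<open>I\<close> and \<open>A\<close>, with \<open>S\<close> made of the lower two and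
  \<open>T\<close> of the upper two. The definition prescribes only the sub-object \<open>S\<close>;
  this recovers \<open>T\<close> as the quotient by \<open>D\<close>.\<close>

lemma filling_dual1:
  assumes d: "ses I D S \<delta> \<gamma>" and a: "ses A I T \<iota> q"
    and st: "s \<in> hm S E" "t \<in> hm E T" "t \<cdot> s = \<iota> \<cdot> \<gamma>" and e: "ses A S E s (q \<cdot> t)"
  shows "ses T D E (s \<cdot> \<delta>) t"
proof (rule sesI)
  note d' = sesD[OF d] and a' = sesD[OF a] and e' = sesD[OF e]
  show "mono D E (s \<cdot> \<delta>)" using mono_comp[OF d'(1) e'(1)] .
  show "epi E T t"
  proof (rule epiI[OF st(2)])
    fix V y assume y: "y \<in> hm T V" "Z (y \<cdot> t)"
    then have "Z ((y \<cdot> \<iota>) \<cdot> \<gamma>)" using st(3) by (metis Z_right assoc)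
    then have "Z (y \<cdot> \<iota>)" using epiD[OF d'(2)] y a'(4,5) comp_hom by blast
    then obtain w where w: "w \<in> hm A V" "w \<cdot> q = y" using a'(7) y by blast
    then have "Z (w \<cdot> q \<cdot> t)" using y by (metis assoc)
    then have "Z w" using epiD[OF e'(2)] w by blast
    then show "Z y" using w Z_right by metis
  qed
  show "Z (t \<cdot> s \<cdot> \<delta>)" using d'(3) st(3) by (metis Z_left assoc)
  fix U x assume x: "x \<in> hm U E" "Z (t \<cdot> x)"
  then have "Z ((q \<cdot> t) \<cdot> x)" by (metis Z_left assoc)
  then obtain z where z: "z \<in> hm U S" "s \<cdot> z = x" using e'(6) x by blast
  have "Z (\<iota> \<cdot> \<gamma> \<cdot> z)" using x z st(3) by (metis assoc)
  then have "Z (\<gamma> \<cdot> z)" using monoD[OF a'(1)] z d'(4,5) comp_hom by blast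
  then obtain v where "v \<in> hm U D" "\<delta> \<cdot> v = z" using d'(6) z by blast
  then show "\<exists>z\<in>hm U D. (s \<cdot> \<delta>) \<cdot> z = x" using z by (metis assoc)
qed

lemma filling_dual:
  assumes d: "ses I D S \<delta> \<gamma>" and a: "ses A I T \<iota> q"
    and st: "s \<in> hm S E" "t \<in> hm E T" "t \<cdot> s = \<iota> \<cdot> \<gamma>"
  shows "ses A S E s (q \<cdot> t) \<longleftrightarrow> ses T D E (s \<cdot> \<delta>) t"
proof
  assume "ses T D E (s \<cdot> \<delta>) t"
  then show "ses A S E s (q \<cdot> t)"
    using ab_cat.filling_dual1[OF op, of I A T q \<iota> D S \<gamma> \<delta> t E s] d a st ses_op by metis
qed (use filling_dual1 assms in blast)

text \<open>Third isomorphism theorem: \<open>T\<close> is \<open>E\<close> modulo \<open>D\<close>,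
  and the quotient \<open>I\<close> of \<open>S\<close> by \<open>D\<close> sits inside it. This is
  the push-forward of the extension along \<open>\<gamma>\<close>.\<close>

lemma quotient_ext:
  assumes d: "ses I D S \<delta> \<gamma>" and e: "ses A S E s p"
  obtains T \<iota> q t where "ses A I T \<iota> q" "epi E T t" "t \<cdot> s = \<iota> \<cdot> \<gamma>" "q \<cdot> t = p"
    "\<And>V y. y \<in> hm E V \<Longrightarrow> Z (y \<cdot> s \<cdot> \<delta>) \<Longrightarrow> \<exists>w\<in>hm T V. w \<cdot> t = y"
proof -
  note d' = sesD[OF d] and e' = sesD[OF e]
  obtain T t where t: "ses T D E (s \<cdot> \<delta>) t" using mono_ses[OF mono_comp[OF d'(1) e'(1)]] .
  note t' = sesD[OF t]
  have ts: "t \<cdot> s \<in> hm S T" using t'(4,5) e'(4,5) comp_hom by blast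
  have "Z ((t \<cdot> s) \<cdot> \<delta>)" using t' by (simp add: assoc)
  then obtain \<iota> where i: "\<iota> \<in> hm I T" "\<iota> \<cdot> \<gamma> = t \<cdot> s" using d'(7) ts by blast
  have "Z (p \<cdot> s \<cdot> \<delta>)" using e' by (metis Z_right assoc)
  then obtain q where q: "q \<in> hm T A" "q \<cdot> t = p" using t'(7) e' by blast
  have "ses A I T \<iota> q"
  proof (rule sesI_refine)
    show "mono I T \<iota>"
    proof (rule monoI[OF i(1)])
      fix U z assume z: "z \<in> hm U I" "Z (\<iota> \<cdot> z)"
      obtain P u x where u: "epi P U u" "x \<in> hm P S" "\<gamma> \<cdot> x = z \<cdot> u" using refine[OF d'(2) z(1)] .
      have "Z (t \<cdot> s \<cdot> x)" using i u z by (metis Z_right assoc)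
      then obtain v where v: "v \<in> hm P D" "(s \<cdot> \<delta>) \<cdot> v = s \<cdot> x" using t'(6) u e'(4,5) comp_hom by blast
      then have "s \<cdot> (\<delta> \<cdot> v) = s \<cdot> x" by (simp add: assoc)
      then have "\<delta> \<cdot> v = x" using mono_cancel[OF e'(1)] v u d'(4,5) comp_hom by metis
      then have "Z (z \<cdot> u)" using u d'(3) by (metis Z_right assoc)
      then show "Z z" using epiD u z by blast
    qed
    show "epi T A q" using epi_right[of A E q t T] e' q by simp
    have "Z ((q \<cdot> \<iota>) \<cdot> \<gamma>)" using i q e' by (metis assoc)
    then show "Z (q \<cdot> \<iota>)" using epiD[OF d'(2)] q i comp_hom by blast
    fix U x assume x: "x \<in> hm U T" "Z (q \<cdot> x)"
    obtain P u v where u: "epi P U u" "v \<in> hm P E" "t \<cdot> v = x \<cdot> u" using refine[OF t'(2) x(1)] .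
    have "Z (p \<cdot> v)" using u q x by (metis assoc Z_right)
    then obtain z where z: "z \<in> hm P S" "s \<cdot> z = v" using e'(6) u by blast
    have "\<iota> \<cdot> (\<gamma> \<cdot> z) = x \<cdot> u" using z u i by (metis assoc)
    then show "\<exists>U' u z. epi U' U u \<and> z \<in> hm U' I \<and> \<iota> \<cdot> z = x \<cdot> u" using z u d'(4,5) comp_hom by metis
  qed
  then show thesis using that t' i q by metis
qed

text \<open>\<open>V\<close> is the preimage of \<open>B\<close> under \<open>p\<close>. Together
  with the dual \<open>flag_quot\<close> it says that a filtration of \<open>Y\<close> with layers
  \<open>D\<close>, \<open>B\<close> and \<open>A\<close> can be given from the top or from the
  bottom, which is the source of associativity.\<close>

lemma flag_sub:
  assumes x: "ses X D Y i p" and a: "ses A B X j q"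
  obtains V m k l where "ses A V Y m (q \<cdot> p)" "ses B D V k l" "m \<cdot> k = i" "p \<cdot> m = j \<cdot> l"
proof -
  note x' = sesD[OF x] and a' = sesD[OF a]
  obtain V m where m: "ses A V Y m (q \<cdot> p)" using epi_ses[OF epi_comp[OF a'(2) x'(2)]] .
  note m' = sesD[OF m]
  have "Z ((q \<cdot> p) \<cdot> i)" using x' by (metis assoc Z_left)
  then obtain k where k: "k \<in> hm D V" "m \<cdot> k = i" using m'(6) x' by blast
  have "Z (q \<cdot> p \<cdot> m)" using m' by (simp add: assoc)
  then obtain l where l: "l \<in> hm V B" "j \<cdot> l = p \<cdot> m" using a'(6) x'(4,5) m'(4,5) comp_hom by blast
  have "ses B D V k l"
  proof (rule sesI)
    show "mono D V k" using mono_left[of D Y m k V] k x' by simp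
    show "epi V B l"
    proof -
      obtain P u e where u: "epi P B u" "e \<in> hm P Y" "p \<cdot> e = j \<cdot> u" using refine[OF x'(2) a'(4)] .
      have "Z ((q \<cdot> p) \<cdot> e)" using u a'(3) by (metis Z_right assoc)
      then obtain v where v: "v \<in> hm P V" "m \<cdot> v = e" using m'(6) u by blast
      have "j \<cdot> (l \<cdot> v) = j \<cdot> u" using v u l by (metis assoc)
      then have "l \<cdot> v = u" using mono_cancel[OF a'(1)] v l u epi_hom comp_hom by metis
      then show ?thesis using epi_right[of B P l v V] u l by simp
    qed
    have "Z (j \<cdot> l \<cdot> k)" using l k x'(3) by (metis assoc)
    then show "Z (l \<cdot> k)" using monoD[OF a'(1)] l k comp_hom by blast
    fix U y assume y: "y \<in> hm U V" "Z (l \<cdot> y)"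
    then have "Z (p \<cdot> m \<cdot> y)" using l by (metis Z_left assoc)
    then obtain w where w: "w \<in> hm U D" "i \<cdot> w = m \<cdot> y" using x'(6) m'(4,5) y comp_hom by blast
    then have "m \<cdot> (k \<cdot> w) = m \<cdot> y" using k by (metis assoc)
    then have "k \<cdot> w = y" using mono_cancel[OF m'(1)] w k y comp_hom by metis
    then show "\<exists>z\<in>hm U D. k \<cdot> z = y" using w by blast
  qed
  then show thesis using that m k l by metis
qed

lemma flag_quot:
  assumes "ses A V Y m r" "ses B D V k l"
  obtains X p j q where "ses X D Y (m \<cdot> k) p" "ses A B X j q" "q \<cdot> p = r" "j \<cdot> l = p \<cdot> m"
  using ab_cat.flag_sub[OF op, of V A Y r m D B l k] assms ses_op that by metis

end

section \<open>Counting short exact sequences\<close>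

lemma card_fibres:
  assumes "finite Z" "finite S" "\<And>z. z \<in> Z \<Longrightarrow> \<pi> z \<in> S"
  shows "card Z = (\<Sum>s\<in>S. card {z \<in> Z. \<pi> z = s})"
  using sum.group[of Z S \<pi> "\<lambda>_. 1::nat"] assms by (simp add: image_subset_iff)

text \<open>Both sides compute the sum of \<open>card (R X Y) / (a X * b Y)\<close> over all pairs,
  once through the fibres of \<open>\<pi>\<close> and once through those of
  \<open>\<rho>\<close>.\<close>

lemma double_count:
  fixes a :: "'x \<Rightarrow> rat" and b d :: "'y \<Rightarrow> rat"
  assumes fin: "finite J" "finite K" "\<And>X Y. X \<in> J \<Longrightarrow> Y \<in> K \<Longrightarrow> finite (R X Y)"
      "\<And>X. X \<in> J \<Longrightarrow> finite (S X)" "\<And>Y. Y \<in> K \<Longrightarrow> finite (T Y)"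
    and pr: "\<And>X Y z. X \<in> J \<Longrightarrow> Y \<in> K \<Longrightarrow> z \<in> R X Y \<Longrightarrow> \<pi> z \<in> S X"
      "\<And>X Y z. X \<in> J \<Longrightarrow> Y \<in> K \<Longrightarrow> z \<in> R X Y \<Longrightarrow> \<rho> z \<in> T Y"
    and h1: "\<And>X s. X \<in> J \<Longrightarrow> s \<in> S X \<Longrightarrow> (\<Sum>Y\<in>K. of_nat (card {z \<in> R X Y. \<pi> z = s}) / b Y) = 1"
    and h2: "\<And>Y t. Y \<in> K \<Longrightarrow> t \<in> T Y \<Longrightarrow> (\<Sum>X\<in>J. of_nat (card {z \<in> R X Y. \<rho> z = t}) / a X) = d Y"
  shows "(\<Sum>X\<in>J. of_nat (card (S X)) / a X) = (\<Sum>Y\<in>K. d Y * of_nat (card (T Y)) / b Y)"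
proof -
  have "(\<Sum>X\<in>J. of_nat (card (S X)) / a X) = (\<Sum>X\<in>J. \<Sum>Y\<in>K. of_nat (card (R X Y)) / (a X * b Y))"
  proof (rule sum.cong[OF refl])
    fix X assume X: "X \<in> J"
    have "(\<Sum>Y\<in>K. of_nat (card (R X Y)) / (a X * b Y)) =
      (\<Sum>Y\<in>K. \<Sum>s\<in>S X. of_nat (card {z \<in> R X Y. \<pi> z = s}) / (a X * b Y))"
      using X fin pr by (intro sum.cong refl) (simp add: card_fibres[of _ "S X" \<pi>] sum_divide_distrib)
    also have "\<dots> = (\<Sum>s\<in>S X. (\<Sum>Y\<in>K. of_nat (card {z \<in> R X Y. \<pi> z = s}) / b Y) / a X)"
      by (subst sum.swap) (simp add: sum_divide_distrib mult.commute)
    also have "\<dots> = of_nat (card (S X)) / a X" using X h1 by simp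
    finally show "of_nat (card (S X)) / a X = (\<Sum>Y\<in>K. of_nat (card (R X Y)) / (a X * b Y))" by simp
  qed
  also have "\<dots> = (\<Sum>Y\<in>K. \<Sum>X\<in>J. of_nat (card (R X Y)) / (a X * b Y))" by (rule sum.swap)
  also have "\<dots> = (\<Sum>Y\<in>K. d Y * of_nat (card (T Y)) / b Y)"
  proof (rule sum.cong[OF refl])
    fix Y assume Y: "Y \<in> K"
    have "(\<Sum>X\<in>J. of_nat (card (R X Y)) / (a X * b Y)) =
      (\<Sum>X\<in>J. \<Sum>t\<in>T Y. of_nat (card {z \<in> R X Y. \<rho> z = t}) / (a X * b Y))"
      using Y fin pr by (intro sum.cong refl) (simp add: card_fibres[of _ "T Y" \<rho>] sum_divide_distrib)
    also have "\<dots> = (\<Sum>t\<in>T Y. (\<Sum>X\<in>J. of_nat (card {z \<in> R X Y. \<rho> z = t}) / a X) / b Y)"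
      by (subst sum.swap) (simp add: sum_divide_distrib)
    also have "\<dots> = d Y * of_nat (card (T Y)) / b Y" using Y h2 by simp
    finally show "(\<Sum>X\<in>J. of_nat (card (R X Y)) / (a X * b Y)) = d Y * of_nat (card (T Y)) / b Y" .
  qed
  finally show ?thesis .
qed

text \<open>\<open>rp\<close> selects a representative of every isomorphism class, which turns sums
  over classes into sums over objects. The last two conditions are the finiteness of the sums in the
  product and in the coproduct.\<close>

locale fin_ab_cat = ab_cat +
  fixes rp :: "'a \<Rightarrow> 'a"
  assumes finite_hm: "finite (hm A B)"
    and rp_obj: "A \<in> obj \<Longrightarrow> rp A \<in> obj"
    and rp_iso: "A \<in> obj \<Longrightarrow> \<exists>h k. (h, k) \<in> isop A (rp A)"
    and rp_eq: "(h, k) \<in> isop A B \<Longrightarrow> rp A = rp B"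
    and fin_mid: "A \<in> obj \<Longrightarrow> B \<in> obj \<Longrightarrow> finite {X \<in> rp ` obj. \<exists>i p. ses A B X i p}"
    and fin_ends: "X \<in> obj \<Longrightarrow> finite {(A, B). A \<in> rp ` obj \<and> B \<in> rp ` obj \<and> (\<exists>i p. ses A B X i p)}"
begin

lemma op_fin: "fin_ab_cat obj (\<lambda>A B. hm B A) (\<lambda>g f. f \<cdot> g) idn add neg (\<lambda>A B. zero B A) rp"
proof (intro fin_ab_cat.intro op fin_ab_cat_axioms.intro; (unfold isop_op ses_op)?)
  fix A B X h k
  show "finite (hm B A)" by (rule finite_hm)
  show "A \<in> obj \<Longrightarrow> rp A \<in> obj" by (rule rp_obj)
  show "A \<in> obj \<Longrightarrow> \<exists>h k. (h, k) \<in> {(h, k). (k, h) \<in> isop A (rp A)}" using rp_iso by blast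
  show "(h, k) \<in> {(h, k). (k, h) \<in> isop A B} \<Longrightarrow> rp A = rp B" using rp_eq by blast
  assume "A \<in> obj" "B \<in> obj"
  then show "finite {X \<in> rp ` obj. \<exists>i p. ses B A X p i}"
    by (intro finite_subset[OF _ fin_mid[of B A]]) auto
next
  fix X assume "X \<in> obj"
  then have "finite ((\<lambda>(A, B). (B, A)) ` {(A, B). A \<in> rp ` obj \<and> B \<in> rp ` obj \<and> (\<exists>i p. ses A B X i p)})"
    by (intro finite_imageI fin_ends)
  then show "finite {(A, B). A \<in> rp ` obj \<and> B \<in> rp ` obj \<and> (\<exists>i p. ses B A X p i)}"
  proof (rule finite_subset[rotated], intro subsetI, clarify)
    fix A' B' i p assume "A' \<in> obj" "B' \<in> obj" "ses (rp B') (rp A') X p i"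
    then show "(rp A', rp B') \<in> (\<lambda>(A, B). (B, A)) ` {(A, B). A \<in> rp ` obj \<and> B \<in> rp ` obj \<and> (\<exists>i p. ses A B X i p)}"
      by (intro image_eqI[of _ _ "(rp B', rp A')"]) auto
  qed
qed

definition reps where "reps = rp ` obj"
definition au :: "'a \<Rightarrow> rat" where "au A = of_nat (card (isop A A))"
definition SES where "SES A B X = {(i, p). ses A B X i p}"
text \<open>Groupoid cardinality: where the automorphisms of \<open>X\<close> act on
  \<open>T X\<close>, this is the sum of the inverse orders of the stabilisers over the isomorphism
  classes of pairs of an object \<open>X\<close> and an element of \<open>T X\<close>. Restricting
  to nonempty \<open>T X\<close> keeps the index set finite in the uses below.\<close>

definition mass :: "('a \<Rightarrow> 'c set) \<Rightarrow> rat" where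
  "mass T = (\<Sum>X | X \<in> reps \<and> T X \<noteq> {}. of_nat (card (T X)) / au X)"

lemma reps_obj: "X \<in> reps \<Longrightarrow> X \<in> obj"
  using rp_obj by (auto simp: reps_def)

lemma rp_reps: "X \<in> obj \<Longrightarrow> rp X \<in> reps"
  by (auto simp: reps_def)

lemma rp_id: "X \<in> reps \<Longrightarrow> rp X = X"
  unfolding reps_def using rp_iso rp_eq by (metis image_iff)

lemma finite_isop: "finite (isop A B)"
  by (rule finite_subset[of _ "hm A B \<times> hm B A"]) (auto simp: isop_def finite_hm)

lemma finite_SES: "finite (SES A B X)"
  by (rule finite_subset[of _ "hm B X \<times> hm X A"]) (auto simp: SES_def finite_hm dest: sesD)

lemma au_pos: "A \<in> obj \<Longrightarrow> au A > 0"
  using isop_idn[of A] finite_isop[of A A] by (auto simp: au_def card_gt_0_iff)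

lemma mass_eq:
  assumes "finite J" "J \<subseteq> reps" "\<And>X. X \<in> reps \<Longrightarrow> T X \<noteq> {} \<Longrightarrow> X \<in> J"
  shows "mass T = (\<Sum>X\<in>J. of_nat (card (T X)) / au X)"
  unfolding mass_def by (rule sum.mono_neutral_left) (use assms in auto)

lemma card_isop_left:
  assumes "(h, k) \<in> isop X X'"
  shows "card (isop X Y) = card (isop X' Y)"
proof (rule bij_betw_same_card[of "\<lambda>(f, g). (f \<cdot> k, h \<cdot> g)"], rule bij_betw_byWitness[of _ "\<lambda>(f, g). (f \<cdot> h, k \<cdot> g)"])
  note i = isopD[OF assms]
  show "\<forall>a\<in>isop X Y. (\<lambda>(f, g). (f \<cdot> h, k \<cdot> g)) ((\<lambda>(f, g). (f \<cdot> k, h \<cdot> g)) a) = a"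
    using i by (auto simp: isop_def assoc ra[OF i(3)] idn_right idn_left)
  show "\<forall>a\<in>isop X' Y. (\<lambda>(f, g). (f \<cdot> k, h \<cdot> g)) ((\<lambda>(f, g). (f \<cdot> h, k \<cdot> g)) a) = a"
    using i by (auto simp: isop_def assoc ra[OF i(4)] idn_right idn_left)
  show "(\<lambda>(f, g). (f \<cdot> k, h \<cdot> g)) ` isop X Y \<subseteq> isop X' Y"
    using isop_comp[OF isop_sym[OF assms]] by auto
  show "(\<lambda>(f, g). (f \<cdot> h, k \<cdot> g)) ` isop X' Y \<subseteq> isop X Y"
    using isop_comp[OF assms] by auto
qed

text \<open>Orbit-stabiliser: the counts force \<open>T X\<close> to be empty unless
  \<open>X\<close> is isomorphic to \<open>Y\<close>, and at the representative of \<open>Y\<close>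
  the quotient of \<open>card (T X)\<close> by the number of automorphisms is
  \<open>1 / m\<close>.\<close>

lemma mass_isop_multiple:
  assumes Y: "Y \<in> obj" and m: "m \<noteq> 0" and fin: "\<And>X. X \<in> reps \<Longrightarrow> finite (T X)"
    and c: "\<And>X. X \<in> reps \<Longrightarrow> of_nat (card (isop Y X)) = m * (of_nat (card (T X)) :: rat)"
  shows "mass T = 1 / m"
proof -
  obtain h k where i: "(h, k) \<in> isop Y (rp Y)" using rp_iso Y by blast
  have rp: "rp Y \<in> reps" using rp_reps Y .
  have "isop Y X = {}" if "X \<in> reps" "X \<noteq> rp Y" for X
    using rp_eq rp_id that by (metis all_not_in_conv prod.exhaust)
  then have T0: "T X = {}" if "X \<in> reps" "X \<noteq> rp Y" for X using c[OF that(1)] m that fin[OF that(1)] by simp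
  have "mass T = (\<Sum>X\<in>{rp Y}. of_nat (card (T X)) / au X)"
    by (rule mass_eq) (use T0 rp in auto)
  also have "\<dots> = of_nat (card (T (rp Y))) / au (rp Y)" by simp
  also have "\<dots> = 1 / m"
  proof -
    have e: "au (rp Y) = m * of_nat (card (T (rp Y)))"
      using c[OF rp] card_isop_left[OF i, of "rp Y"] by (simp add: au_def)
    moreover from this have "card (T (rp Y)) \<noteq> 0" using au_pos[OF rp_obj[OF Y]]
      by (metis less_irrefl mult_zero_right of_nat_0)
    ultimately show ?thesis by simp
  qed
  finally show ?thesis .
qed

text \<open>A structure that is unique up to unique isomorphism, such as one given by a universal
  property, has mass one. Most fibres in the double counts are of this kind; \<open>G\<close> is the
  transport of structure from the model \<open>Y\<close>.\<close>

lemma mass_bij: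
  assumes Y: "Y \<in> obj"
    and G: "\<And>X h k. X \<in> reps \<Longrightarrow> (h, k) \<in> isop Y X \<Longrightarrow> G X h k \<in> T X"
    and inj: "\<And>X h k h' k'. X \<in> reps \<Longrightarrow> (h, k) \<in> isop Y X \<Longrightarrow> (h', k') \<in> isop Y X \<Longrightarrow>
      G X h k = G X h' k' \<Longrightarrow> h = h'"
    and sur: "\<And>X t. X \<in> reps \<Longrightarrow> t \<in> T X \<Longrightarrow> \<exists>h k. (h, k) \<in> isop Y X \<and> t = G X h k"
  shows "mass T = 1"
proof -
  have b: "bij_betw (\<lambda>(h, k). G X h k) (isop Y X) (T X)" if X: "X \<in> reps" for X
    unfolding bij_betw_def
  proof
    show "inj_on (\<lambda>(h, k). G X h k) (isop Y X)"
      using inj[OF X] isop_unique by (fastforce intro!: inj_onI)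
    show "(\<lambda>(h, k). G X h k) ` isop Y X = T X" using G[OF X] sur[OF X] by fastforce
  qed
  have "mass T = 1 / 1"
  proof (rule mass_isop_multiple[OF Y])
    fix X assume X: "X \<in> reps"
    show "finite (T X)" using b[OF X] finite_isop bij_betw_finite by blast
    show "of_nat (card (isop Y X)) = 1 * (of_nat (card (T X)) :: rat)"
      using bij_betw_same_card[OF b[OF X]] by simp
  qed simp
  then show ?thesis by simp
qed

text \<open>The form in which double counts are carried out: \<open>R\<close> is a correspondence
  whose fibres have mass one over \<open>S\<close> and mass \<open>d\<close> over
  \<open>T\<close>.\<close>

lemma mass_double:
  assumes fin: "finite {X \<in> reps. S X \<noteq> {}}" "finite {Y \<in> reps. T Y \<noteq> {}}"
    "\<And>X. X \<in> reps \<Longrightarrow> finite (S X)" "\<And>Y. Y \<in> reps \<Longrightarrow> finite (T Y)"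
    "\<And>X Y. X \<in> reps \<Longrightarrow> Y \<in> reps \<Longrightarrow> finite (R X Y)"
    and pr: "\<And>X Y z. X \<in> reps \<Longrightarrow> Y \<in> reps \<Longrightarrow> z \<in> R X Y \<Longrightarrow> \<pi> z \<in> S X"
      "\<And>X Y z. X \<in> reps \<Longrightarrow> Y \<in> reps \<Longrightarrow> z \<in> R X Y \<Longrightarrow> \<rho> z \<in> T Y"
    and h1: "\<And>X s. X \<in> reps \<Longrightarrow> s \<in> S X \<Longrightarrow> mass (\<lambda>Y. {z \<in> R X Y. \<pi> z = s}) = 1"
    and h2: "\<And>Y t. Y \<in> reps \<Longrightarrow> t \<in> T Y \<Longrightarrow> mass (\<lambda>X. {z \<in> R X Y. \<rho> z = t}) = d"
  shows "mass S = d * mass T"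
proof -
  let ?J = "{X \<in> reps. S X \<noteq> {}}" and ?K = "{Y \<in> reps. T Y \<noteq> {}}"
  have "(\<Sum>X\<in>?J. of_nat (card (S X)) / au X) = (\<Sum>Y\<in>?K. d * of_nat (card (T Y)) / au Y)"
  proof (rule double_count[of ?J ?K R S T \<pi> \<rho>])
    fix X s assume X: "X \<in> ?J" and s: "s \<in> S X"
    have "mass (\<lambda>Y. {z \<in> R X Y. \<pi> z = s}) = (\<Sum>Y\<in>?K. of_nat (card {z \<in> R X Y. \<pi> z = s}) / au Y)"
      by (rule mass_eq) (use fin pr X in \<open>(simp; fail | blast)+\<close>)
    then show "(\<Sum>Y\<in>?K. of_nat (card {z \<in> R X Y. \<pi> z = s}) / au Y) = 1" using h1 X s by simp
  next
    fix Y t assume Y: "Y \<in> ?K" and t: "t \<in> T Y"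
    have "mass (\<lambda>X. {z \<in> R X Y. \<rho> z = t}) = (\<Sum>X\<in>?J. of_nat (card {z \<in> R X Y. \<rho> z = t}) / au X)"
      by (rule mass_eq) (use fin pr Y in \<open>(simp; fail | blast)+\<close>)
    then show "(\<Sum>X\<in>?J. of_nat (card {z \<in> R X Y. \<rho> z = t}) / au X) = d" using h2 Y t by simp
  qed (use fin pr in auto)
  then show ?thesis by (simp add: mass_def sum_distrib_left)
qed

lemma fin_mid': "A \<in> obj \<Longrightarrow> B \<in> obj \<Longrightarrow> finite {X \<in> reps. SES A B X \<noteq> {}}"
  using fin_mid[of A B] by (auto simp: reps_def SES_def elim!: rev_finite_subset)

text \<open>Both sides count filtrations of \<open>Y\<close> with layers \<open>D\<close>,
  \<open>B\<close> and \<open>A\<close>: through the quotient \<open>X\<close> of \<open>Y\<close>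
  by the lowest layer, or through the sub-object \<open>V\<close> formed by the lower two.
  \<open>R\<close> pairs the two descriptions of one filtration.\<close>

lemma assoc_mass:
  assumes o: "A \<in> obj" "B \<in> obj" "D \<in> obj" "Y \<in> obj"
  shows "mass (\<lambda>X. SES X D Y \<times> SES A B X) = mass (\<lambda>V. SES A V Y \<times> SES B D V)"
proof -
  define R where "R X V = {(((i, p), (j, q)), ((m, r), (k, l))) |i p j q m r k l.
    (i, p) \<in> SES X D Y \<and> (j, q) \<in> SES A B X \<and> (m, r) \<in> SES A V Y \<and> (k, l) \<in> SES B D V \<and>
    i = m \<cdot> k \<and> r = q \<cdot> p \<and> p \<cdot> m = j \<cdot> l}" for X V
  have "mass (\<lambda>X. SES X D Y \<times> SES A B X) = 1 * mass (\<lambda>V. SES A V Y \<times> SES B D V)"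
  proof (rule mass_double[of _ _ R fst snd])
    show "finite {X \<in> reps. SES X D Y \<times> SES A B X \<noteq> {}}"
      by (rule finite_subset[OF _ fin_mid'[OF o(1,2)]]) auto
    show "finite {V \<in> reps. SES A V Y \<times> SES B D V \<noteq> {}}"
      by (rule finite_subset[OF _ fin_mid'[OF o(2,3)]]) auto
    show "finite (R X V)" for X V
      by (rule finite_subset[of _ "(SES X D Y \<times> SES A B X) \<times> (SES A V Y \<times> SES B D V)"])
        (auto simp: R_def finite_SES)
    show "fst z \<in> SES X D Y \<times> SES A B X" "snd z \<in> SES A V Y \<times> SES B D V" if "z \<in> R X V" for X V z
      using that by (auto simp: R_def)
  next
    fix X s assume X: "X \<in> reps" and "s \<in> SES X D Y \<times> SES A B X"
    then obtain i p j q where s: "s = ((i, p), (j, q))" "ses X D Y i p" "ses A B X j q"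
      by (auto simp: SES_def)
    obtain V m k l where v: "ses A V Y m (q \<cdot> p)" "ses B D V k l" "m \<cdot> k = i" "p \<cdot> m = j \<cdot> l"
      using flag_sub[OF s(2,3)] .
    note m = sesD[OF v(1)] and kl = sesD[OF v(2)] and j = sesD[OF s(3)]
    \<comment> \<open>\<open>V\<close> is the kernel of \<open>q \<cdot> p\<close>, so it is unique
      up to unique isomorphism, and its embedding determines \<open>k\<close> and
      \<open>l\<close>.\<close>
    show "mass (\<lambda>V. {z \<in> R X V. fst z = s}) = 1"
    proof (rule mass_bij[OF m(9), of "\<lambda>_ h g. (s, ((m \<cdot> g, q \<cdot> p), (h \<cdot> k, l \<cdot> g)))"])
      fix V' h g assume i: "(h, g) \<in> isop V V'"
      show "(s, ((m \<cdot> g, q \<cdot> p), (h \<cdot> k, l \<cdot> g))) \<in> {z \<in> R X V'. fst z = s}"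
        using ses_iso_sub[OF v(1) i] ses_iso_mid[OF v(2) i] s v isopD[OF i] kl(4)
        by (auto simp: R_def SES_def assoc ra[OF isopD(3)[OF i]] idn_left ra[OF v(4)])
    next
      fix V' h g h' g' assume i: "(h, g) \<in> isop V V'" "(h', g') \<in> isop V V'"
        and e: "(s, ((m \<cdot> g, q \<cdot> p), (h \<cdot> k, l \<cdot> g))) = (s, ((m \<cdot> g', q \<cdot> p), (h' \<cdot> k, l \<cdot> g')))"
      then have "g = g'" using mono_cancel[OF m(1) isopD(2)[OF i(1)] isopD(2)[OF i(2)]] by simp
      then show "h = h'" using i isop_sym isop_unique by metis
    next
      fix V' z assume "z \<in> {z \<in> R X V'. fst z = s}"
      then obtain m' k' l' where z: "z = (s, ((m', q \<cdot> p), (k', l')))" "ses A V' Y m' (q \<cdot> p)"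
        "ses B D V' k' l'" "i = m' \<cdot> k'" "p \<cdot> m' = j \<cdot> l'" using s by (auto simp: R_def SES_def)
      note m' = sesD[OF z(2)] and kl' = sesD[OF z(3)]
      obtain g where g: "g \<in> hm V' V" "m \<cdot> g = m'" using m(6) m'(3,4) by blast
      obtain h where h: "h \<in> hm V V'" "m' \<cdot> h = m" using m'(6) m(3,4) by blast
      have "m \<cdot> (g \<cdot> h) = m \<cdot> idn V" "m' \<cdot> (h \<cdot> g) = m' \<cdot> idn V'"
        using g h m m' by (simp_all add: ra[OF g(2)] ra[OF h(2)] idn_right)
      then have gh: "g \<cdot> h = idn V" "h \<cdot> g = idn V'"
        using mono_cancel[OF m(1)] mono_cancel[OF m'(1)] g h m(9) m'(9) comp_hom idn_hom by metis+
      have "m' \<cdot> k' = m' \<cdot> (h \<cdot> k)" using z(4) v(3) by (simp add: ra[OF h(2)])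
      then have k': "k' = h \<cdot> k" using mono_cancel[OF m'(1) kl'(4) comp_hom[OF kl(4) h(1)]] by simp
      have "j \<cdot> l' = j \<cdot> (l \<cdot> g)" using z(5) v(4) g(2) by (metis assoc)
      then have l': "l' = l \<cdot> g" using mono_cancel[OF j(1) kl'(5) comp_hom[OF g(1) kl(5)]] by simp
      have "(h, g) \<in> isop V V'" using g h gh by (simp add: isop_def)
      then show "\<exists>h g. (h, g) \<in> isop V V' \<and> z = (s, ((m \<cdot> g, q \<cdot> p), (h \<cdot> k, l \<cdot> g)))"
        using z g k' l' by blast
    qed
  next
    fix V t assume V: "V \<in> reps" and "t \<in> SES A V Y \<times> SES B D V"
    then obtain m r k l where s: "t = ((m, r), (k, l))" "ses A V Y m r" "ses B D V k l"
      by (auto simp: SES_def)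
    obtain X p j q where v: "ses X D Y (m \<cdot> k) p" "ses A B X j q" "q \<cdot> p = r" "j \<cdot> l = p \<cdot> m"
      using flag_quot[OF s(2,3)] .
    note p = sesD[OF v(1)] and jq = sesD[OF v(2)] and l = sesD[OF s(3)]
    show "mass (\<lambda>X. {z \<in> R X V. snd z = t}) = 1"
    proof (rule mass_bij[OF p(8), of "\<lambda>_ h g. (((m \<cdot> k, h \<cdot> p), (h \<cdot> j, q \<cdot> g)), t)"])
      fix X' h g assume i: "(h, g) \<in> isop X X'"
      show "(((m \<cdot> k, h \<cdot> p), (h \<cdot> j, q \<cdot> g)), t) \<in> {z \<in> R X' V. snd z = t}"
        using ses_iso_quot[OF v(1) i] ses_iso_mid[OF v(2) i] s v isopD[OF i] p(5)
        by (auto simp: R_def SES_def assoc ra[OF isopD(3)[OF i]] idn_left v(4))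
    next
      fix X' h g h' g' assume i: "(h, g) \<in> isop X X'" "(h', g') \<in> isop X X'"
        and e: "(((m \<cdot> k, h \<cdot> p), (h \<cdot> j, q \<cdot> g)), t) = (((m \<cdot> k, h' \<cdot> p), (h' \<cdot> j, q \<cdot> g')), t)"
      then show "h = h'" using epi_cancel[OF p(2) isopD(1)[OF i(1)] isopD(1)[OF i(2)]] by simp
    next
      fix X' z assume "z \<in> {z \<in> R X' V. snd z = t}"
      then obtain p' j' q' where z: "z = (((m \<cdot> k, p'), (j', q')), t)" "ses X' D Y (m \<cdot> k) p'"
        "ses A B X' j' q'" "r = q' \<cdot> p'" "p' \<cdot> m = j' \<cdot> l" using s by (auto simp: R_def SES_def)
      note p' = sesD[OF z(2)] and jq' = sesD[OF z(3)]
      obtain h where h: "h \<in> hm X X'" "h \<cdot> p = p'" using p(7)[OF p'(5) p'(3)] by blast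
      obtain g where g: "g \<in> hm X' X" "g \<cdot> p' = p" using p'(7)[OF p(5) p(3)] by blast
      have "(g \<cdot> h) \<cdot> p = idn X \<cdot> p" "(h \<cdot> g) \<cdot> p' = idn X' \<cdot> p'"
        using g h p p' by (simp_all add: assoc idn_left)
      then have gh: "g \<cdot> h = idn X" "h \<cdot> g = idn X'"
        using epi_cancel[OF p(2)] epi_cancel[OF p'(2)] g h p(8) p'(8) comp_hom idn_hom by metis+
      have "q' \<cdot> p' = (q \<cdot> g) \<cdot> p'" using z(4) v(3) g by (simp add: assoc)
      then have q': "q' = q \<cdot> g" using epi_cancel[OF p'(2) jq'(5) comp_hom[OF g(1) jq(5)]] by simp
      have "j' \<cdot> l = (h \<cdot> j) \<cdot> l" using z(5) v(4) h(2) by (metis assoc)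
      then have j': "j' = h \<cdot> j" using epi_cancel[OF l(2) jq'(4) comp_hom[OF jq(4) h(1)]] by simp
      have "(h, g) \<in> isop X X'" using g h gh by (simp add: isop_def)
      then show "\<exists>h g. (h, g) \<in> isop X X' \<and> z = (((m \<cdot> k, h \<cdot> p), (h \<cdot> j, q \<cdot> g)), t)"
        using z h q' j' by blast
    qed
  qed (auto simp: finite_SES)
  then show ?thesis by simp
qed

lemma mass_cong_bij:
  assumes "\<And>E. bij_betw (f E) (S E) (T E)"
  shows "mass S = mass T"
proof -
  have "S E = {} \<longleftrightarrow> T E = {}" "card (S E) = card (T E)" for E
    using bij_betw_imp_surj_on[OF assms[of E]] bij_betw_same_card[OF assms[of E]] by auto
  then show ?thesis unfolding mass_def by simp
qed

definition split_exts where
  "split_exts E D S s W = {(d, b, l). ses E D W d b \<and> l \<in> hm S W \<and> b \<cdot> l = s}"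

lemma finite_split_exts: "finite (split_exts E D S s W)"
  by (rule finite_subset[of _ "hm D W \<times> hm W E \<times> hm S W"])
    (auto simp: split_exts_def finite_hm dest: sesD)

lemma fin_mid_split: "E \<in> obj \<Longrightarrow> D \<in> obj \<Longrightarrow> finite {W \<in> reps. split_exts E D S s W \<noteq> {}}"
  by (rule finite_subset[OF _ fin_mid'[of E D]]) (auto simp: split_exts_def SES_def)

text \<open>\<open>R\<close> links the two kinds of extension by a map \<open>g\<close> of middle
  terms. Dividing by the lifted \<open>S\<close> and pulling back along \<open>p\<close> are both
  universal constructions, so each side determines the other up to unique isomorphism.\<close>

lemma split_exts_mass:
  assumes s: "ses A S E s p" and D: "D \<in> obj"
  shows "mass (split_exts E D S s) = mass (SES A D)"
proof -
  define R where "R W F = {((d, b, l), (i, q), g) |d b l i q g.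
    (d, b, l) \<in> split_exts E D S s W \<and> (i, q) \<in> SES A D F \<and> g \<in> hm W F \<and> Z (g \<cdot> l) \<and>
    g \<cdot> d = i \<and> q \<cdot> g = p \<cdot> b}" for W F
  note s' = sesD[OF s]
  have "mass (split_exts E D S s) = 1 * mass (SES A D)"
  proof (rule mass_double[of _ _ R fst "fst \<circ> snd"])
    show "finite {W \<in> reps. split_exts E D S s W \<noteq> {}}" using fin_mid_split s' D by blast
    show "finite {F \<in> reps. SES A D F \<noteq> {}}" using fin_mid' s' D by blast
    show "finite (R W F)" for W F
      by (rule finite_subset[of _ "split_exts E D S s W \<times> SES A D F \<times> hm W F"])
        (auto simp: R_def finite_SES finite_split_exts finite_hm)
    show "fst z \<in> split_exts E D S s W" "(fst \<circ> snd) z \<in> SES A D F" if "z \<in> R W F" for W F z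
      using that by (auto simp: R_def)
  next
    fix W t assume "W \<in> reps" and "t \<in> split_exts E D S s W"
    then obtain d b l where t: "t = (d, b, l)" and w: "ses E D W d b" "l \<in> hm S W" "b \<cdot> l = s"
      by (auto simp: split_exts_def)
    obtain F i q g where f: "ses A D F i q" "epi W F g" "Z (g \<cdot> l)" "g \<cdot> d = i" "q \<cdot> g = p \<cdot> b"
      and cok: "\<And>V y. y \<in> hm W V \<Longrightarrow> Z (y \<cdot> l) \<Longrightarrow> \<exists>w\<in>hm F V. w \<cdot> g = y"
      using descend_ext[OF s w] by metis
    note f' = sesD[OF f(1)] and g' = epi_hom[OF f(2)]
    show "mass (\<lambda>F. {z \<in> R W F. fst z = t}) = 1"
    proof (rule mass_bij[OF f'(10), of "\<lambda>_ h k. (t, (h \<cdot> i, q \<cdot> k), h \<cdot> g)"])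
      fix F' h k assume i: "(h, k) \<in> isop F F'"
      show "(t, (h \<cdot> i, q \<cdot> k), h \<cdot> g) \<in> {z \<in> R W F'. fst z = t}"
        using ses_iso_mid[OF f(1) i] w t isopD[OF i] g' f
        by (auto simp: R_def SES_def split_exts_def assoc ra[OF isopD(3)[OF i]] idn_left comp_hom Z_left)
    next
      fix F' h k h' k' assume i: "(h, k) \<in> isop F F'" "(h', k') \<in> isop F F'"
        and e: "(t, (h \<cdot> i, q \<cdot> k), h \<cdot> g) = (t, (h' \<cdot> i, q \<cdot> k'), h' \<cdot> g)"
      then show "h = h'" using epi_cancel[OF f(2) isopD(1)[OF i(1)] isopD(1)[OF i(2)]] by simp
    next
      fix F' z assume "z \<in> {z \<in> R W F'. fst z = t}"
      then obtain i' q' g2 where z: "z = (t, (i', q'), g2)" "ses A D F' i' q'" "g2 \<in> hm W F'"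
        "Z (g2 \<cdot> l)" "g2 \<cdot> d = i'" "q' \<cdot> g2 = p \<cdot> b" using t by (auto simp: R_def SES_def)
      obtain h where h: "h \<in> hm F F'" "h \<cdot> g = g2" using cok[OF z(3,4)] by blast
      have hi: "h \<cdot> i = i'" using h(2) z(5) f(4) by (metis assoc)
      have "(q' \<cdot> h) \<cdot> g = q \<cdot> g" using h(2) z(6) f(5) by (metis assoc)
      then have qh: "q' \<cdot> h = q" using epi_cancel[OF f(2) comp_hom[OF h(1) sesD(5)[OF z(2)]] f'(5)] by simp
      obtain k where k: "(h, k) \<in> isop F F'" using short_five[OF f(1) z(2) h(1) hi qh] .
      have "q' = q \<cdot> k" using qh isopD[OF k] sesD(5)[OF z(2)] by (metis assoc idn_right)
      then show "\<exists>h k. (h, k) \<in> isop F F' \<and> z = (t, (h \<cdot> i, q \<cdot> k), h \<cdot> g)"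
        using z(1) k hi h(2) by blast
    qed
  next
    fix F t assume "F \<in> reps" and "t \<in> SES A D F"
    then obtain i q where t: "t = (i, q)" and f: "ses A D F i q" by (auto simp: SES_def)
    obtain W d b l g where w: "ses E D W d b" "l \<in> hm S W" "b \<cdot> l = s" "Z (g \<cdot> l)" "g \<cdot> d = i"
      and pb: "pullback W E F A b g p q" using ascend_ext[OF s f] .
    note w' = sesD[OF w(1)] and p' = pullbackD[OF pb]
    show "mass (\<lambda>W. {z \<in> R W F. (fst \<circ> snd) z = t}) = 1"
    proof (rule mass_bij[OF w'(10), of "\<lambda>_ h k. ((h \<cdot> d, b \<cdot> k, h \<cdot> l), t, g \<cdot> k)"])
      fix W' h k assume i: "(h, k) \<in> isop W W'"
      show "((h \<cdot> d, b \<cdot> k, h \<cdot> l), t, g \<cdot> k) \<in> {z \<in> R W' F. (fst \<circ> snd) z = t}"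
        using ses_iso_mid[OF w(1) i] f w t isopD[OF i] p'(1-5) w'(4)
        by (auto simp: R_def SES_def split_exts_def assoc ra[OF isopD(3)[OF i]] idn_left comp_hom ra[OF p'(5)])
    next
      fix W' h k h' k' assume i: "(h, k) \<in> isop W W'" "(h', k') \<in> isop W W'"
        and e: "((h \<cdot> d, b \<cdot> k, h \<cdot> l), t, g \<cdot> k) = ((h' \<cdot> d, b \<cdot> k', h' \<cdot> l), t, g \<cdot> k')"
      then have "k = k'" using p'(7)[OF isopD(2)[OF i(1)] isopD(2)[OF i(2)]] by simp
      then show "h = h'" using i isop_sym isop_unique by metis
    next
      fix W' z assume "z \<in> {z \<in> R W' F. (fst \<circ> snd) z = t}"
      then obtain d2 b2 l2 g2 where z: "z = ((d2, b2, l2), t, g2)" "ses E D W' d2 b2" "l2 \<in> hm S W'"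
        "b2 \<cdot> l2 = s" "g2 \<in> hm W' F" "Z (g2 \<cdot> l2)" "g2 \<cdot> d2 = i" "q \<cdot> g2 = p \<cdot> b2"
        using t by (auto simp: R_def split_exts_def)
      note z' = sesD[OF z(2)]
      obtain h where h: "h \<in> hm W' W" "b \<cdot> h = b2" "g \<cdot> h = g2" using p'(6)[OF z'(5) z(5)] z(8) by metis
      have hd: "h \<cdot> d2 = d"
      proof (rule p'(7))
        show "h \<cdot> d2 \<in> hm D W" "d \<in> hm D W" using h z' w' comp_hom by blast+
        show "b \<cdot> h \<cdot> d2 = b \<cdot> d"
          by (rule Z_unique[of _ _ D E]) (use h z'(3,4,5) w'(3,4,5) in \<open>auto simp: ra intro: comp_hom\<close>)
        show "g \<cdot> h \<cdot> d2 = g \<cdot> d" using h z(7) w(5) by (simp add: ra)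
      qed
      have hl: "h \<cdot> l2 = l"
      proof (rule p'(7))
        show "h \<cdot> l2 \<in> hm S W" "l \<in> hm S W" using h z(3) w(2) comp_hom by blast+
        show "b \<cdot> h \<cdot> l2 = b \<cdot> l" using h z(4) w(3) by (simp add: ra)
        show "g \<cdot> h \<cdot> l2 = g \<cdot> l"
          by (rule Z_unique[of _ _ S F]) (use h z(3,5,6) w(2,4) p'(2) in \<open>auto simp: ra intro: comp_hom\<close>)
      qed
      obtain k where k: "(h, k) \<in> isop W' W" using short_five[OF z(2) w(1) h(1) hd h(2)] .
      have "d2 = k \<cdot> d" "l2 = k \<cdot> l" using hd hl isopD[OF k] z'(4) z(3) by (metis assoc idn_left)+
      then show "\<exists>h k. (h, k) \<in> isop W W' \<and> z = ((h \<cdot> d, b \<cdot> k, h \<cdot> l), t, g \<cdot> k)"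
        using z(1) isop_sym[OF k] h by blast
    qed
  qed (auto simp: finite_SES finite_split_exts)
  then show ?thesis by simp
qed

lemma finite_fillings: "finite (fillings A S T c q E)"
  by (rule finite_subset[of _ "hm S E \<times> hm E T"]) (auto simp: fillings_def finite_hm)

lemma fin_mid_fillings: "A \<in> obj \<Longrightarrow> S \<in> obj \<Longrightarrow> finite {E \<in> reps. fillings A S T c q E \<noteq> {}}"
  by (rule finite_subset[OF _ fin_mid'[of A S]]) (auto simp: fillings_def SES_def)

text \<open>Fillings form a torsor under the extensions of \<open>A\<close> by \<open>D\<close>: the difference of two fillings
  \<open>E\<close> and \<open>E\<^sub>0\<close> is read off the fibre product \<open>E \<times>\<^sub>T E\<^sub>0\<close>.\<close>

lemma fillings_mass:
  assumes d: "ses I D S \<delta> \<gamma>" and a: "ses A I T \<iota> q"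
    and E0: "(s\<^sub>0, t\<^sub>0) \<in> fillings A S T (\<iota> \<cdot> \<gamma>) q E\<^sub>0"
  shows "mass (fillings A S T (\<iota> \<cdot> \<gamma>) q) = mass (SES A D)"
proof -
  note d' = sesD[OF d] and a' = sesD[OF a]
  have e0: "s\<^sub>0 \<in> hm S E\<^sub>0" "t\<^sub>0 \<in> hm E\<^sub>0 T" "t\<^sub>0 \<cdot> s\<^sub>0 = \<iota> \<cdot> \<gamma>" "ses A S E\<^sub>0 s\<^sub>0 (q \<cdot> t\<^sub>0)"
    using E0 by (auto simp: fillings_def)
  have e0d: "ses T D E\<^sub>0 (s\<^sub>0 \<cdot> \<delta>) t\<^sub>0" using filling_dual[OF d a e0(1-3)] e0(4) by blast
  \<comment> \<open>\<open>c\<close> and \<open>b\<close> are to be the two projections of the fibre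
    product \<open>W\<close>: they agree in \<open>T\<close>, and the lift \<open>l\<close> of
    \<open>S\<close> projects to \<open>s\<close> and to \<open>s\<^sub>0\<close>.\<close>
  define R where "R E W = {((s, t), (d, b, l), c) |s t d b l c.
    (s, t) \<in> fillings A S T (\<iota> \<cdot> \<gamma>) q E \<and> (d, b, l) \<in> split_exts E\<^sub>0 D S s\<^sub>0 W \<and> c \<in> hm W E \<and>
    c \<cdot> d = s \<cdot> \<delta> \<and> t \<cdot> c = t\<^sub>0 \<cdot> b \<and> c \<cdot> l = s}" for E W
  have "mass (fillings A S T (\<iota> \<cdot> \<gamma>) q) = 1 * mass (split_exts E\<^sub>0 D S s\<^sub>0)"
  proof (rule mass_double[of _ _ R fst "fst \<circ> snd"])
    show "finite {W \<in> reps. split_exts E\<^sub>0 D S s\<^sub>0 W \<noteq> {}}" using fin_mid_split sesD(10)[OF e0(4)] d' by blast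
    show "finite {E \<in> reps. fillings A S T (\<iota> \<cdot> \<gamma>) q E \<noteq> {}}" using fin_mid_fillings a' d' by blast
    show "finite (R E W)" for E W
      by (rule finite_subset[of _ "fillings A S T (\<iota> \<cdot> \<gamma>) q E \<times> split_exts E\<^sub>0 D S s\<^sub>0 W \<times> hm W E"])
        (auto simp: R_def finite_fillings finite_split_exts finite_hm)
    show "fst z \<in> fillings A S T (\<iota> \<cdot> \<gamma>) q E" "(fst \<circ> snd) z \<in> split_exts E\<^sub>0 D S s\<^sub>0 W" if "z \<in> R E W" for E W z
      using that by (auto simp: R_def)
  next
    fix E r assume "E \<in> reps" and "r \<in> fillings A S T (\<iota> \<cdot> \<gamma>) q E"
    then obtain s t where r: "r = (s, t)" and st: "s \<in> hm S E" "t \<in> hm E T" "t \<cdot> s = \<iota> \<cdot> \<gamma>" "ses A S E s (q \<cdot> t)"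
      by (auto simp: fillings_def)
    have std: "ses T D E (s \<cdot> \<delta>) t" using filling_dual[OF d a st(1-3)] st(4) by blast
    \<comment> \<open>Over a given filling \<open>E\<close> the extension \<open>W\<close> is the
      fibre product. The maps from \<open>S\<close> to \<open>E\<^sub>0\<close> and to
      \<open>E\<close> agree in \<open>T\<close>, so they combine to \<open>l\<close>.\<close>
    obtain W w b l0 c where w: "ses E\<^sub>0 D W w b" "l0 \<in> hm D W" "b \<cdot> l0 = s\<^sub>0 \<cdot> \<delta>" "Z (c \<cdot> l0)" "c \<cdot> w = s \<cdot> \<delta>"
      and pb: "pullback W E\<^sub>0 E T b c t\<^sub>0 t" using ascend_ext[OF e0d std] .
    note w' = sesD[OF w(1)] and p' = pullbackD[OF pb]
    obtain l where l: "l \<in> hm S W" "b \<cdot> l = s\<^sub>0" "c \<cdot> l = s" using p'(6)[OF e0(1) st(1)] e0(3) st(3) by metis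
    show "mass (\<lambda>W. {z \<in> R E W. fst z = r}) = 1"
    proof (rule mass_bij[OF w'(10), of "\<lambda>_ h k. (r, (h \<cdot> w, b \<cdot> k, h \<cdot> l), c \<cdot> k)"])
      fix W' h k assume i: "(h, k) \<in> isop W W'"
      show "(r, (h \<cdot> w, b \<cdot> k, h \<cdot> l), c \<cdot> k) \<in> {z \<in> R E W'. fst z = r}"
        using ses_iso_mid[OF w(1) i] w r st l isopD[OF i] p'(1-5) w'(4)
        by (auto simp: R_def split_exts_def fillings_def assoc ra[OF isopD(3)[OF i]] idn_left ra[OF idn_left[OF l(1)]] comp_hom ra[OF p'(5)])
    next
      fix W' h k h' k' assume i: "(h, k) \<in> isop W W'" "(h', k') \<in> isop W W'"
        and e: "(r, (h \<cdot> w, b \<cdot> k, h \<cdot> l), c \<cdot> k) = (r, (h' \<cdot> w, b \<cdot> k', h' \<cdot> l), c \<cdot> k')"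
      then have "k = k'" using p'(7)[OF isopD(2)[OF i(1)] isopD(2)[OF i(2)]] by simp
      then show "h = h'" using i isop_sym isop_unique by metis
    next
      fix W' z assume "z \<in> {z \<in> R E W'. fst z = r}"
      then obtain w2 b2 l2 c2 where z: "z = (r, (w2, b2, l2), c2)" "ses E\<^sub>0 D W' w2 b2" "l2 \<in> hm S W'"
        "b2 \<cdot> l2 = s\<^sub>0" "c2 \<in> hm W' E" "c2 \<cdot> w2 = s \<cdot> \<delta>" "t \<cdot> c2 = t\<^sub>0 \<cdot> b2" "c2 \<cdot> l2 = s"
        using r by (auto simp: R_def split_exts_def)
      note z' = sesD[OF z(2)]
      obtain h where h: "h \<in> hm W' W" "b \<cdot> h = b2" "c \<cdot> h = c2" using p'(6)[OF z'(5) z(5)] z(7) by metis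
      have hd: "h \<cdot> w2 = w"
      proof (rule p'(7))
        show "h \<cdot> w2 \<in> hm D W" "w \<in> hm D W" using h z' w' comp_hom by blast+
        show "b \<cdot> h \<cdot> w2 = b \<cdot> w"
          by (rule Z_unique[of _ _ D E\<^sub>0]) (use h z'(3,4,5) w'(3,4,5) in \<open>auto simp: ra intro: comp_hom\<close>)
        show "c \<cdot> h \<cdot> w2 = c \<cdot> w" using h z(6) w(5) by (simp add: ra)
      qed
      have hl: "h \<cdot> l2 = l"
      proof (rule p'(7))
        show "h \<cdot> l2 \<in> hm S W" "l \<in> hm S W" using h z(3) l(1) comp_hom by blast+
        show "b \<cdot> h \<cdot> l2 = b \<cdot> l" using h z(4) l(2) by (simp add: ra)
        show "c \<cdot> h \<cdot> l2 = c \<cdot> l" using h z(8) l(3) by (simp add: ra)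
      qed
      obtain k where k: "(h, k) \<in> isop W' W" using short_five[OF z(2) w(1) h(1) hd h(2)] .
      have "w2 = k \<cdot> w" "l2 = k \<cdot> l" using hd hl isopD[OF k] z'(4) z(3) by (metis assoc idn_left)+
      then show "\<exists>h k. (h, k) \<in> isop W W' \<and> z = (r, (h \<cdot> w, b \<cdot> k, h \<cdot> l), c \<cdot> k)"
        using z(1) isop_sym[OF k] h by blast
    qed
  next
    fix W r assume "W \<in> reps" and "r \<in> split_exts E\<^sub>0 D S s\<^sub>0 W"
    then obtain w b l where r: "r = (w, b, l)" and w: "ses E\<^sub>0 D W w b" "l \<in> hm S W" "b \<cdot> l = s\<^sub>0"
      by (auto simp: split_exts_def)
    note w' = sesD[OF w(1)]
    \<comment> \<open>The copy of \<open>D\<close> that must be divided out to recover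
      \<open>E\<close>: in \<open>E\<close> the embedding \<open>w\<close> and the restriction of
      \<open>l\<close> to \<open>D\<close> have to coincide, so their difference is killed. It lifts
      \<open>s\<^sub>0 \<cdot> \<delta>\<close>, hence \<open>descend_ext\<close> applies.\<close>
    define l0 where "l0 = l \<cdot> \<delta> \<boxminus> w"
    have ld: "l \<cdot> \<delta> \<in> hm D W" using w(2) d'(4) comp_hom by blast
    have l0: "l0 \<in> hm D W" unfolding l0_def using ld w'(4) sub_hom by blast
    have t1: "b \<cdot> w \<in> hm D E\<^sub>0" using comp_hom[OF w'(4,5)] .
    have "b \<cdot> l0 = s\<^sub>0 \<cdot> \<delta> \<boxminus> b \<cdot> w" unfolding l0_def using w(3) by (simp add: distl comp_neg ra)
    also have "\<dots> = s\<^sub>0 \<cdot> \<delta>"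
      by (rule add_zerop[OF comp_hom[OF d'(4) e0(1)] neg_hom[OF t1]]) (use Z_neg[OF t1] w'(3) in blast)
    finally have bl0: "b \<cdot> l0 = s\<^sub>0 \<cdot> \<delta>" .
    obtain E i t c where f: "ses T D E i t" "epi W E c" "Z (c \<cdot> l0)" "c \<cdot> w = i" "t \<cdot> c = t\<^sub>0 \<cdot> b"
      and cok: "\<And>V y. y \<in> hm W V \<Longrightarrow> Z (y \<cdot> l0) \<Longrightarrow> \<exists>w\<in>hm E V. w \<cdot> c = y"
      using descend_ext[OF e0d w(1) l0 bl0] by metis
    note f' = sesD[OF f(1)] and c' = epi_hom[OF f(2)]
    define s where "s = c \<cdot> l"
    have s: "s \<in> hm S E" unfolding s_def using c' w(2) comp_hom by blast
    have Zl0: "Z (y \<cdot> l0) \<longleftrightarrow> y \<cdot> l \<cdot> \<delta> = y \<cdot> w" if "y \<in> hm W V" for y V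
      unfolding l0_def using Z_sub[OF comp_hom[OF ld that] comp_hom[OF w'(4) that]]
      by (simp add: distl comp_neg)
    have sd: "s \<cdot> \<delta> = i" using Zl0[OF c'] f(3,4) by (simp add: s_def assoc)
    have ts: "t \<cdot> s = \<iota> \<cdot> \<gamma>" unfolding s_def using f(5) w(3) e0(3) by (simp add: ra[OF f(5)] assoc)
    have se: "ses A S E s (q \<cdot> t)" using filling_dual[OF d a s f'(5) ts] f(1) sd by simp
    show "mass (\<lambda>E. {z \<in> R E W. (fst \<circ> snd) z = r}) = 1"
    proof (rule mass_bij[OF f'(10), of "\<lambda>_ h k. ((h \<cdot> s, t \<cdot> k), r, h \<cdot> c)"])
      fix E' h k assume i: "(h, k) \<in> isop E E'"
      show "((h \<cdot> s, t \<cdot> k), r, h \<cdot> c) \<in> {z \<in> R E' W. (fst \<circ> snd) z = r}"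
        using ses_iso_mid[OF se i] w r isopD[OF i] c' f s ts sd f'(5)
        by (auto simp: R_def split_exts_def fillings_def assoc ra[OF isopD(3)[OF i]] idn_left ra[OF idn_left[OF c']] s_def intro: comp_hom)
    next
      fix E' h k h' k' assume i: "(h, k) \<in> isop E E'" "(h', k') \<in> isop E E'"
        and e: "((h \<cdot> s, t \<cdot> k), r, h \<cdot> c) = ((h' \<cdot> s, t \<cdot> k'), r, h' \<cdot> c)"
      then show "h = h'" using epi_cancel[OF f(2) isopD(1)[OF i(1)] isopD(1)[OF i(2)]] by simp
    next
      fix E' z assume "z \<in> {z \<in> R E' W. (fst \<circ> snd) z = r}"
      then obtain s2 t2 c2 where z: "z = ((s2, t2), r, c2)" "s2 \<in> hm S E'" "t2 \<in> hm E' T" "t2 \<cdot> s2 = \<iota> \<cdot> \<gamma>"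
        "ses A S E' s2 (q \<cdot> t2)" "c2 \<in> hm W E'" "c2 \<cdot> w = s2 \<cdot> \<delta>" "t2 \<cdot> c2 = t\<^sub>0 \<cdot> b" "c2 \<cdot> l = s2"
        using r by (auto simp: R_def fillings_def)
      have z2: "ses T D E' (s2 \<cdot> \<delta>) t2" using filling_dual[OF d a z(2-4)] z(5) by blast
      have "Z (c2 \<cdot> l0)" using Zl0[OF z(6)] z(7,9) by (simp add: ra)
      then obtain h where h: "h \<in> hm E E'" "h \<cdot> c = c2" using cok z(6) by blast
      have hs: "h \<cdot> s = s2" unfolding s_def using h(2) z(9) by (simp add: ra)
      have hi: "h \<cdot> i = s2 \<cdot> \<delta>" using hs sd by (metis assoc)
      have "(t2 \<cdot> h) \<cdot> c = t \<cdot> c" using h(2) z(8) f(5) by (simp add: assoc)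
      then have th: "t2 \<cdot> h = t" using epi_cancel[OF f(2) comp_hom[OF h(1) z(3)] f'(5)] by simp
      obtain k where k: "(h, k) \<in> isop E E'" using short_five[OF f(1) z2 h(1) hi th] .
      have "t2 = t \<cdot> k" using th isopD[OF k] z(3) by (metis assoc idn_right)
      then show "\<exists>h k. (h, k) \<in> isop E E' \<and> z = ((h \<cdot> s, t \<cdot> k), r, h \<cdot> c)"
        using z(1) k hs h(2) by blast
    qed
  qed (auto simp: finite_fillings finite_split_exts)
  then show ?thesis using split_exts_mass[OF e0(4)] d' by simp
qed

text \<open>Each extension of \<open>A\<close> by \<open>S\<close> pushes forward along
  \<open>\<gamma>\<close> to an extension of \<open>A\<close> by \<open>I\<close>. The fibre of this
  map is a set of fillings, whose mass is that of \<open>SES A D\<close> as soon as one filling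
  exists; existence is what the vanishing of Ext^2 provides.\<close>

lemma mass_mult_right:
  assumes d: "ses I D S \<delta> \<gamma>" and A: "A \<in> obj"
    and ex: "\<And>T \<iota> q. ses A I T \<iota> q \<Longrightarrow> \<exists>E. fillings A S T (\<iota> \<cdot> \<gamma>) q E \<noteq> {}"
  shows "mass (SES A S) = mass (SES A D) * mass (SES A I)"
proof -
  note d' = sesD[OF d]
  define R where "R E T = {((s, p), (\<iota>, q), t) |s p \<iota> q t.
    (s, p) \<in> SES A S E \<and> (\<iota>, q) \<in> SES A I T \<and> t \<in> hm E T \<and> t \<cdot> s = \<iota> \<cdot> \<gamma> \<and> q \<cdot> t = p}" for E T
  show ?thesis
  proof (rule mass_double[of _ _ R fst "fst \<circ> snd"])
    show "finite {E \<in> reps. SES A S E \<noteq> {}}" "finite {T \<in> reps. SES A I T \<noteq> {}}"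
      using fin_mid' A d' by blast+
    show "finite (R E T)" for E T
      by (rule finite_subset[of _ "SES A S E \<times> SES A I T \<times> hm E T"]) (auto simp: R_def finite_SES finite_hm)
    show "fst z \<in> SES A S E" "(fst \<circ> snd) z \<in> SES A I T" if "z \<in> R E T" for E T z
      using that by (auto simp: R_def)
  next
    fix E r assume "E \<in> reps" and "r \<in> SES A S E"
    then obtain s p where r: "r = (s, p)" and e: "ses A S E s p" by (auto simp: SES_def)
    obtain T \<iota> q t where t: "ses A I T \<iota> q" "epi E T t" "t \<cdot> s = \<iota> \<cdot> \<gamma>" "q \<cdot> t = p"
      and cok: "\<And>V y. y \<in> hm E V \<Longrightarrow> Z (y \<cdot> s \<cdot> \<delta>) \<Longrightarrow> \<exists>w\<in>hm T V. w \<cdot> t = y"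
      using quotient_ext[OF d e] by metis
    note t' = sesD[OF t(1)]
    show "mass (\<lambda>T. {z \<in> R E T. fst z = r}) = 1"
    proof (rule mass_bij[OF t'(10), of "\<lambda>_ h k. (r, (h \<cdot> \<iota>, q \<cdot> k), h \<cdot> t)"])
      fix T' h k assume i: "(h, k) \<in> isop T T'"
      show "(r, (h \<cdot> \<iota>, q \<cdot> k), h \<cdot> t) \<in> {z \<in> R E T'. fst z = r}"
        using ses_iso_mid[OF t(1) i] r e isopD[OF i] epi_hom[OF t(2)] t
        by (auto simp: R_def SES_def assoc ra[OF isopD(3)[OF i]] idn_left comp_hom)
    next
      fix T' h k h' k' assume i: "(h, k) \<in> isop T T'" "(h', k') \<in> isop T T'"
        and e: "(r, (h \<cdot> \<iota>, q \<cdot> k), h \<cdot> t) = (r, (h' \<cdot> \<iota>, q \<cdot> k'), h' \<cdot> t)"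
      then show "h = h'" using epi_cancel[OF t(2) isopD(1)[OF i(1)] isopD(1)[OF i(2)]] by simp
    next
      fix T' z assume "z \<in> {z \<in> R E T'. fst z = r}"
      then obtain \<iota>2 q2 t2 where z: "z = (r, (\<iota>2, q2), t2)" "ses A I T' \<iota>2 q2" "t2 \<in> hm E T'"
        "t2 \<cdot> s = \<iota>2 \<cdot> \<gamma>" "q2 \<cdot> t2 = p" using r by (auto simp: R_def SES_def)
      note z' = sesD[OF z(2)]
      have "Z (t2 \<cdot> s \<cdot> \<delta>)" using d'(3) by (simp add: ra[OF z(4)] assoc Z_left)
      then obtain h where h: "h \<in> hm T T'" "h \<cdot> t = t2" using cok z(3) by blast
      have "(h \<cdot> \<iota>) \<cdot> \<gamma> = \<iota>2 \<cdot> \<gamma>" using h(2) z(4) t(3) by (metis assoc)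
      then have hi: "h \<cdot> \<iota> = \<iota>2" using epi_cancel[OF d'(2) comp_hom[OF t'(4) h(1)] z'(4)] by simp
      have "(q2 \<cdot> h) \<cdot> t = q \<cdot> t" using h(2) z(5) t(4) by (simp add: assoc)
      then have qh: "q2 \<cdot> h = q" using epi_cancel[OF t(2) comp_hom[OF h(1) z'(5)] t'(5)] by simp
      obtain k where k: "(h, k) \<in> isop T T'" using short_five[OF t(1) z(2) h(1) hi qh] .
      have "q2 = q \<cdot> k" using qh isopD[OF k] z'(5) by (metis assoc idn_right)
      then show "\<exists>h k. (h, k) \<in> isop T T' \<and> z = (r, (h \<cdot> \<iota>, q \<cdot> k), h \<cdot> t)"
        using z(1) k hi h(2) by blast
    qed
  next
    fix T r assume "T \<in> reps" and "r \<in> SES A I T"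
    then obtain \<iota> q where r: "r = (\<iota>, q)" and e: "ses A I T \<iota> q" by (auto simp: SES_def)
    obtain E\<^sub>0 s\<^sub>0 t\<^sub>0 where E0: "(s\<^sub>0, t\<^sub>0) \<in> fillings A S T (\<iota> \<cdot> \<gamma>) q E\<^sub>0" using ex[OF e] by auto
    have "mass (\<lambda>E. {z \<in> R E T. (fst \<circ> snd) z = r}) = mass (fillings A S T (\<iota> \<cdot> \<gamma>) q)"
    proof (rule mass_cong_bij)
      fix E
      show "bij_betw (\<lambda>((s, p), r, t). (s, t)) {z \<in> R E T. (fst \<circ> snd) z = r} (fillings A S T (\<iota> \<cdot> \<gamma>) q E)"
        by (rule bij_betw_byWitness[of _ "\<lambda>(s, t). ((s, q \<cdot> t), r, t)"])
          (use r e in \<open>auto simp: R_def fillings_def SES_def dest: sesD\<close>)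
    qed
    then show "mass (\<lambda>E. {z \<in> R E T. (fst \<circ> snd) z = r}) = mass (SES A D)"
      using fillings_mass[OF d e E0] by simp
  qed (auto simp: finite_SES)
qed

end

section \<open>Crosses, frames, and the four-term exact sequence of a frame\<close>

context ab_cat
begin

lemma pullback_zero:
  assumes pb: "pullback P X Y W a b f g" and z: "z \<in> hm U P" "Z (a \<cdot> z)" "Z (b \<cdot> z)"
  shows "Z z"
proof -
  note p = pullbackD[OF pb]
  have o: "U \<in> obj" "P \<in> obj" using z hom_obj by blast+
  then have z0: "zero U P \<in> hm U P" "Z (zero U P)" by (auto intro: zero_hom zerop_zero)
  have "b \<cdot> z = b \<cdot> zero U P" "a \<cdot> z = a \<cdot> zero U P"
    using Z_comp_zero p(1,2) z by blast+
  then show "Z z" using p(7)[OF z(1) z0(1)] z0 by simp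
qed

lemmas pushout_zero = ab_cat.pullback_zero[OF op]

lemma kernel_unique:
  assumes s: "ses A B X i p" "ses A B' X i' p"
  obtains h k where "(h, k) \<in> isop B B'" "i' = i \<cdot> k"
proof -
  note s1 = sesD[OF s(1)] and s2 = sesD[OF s(2)]
  obtain k where k: "k \<in> hm B' B" "i \<cdot> k = i'" using s1(6)[OF s2(4,3)] by blast
  obtain h where h: "h \<in> hm B B'" "i' \<cdot> h = i" using s2(6)[OF s1(4,3)] by blast
  have "i \<cdot> (k \<cdot> h) = i \<cdot> idn B" "i' \<cdot> (h \<cdot> k) = i' \<cdot> idn B'"
    using k h s1(4) s2(4) by (simp_all add: ra[OF k(2)] ra[OF h(2)] idn_right)
  then have "k \<cdot> h = idn B" "h \<cdot> k = idn B'"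
    using mono_cancel[OF s1(1) comp_hom[OF h(1) k(1)] idn_hom[OF s1(9)]]
      mono_cancel[OF s2(1) comp_hom[OF k(1) h(1)] idn_hom[OF s2(9)]] by blast+
  then show thesis using that k h by (simp add: isop_def)
qed

lemma cokernel_unique:
  assumes "ses A B X i p" "ses A' B X i p'"
  obtains h k where "(h, k) \<in> isop A A'" "p' = h \<cdot> p"
  using ab_cat.kernel_unique[OF op, of B A X p i A' p'] assms ses_op isop_op that by auto

lemma image_unique:
  assumes e: "epi N I c" "epi N I' c'" and m: "mono I X d" "mono I' X d'" and eq: "d \<cdot> c = d' \<cdot> c'"
  obtains h k where "(h, k) \<in> isop I I'" "c' = h \<cdot> c" "d' = d \<cdot> k"
proof -
  obtain K i where "ses I K N i c" using epi_ses[OF e(1)] .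
  note s = sesD[OF this]
  have "Z (d' \<cdot> c' \<cdot> i)" using s(3) eq by (metis assoc Z_left)
  then have "Z (c' \<cdot> i)" using monoD[OF m(2) comp_hom[OF s(4) epi_hom[OF e(2)]]] by blast
  then obtain h where h: "h \<in> hm I I'" "h \<cdot> c = c'" using s(7)[OF epi_hom[OF e(2)]] by blast
  have "(d' \<cdot> h) \<cdot> c = d \<cdot> c" using h eq by (simp add: assoc)
  then have dh: "d' \<cdot> h = d" using epi_cancel[OF e(1) comp_hom[OF h(1) mono_hom[OF m(2)]] mono_hom[OF m(1)]] by simp
  have "mono I I' h" using mono_left[of I X d' h I'] m(1) dh h(1) by simp
  moreover have "epi I I' h" using epi_right[of I' N h c I] e(2) h by simp
  ultimately obtain k where k: "(h, k) \<in> isop I I'" using mono_epi_isop by blast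
  have "d' = d \<cdot> k" using dh isopD[OF k] mono_hom[OF m(2)] by (metis assoc idn_right)
  then show thesis using that k h by blast
qed

text \<open>On a cover an element of the pushout is the sum of one from \<open>N\<close> and one
  from \<open>Y\<close>. The map \<open>f\<close> sees only the first and \<open>g\<close> only the
  second, so vanishing of both puts both summands into \<open>D\<close>.\<close>

lemma frame_kernel:
  assumes po: "pushout S N Y D \<kappa>\<^sub>1 \<kappa>\<^sub>2 d1 d2" and sN: "ses C D N d1 c1" and sY: "ses B D Y d2 b1"
    and c2: "mono C X c2" and b2: "mono B M b2"
    and f: "f \<in> hm S X" "f \<cdot> \<kappa>\<^sub>1 = c2 \<cdot> c1" "Z (f \<cdot> \<kappa>\<^sub>2)"
    and g: "g \<in> hm S M" "g \<cdot> \<kappa>\<^sub>2 = b2 \<cdot> b1" "Z (g \<cdot> \<kappa>\<^sub>1)"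
    and z: "z \<in> hm U S" "Z (f \<cdot> z)" "Z (g \<cdot> z)"
  shows "\<exists>v\<in>hm U D. (\<kappa>\<^sub>1 \<cdot> d1) \<cdot> v = z"
proof -
  note p = pushoutD[OF po] and n = sesD[OF sN] and y = sesD[OF sY]
  obtain P u z1 z2 where u: "epi P U u" "z1 \<in> hm P N" "z2 \<in> hm P Y" "z \<cdot> u = \<kappa>\<^sub>1 \<cdot> z1 \<boxplus> \<kappa>\<^sub>2 \<cdot> z2"
    using pushout_refine[OF po z(1)] .
  have k: "\<kappa>\<^sub>1 \<cdot> z1 \<in> hm P S" "\<kappa>\<^sub>2 \<cdot> z2 \<in> hm P S" using u p(1,2) comp_hom by blast+
  have "Z (f \<cdot> (z \<cdot> u))" using z(2) by (metis assoc Z_right)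
  moreover have "f \<cdot> (z \<cdot> u) = f \<cdot> \<kappa>\<^sub>1 \<cdot> z1"
    unfolding u(4) distl by (rule add_zerop[OF comp_hom[OF k(1) f(1)] comp_hom[OF k(2) f(1)]]) (use Z_right[OF f(3)] in \<open>simp add: assoc\<close>)
  ultimately have "Z (c2 \<cdot> c1 \<cdot> z1)" using f(2) by (metis assoc)
  then have "Z (c1 \<cdot> z1)" using monoD[OF c2 comp_hom[OF u(2) n(5)]] by blast
  then obtain v1 where v1: "v1 \<in> hm P D" "d1 \<cdot> v1 = z1" using n(6)[OF u(2)] by blast
  have "Z (g \<cdot> (z \<cdot> u))" using z(3) by (metis assoc Z_right)
  moreover have "g \<cdot> (z \<cdot> u) = g \<cdot> \<kappa>\<^sub>2 \<cdot> z2"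
    unfolding u(4) distl by (rule zero_add[OF comp_hom[OF k(2) g(1)] comp_hom[OF k(1) g(1)]]) (use Z_right[OF g(3)] in \<open>simp add: assoc\<close>)
  ultimately have "Z (b2 \<cdot> b1 \<cdot> z2)" using g(2) by (metis assoc)
  then have "Z (b1 \<cdot> z2)" using monoD[OF b2 comp_hom[OF u(3) y(5)]] by blast
  then obtain v2 where v2: "v2 \<in> hm P D" "d2 \<cdot> v2 = z2" using y(6)[OF u(3)] by blast
  have "(\<kappa>\<^sub>1 \<cdot> d1) \<cdot> (v1 \<boxplus> v2) = \<kappa>\<^sub>1 \<cdot> (d1 \<cdot> v1) \<boxplus> (\<kappa>\<^sub>1 \<cdot> d1) \<cdot> v2" by (simp add: distl assoc)
  also have "(\<kappa>\<^sub>1 \<cdot> d1) \<cdot> v2 = \<kappa>\<^sub>2 \<cdot> d2 \<cdot> v2" using p(5) by (metis assoc)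
  finally have e: "(\<kappa>\<^sub>1 \<cdot> d1) \<cdot> (v1 \<boxplus> v2) = z \<cdot> u" using v1 v2 u(4) by simp
  have "mono D S (\<kappa>\<^sub>1 \<cdot> d1)" using mono_comp[OF n(1) pushout_mono[OF po y(1)]] .
  from ortho[OF this u(1) z(1) add_hom[OF v1(1) v2(1)] e] show ?thesis .
qed

text \<open>The four-term sequence \<open>D\<close>, \<open>S\<close>, \<open>T\<close>,
  \<open>A\<close> attached to a frame, with \<open>S\<close> the amalgamated sum of
  \<open>N\<close> and \<open>Y\<close> over \<open>D\<close> and \<open>T\<close> the fibre product
  of \<open>X\<close> and \<open>M\<close> over \<open>A\<close>. Its class in Ext^2 is the
  obstruction to a central object. Exactness at \<open>T\<close> is exactness at \<open>S\<close> in
  the opposite category.\<close>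

lemma frame_exact:
  assumes sN: "ses C D N d1 c1" and sY: "ses B D Y d2 b1" and sX: "ses A C X c2 a1" and sM: "ses A B M b2 a2"
    and po: "pushout S N Y D \<kappa>\<^sub>1 \<kappa>\<^sub>2 d1 d2" and pb: "pullback T X M A \<pi>\<^sub>1 \<pi>\<^sub>2 a1 a2"
  obtains I \<gamma> \<iota> where "ses I D S (\<kappa>\<^sub>1 \<cdot> d1) \<gamma>" "ses A I T \<iota> (a1 \<cdot> \<pi>\<^sub>1)"
    "\<pi>\<^sub>1 \<cdot> \<iota> \<cdot> \<gamma> \<cdot> \<kappa>\<^sub>1 = c2 \<cdot> c1" "Z (\<pi>\<^sub>2 \<cdot> \<iota> \<cdot> \<gamma> \<cdot> \<kappa>\<^sub>1)"
    "Z (\<pi>\<^sub>1 \<cdot> \<iota> \<cdot> \<gamma> \<cdot> \<kappa>\<^sub>2)" "\<pi>\<^sub>2 \<cdot> \<iota> \<cdot> \<gamma> \<cdot> \<kappa>\<^sub>2 = b2 \<cdot> b1"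
proof -
  note p = pushoutD[OF po] and q = pullbackD[OF pb]
    and n = sesD[OF sN] and y = sesD[OF sY] and x = sesD[OF sX] and m = sesD[OF sM]
  have cc: "c2 \<cdot> c1 \<in> hm N X" "b2 \<cdot> b1 \<in> hm Y M" using n x y m comp_hom by metis+
  have z: "zero N M \<in> hm N M" "Z (zero N M)" "zero Y X \<in> hm Y X" "Z (zero Y X)"
    using n(10) m(10) y(10) x(10) by (auto intro: zero_hom zerop_zero)
  \<comment> \<open>The middle arrow is a diagonal matrix: \<open>N\<close> maps to \<open>X\<close>
    through \<open>C\<close> and by zero to \<open>M\<close>, while \<open>Y\<close> maps to
    \<open>M\<close> through \<open>B\<close> and by zero to \<open>X\<close>.\<close>
  have "a1 \<cdot> c2 \<cdot> c1 = a2 \<cdot> zero N M"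
    by (rule Z_unique[OF _ Z_left comp_hom[OF cc(1) x(5)] comp_hom[OF z(1) m(5)]]) (use z Z_right[OF x(3)] in \<open>simp_all add: assoc\<close>)
  then obtain g1 where g1: "g1 \<in> hm N T" "\<pi>\<^sub>1 \<cdot> g1 = c2 \<cdot> c1" "\<pi>\<^sub>2 \<cdot> g1 = zero N M" using q(6)[OF cc(1) z(1)] by blast
  have "a1 \<cdot> zero Y X = a2 \<cdot> b2 \<cdot> b1"
    by (rule Z_unique[OF Z_left _ comp_hom[OF z(3) x(5)] comp_hom[OF cc(2) m(5)]]) (use z Z_right[OF m(3)] in \<open>simp_all add: assoc\<close>)
  then obtain g2 where g2: "g2 \<in> hm Y T" "\<pi>\<^sub>1 \<cdot> g2 = zero Y X" "\<pi>\<^sub>2 \<cdot> g2 = b2 \<cdot> b1" using q(6)[OF z(3) cc(2)] by blast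
  have "Z (g1 \<cdot> d1)"
  proof (rule pullback_zero[OF pb comp_hom[OF n(4) g1(1)]])
    show "Z (\<pi>\<^sub>1 \<cdot> g1 \<cdot> d1)" using n(3) by (simp add: ra[OF g1(2)] assoc Z_left)
    show "Z (\<pi>\<^sub>2 \<cdot> g1 \<cdot> d1)" using z by (simp add: ra[OF g1(3)] Z_right)
  qed
  moreover have "Z (g2 \<cdot> d2)"
  proof (rule pullback_zero[OF pb comp_hom[OF y(4) g2(1)]])
    show "Z (\<pi>\<^sub>2 \<cdot> g2 \<cdot> d2)" using y(3) by (simp add: ra[OF g2(3)] assoc Z_left)
    show "Z (\<pi>\<^sub>1 \<cdot> g2 \<cdot> d2)" using z by (simp add: ra[OF g2(2)] Z_right)
  qed
  ultimately have "g1 \<cdot> d1 = g2 \<cdot> d2"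
    using Z_unique comp_hom[OF n(4) g1(1)] comp_hom[OF y(4) g2(1)] by blast
  then obtain c where c: "c \<in> hm S T" "c \<cdot> \<kappa>\<^sub>1 = g1" "c \<cdot> \<kappa>\<^sub>2 = g2" using p(6)[OF g1(1) g2(1)] by blast
  obtain I \<gamma> \<iota> where i: "epi S I \<gamma>" "mono I T \<iota>" "\<iota> \<cdot> \<gamma> = c" using image[OF c(1)] .
  note \<gamma> = epi_hom[OF i(1)] and \<iota> = mono_hom[OF i(2)]
  have e: "\<pi>\<^sub>1 \<cdot> c \<cdot> \<kappa>\<^sub>1 = c2 \<cdot> c1" "Z (\<pi>\<^sub>2 \<cdot> c \<cdot> \<kappa>\<^sub>1)" "Z (\<pi>\<^sub>1 \<cdot> c \<cdot> \<kappa>\<^sub>2)" "\<pi>\<^sub>2 \<cdot> c \<cdot> \<kappa>\<^sub>2 = b2 \<cdot> b1"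
    using g1 g2 c z by simp_all
  have s1: "ses I D S (\<kappa>\<^sub>1 \<cdot> d1) \<gamma>"
  proof (rule sesI)
    show "mono D S (\<kappa>\<^sub>1 \<cdot> d1)" using mono_comp[OF n(1) pushout_mono[OF po y(1)]] .
    show "epi S I \<gamma>" by fact
    have "Z (\<iota> \<cdot> \<gamma> \<cdot> \<kappa>\<^sub>1 \<cdot> d1)" using \<open>Z (g1 \<cdot> d1)\<close> c(2) by (simp add: ra[OF i(3)] ra[OF c(2)])
    then show "Z (\<gamma> \<cdot> \<kappa>\<^sub>1 \<cdot> d1)"
      by (rule monoD[OF i(2), rotated]) (rule comp_hom[OF comp_hom[OF n(4) p(1)] \<gamma>])
    fix U z assume "z \<in> hm U S" "Z (\<gamma> \<cdot> z)"
    moreover from this have "Z ((\<pi>\<^sub>1 \<cdot> c) \<cdot> z)" "Z ((\<pi>\<^sub>2 \<cdot> c) \<cdot> z)"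
      unfolding i(3)[symmetric] by (simp_all add: assoc Z_left)
    ultimately show "\<exists>v\<in>hm U D. (\<kappa>\<^sub>1 \<cdot> d1) \<cdot> v = z"
      using frame_kernel[OF po sN sY x(1) m(1) comp_hom[OF c(1) q(1)] _ _ comp_hom[OF c(1) q(2)]] e
      by (simp add: assoc)
  qed
  have s2: "ses A I T \<iota> (a1 \<cdot> \<pi>\<^sub>1)"
  proof (rule sesI_op)
    show "epi T A (a1 \<cdot> \<pi>\<^sub>1)" using epi_comp[OF x(2) pullback_epi[OF pb m(2)]] .
    show "mono I T \<iota>" by fact
    have "Z (((a1 \<cdot> \<pi>\<^sub>1) \<cdot> \<iota> \<cdot> \<gamma>))"
    proof (rule pushout_zero[OF po])
      show "(a1 \<cdot> \<pi>\<^sub>1) \<cdot> \<iota> \<cdot> \<gamma> \<in> hm S A" using i(3) comp_hom[OF c(1) comp_hom[OF q(1,3)]] by simp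
      show "Z (((a1 \<cdot> \<pi>\<^sub>1) \<cdot> \<iota> \<cdot> \<gamma>) \<cdot> \<kappa>\<^sub>1)"
        using Z_right[OF x(3)] by (simp add: assoc i(3) ra[OF i(3)] e(1))
      show "Z (((a1 \<cdot> \<pi>\<^sub>1) \<cdot> \<iota> \<cdot> \<gamma>) \<cdot> \<kappa>\<^sub>2)"
        using e(3) by (simp add: assoc i(3) ra[OF i(3)] Z_left)
    qed
    then have "Z (((a1 \<cdot> \<pi>\<^sub>1) \<cdot> \<iota>) \<cdot> \<gamma>)" by (simp add: assoc)
    then show "Z ((a1 \<cdot> \<pi>\<^sub>1) \<cdot> \<iota>)"
      using epiD[OF i(1)] comp_hom[OF \<iota> comp_hom[OF q(1,3)]] by blast
    fix V z assume z: "z \<in> hm T V" "Z (z \<cdot> \<iota>)"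
    then have "Z (z \<cdot> c \<cdot> \<kappa>\<^sub>1)" "Z (z \<cdot> c \<cdot> \<kappa>\<^sub>2)"
      unfolding i(3)[symmetric] by (metis assoc Z_right)+
    then show "\<exists>w\<in>hm A V. w \<cdot> (a1 \<cdot> \<pi>\<^sub>1) = z"
      using ab_cat.frame_kernel[OF op, of T X M A \<pi>\<^sub>1 \<pi>\<^sub>2 a1 a2 C c2 B b2 N c1 Y b1 "c \<cdot> \<kappa>\<^sub>1" "c \<cdot> \<kappa>\<^sub>2" z V]
        pb sX sM n(2) y(2) comp_hom[OF p(1) c(1)] comp_hom[OF p(2) c(1)] e z(1) ses_op by simp
  qed
  show thesis using that[OF s1 s2] e by (simp add: ra[OF i(3)])
qed

text \<open>In a completed diagram \<open>N\<close> and \<open>Y\<close> meet in \<open>D\<close>,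
  so their sum inside \<open>E\<close> is the pushout \<open>S\<close>, and the quotient of
  \<open>E\<close> by it is \<open>A\<close>.\<close>

lemma cross_filling:
  assumes sN: "ses C D N d1 c1" and sY: "ses B D Y d2 b1" and sX: "ses A C X c2 a1" and sM: "ses A B M b2 a2"
    and po: "pushout S N Y D \<kappa>\<^sub>1 \<kappa>\<^sub>2 d1 d2"
    and nm: "ses M N E n m" and yx: "ses X Y E y x"
    and cmp: "x \<cdot> n = c2 \<cdot> c1" "m \<cdot> y = b2 \<cdot> b1"
    and s: "s \<in> hm S E" "s \<cdot> \<kappa>\<^sub>1 = n" "s \<cdot> \<kappa>\<^sub>2 = y"
  shows "ses A S E s (a1 \<cdot> x)"
proof (rule sesI_refine)
  note p = pushoutD[OF po] and N' = sesD[OF sN] and Y' = sesD[OF sY] and X' = sesD[OF sX] and M' = sesD[OF sM]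
    and nm' = sesD[OF nm] and yx' = sesD[OF yx]
  show "mono S E s"
  proof (rule monoI[OF s(1)])
    fix U z assume z: "z \<in> hm U S" "Z (s \<cdot> z)"
    have "Z ((x \<cdot> s) \<cdot> z)" "Z ((m \<cdot> s) \<cdot> z)" using z(2) by (simp_all add: assoc Z_left)
    then obtain v where v: "v \<in> hm U D" "(\<kappa>\<^sub>1 \<cdot> d1) \<cdot> v = z"
      using frame_kernel[OF po sN sY X'(1) M'(1) comp_hom[OF s(1) yx'(5)] _ _ comp_hom[OF s(1) nm'(5)] _ _ z(1)]
        cmp yx'(3) nm'(3) s by (auto simp: assoc)
    have "Z ((n \<cdot> d1) \<cdot> v)" using z(2) unfolding v(2)[symmetric] by (simp add: assoc ra[OF s(2)])
    then have "Z v" using monoD[OF mono_comp[OF N'(1) nm'(1)] v(1)] by blast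
    then show "Z z" using v(2) Z_left by blast
  qed
  show "epi E A (a1 \<cdot> x)" using epi_comp[OF X'(2) yx'(2)] .
  show "Z ((a1 \<cdot> x) \<cdot> s)"
  proof (rule pushout_zero[OF po comp_hom[OF s(1) comp_hom[OF yx'(5) X'(5)]]])
    show "Z (((a1 \<cdot> x) \<cdot> s) \<cdot> \<kappa>\<^sub>1)" using Z_right[OF X'(3)] by (simp add: assoc s cmp)
    show "Z (((a1 \<cdot> x) \<cdot> s) \<cdot> \<kappa>\<^sub>2)" using yx'(3) by (simp add: assoc s Z_left)
  qed
  fix U e assume e: "e \<in> hm U E" "Z ((a1 \<cdot> x) \<cdot> e)"
  then obtain w where w: "w \<in> hm U C" "c2 \<cdot> w = x \<cdot> e" using X'(6)[OF comp_hom[OF e(1) yx'(5)]] by (auto simp: assoc)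
  obtain P u z1 where u: "epi P U u" "z1 \<in> hm P N" "c1 \<cdot> z1 = w \<cdot> u" using refine[OF N'(2) w(1)] .
  have "x \<cdot> n \<cdot> z1 = c2 \<cdot> w \<cdot> u" using cmp(1) u(3) by (metis assoc)
  also have "\<dots> = x \<cdot> e \<cdot> u" using w(2) by (metis assoc)
  finally have xe: "x \<cdot> e \<cdot> u = x \<cdot> n \<cdot> z1" by simp
  have t: "e \<cdot> u \<in> hm P E" "n \<cdot> z1 \<in> hm P E" using e(1) u nm'(4) epi_hom comp_hom by metis+
  have "Z (x \<cdot> (e \<cdot> u \<boxminus> n \<cdot> z1))" using xe by (simp add: distl comp_neg zerop_add_neg)
  then obtain z2 where z2: "z2 \<in> hm P Y" "y \<cdot> z2 = e \<cdot> u \<boxminus> n \<cdot> z1" using yx'(6)[OF sub_hom[OF t]] by blast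
  have "s \<cdot> (\<kappa>\<^sub>2 \<cdot> z2 \<boxplus> \<kappa>\<^sub>1 \<cdot> z1) = e \<cdot> u" using sub_add[OF t] z2(2) s by (simp add: distl ra)
  moreover have "\<kappa>\<^sub>2 \<cdot> z2 \<boxplus> \<kappa>\<^sub>1 \<cdot> z1 \<in> hm P S" using z2 u p(1,2) comp_hom add_hom by metis
  ultimately show "\<exists>U' u z. epi U' U u \<and> z \<in> hm U' S \<and> s \<cdot> z = e \<cdot> u" using u(1) by blast
qed

text \<open>A filling contains \<open>N\<close> through \<open>S\<close> and maps onto
  \<open>M\<close> through \<open>T\<close>. Only the row of the cross is treated; the column is the
  same statement with the two factors of the pushout and of the pullback exchanged.\<close>

lemma filling_cross:
  assumes sY: "ses B D Y d2 b1" and a1: "epi X A a1" and b2: "mono B M b2" 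
    and po: "pushout S N Y D \<kappa>\<^sub>1 \<kappa>\<^sub>2 d1 d2" and pb: "pullback T X M A \<pi>\<^sub>1 \<pi>\<^sub>2 a1 a2"
    and s: "ses A S E s (a1 \<cdot> \<pi>\<^sub>1 \<cdot> t)" and t: "epi E T t"
    and st: "Z (\<pi>\<^sub>2 \<cdot> t \<cdot> s \<cdot> \<kappa>\<^sub>1)" "\<pi>\<^sub>2 \<cdot> t \<cdot> s \<cdot> \<kappa>\<^sub>2 = b2 \<cdot> b1"
  shows "ses M N E (s \<cdot> \<kappa>\<^sub>1) (\<pi>\<^sub>2 \<cdot> t)"
proof (rule sesI_refine)
  note p = pushoutD[OF po] and q = pullbackD[OF pb] and Y' = sesD[OF sY] and s' = sesD[OF s]
  note th = epi_hom[OF t]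
  show "mono N E (s \<cdot> \<kappa>\<^sub>1)" using mono_comp[OF pushout_mono[OF po Y'(1)] s'(1)] .
  show "epi E M (\<pi>\<^sub>2 \<cdot> t)" using epi_comp[OF pullback_epi[OF pullback_swap[OF pb] a1] t] .
  show "Z ((\<pi>\<^sub>2 \<cdot> t) \<cdot> s \<cdot> \<kappa>\<^sub>1)" using st(1) by (simp add: assoc)
  fix U e assume e: "e \<in> hm U E" "Z ((\<pi>\<^sub>2 \<cdot> t) \<cdot> e)"
  then have "Z (a2 \<cdot> \<pi>\<^sub>2 \<cdot> t \<cdot> e)" by (simp add: assoc Z_left)
  then have "Z ((a1 \<cdot> \<pi>\<^sub>1 \<cdot> t) \<cdot> e)" using q(5) by (simp add: assoc ra[OF q(5)])
  then obtain z where z: "z \<in> hm U S" "s \<cdot> z = e" using s'(6)[OF e(1)] by blast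
  obtain P u z1 z2 where u: "epi P U u" "z1 \<in> hm P N" "z2 \<in> hm P Y" "z \<cdot> u = \<kappa>\<^sub>1 \<cdot> z1 \<boxplus> \<kappa>\<^sub>2 \<cdot> z2"
    using pushout_refine[OF po z(1)] .
  define r where "r = \<pi>\<^sub>2 \<cdot> t \<cdot> s"
  have r: "r \<in> hm S M" unfolding r_def using comp_hom[OF comp_hom[OF s'(4) th] q(2)] .
  have k: "\<kappa>\<^sub>1 \<cdot> z1 \<in> hm P S" "\<kappa>\<^sub>2 \<cdot> z2 \<in> hm P S" using u p(1,2) comp_hom by blast+
  have "Z (((\<pi>\<^sub>2 \<cdot> t) \<cdot> e) \<cdot> u)" using e(2) Z_right by blast
  moreover have "((\<pi>\<^sub>2 \<cdot> t) \<cdot> e) \<cdot> u = r \<cdot> (z \<cdot> u)" unfolding r_def z(2)[symmetric] by (simp add: assoc)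
  ultimately have "Z (r \<cdot> (z \<cdot> u))" by simp
  moreover have "r \<cdot> (z \<cdot> u) = r \<cdot> \<kappa>\<^sub>2 \<cdot> z2"
    unfolding u(4) distl by (rule zero_add[OF comp_hom[OF k(2) r] comp_hom[OF k(1) r]])
      (use Z_right[OF st(1)] in \<open>simp add: assoc r_def\<close>)
  moreover have "r \<cdot> \<kappa>\<^sub>2 \<cdot> z2 = b2 \<cdot> b1 \<cdot> z2" using st(2) unfolding r_def by (metis assoc)
  ultimately have "Z (b1 \<cdot> z2)" using monoD[OF b2 comp_hom[OF u(3) Y'(5)]] by simp
  then obtain v where v: "v \<in> hm P D" "d2 \<cdot> v = z2" using Y'(6)[OF u(3)] by blast
  have "\<kappa>\<^sub>1 \<cdot> (z1 \<boxplus> d1 \<cdot> v) = z \<cdot> u" using u(4) v(2) p(5) by (simp add: distl) (metis assoc)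
  then have "(s \<cdot> \<kappa>\<^sub>1) \<cdot> (z1 \<boxplus> d1 \<cdot> v) = e \<cdot> u" using z(2) by (metis assoc)
  moreover have "z1 \<boxplus> d1 \<cdot> v \<in> hm P N" using u v p(3) comp_hom add_hom by metis
  ultimately show "\<exists>U' u z. epi U' U u \<and> z \<in> hm U' N \<and> (s \<cdot> \<kappa>\<^sub>1) \<cdot> z = e \<cdot> u" using u(1) by blast
qed

text \<open>\<open>D\<close> is the intersection of \<open>N\<close> and \<open>Y\<close> in
  \<open>E\<close>. The opposite corner \<open>A\<close> comes from the same statement in the
  opposite category.\<close>

lemma cross_frame_half:
  assumes nm: "ses M N E n m" and yx: "ses X Y E y x"
    and c: "c2 \<cdot> c1 = x \<cdot> n" "mono C X c2" and b: "b2 \<cdot> b1 = m \<cdot> y" "epi Y B b1" "mono B M b2"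
    and d: "ses C D N d1 c1"
  obtains d2 where "ses B D Y d2 b1" "n \<cdot> d1 = y \<cdot> d2"
proof -
  note d' = sesD[OF d] and nm' = sesD[OF nm] and yx' = sesD[OF yx]
  have "Z (x \<cdot> n \<cdot> d1)" using d'(3) c(1) by (metis assoc Z_left)
  then obtain d2 where d2: "d2 \<in> hm D Y" "y \<cdot> d2 = n \<cdot> d1" using yx'(6)[OF comp_hom[OF d'(4) nm'(4)]] by blast
  have "ses B D Y d2 b1"
  proof (rule sesI)
    show "mono D Y d2" using mono_left[of D E y d2 Y] mono_comp[OF d'(1) nm'(1)] d2 by simp
    show "epi Y B b1" by fact
    have "Z (b2 \<cdot> b1 \<cdot> d2)" using b(1) d2(2) nm'(3) by (metis assoc Z_right)
    then show "Z (b1 \<cdot> d2)" using monoD[OF b(3) comp_hom[OF d2(1) epi_hom[OF b(2)]]] by blast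
    fix U w assume w: "w \<in> hm U Y" "Z (b1 \<cdot> w)"
    then have "Z (m \<cdot> y \<cdot> w)" using b(1) by (metis assoc Z_left)
    then obtain z where z: "z \<in> hm U N" "n \<cdot> z = y \<cdot> w" using nm'(6)[OF comp_hom[OF w(1) yx'(4)]] by blast
    have "Z (c2 \<cdot> c1 \<cdot> z)" using c(1) z(2) yx'(3) by (metis assoc Z_right)
    then have "Z (c1 \<cdot> z)" using monoD[OF c(2) comp_hom[OF z(1) d'(5)]] by blast
    then obtain v where v: "v \<in> hm U D" "d1 \<cdot> v = z" using d'(6)[OF z(1)] by blast
    have "y \<cdot> (d2 \<cdot> v) = y \<cdot> w" using d2(2) v(2) z(2) by (metis assoc)
    then show "\<exists>v\<in>hm U D. d2 \<cdot> v = w" using mono_cancel[OF yx'(1) comp_hom[OF v(1) d2(1)] w(1)] v(1) by blast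
  qed
  then show thesis using that d2 by simp
qed

text \<open>The corners are forced: \<open>C\<close> and \<open>B\<close> are the images of
  \<open>N\<close> in \<open>X\<close> and of \<open>Y\<close> in \<open>M\<close>, and
  \<open>D\<close> and \<open>A\<close> are the kernel and the cokernel that remain.\<close>

lemma cross_frame:
  assumes nm: "ses M N E n m" and yx: "ses X Y E y x"
  obtains A B C D d1 c1 d2 b1 c2 a1 b2 a2 where
    "ses C D N d1 c1" "ses B D Y d2 b1" "ses A C X c2 a1" "ses A B M b2 a2"
    "n \<cdot> d1 = y \<cdot> d2" "x \<cdot> n = c2 \<cdot> c1" "m \<cdot> y = b2 \<cdot> b1" "a1 \<cdot> x = a2 \<cdot> m"
proof -
  note nm' = sesD[OF nm] and yx' = sesD[OF yx]
  obtain C c1 c2 where c: "epi N C c1" "mono C X c2" "c2 \<cdot> c1 = x \<cdot> n" using image[OF comp_hom[OF nm'(4) yx'(5)]] .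
  obtain B b1 b2 where b: "epi Y B b1" "mono B M b2" "b2 \<cdot> b1 = m \<cdot> y" using image[OF comp_hom[OF yx'(4) nm'(5)]] .
  obtain D d1 where d1: "ses C D N d1 c1" using epi_ses[OF c(1)] .
  obtain d2 where d2: "ses B D Y d2 b1" "n \<cdot> d1 = y \<cdot> d2" using cross_frame_half[OF nm yx c(3,2) b(3,1,2) d1] .
  obtain A a2 where a2: "ses A B M b2 a2" using mono_ses[OF b(2)] .
  obtain a1 where a1: "ses A C X c2 a1" "a2 \<cdot> m = a1 \<cdot> x"
    using ab_cat.cross_frame_half[OF op, of N M E m n Y X x y b2 b1 B c2 c1 C A a2]
      nm yx b c a2 ses_op by metis
  show thesis using that[OF d1 d2(1) a1(1) a2 d2(2)] c(3) b(3) a1(2) by simp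
qed

definition ext_rel where
  "ext_rel A B = {((F, i, p), (F', i', p')). ses A B F i p \<and> ses A B F' i' p' \<and>
     (\<exists>h\<in>hm F F'. h \<cdot> i = i' \<and> p' \<cdot> h = p)}"

definition ext_seqs where
  "ext_seqs A B = {(F, i, p). ses A B F i p}"

text \<open>By the short five lemma, maps of extensions fixing both ends are invertible, so in
  degree one the relation is symmetric before any closure is taken.\<close>

lemma equiv_ext_rel: "equiv (ext_seqs A B) (ext_rel A B)"
proof (rule equivI)
  show "ext_rel A B \<subseteq> ext_seqs A B \<times> ext_seqs A B" by (auto simp: ext_rel_def ext_seqs_def)
  show "refl_on (ext_seqs A B) (ext_rel A B)"
  proof (rule refl_onI)
    fix x assume "x \<in> ext_seqs A B"
    then obtain F i p where x: "x = (F, i, p)" and s: "ses A B F i p" by (auto simp: ext_seqs_def)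
    note s' = sesD[OF s]
    have "idn F \<cdot> i = i" "p \<cdot> idn F = p" using idn_left idn_right s' by blast+
    then show "(x, x) \<in> ext_rel A B" using s x idn_hom[OF s'(10)] by (auto simp: ext_rel_def)
  qed
  show "sym (ext_rel A B)"
  proof (rule symI)
    fix x y assume "(x, y) \<in> ext_rel A B"
    then obtain F i p F' i' p' h where e: "x = (F, i, p)" "y = (F', i', p')" "ses A B F i p" "ses A B F' i' p'"
      "h \<in> hm F F'" "h \<cdot> i = i'" "p' \<cdot> h = p" by (auto simp: ext_rel_def)
    obtain k where k: "(h, k) \<in> isop F F'" using short_five[OF e(3-7)] .
    have "k \<cdot> i' = i" "p \<cdot> k = p'" using isopD[OF k] e(6,7) sesD(4)[OF e(3)] sesD(5)[OF e(4)]
      by (metis assoc idn_left, metis assoc idn_right)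
    then show "(y, x) \<in> ext_rel A B" using e isopD(2)[OF k] by (auto simp: ext_rel_def)
  qed
  show "trans (ext_rel A B)"
  proof (rule transI)
    fix x y z assume "(x, y) \<in> ext_rel A B" "(y, z) \<in> ext_rel A B"
    then obtain F i p F' i' p' F'' i'' p'' h h' where e: "x = (F, i, p)" "z = (F'', i'', p'')" "ses A B F i p" "ses A B F'' i'' p''"
      "h \<in> hm F F'" "h \<cdot> i = i'" "p' \<cdot> h = p" "h' \<in> hm F' F''" "h' \<cdot> i' = i''" "p'' \<cdot> h' = p'"
      by (auto simp: ext_rel_def)
    then have "h' \<cdot> h \<in> hm F F''" "(h' \<cdot> h) \<cdot> i = i''" "p'' \<cdot> (h' \<cdot> h) = p"
      using comp_hom by (blast, metis assoc, metis assoc)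
    then show "(x, z) \<in> ext_rel A B" using e by (auto simp: ext_rel_def)
  qed
qed

end

context fin_ab_cat
begin

lemma inj_on_fst_isop: "inj_on fst (isop A B)"
proof (rule inj_onI)
  fix x y assume "x \<in> isop A B" "y \<in> isop A B" "fst x = fst y"
  then show "x = y" using isop_unique by (cases x; cases y) auto
qed

text \<open>Two extensions are equivalent iff they are related by an isomorphism of the middle terms, and
  the stabiliser of an extension of \<open>A\<close> by \<open>B\<close> consists of the maps \<open>1 + i \<phi> p\<close> with
  \<open>\<phi>\<close> in \<open>hm A B\<close>.\<close>

lemma ext_class_mass:
  assumes s: "ses A B F\<^sub>0 i\<^sub>0 p\<^sub>0"
  shows "mass (\<lambda>F. {(i, p) \<in> SES A B F. \<exists>h\<in>hm F\<^sub>0 F. h \<cdot> i\<^sub>0 = i \<and> p \<cdot> h = p\<^sub>0}) = 1 / of_nat (card (hm A B))"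
proof (rule mass_isop_multiple)
  note s' = sesD[OF s]
  show "F\<^sub>0 \<in> obj" using s' by simp
  have "zero A B \<in> hm A B" using s' zero_hom by blast
  then show "of_nat (card (hm A B)) \<noteq> (0::rat)" using finite_hm by auto
  fix F assume "F \<in> reps"
  let ?T = "{(i, p) \<in> SES A B F. \<exists>h\<in>hm F\<^sub>0 F. h \<cdot> i\<^sub>0 = i \<and> p \<cdot> h = p\<^sub>0}"
  show fT: "finite ?T" by (rule finite_subset[OF _ finite_SES]) auto
  let ?f = "\<lambda>(h, k). (h \<cdot> i\<^sub>0, p\<^sub>0 \<cdot> k)"
  have "card (isop F\<^sub>0 F) = (\<Sum>t\<in>?T. card {z \<in> isop F\<^sub>0 F. ?f z = t})"
  proof (rule card_fibres[OF finite_isop fT])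
    fix z assume "z \<in> isop F\<^sub>0 F"
    then obtain h k where z: "z = (h, k)" "(h, k) \<in> isop F\<^sub>0 F" by (cases z) auto
    note i = isopD[OF z(2)]
    have "(p\<^sub>0 \<cdot> k) \<cdot> h = p\<^sub>0" using i s'(5) by (simp add: assoc idn_right)
    then show "?f z \<in> ?T" using ses_iso_mid[OF s z(2)] i(1) z(1) by (auto simp: SES_def)
  qed
  also have "\<dots> = (\<Sum>t\<in>?T. card (hm A B))"
  proof (rule sum.cong[OF refl])
    fix t assume "t \<in> ?T"
    then obtain i p h0 where t: "t = (i, p)" "ses A B F i p" "h0 \<in> hm F\<^sub>0 F" "h0 \<cdot> i\<^sub>0 = i" "p \<cdot> h0 = p\<^sub>0"
      by (auto simp: SES_def)
    note t' = sesD[OF t(2)]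
    let ?g = "\<lambda>\<phi>. h0 \<boxplus> i \<cdot> \<phi> \<cdot> p\<^sub>0"
    let ?H = "{h \<in> hm F\<^sub>0 F. h \<cdot> i\<^sub>0 = i \<and> p \<cdot> h = p\<^sub>0}"
    have b1: "bij_betw fst {z \<in> isop F\<^sub>0 F. ?f z = t} ?H"
      unfolding bij_betw_def
    proof
      show "inj_on fst {z \<in> isop F\<^sub>0 F. ?f z = t}" by (rule inj_on_subset[OF inj_on_fst_isop]) auto
      show "fst ` {z \<in> isop F\<^sub>0 F. ?f z = t} = ?H"
      proof (intro equalityI subsetI)
        fix h assume "h \<in> fst ` {z \<in> isop F\<^sub>0 F. ?f z = t}"
        then obtain k where k: "(h, k) \<in> isop F\<^sub>0 F" "h \<cdot> i\<^sub>0 = i" "p\<^sub>0 \<cdot> k = p" using t by auto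
        then have "p \<cdot> h = p\<^sub>0" using isopD[OF k(1)] s'(5) by (metis assoc idn_right)
        then show "h \<in> ?H" using k isopD by auto
      next
        fix h assume h: "h \<in> ?H"
        then obtain k where k: "(h, k) \<in> isop F\<^sub>0 F" using short_five[OF s t(2), of h] by auto
        have "p\<^sub>0 \<cdot> k = p" using h isopD[OF k] t'(5) by (metis (mono_tags, lifting) mem_Collect_eq assoc idn_right)
        then show "h \<in> fst ` {z \<in> isop F\<^sub>0 F. ?f z = t}" using k h t by (force simp: image_iff)
      qed
    qed
    have b2: "bij_betw ?g (hm A B) ?H"
      unfolding bij_betw_def
    proof
      have ty: "i \<cdot> \<phi> \<cdot> p\<^sub>0 \<in> hm F\<^sub>0 F" if "\<phi> \<in> hm A B" for \<phi>
        using comp_hom[OF comp_hom[OF s'(5) that] t'(4)] .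
      show "inj_on ?g (hm A B)"
      proof (rule inj_onI)
        fix \<phi> \<psi> assume f: "\<phi> \<in> hm A B" "\<psi> \<in> hm A B" "?g \<phi> = ?g \<psi>"
        then have "i \<cdot> (\<phi> \<cdot> p\<^sub>0) = i \<cdot> (\<psi> \<cdot> p\<^sub>0)" using add_cancel[OF t(3) ty ty] by blast
        then have "\<phi> \<cdot> p\<^sub>0 = \<psi> \<cdot> p\<^sub>0" using mono_cancel[OF t'(1)] comp_hom[OF s'(5)] f by blast
        then show "\<phi> = \<psi>" using epi_cancel[OF s'(2)] f by blast
      qed
      show "?g ` hm A B = ?H"
      proof (intro equalityI subsetI)
        fix h assume "h \<in> ?g ` hm A B"
        then obtain \<phi> where f: "\<phi> \<in> hm A B" "h = ?g \<phi>" by auto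
        have "h \<cdot> i\<^sub>0 = i \<boxplus> i \<cdot> \<phi> \<cdot> p\<^sub>0 \<cdot> i\<^sub>0" using f t by (simp add: distr assoc)
        also have "\<dots> = i" by (rule add_zerop[OF t'(4) comp_hom[OF comp_hom[OF comp_hom[OF s'(4,5)] f(1)] t'(4)]])
           (use s'(3) Z_left in blast)
        moreover have "p \<cdot> h = p\<^sub>0 \<boxplus> p \<cdot> i \<cdot> \<phi> \<cdot> p\<^sub>0" using f t by (simp add: distl assoc)
        moreover have "\<dots> = p\<^sub>0" by (rule add_zerop[OF s'(5) comp_hom[OF ty[OF f(1)] t'(5)]])
           (use Z_right[OF t'(3)] in \<open>simp add: assoc\<close>)
        ultimately show "h \<in> ?H" using f add_hom[OF t(3) ty] by simp
      next
        fix h assume h: "h \<in> ?H"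
        \<comment> \<open>The difference of two maps of extensions kills \<open>i\<^sub>0\<close>
          and is killed by \<open>p\<close>, so it factors through \<open>p\<^sub>0\<close> on one
          side and through \<open>i\<close> on the other.\<close>
        have d: "h \<boxminus> h0 \<in> hm F\<^sub>0 F" using h t(3) sub_hom by blast
        have "Z ((h \<boxminus> h0) \<cdot> i\<^sub>0)" using h t by (simp add: distr neg_comp zerop_add_neg)
        then obtain w where w: "w \<in> hm A F" "w \<cdot> p\<^sub>0 = h \<boxminus> h0" using s'(7)[OF d] by blast
        have "Z (p \<cdot> w \<cdot> p\<^sub>0)" unfolding w(2) using h t by (simp add: distl comp_neg zerop_add_neg)
        then have "Z ((p \<cdot> w) \<cdot> p\<^sub>0)" by (simp add: assoc)
        then have "Z (p \<cdot> w)" using epiD[OF s'(2) comp_hom[OF w(1) t'(5)]] by blast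
        then obtain \<phi> where f: "\<phi> \<in> hm A B" "i \<cdot> \<phi> = w" using t'(6)[OF w(1)] by blast
        have "h = ?g \<phi>" using sub_add[of h F\<^sub>0 F h0] h t(3) w(2) f(2) by (metis (mono_tags, lifting) mem_Collect_eq assoc add_comm)
        then show "h \<in> ?g ` hm A B" using f(1) by blast
      qed
    qed
    show "card {z \<in> isop F\<^sub>0 F. ?f z = t} = card (hm A B)"
      using bij_betw_same_card[OF b1] bij_betw_same_card[OF b2] by simp
  qed
  finally show "of_nat (card (isop F\<^sub>0 F)) = of_nat (card (hm A B)) * (of_nat (card ?T) :: rat)" by simp
qed

text \<open>Riedtmann's formula.\<close>

lemma mass_SES:
  assumes o: "A \<in> obj" "B \<in> obj"
  shows "mass (SES A B) = of_nat (card (ext_seqs A B // ext_rel A B)) / of_nat (card (hm A B))"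
    and "finite (ext_seqs A B // ext_rel A B)"
proof -
  let ?J = "{F \<in> reps. SES A B F \<noteq> {}}" and ?Q = "ext_seqs A B // ext_rel A B"
  note eq = equiv_ext_rel[of A B]
  have fJ: "finite ?J" using fin_mid' o .
  \<comment> \<open>Every class has a member whose middle term is a chosen representative, by
    transport along an isomorphism.\<close>
  have "?Q \<subseteq> (\<lambda>x. ext_rel A B `` {x}) ` (SIGMA F:?J. SES A B F)"
  proof
    fix \<xi> assume "\<xi> \<in> ?Q"
    then obtain F i p where x: "\<xi> = ext_rel A B `` {(F, i, p)}" and s: "ses A B F i p"
      by (auto simp: ext_seqs_def elim!: quotientE)
    note s' = sesD[OF s]
    obtain h k where i: "(h, k) \<in> isop F (rp F)" using rp_iso s'(10) by blast
    have s2: "ses A B (rp F) (h \<cdot> i) (p \<cdot> k)" using ses_iso_mid[OF s i] .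
    have "(p \<cdot> k) \<cdot> h = p" using isopD[OF i] s'(5) by (simp add: assoc idn_right)
    then have "((F, i, p), (rp F, h \<cdot> i, p \<cdot> k)) \<in> ext_rel A B"
      using s s2 isopD(1)[OF i] by (auto simp: ext_rel_def)
    then have "\<xi> = ext_rel A B `` {(rp F, h \<cdot> i, p \<cdot> k)}" using x equiv_class_eq[OF eq] by blast
    moreover have "(rp F, h \<cdot> i, p \<cdot> k) \<in> (SIGMA F:?J. SES A B F)"
      using s2 rp_reps[OF s'(10)] by (auto simp: SES_def)
    ultimately show "\<xi> \<in> (\<lambda>x. ext_rel A B `` {x}) ` (SIGMA F:?J. SES A B F)" by blast
  qed
  then show fQ: "finite ?Q"
    by (rule finite_subset) (use fJ finite_SES in auto)
  \<comment> \<open>Sorting the extensions by their class leaves one summand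
    \<open>1 / card (hm A B)\<close> for each class.\<close>
  have "mass (SES A B) = (\<Sum>F\<in>?J. (\<Sum>\<xi>\<in>?Q. of_nat (card {t \<in> SES A B F. (F, t) \<in> \<xi>})) / au F)"
    unfolding mass_def
  proof (rule sum.cong[OF refl])
    fix F assume "F \<in> ?J"
    have "card (SES A B F) = (\<Sum>\<xi>\<in>?Q. card {t \<in> SES A B F. ext_rel A B `` {(F, t)} = \<xi>})"
      by (rule card_fibres[OF finite_SES fQ]) (auto simp: SES_def ext_seqs_def intro: quotientI)
    also have "\<dots> = (\<Sum>\<xi>\<in>?Q. card {t \<in> SES A B F. (F, t) \<in> \<xi>})"
    proof (rule sum.cong[OF refl], rule arg_cong[of _ _ card], rule Collect_cong, rule conj_cong[OF refl])
      fix \<xi> t assume x: "\<xi> \<in> ?Q" and t: "t \<in> SES A B F"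
      then have Ft: "(F, t) \<in> ext_seqs A B" by (auto simp: SES_def ext_seqs_def)
      obtain y where y: "y \<in> ext_seqs A B" "\<xi> = ext_rel A B `` {y}" using x by (rule quotientE)
      show "ext_rel A B `` {(F, t)} = \<xi> \<longleftrightarrow> (F, t) \<in> \<xi>"
        using eq_equiv_class_iff[OF eq y(1) Ft] y(2) by (metis Image_singleton_iff)
    qed
    finally show "of_nat (card (SES A B F)) / au F = (\<Sum>\<xi>\<in>?Q. of_nat (card {t \<in> SES A B F. (F, t) \<in> \<xi>})) / au F"
      by simp
  qed
  also have "\<dots> = (\<Sum>\<xi>\<in>?Q. \<Sum>F\<in>?J. of_nat (card {t \<in> SES A B F. (F, t) \<in> \<xi>}) / au F)"
    by (subst sum.swap) (simp add: sum_divide_distrib)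
  also have "\<dots> = (\<Sum>\<xi>\<in>?Q. 1 / of_nat (card (hm A B)))"
  proof (rule sum.cong[OF refl])
    fix \<xi> assume "\<xi> \<in> ?Q"
    then obtain F0 i0 p0 where x: "\<xi> = ext_rel A B `` {(F0, i0, p0)}" and s: "ses A B F0 i0 p0"
      by (auto simp: ext_seqs_def elim!: quotientE)
    have e: "{t \<in> SES A B F. (F, t) \<in> \<xi>} = {(i, p) \<in> SES A B F. \<exists>h\<in>hm F0 F. h \<cdot> i0 = i \<and> p \<cdot> h = p0}" for F
      using x s by (auto simp: ext_rel_def SES_def)
    have "(\<Sum>F\<in>?J. of_nat (card {t \<in> SES A B F. (F, t) \<in> \<xi>}) / au F) = mass (\<lambda>F. {t \<in> SES A B F. (F, t) \<in> \<xi>})"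
      by (rule mass_eq[symmetric]) (use fJ in auto)
    then show "(\<Sum>F\<in>?J. of_nat (card {t \<in> SES A B F. (F, t) \<in> \<xi>}) / au F) = 1 / of_nat (card (hm A B))"
      unfolding e using ext_class_mass[OF s] by simp
  qed
  finally show "mass (SES A B) = of_nat (card ?Q) / of_nat (card (hm A B))" by simp
qed

end

text \<open>The exact sequence \<open>D \<rightarrow> S \<rightarrow> T \<rightarrow> A\<close> represents a class in \<open>Ext\<^sup>2(A,D)\<close>, which vanishes iff the
  sequence has a filling.\<close>

locale her_cat = fin_ab_cat +
  assumes fill: "ses I D S \<delta> \<gamma> \<Longrightarrow> ses A I T \<iota> q \<Longrightarrow> \<exists>E. fillings A S T (\<iota> \<cdot> \<gamma>) q E \<noteq> {}"
begin

text \<open>The filtration behind a filling can be read from either end, by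
  \<open>filling_dual\<close>, so the existence of fillings is a self-dual condition.\<close>

lemma op_her: "her_cat obj (\<lambda>A B. hm B A) (\<lambda>g f. f \<cdot> g) idn add neg (\<lambda>A B. zero B A) rp"
proof (intro her_cat.intro op_fin her_cat_axioms.intro, unfold ses_op)
  fix I D S \<delta> \<gamma> A T \<iota> q assume s: "ses D I S \<gamma> \<delta>" "ses I A T q \<iota>"
  from fill[OF s(2,1)] obtain E u v where "(u, v) \<in> fillings D T S (\<gamma> \<cdot> \<iota>) \<delta> E" by fastforce
  then have e: "u \<in> hm T E" "v \<in> hm E S" "v \<cdot> u = \<gamma> \<cdot> \<iota>" "ses D T E u (\<delta> \<cdot> v)"
    by (auto simp: fillings_def)
  then have "ses S A E (u \<cdot> q) v" using filling_dual[OF s(2,1) e(1-3)] by blast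
  then have "(v, u) \<in> ab_cat.fillings (\<lambda>A B. hm B A) (\<lambda>g f. f \<cdot> g) add A S T (\<gamma> \<cdot> \<iota>) q E"
    using e by (simp add: ab_cat.fillings_def[OF op] ses_op)
  then show "\<exists>E. ab_cat.fillings (\<lambda>A B. hm B A) (\<lambda>g f. f \<cdot> g) add A S T (\<gamma> \<cdot> \<iota>) q E \<noteq> {}"
    by blast
qed

end

context fin_ab_cat
begin

lemma op_au: "fin_ab_cat.au (\<lambda>A B. hm B A) (\<lambda>g f. f \<cdot> g) idn A = au A"
proof -
  have "bij_betw (\<lambda>(h, k). (k, h)) {(h, k). (k, h) \<in> isop A A} (isop A A)"
    by (rule bij_betw_byWitness[of _ "\<lambda>(h, k). (k, h)"]) auto
  then show ?thesis
    unfolding fin_ab_cat.au_def[OF op_fin] au_def isop_op using bij_betw_same_card by metis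
qed

lemma op_SES: "fin_ab_cat.SES (\<lambda>A B. hm B A) (\<lambda>g f. f \<cdot> g) add A B X = {(p, i). (i, p) \<in> SES B A X}"
  unfolding fin_ab_cat.SES_def[OF op_fin] SES_def ses_op by auto

lemma op_mass_SES:
  "fin_ab_cat.mass obj (\<lambda>A B. hm B A) (\<lambda>g f. f \<cdot> g) idn rp (fin_ab_cat.SES (\<lambda>A B. hm B A) (\<lambda>g f. f \<cdot> g) add A B) = mass (SES B A)"
proof -
  have b: "bij_betw (\<lambda>(p, i). (i, p)) {(p, i). (i, p) \<in> SES B A X} (SES B A X)" for X
    by (rule bij_betw_byWitness[of _ "\<lambda>(h, k). (k, h)"]) auto
  have "card {(p, i). (i, p) \<in> SES B A X} = card (SES B A X)" for X
    using bij_betw_same_card[OF b] .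
  moreover have "{(p, i). (i, p) \<in> SES B A X} = {} \<longleftrightarrow> SES B A X = {}" for X by auto
  ultimately show ?thesis
    unfolding fin_ab_cat.mass_def[OF op_fin] mass_def op_au fin_ab_cat.reps_def[OF op_fin] reps_def op_SES by simp
qed

end

section \<open>Green's formula\<close>

context her_cat
begin

lemma mass_SES_right:
  assumes "ses I D S \<delta> \<gamma>" "A \<in> obj"
  shows "mass (SES A S) = mass (SES A D) * mass (SES A I)"
  using mass_mult_right[OF assms] fill[OF assms(1)] by blast

lemma mass_SES_left:
  assumes "ses I D S \<delta> \<gamma>" "A \<in> obj"
  shows "mass (SES S A) = mass (SES D A) * mass (SES I A)"
  using her_cat.mass_SES_right[OF op_her, of D I S \<gamma> \<delta> A] assms
  unfolding op_mass_SES ses_op by simp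

text \<open>A frame is the boundary of a \<open>3 \<times> 3\<close> diagram with rows \<open>D \<rightarrow> Y \<rightarrow> B\<close>, \<open>N \<rightarrow> E \<rightarrow> M\<close> and \<open>C \<rightarrow> X \<rightarrow> A\<close>;
  a pair of extensions with middle term \<open>E\<close> is the cross in its centre.\<close>

definition frames where
  "frames N Y X M = (\<lambda>(A, B, C, D). SES C D N \<times> SES B D Y \<times> SES A C X \<times> SES A B M)"

text \<open>\<open>n\<close> and \<open>m\<close> form the middle row of the cross, \<open>y\<close>
  and \<open>x\<close> its middle column; the conditions are the commutativity of the four small
  squares.\<close>

definition compat where
  "compat = (\<lambda>((n, m), (y, x)) ((d1, c1), (d2, b1), (c2, a1), (b2, a2)).
     n \<cdot> d1 = y \<cdot> d2 \<and> x \<cdot> n = c2 \<cdot> c1 \<and> m \<cdot> y = b2 \<cdot> b1 \<and> a1 \<cdot> x = a2 \<cdot> m)"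

definition quads where "quads = reps \<times> reps \<times> reps \<times> reps"

lemma finite_frames: "finite (frames N Y X M q)"
  unfolding frames_def by (auto split: prod.split simp: finite_SES)

lemma fin_ends': "X \<in> obj \<Longrightarrow> finite {(A, B). A \<in> reps \<and> B \<in> reps \<and> SES A B X \<noteq> {}}"
  by (rule finite_subset[OF _ fin_ends[of X]]) (auto simp: SES_def reps_def)

lemma finite_quads:
  assumes "N \<in> obj" "M \<in> obj"
  shows "finite {q \<in> quads. frames N Y X M q \<noteq> {}}"
proof (rule finite_subset)
  let ?E = "\<lambda>X. {(A, B). A \<in> reps \<and> B \<in> reps \<and> SES A B X \<noteq> {}}"
  show "finite ((\<lambda>((C, D), (A, B)). (A, B, C, D)) ` (?E N \<times> ?E M))"
    using fin_ends' assms by (intro finite_imageI finite_cartesian_product)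
  show "{q \<in> quads. frames N Y X M q \<noteq> {}} \<subseteq> (\<lambda>((C, D), (A, B)). (A, B, C, D)) ` (?E N \<times> ?E M)"
  proof
    fix q assume q: "q \<in> {q \<in> quads. frames N Y X M q \<noteq> {}}"
    obtain A B C D where [simp]: "q = (A, B, C, D)" by (cases q)
    show "q \<in> (\<lambda>((C, D), (A, B)). (A, B, C, D)) ` (?E N \<times> ?E M)"
      using q by (intro image_eqI[of _ _ "((C, D), (A, B))"]) (auto simp: quads_def frames_def)
  qed
qed

text \<open>Green's formula is a double count: a pair of extensions with the same middle term determines
  its frame up to unique isomorphism, and the pairs with a given frame are fillings.\<close>

lemma frames_of_cross:
  assumes nm: "ses M N E n m" and yx: "ses X Y E y x"
  shows "(\<Sum>q | q \<in> quads \<and> frames N Y X M q \<noteq> {}.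
      of_nat (card {f \<in> frames N Y X M q. compat ((n, m), (y, x)) f}) /
      (case q of (A, B, C, D) \<Rightarrow> au A * au B * au C * au D)) = 1"
proof -
  note nm' = sesD[OF nm] and yx' = sesD[OF yx]
  obtain A\<^sub>0 B\<^sub>0 C\<^sub>0 D\<^sub>0 d1 c1 d2 b1 c2 a1 b2 a2 where
    f: "ses C\<^sub>0 D\<^sub>0 N d1 c1" "ses B\<^sub>0 D\<^sub>0 Y d2 b1" "ses A\<^sub>0 C\<^sub>0 X c2 a1" "ses A\<^sub>0 B\<^sub>0 M b2 a2"
    and c: "n \<cdot> d1 = y \<cdot> d2" "x \<cdot> n = c2 \<cdot> c1" "m \<cdot> y = b2 \<cdot> b1" "a1 \<cdot> x = a2 \<cdot> m"
    using cross_frame[OF nm yx] .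
  note f1 = sesD[OF f(1)] and f2 = sesD[OF f(2)] and f3 = sesD[OF f(3)] and f4 = sesD[OF f(4)]
  let ?F = "\<lambda>q. {f \<in> frames N Y X M q. compat ((n, m), (y, x)) f}"
  let ?P = "\<lambda>(A, B, C, D). isop A\<^sub>0 A \<times> isop B\<^sub>0 B \<times> isop C\<^sub>0 C \<times> isop D\<^sub>0 D"
  let ?G = "\<lambda>((\<alpha>, \<alpha>'), (\<beta>, \<beta>'), (\<gamma>, \<gamma>'), (\<delta>, \<delta>')).
     ((d1 \<cdot> \<delta>', \<gamma> \<cdot> c1), (d2 \<cdot> \<delta>', \<beta> \<cdot> b1), (c2 \<cdot> \<gamma>', \<alpha> \<cdot> a1), (b2 \<cdot> \<beta>', \<alpha> \<cdot> a2))"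
  \<comment> \<open>Every frame of the cross differs from the constructed one by isomorphisms of the
    four corners, and these are unique.\<close>
  have bij: "bij_betw ?G (?P q) (?F q)" for q
  proof -
    obtain A B C D where q: "q = (A, B, C, D)" by (cases q)
    show ?thesis
      unfolding q prod.case bij_betw_def
    proof
      show "inj_on ?G (isop A\<^sub>0 A \<times> isop B\<^sub>0 B \<times> isop C\<^sub>0 C \<times> isop D\<^sub>0 D)"
      proof (rule inj_onI)
        fix u v assume "u \<in> isop A\<^sub>0 A \<times> isop B\<^sub>0 B \<times> isop C\<^sub>0 C \<times> isop D\<^sub>0 D"
          "v \<in> isop A\<^sub>0 A \<times> isop B\<^sub>0 B \<times> isop C\<^sub>0 C \<times> isop D\<^sub>0 D" and G: "?G u = ?G v"
        then obtain \<alpha> \<alpha>' \<beta> \<beta>' \<gamma> \<gamma>' \<delta> \<delta>' \<alpha>2 \<alpha>2' \<beta>2 \<beta>2' \<gamma>2 \<gamma>2' \<delta>2 \<delta>2' where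
          uv: "u = ((\<alpha>, \<alpha>'), (\<beta>, \<beta>'), (\<gamma>, \<gamma>'), (\<delta>, \<delta>'))" "v = ((\<alpha>2, \<alpha>2'), (\<beta>2, \<beta>2'), (\<gamma>2, \<gamma>2'), (\<delta>2, \<delta>2'))"
          and i: "(\<alpha>, \<alpha>') \<in> isop A\<^sub>0 A" "(\<beta>, \<beta>') \<in> isop B\<^sub>0 B" "(\<gamma>, \<gamma>') \<in> isop C\<^sub>0 C" "(\<delta>, \<delta>') \<in> isop D\<^sub>0 D"
          "(\<alpha>2, \<alpha>2') \<in> isop A\<^sub>0 A" "(\<beta>2, \<beta>2') \<in> isop B\<^sub>0 B" "(\<gamma>2, \<gamma>2') \<in> isop C\<^sub>0 C" "(\<delta>2, \<delta>2') \<in> isop D\<^sub>0 D"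
          by (elim SigmaE) fast
        have e: "d1 \<cdot> \<delta>' = d1 \<cdot> \<delta>2'" "\<gamma> \<cdot> c1 = \<gamma>2 \<cdot> c1" "\<beta> \<cdot> b1 = \<beta>2 \<cdot> b1" "\<alpha> \<cdot> a1 = \<alpha>2 \<cdot> a1"
          using G unfolding uv by simp_all
        have "\<alpha> = \<alpha>2" by (rule epi_cancel[OF f3(2) isopD(1)[OF i(1)] isopD(1)[OF i(5)] e(4)])
        moreover from this have "\<alpha>' = \<alpha>2'" using isop_unique i by blast
        moreover have "\<beta> = \<beta>2" by (rule epi_cancel[OF f2(2) isopD(1)[OF i(2)] isopD(1)[OF i(6)] e(3)])
        moreover from this have "\<beta>' = \<beta>2'" using isop_unique i by blast
        moreover have "\<gamma> = \<gamma>2" by (rule epi_cancel[OF f1(2) isopD(1)[OF i(3)] isopD(1)[OF i(7)] e(2)])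
        moreover from this have "\<gamma>' = \<gamma>2'" using isop_unique i by blast
        moreover have "\<delta>' = \<delta>2'" by (rule mono_cancel[OF f1(1) isopD(2)[OF i(4)] isopD(2)[OF i(8)] e(1)])
        moreover from this have "\<delta> = \<delta>2" using isop_unique isop_sym i(4,8) by blast
        ultimately show "u = v" unfolding uv by simp
      qed
      show "?G ` (isop A\<^sub>0 A \<times> isop B\<^sub>0 B \<times> isop C\<^sub>0 C \<times> isop D\<^sub>0 D) = {f \<in> frames N Y X M (A, B, C, D). compat ((n, m), (y, x)) f}"
      proof (intro equalityI subsetI)
        fix z assume "z \<in> ?G ` (isop A\<^sub>0 A \<times> isop B\<^sub>0 B \<times> isop C\<^sub>0 C \<times> isop D\<^sub>0 D)"
        then obtain \<alpha> \<alpha>' \<beta> \<beta>' \<gamma> \<gamma>' \<delta> \<delta>' where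
          i: "(\<alpha>, \<alpha>') \<in> isop A\<^sub>0 A" "(\<beta>, \<beta>') \<in> isop B\<^sub>0 B" "(\<gamma>, \<gamma>') \<in> isop C\<^sub>0 C" "(\<delta>, \<delta>') \<in> isop D\<^sub>0 D"
          and z: "z = ((d1 \<cdot> \<delta>', \<gamma> \<cdot> c1), (d2 \<cdot> \<delta>', \<beta> \<cdot> b1), (c2 \<cdot> \<gamma>', \<alpha> \<cdot> a1), (b2 \<cdot> \<beta>', \<alpha> \<cdot> a2))"
          by force
        have "n \<cdot> d1 \<cdot> \<delta>' = y \<cdot> d2 \<cdot> \<delta>'" using c(1) by (metis assoc)
        moreover have "x \<cdot> n = (c2 \<cdot> \<gamma>') \<cdot> (\<gamma> \<cdot> c1)"
          using c(2) f1(5) isopD[OF i(3)] by (simp add: assoc ra[OF isopD(3)[OF i(3)]] idn_left)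
        moreover have "m \<cdot> y = (b2 \<cdot> \<beta>') \<cdot> (\<beta> \<cdot> b1)"
          using c(3) f2(5) isopD[OF i(2)] by (simp add: assoc ra[OF isopD(3)[OF i(2)]] idn_left)
        moreover have "(\<alpha> \<cdot> a1) \<cdot> x = (\<alpha> \<cdot> a2) \<cdot> m" using c(4) by (simp add: assoc)
        ultimately have "compat ((n, m), (y, x)) z" unfolding compat_def z by simp
        moreover have "z \<in> frames N Y X M (A, B, C, D)"
          unfolding frames_def z SES_def
          using ses_iso_quot[OF ses_iso_sub[OF f(1) i(4)] i(3)] ses_iso_quot[OF ses_iso_sub[OF f(2) i(4)] i(2)]
            ses_iso_quot[OF ses_iso_sub[OF f(3) i(3)] i(1)] ses_iso_quot[OF ses_iso_sub[OF f(4) i(2)] i(1)] by simp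
        ultimately show "z \<in> {f \<in> frames N Y X M (A, B, C, D). compat ((n, m), (y, x)) f}" by blast
      next
        fix z assume "z \<in> {f \<in> frames N Y X M (A, B, C, D). compat ((n, m), (y, x)) f}"
        then obtain e1 r1 e2 q1 r2 p1 q2 p2 where z: "z = ((e1, r1), (e2, q1), (r2, p1), (q2, p2))"
          and g: "ses C D N e1 r1" "ses B D Y e2 q1" "ses A C X r2 p1" "ses A B M q2 p2"
          and k: "n \<cdot> e1 = y \<cdot> e2" "x \<cdot> n = r2 \<cdot> r1" "m \<cdot> y = q2 \<cdot> q1" "p1 \<cdot> x = p2 \<cdot> m"
          by (auto simp: frames_def compat_def SES_def)
        note g1 = sesD[OF g(1)] and g2 = sesD[OF g(2)] and g3 = sesD[OF g(3)] and g4 = sesD[OF g(4)]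
        have "c2 \<cdot> c1 = r2 \<cdot> r1" "b2 \<cdot> b1 = q2 \<cdot> q1" using c k by simp_all
        \<comment> \<open>\<open>C\<close> and \<open>B\<close> are compared as images, then
          \<open>D\<close> and \<open>A\<close> as kernel and cokernel; the remaining two equations
          follow by cancelling \<open>y\<close> and \<open>m\<close>.\<close>
        obtain \<gamma> \<gamma>' where \<gamma>: "(\<gamma>, \<gamma>') \<in> isop C\<^sub>0 C" "r1 = \<gamma> \<cdot> c1" "r2 = c2 \<cdot> \<gamma>'"
          using image_unique[OF f1(2) g1(2) f3(1) g3(1) \<open>c2 \<cdot> c1 = _\<close>] .
        obtain \<beta> \<beta>' where \<beta>: "(\<beta>, \<beta>') \<in> isop B\<^sub>0 B" "q1 = \<beta> \<cdot> b1" "q2 = b2 \<cdot> \<beta>'"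
          using image_unique[OF f2(2) g2(2) f4(1) g4(1) \<open>b2 \<cdot> b1 = _\<close>] .
        obtain \<delta> \<delta>' where \<delta>: "(\<delta>, \<delta>') \<in> isop D\<^sub>0 D" "e1 = d1 \<cdot> \<delta>'"
          using kernel_unique[OF ses_iso_quot[OF f(1) \<gamma>(1)] g(1)[unfolded \<gamma>(2)]] .
        have "y \<cdot> e2 = y \<cdot> (d2 \<cdot> \<delta>')" using k(1) \<delta>(2) c(1) by (metis assoc)
        then have e2: "e2 = d2 \<cdot> \<delta>'"
          using mono_cancel[OF yx'(1) g2(4) comp_hom[OF isopD(2)[OF \<delta>(1)] f2(4)]] by blast
        obtain \<alpha> \<alpha>' where \<alpha>: "(\<alpha>, \<alpha>') \<in> isop A\<^sub>0 A" "p1 = \<alpha> \<cdot> a1"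
          using cokernel_unique[OF ses_iso_sub[OF f(3) \<gamma>(1)] g(3)[unfolded \<gamma>(3)]] .
        have "p2 \<cdot> m = (\<alpha> \<cdot> a2) \<cdot> m" using k(4) \<alpha>(2) c(4) by (metis assoc)
        then have p2: "p2 = \<alpha> \<cdot> a2"
          using epi_cancel[OF nm'(2) g4(5) comp_hom[OF f4(5) isopD(1)[OF \<alpha>(1)]]] by blast
        show "z \<in> ?G ` (isop A\<^sub>0 A \<times> isop B\<^sub>0 B \<times> isop C\<^sub>0 C \<times> isop D\<^sub>0 D)"
          by (rule image_eqI[of _ _ "((\<alpha>, \<alpha>'), (\<beta>, \<beta>'), (\<gamma>, \<gamma>'), (\<delta>, \<delta>'))"])
            (use z \<alpha> \<beta> \<gamma> \<delta> e2 p2 in auto)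
      qed
    qed
  qed
  \<comment> \<open>Only the quadruple of representatives of the corners contributes, and there the
    number of frames is the product of the orders of the four automorphism groups.\<close>
  let ?q\<^sub>0 = "(rp A\<^sub>0, rp B\<^sub>0, rp C\<^sub>0, rp D\<^sub>0)"
  let ?w = "\<lambda>q. case q of (A, B, C, D) \<Rightarrow> au A * au B * au C * au D"
  note o = f3(8) f2(8) f1(8) f1(9)
  obtain \<alpha> \<beta> \<gamma> \<delta> where i: "\<alpha> \<in> isop A\<^sub>0 (rp A\<^sub>0)" "\<beta> \<in> isop B\<^sub>0 (rp B\<^sub>0)" "\<gamma> \<in> isop C\<^sub>0 (rp C\<^sub>0)" "\<delta> \<in> isop D\<^sub>0 (rp D\<^sub>0)"
    using rp_iso[OF o(1)] rp_iso[OF o(2)] rp_iso[OF o(3)] rp_iso[OF o(4)] by (elim exE) (rule that)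
  have q0: "?q\<^sub>0 \<in> quads" using o rp_reps by (simp add: quads_def)
  have ne: "isop X\<^sub>0 X = {}" if "X \<in> reps" "X \<noteq> rp X\<^sub>0" for X\<^sub>0 X
    using rp_eq rp_id that by (metis all_not_in_conv prod.exhaust)
  have other: "?F q = {}" if q: "q \<in> quads" "q \<noteq> ?q\<^sub>0" for q
  proof -
    have "?P q = {}" using q ne[of _ A\<^sub>0] ne[of _ B\<^sub>0] ne[of _ C\<^sub>0] ne[of _ D\<^sub>0] by (cases q) (auto simp: quads_def)
    then show ?thesis using bij_betw_imp_surj_on[OF bij[of q]] by (simp only: image_empty)
  qed
  have cardq0: "card (?F ?q\<^sub>0) = card (isop (rp A\<^sub>0) (rp A\<^sub>0)) * (card (isop (rp B\<^sub>0) (rp B\<^sub>0)) * (card (isop (rp C\<^sub>0) (rp C\<^sub>0)) * card (isop (rp D\<^sub>0) (rp D\<^sub>0))))"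
    using bij_betw_same_card[OF bij[of ?q\<^sub>0]] i card_isop_left by (cases \<alpha>; cases \<beta>; cases \<gamma>; cases \<delta>) (simp add: card_cartesian_product)
  have ap: "au (rp A\<^sub>0) > 0" "au (rp B\<^sub>0) > 0" "au (rp C\<^sub>0) > 0" "au (rp D\<^sub>0) > 0" using au_pos rp_obj o by blast+
  have one: "of_nat (card (?F ?q\<^sub>0)) / ?w ?q\<^sub>0 = 1" using ap unfolding cardq0 by (simp add: au_def)
  have "?F ?q\<^sub>0 \<noteq> {}"
  proof
    assume "?F ?q\<^sub>0 = {}"
    then show False using one by (simp only: card.empty of_nat_0 div_0 zero_neq_one)
  qed
  then have q0': "?q\<^sub>0 \<in> {q \<in> quads. frames N Y X M q \<noteq> {}}" using q0 by blast
  have "(\<Sum>q | q \<in> quads \<and> frames N Y X M q \<noteq> {}. of_nat (card (?F q)) / ?w q) = (\<Sum>q\<in>{?q\<^sub>0}. of_nat (card (?F q)) / ?w q)"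
  proof (rule sum.mono_neutral_right)
    show "finite {q. q \<in> quads \<and> frames N Y X M q \<noteq> {}}" using finite_quads[OF nm'(9,8)] .
    show "\<forall>q\<in>{q. q \<in> quads \<and> frames N Y X M q \<noteq> {}} - {?q\<^sub>0}. of_nat (card (?F q)) / ?w q = 0"
    proof
      fix q assume "q \<in> {q. q \<in> quads \<and> frames N Y X M q \<noteq> {}} - {?q\<^sub>0}"
      then have "?F q = {}" using other by blast
      then show "of_nat (card (?F q)) / ?w q = 0" by (simp only: card.empty of_nat_0 div_0)
    qed
  qed (use q0' in simp)
  also have "\<dots> = of_nat (card (?F ?q\<^sub>0)) / ?w ?q\<^sub>0" by (simp only: sum.insert sum.empty finite.emptyI empty_iff not_False_eq_True add_0_right)
  also note one
  finally show ?thesis .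
qed

text \<open>Maps out of the pushout \<open>S\<close> and into the pullback \<open>T\<close>
  amalgamate the row and the column of a cross into one filling. The compatible crosses thus
  correspond to the fillings of the four-term sequence, which exist by \<open>fill\<close> and are
  counted by \<open>fillings_mass\<close>.\<close>

lemma crosses_of_frame:
  assumes f: "ses C D N d1 c1" "ses B D Y d2 b1" "ses A C X c2 a1" "ses A B M b2 a2"
  shows "mass (\<lambda>E. {z \<in> SES M N E \<times> SES X Y E. compat z ((d1, c1), (d2, b1), (c2, a1), (b2, a2))}) = mass (SES A D)"
proof -
  note f1 = sesD[OF f(1)] and f2 = sesD[OF f(2)] and f3 = sesD[OF f(3)] and f4 = sesD[OF f(4)]
  obtain S \<kappa>\<^sub>1 \<kappa>\<^sub>2 where po: "pushout S N Y D \<kappa>\<^sub>1 \<kappa>\<^sub>2 d1 d2" using pushout_ex[OF f1(4) f2(4)] .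
  obtain T \<pi>\<^sub>1 \<pi>\<^sub>2 where pb: "pullback T X M A \<pi>\<^sub>1 \<pi>\<^sub>2 a1 a2" using pullback_ex[OF f3(5) f4(5)] .
  note p = pushoutD[OF po] and q = pullbackD[OF pb]
  obtain I \<gamma> \<iota> where e: "ses I D S (\<kappa>\<^sub>1 \<cdot> d1) \<gamma>" "ses A I T \<iota> (a1 \<cdot> \<pi>\<^sub>1)"
    and c: "\<pi>\<^sub>1 \<cdot> \<iota> \<cdot> \<gamma> \<cdot> \<kappa>\<^sub>1 = c2 \<cdot> c1" "Z (\<pi>\<^sub>2 \<cdot> \<iota> \<cdot> \<gamma> \<cdot> \<kappa>\<^sub>1)"
    "Z (\<pi>\<^sub>1 \<cdot> \<iota> \<cdot> \<gamma> \<cdot> \<kappa>\<^sub>2)" "\<pi>\<^sub>2 \<cdot> \<iota> \<cdot> \<gamma> \<cdot> \<kappa>\<^sub>2 = b2 \<cdot> b1"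
    using frame_exact[OF f po pb] .
  note e1 = sesD[OF e(1)] and e2 = sesD[OF e(2)]
  let ?R = "\<lambda>E. {z \<in> SES M N E \<times> SES X Y E. compat z ((d1, c1), (d2, b1), (c2, a1), (b2, a2))}"
  let ?L = "fillings A S T (\<iota> \<cdot> \<gamma>) (a1 \<cdot> \<pi>\<^sub>1)"
  let ?g = "\<lambda>(s, t). ((s \<cdot> \<kappa>\<^sub>1, \<pi>\<^sub>2 \<cdot> t), (s \<cdot> \<kappa>\<^sub>2, \<pi>\<^sub>1 \<cdot> t))"
  have "bij_betw ?g (?L E) (?R E)" for E
    unfolding bij_betw_def
  proof
    show "inj_on ?g (?L E)"
    proof (rule inj_onI, clarify)
      fix s t s' t' assume "(s, t) \<in> ?L E" "(s', t') \<in> ?L E"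
        and g: "s \<cdot> \<kappa>\<^sub>1 = s' \<cdot> \<kappa>\<^sub>1" "\<pi>\<^sub>2 \<cdot> t = \<pi>\<^sub>2 \<cdot> t'" "s \<cdot> \<kappa>\<^sub>2 = s' \<cdot> \<kappa>\<^sub>2" "\<pi>\<^sub>1 \<cdot> t = \<pi>\<^sub>1 \<cdot> t'"
      then have "s \<in> hm S E" "s' \<in> hm S E" "t \<in> hm E T" "t' \<in> hm E T" by (auto simp: fillings_def)
      then show "s = s' \<and> t = t'" using p(7)[of s E s'] q(7)[of t E t'] g by blast
    qed
    show "?g ` ?L E = ?R E"
    proof (intro equalityI subsetI)
      fix z assume "z \<in> ?g ` ?L E"
      then obtain s t where z: "z = ((s \<cdot> \<kappa>\<^sub>1, \<pi>\<^sub>2 \<cdot> t), (s \<cdot> \<kappa>\<^sub>2, \<pi>\<^sub>1 \<cdot> t))" and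
        st: "s \<in> hm S E" "t \<in> hm E T" "t \<cdot> s = \<iota> \<cdot> \<gamma>" "ses A S E s ((a1 \<cdot> \<pi>\<^sub>1) \<cdot> t)"
        by (auto simp: fillings_def)
      have te: "epi E T t" using filling_dual1[OF e st] sesD by blast
      have s1: "ses A S E s (a1 \<cdot> \<pi>\<^sub>1 \<cdot> t)" using st(4) by (simp add: assoc)
      have s2: "ses A S E s (a2 \<cdot> \<pi>\<^sub>2 \<cdot> t)" using st(4) by (simp add: assoc q(5) ra[OF q(5)])
      have ts: "t \<cdot> s \<cdot> v = \<iota> \<cdot> \<gamma> \<cdot> v" for v using ra[OF st(3)] by (simp add: assoc)
      have "ses M N E (s \<cdot> \<kappa>\<^sub>1) (\<pi>\<^sub>2 \<cdot> t)"
        by (rule filling_cross[OF f(2) f3(2) f4(1) po pb s1 te]) (use c in \<open>simp_all add: ts\<close>)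
      moreover have "ses X Y E (s \<cdot> \<kappa>\<^sub>2) (\<pi>\<^sub>1 \<cdot> t)"
        by (rule filling_cross[OF f(1) f4(2) f3(1) pushout_swap[OF po] pullback_swap[OF pb] s2 te]) (use c in \<open>simp_all add: ts\<close>)
      moreover have "compat z ((d1, c1), (d2, b1), (c2, a1), (b2, a2))"
        unfolding compat_def z using c p(5) q(5) by (simp add: assoc ts ra[OF q(5)])
      ultimately show "z \<in> ?R E" using z by (auto simp: SES_def)
    next
      fix z assume "z \<in> ?R E"
      then obtain n m y x where z: "z = ((n, m), (y, x))" and nm: "ses M N E n m" and yx: "ses X Y E y x"
        and k: "n \<cdot> d1 = y \<cdot> d2" "x \<cdot> n = c2 \<cdot> c1" "m \<cdot> y = b2 \<cdot> b1" "a1 \<cdot> x = a2 \<cdot> m"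
        by (auto simp: SES_def compat_def)
      note nm' = sesD[OF nm] and yx' = sesD[OF yx]
      obtain s where s: "s \<in> hm S E" "s \<cdot> \<kappa>\<^sub>1 = n" "s \<cdot> \<kappa>\<^sub>2 = y" using p(6)[OF nm'(4) yx'(4) k(1)] by blast
      obtain t where t: "t \<in> hm E T" "\<pi>\<^sub>1 \<cdot> t = x" "\<pi>\<^sub>2 \<cdot> t = m" using q(6)[OF yx'(5) nm'(5) k(4)] by blast
      have se: "ses A S E s ((a1 \<cdot> \<pi>\<^sub>1) \<cdot> t)" using cross_filling[OF f po nm yx k(2,3) s] t(2) by (simp add: assoc)
      have ig: "\<iota> \<cdot> \<gamma> \<in> hm S T" using comp_hom[OF e1(5) e2(4)] .
      \<comment> \<open>The identity of \<open>t \<cdot> s\<close> with the middle arrow is checked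
        on the four entries of the matrix; the off-diagonal ones are zero by exactness of the row
        and of the column.\<close>
      have "\<pi>\<^sub>1 \<cdot> t \<cdot> s \<cdot> \<kappa>\<^sub>1 = \<pi>\<^sub>1 \<cdot> (\<iota> \<cdot> \<gamma>) \<cdot> \<kappa>\<^sub>1" "\<pi>\<^sub>2 \<cdot> t \<cdot> s \<cdot> \<kappa>\<^sub>2 = \<pi>\<^sub>2 \<cdot> (\<iota> \<cdot> \<gamma>) \<cdot> \<kappa>\<^sub>2"
        using s t k c by (simp_all add: assoc ra[OF t(2)] ra[OF t(3)])
      moreover have "\<pi>\<^sub>2 \<cdot> t \<cdot> s \<cdot> \<kappa>\<^sub>1 = \<pi>\<^sub>2 \<cdot> (\<iota> \<cdot> \<gamma>) \<cdot> \<kappa>\<^sub>1"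
        by (rule Z_unique[OF _ _ comp_hom[OF comp_hom[OF comp_hom[OF p(1) s(1)] t(1)] q(2)] comp_hom[OF comp_hom[OF p(1) ig] q(2)]])
          (use s t c nm'(3) in \<open>simp_all add: assoc ra[OF t(3)]\<close>)
      moreover have "\<pi>\<^sub>1 \<cdot> t \<cdot> s \<cdot> \<kappa>\<^sub>2 = \<pi>\<^sub>1 \<cdot> (\<iota> \<cdot> \<gamma>) \<cdot> \<kappa>\<^sub>2"
        by (rule Z_unique[OF _ _ comp_hom[OF comp_hom[OF comp_hom[OF p(2) s(1)] t(1)] q(1)] comp_hom[OF comp_hom[OF p(2) ig] q(1)]])
          (use s t c yx'(3) in \<open>simp_all add: assoc ra[OF t(2)]\<close>)
      ultimately have "(t \<cdot> s) \<cdot> \<kappa>\<^sub>1 = (\<iota> \<cdot> \<gamma>) \<cdot> \<kappa>\<^sub>1" "(t \<cdot> s) \<cdot> \<kappa>\<^sub>2 = (\<iota> \<cdot> \<gamma>) \<cdot> \<kappa>\<^sub>2"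
        using q(7)[OF comp_hom[OF p(1) comp_hom[OF s(1) t(1)]] comp_hom[OF p(1) ig]]
          q(7)[OF comp_hom[OF p(2) comp_hom[OF s(1) t(1)]] comp_hom[OF p(2) ig]] by (simp_all add: assoc)
      then have "t \<cdot> s = \<iota> \<cdot> \<gamma>" using p(7)[OF comp_hom[OF s(1) t(1)] ig] by blast
      then have "(s, t) \<in> ?L E" using s t se by (simp add: fillings_def)
      then show "z \<in> ?g ` ?L E" by (rule rev_image_eqI) (use z s t in simp)
    qed
  qed
  then have "mass ?L = mass ?R" by (rule mass_cong_bij)
  moreover obtain E\<^sub>0 s\<^sub>0 t\<^sub>0 where "(s\<^sub>0, t\<^sub>0) \<in> ?L E\<^sub>0" using fill[OF e] by auto
  ultimately show ?thesis using fillings_mass[OF e] by simp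
qed

text \<open>In the product of the coproducts of [M] and [N], the corner \<open>A\<close> is the
  quotient part of \<open>M\<close> and stands second in the first tensor, and \<open>D\<close> is
  the sub-object part of \<open>N\<close> and stands first in the second tensor. These are the
  factors exchanged by the braiding, and the weight \<open>mass (SES A D)\<close> becomes its
  scalar.\<close>

theorem green:
  assumes o: "M \<in> obj" "N \<in> obj" "X \<in> obj" "Y \<in> obj"
  shows "mass (\<lambda>E. SES M N E \<times> SES X Y E) =
    (\<Sum>q | q \<in> quads \<and> frames N Y X M q \<noteq> {}. (case q of (A, B, C, D) \<Rightarrow> mass (SES A D)) *
       of_nat (card (frames N Y X M q)) / (case q of (A, B, C, D) \<Rightarrow> au A * au B * au C * au D))"
proof -
  let ?J = "{E. E \<in> reps \<and> SES M N E \<times> SES X Y E \<noteq> {}}"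
  let ?K = "{q. q \<in> quads \<and> frames N Y X M q \<noteq> {}}"
  let ?R = "\<lambda>E q. {(s, f). s \<in> SES M N E \<times> SES X Y E \<and> f \<in> frames N Y X M q \<and> compat s f}"
  have fJ: "finite ?J" by (rule finite_subset[OF _ fin_mid'[OF o(1,2)]]) auto
  show ?thesis
    unfolding mass_def[of "\<lambda>E. SES M N E \<times> SES X Y E"]
  proof (rule double_count[of ?J ?K ?R "\<lambda>E. SES M N E \<times> SES X Y E" "frames N Y X M" fst snd])
    show "finite (?R E q)" for E q
      by (rule finite_subset[of _ "(SES M N E \<times> SES X Y E) \<times> frames N Y X M q"]) (auto simp: finite_SES finite_frames)
    fix E s assume "s \<in> SES M N E \<times> SES X Y E"
    then obtain n m y x where s: "s = ((n, m), (y, x))" "ses M N E n m" "ses X Y E y x" and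
      sin: "s \<in> SES M N E \<times> SES X Y E" by (auto simp: SES_def)
    have "card {z \<in> ?R E q. fst z = s} = card {f \<in> frames N Y X M q. compat s f}" for q
    proof (rule bij_betw_same_card[of snd], rule bij_betw_byWitness[of _ "\<lambda>f. (s, f)"])
    qed (use sin in auto)
    then show "(\<Sum>q\<in>?K. of_nat (card {z \<in> ?R E q. fst z = s}) / (case q of (A, B, C, D) \<Rightarrow> au A * au B * au C * au D)) = 1"
      using frames_of_cross[OF s(2,3)] s(1) by simp
  next
    fix q f assume f: "f \<in> frames N Y X M q"
    obtain A B C D where q: "q = (A, B, C, D)" by (cases q)
    obtain d1 c1 d2 b1 c2 a1 b2 a2 where ff: "f = ((d1, c1), (d2, b1), (c2, a1), (b2, a2))" and
      s: "ses C D N d1 c1" "ses B D Y d2 b1" "ses A C X c2 a1" "ses A B M b2 a2"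
      using f by (auto simp: q frames_def SES_def)
    have "card {z \<in> ?R E q. snd z = f} = card {s \<in> SES M N E \<times> SES X Y E. compat s f}" for E
    proof (rule bij_betw_same_card[of fst], rule bij_betw_byWitness[of _ "\<lambda>s. (s, f)"])
    qed (use f in auto)
    then have "(\<Sum>E\<in>?J. of_nat (card {z \<in> ?R E q. snd z = f}) / au E) =
      (\<Sum>E\<in>?J. of_nat (card {s \<in> SES M N E \<times> SES X Y E. compat s f}) / au E)" by simp
    also have "\<dots> = mass (\<lambda>E. {s \<in> SES M N E \<times> SES X Y E. compat s f})"
      by (rule mass_eq[symmetric]) (use fJ in auto)
    finally show "(\<Sum>E\<in>?J. of_nat (card {z \<in> ?R E q. snd z = f}) / au E) = (case q of (A, B, C, D) \<Rightarrow> mass (SES A D))"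
      using crosses_of_frame[OF s] ff q by simp
  qed (use fJ finite_quads[OF o(2,1)] finite_SES finite_frames in auto)
qed

end

section \<open>Push-forward of extensions and of fillings\<close>

context ab_cat
begin

lemma pushout_ses:
  assumes s: "ses A S E s p" and h: "h \<in> hm S S'"
  obtains E' s' e p' where "ses A S' E' s' p'" "e \<cdot> s = s' \<cdot> h" "p' \<cdot> e = p" "pushout E' S' E S s' e h s"
proof -
  note s' = sesD[OF s]
  obtain E' r e where po: "pushout E' S' E S r e h s" using pushout_ex[OF h s'(4)] .
  note p = pushoutD[OF po]
  have S': "S' \<in> obj" using h hom_obj by blast
  have z: "zero S' A \<in> hm S' A" "Z (zero S' A)" using S' s'(8) by (auto intro: zero_hom zerop_zero)
  have "zero S' A \<cdot> h = p \<cdot> s"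
    by (rule Z_unique[OF Z_right[OF z(2)] s'(3) comp_hom[OF h z(1)] comp_hom[OF s'(4,5)]])
  then obtain p' where p': "p' \<in> hm E' A" "p' \<cdot> r = zero S' A" "p' \<cdot> e = p" using p(6)[OF z(1) s'(5)] by blast
  have "ses A S' E' r p'"
  proof (rule sesI_op)
    show "mono S' E' r" using pushout_mono[OF po s'(1)] .
    show "epi E' A p'" using epi_right[of A E p' e E'] s'(2) p' by simp
    show "Z (p' \<cdot> r)" using p' z by simp
    fix V y assume y: "y \<in> hm E' V" "Z (y \<cdot> r)"
    have "Z ((y \<cdot> e) \<cdot> s)" using y(2) p(5) by (metis assoc Z_right)
    then obtain w where w: "w \<in> hm A V" "w \<cdot> p = y \<cdot> e" using s'(7)[OF comp_hom[OF p(2) y(1)]] by blast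
    have "(w \<cdot> p') \<cdot> r = y \<cdot> r"
      by (rule Z_unique[OF _ y(2) _ comp_hom[OF p(1) y(1)]])
        (use p' z w in \<open>auto simp: assoc intro: Z_left comp_hom\<close>)
    moreover have "(w \<cdot> p') \<cdot> e = y \<cdot> e" using w p' by (simp add: assoc)
    ultimately have "w \<cdot> p' = y" using p(7)[OF comp_hom[OF p'(1) w(1)] y(1)] by blast
    then show "\<exists>z\<in>hm A V. z \<cdot> p' = y" using w(1) by blast
  qed
  then show thesis using that[of E' r p' e] p(5) p'(3) po by simp
qed

text \<open>Push-forward of the filtration along a map of exact sequences that is the identity at
  \<open>A\<close>; the new middle object is the pushout of \<open>E\<close> along
  \<open>h1\<close>. The dual moves fillings in the other direction, along maps that are the
  identity at the sub-object end.\<close>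

lemma filling_push:
  assumes e: "ses A S E s (q \<cdot> t)" "t \<in> hm E T"
    and h: "h1 \<in> hm S S'" "h2 \<in> hm T T'" "c \<in> hm S' T'" "q' \<in> hm T' A"
    and eq: "c \<cdot> h1 = h2 \<cdot> t \<cdot> s" "q' \<cdot> h2 = q" "Z (q' \<cdot> c)"
  shows "\<exists>E' s' t'. s' \<in> hm S' E' \<and> t' \<in> hm E' T' \<and> t' \<cdot> s' = c \<and> ses A S' E' s' (q' \<cdot> t')"
proof -
  obtain E' s' e' p' where f: "ses A S' E' s' p'" "e' \<cdot> s = s' \<cdot> h1" "p' \<cdot> e' = q \<cdot> t" "pushout E' S' E S s' e' h1 s"
    using pushout_ses[OF e(1) h(1)] .
  note p = pushoutD[OF f(4)] and f' = sesD[OF f(1)]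
  obtain t' where t': "t' \<in> hm E' T'" "t' \<cdot> s' = c" "t' \<cdot> e' = h2 \<cdot> t"
    using p(6)[OF h(3) comp_hom[OF e(2) h(2)]] eq(1) by (auto simp: assoc)
  have "(q' \<cdot> t') \<cdot> s' = p' \<cdot> s'"
    by (rule Z_unique[OF _ f'(3) comp_hom[OF p(1) comp_hom[OF t'(1) h(4)]] comp_hom[OF p(1) f'(5)]])
      (use t' eq in \<open>simp add: assoc\<close>)
  moreover have "(q' \<cdot> t') \<cdot> e' = p' \<cdot> e'" using t' eq f(3) by (simp add: assoc ra[OF eq(2)])
  ultimately have "q' \<cdot> t' = p'" using p(7)[OF comp_hom[OF t'(1) h(4)] f'(5)] by blast
  then show ?thesis using t' f(1) p(1) by blast
qed

lemma biproduct_ses: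
  assumes "A \<in> obj" "B \<in> obj"
  obtains S i1 i2 p1 p2 where "i1 \<in> hm A S" "i2 \<in> hm B S" "p1 \<in> hm S A" "p2 \<in> hm S B"
    "p1 \<cdot> i1 = idn A" "p2 \<cdot> i2 = idn B" "i1 \<cdot> p1 \<boxplus> i2 \<cdot> p2 = idn S" "ses A B S i2 p1" "ses B A S i1 p2"
proof -
  have half: "ses A B S i2 p1" if b: "i1 \<in> hm A S" "i2 \<in> hm B S" "p1 \<in> hm S A" "p2 \<in> hm S B"
    "p1 \<cdot> i1 = idn A" "p2 \<cdot> i2 = idn B" "Z (p1 \<cdot> i2)" "i1 \<cdot> p1 \<boxplus> i2 \<cdot> p2 = idn S"
    for A B S i1 i2 p1 p2
  proof (rule sesI)
    have o: "A \<in> obj" "B \<in> obj" using b hom_obj by blast+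
    show "mono B S i2" using mono_left[of B B p2 i2 S] b mono_idn[OF o(2)] by simp
    show "epi S A p1" using epi_right[of A A p1 i1 S] b epi_idn[OF o(1)] by simp
    show "Z (p1 \<cdot> i2)" by fact
    fix U x assume x: "x \<in> hm U S" "Z (p1 \<cdot> x)"
    have "x = (i1 \<cdot> p1 \<boxplus> i2 \<cdot> p2) \<cdot> x" using b x idn_left by simp
    also have "\<dots> = i1 \<cdot> p1 \<cdot> x \<boxplus> i2 \<cdot> p2 \<cdot> x" by (simp add: distr assoc)
    also have "\<dots> = i2 \<cdot> p2 \<cdot> x"
      by (rule zero_add[OF comp_hom[OF comp_hom[OF x(1) b(4)] b(2)] comp_hom[OF comp_hom[OF x(1) b(3)] b(1)] Z_left[OF x(2)]])
    finally show "\<exists>z\<in>hm U B. i2 \<cdot> z = x" using comp_hom[OF x(1) b(4)] by metis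
  qed
  obtain S i1 i2 p1 p2 where b: "i1 \<in> hm A S" "i2 \<in> hm B S" "p1 \<in> hm S A" "p2 \<in> hm S B"
    "p1 \<cdot> i1 = idn A" "p2 \<cdot> i2 = idn B" "Z (p2 \<cdot> i1)" "Z (p1 \<cdot> i2)" "i1 \<cdot> p1 \<boxplus> i2 \<cdot> p2 = idn S"
    using biproduct[OF assms] by blast
  have "i2 \<cdot> p2 \<boxplus> i1 \<cdot> p1 = idn S" using b(9) by (simp add: add_comm)
  then show thesis using that[of i1 S i2 p1 p2] b half[of i1 A S i2 B p1 p2] half[of i2 B S i1 A p2 p1] by blast
qed

end

section \<open>Passage from the given category to total operations\<close>

context abelian_category
begin

text \<open>\<open>None\<close> is the value of every ill-typed composite or sum and absorbs under
  both operations, so the unconditional laws of \<open>ab_cat\<close> hold. It is idempotent for the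
  addition, so even \<open>f\<close> minus \<open>f\<close> is a zero arrow without a typing
  condition.\<close>

definition ocomp :: "'b option \<Rightarrow> 'b option \<Rightarrow> 'b option" where
  "ocomp g f = (case (g, f) of (Some g, Some f) \<Rightarrow>
     if g \<in> Arr C \<and> f \<in> Arr C \<and> Dom C g = Cod C f then Some (Comp C g f) else None | _ \<Rightarrow> None)"

definition oadd :: "'b option \<Rightarrow> 'b option \<Rightarrow> 'b option" where
  "oadd g f = (case (g, f) of (Some g, Some f) \<Rightarrow>
     if g \<in> Arr C \<and> f \<in> Arr C \<and> Dom C g = Dom C f \<and> Cod C g = Cod C f then Some (Add C g f) else None | _ \<Rightarrow> None)"

definition oneg :: "'b option \<Rightarrow> 'b option" where
  "oneg f = (case f of Some f \<Rightarrow>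
     if f \<in> Arr C then Some (inv\<^bsub>Hom_group C (Dom C f) (Cod C f)\<^esub> f) else None | _ \<Rightarrow> None)"

definition ohm :: "'a \<Rightarrow> 'a \<Rightarrow> 'b option set" where
  "ohm A B = Some ` Hom C A B"

lemma Hom_iff: "f \<in> Hom C A B \<longleftrightarrow> f \<in> Arr C \<and> Dom C f = A \<and> Cod C f = B"
  by (auto simp: Hom_def)

lemma Comp_Arr:
  assumes "g \<in> Arr C" "f \<in> Arr C" "Dom C g = Cod C f"
  shows "Comp C g f \<in> Arr C" "Dom C (Comp C g f) = Dom C f" "Cod C (Comp C g f) = Cod C g"
  using Comp_in_Hom[of f "Dom C f" "Cod C f" g "Cod C g"] assms by (auto simp: Hom_iff)

lemma group_facts:
  assumes "A \<in> Obj C" "B \<in> Obj C"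
  shows "Zer C A B \<in> Hom C A B"
    and "f \<in> Hom C A B \<Longrightarrow> g \<in> Hom C A B \<Longrightarrow> Add C f g \<in> Hom C A B"
    and "f \<in> Hom C A B \<Longrightarrow> inv\<^bsub>Hom_group C A B\<^esub> f \<in> Hom C A B"
    and "f \<in> Hom C A B \<Longrightarrow> Add C f (inv\<^bsub>Hom_group C A B\<^esub> f) = Zer C A B"
    and "f \<in> Hom C A B \<Longrightarrow> Add C f (Zer C A B) = f"
    and "f \<in> Hom C A B \<Longrightarrow> g \<in> Hom C A B \<Longrightarrow> Add C f g = Add C g f"
    and "f \<in> Hom C A B \<Longrightarrow> g \<in> Hom C A B \<Longrightarrow> h \<in> Hom C A B \<Longrightarrow> Add C (Add C f g) h = Add C f (Add C g h)"
    and "f \<in> Hom C A B \<Longrightarrow> Add C f f = f \<longleftrightarrow> f = Zer C A B"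
    and "f \<in> Hom C A B \<Longrightarrow> g \<in> Hom C A B \<Longrightarrow> Add C f g = Zer C A B \<Longrightarrow> g = inv\<^bsub>Hom_group C A B\<^esub> f"
proof -
  interpret H: comm_group "Hom_group C A B" using Hom_comm_group[OF assms] .
  have [simp]: "carrier (Hom_group C A B) = Hom C A B" "mult (Hom_group C A B) = Add C" "one (Hom_group C A B) = Zer C A B"
    by (simp_all add: Hom_group_def)
  show "Zer C A B \<in> Hom C A B" using H.one_closed by simp
  show "f \<in> Hom C A B \<Longrightarrow> g \<in> Hom C A B \<Longrightarrow> Add C f g \<in> Hom C A B" using H.m_closed by simp
  show "f \<in> Hom C A B \<Longrightarrow> inv\<^bsub>Hom_group C A B\<^esub> f \<in> Hom C A B" using H.inv_closed by simp
  show "f \<in> Hom C A B \<Longrightarrow> Add C f (inv\<^bsub>Hom_group C A B\<^esub> f) = Zer C A B" using H.r_inv by simp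
  show "f \<in> Hom C A B \<Longrightarrow> Add C f (Zer C A B) = f" using H.r_one by simp
  show "f \<in> Hom C A B \<Longrightarrow> g \<in> Hom C A B \<Longrightarrow> Add C f g = Add C g f" using H.m_comm by simp
  show "f \<in> Hom C A B \<Longrightarrow> g \<in> Hom C A B \<Longrightarrow> h \<in> Hom C A B \<Longrightarrow> Add C (Add C f g) h = Add C f (Add C g h)"
    using H.m_assoc by simp
  show "f \<in> Hom C A B \<Longrightarrow> Add C f f = f \<longleftrightarrow> f = Zer C A B" using H.r_cancel_one[of f f] by simp
  show "f \<in> Hom C A B \<Longrightarrow> g \<in> Hom C A B \<Longrightarrow> Add C f g = Zer C A B \<Longrightarrow> g = inv\<^bsub>Hom_group C A B\<^esub> f"
    using H.inv_equality[of g f] H.m_comm by simp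
qed

lemma Arr_Hom: "f \<in> Arr C \<Longrightarrow> f \<in> Hom C (Dom C f) (Cod C f)"
  by (simp add: Hom_iff)

lemma Add_Arr:
  assumes "g \<in> Arr C" "f \<in> Arr C" "Dom C g = Dom C f" "Cod C g = Cod C f"
  shows "Add C g f \<in> Arr C" "Dom C (Add C g f) = Dom C f" "Cod C (Add C g f) = Cod C f"
  using group_facts(2)[of "Dom C f" "Cod C f" g f] assms ends_in_Obj by (auto simp: Hom_iff)

lemma neg_Arr:
  assumes "f \<in> Arr C"
  shows "inv\<^bsub>Hom_group C (Dom C f) (Cod C f)\<^esub> f \<in> Arr C"
    "Dom C (inv\<^bsub>Hom_group C (Dom C f) (Cod C f)\<^esub> f) = Dom C f"
    "Cod C (inv\<^bsub>Hom_group C (Dom C f) (Cod C f)\<^esub> f) = Cod C f"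
  using group_facts(3)[of "Dom C f" "Cod C f" f] assms ends_in_Obj by (auto simp: Hom_iff)

lemma Comp_Zer_right:
  assumes "h \<in> Hom C Y Z" "X \<in> Obj C"
  shows "Comp C h (Zer C X Y) = Zer C X Z"
proof -
  have o: "Y \<in> Obj C" "Z \<in> Obj C" using assms(1) ends_in_Obj by (auto simp: Hom_iff)
  have z: "Zer C X Y \<in> Hom C X Y" using group_facts(1) o assms by blast
  have "Add C (Comp C h (Zer C X Y)) (Comp C h (Zer C X Y)) = Comp C h (Zer C X Y)"
    using Comp_Add_right[OF z z assms(1)] group_facts(8)[OF assms(2) o(1) z] by simp
  then show ?thesis using group_facts(8)[OF assms(2) o(2) Comp_in_Hom[OF z assms(1)]] by simp
qed

lemma Comp_Zer_left:
  assumes "h \<in> Hom C X Y" "Z \<in> Obj C"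
  shows "Comp C (Zer C Y Z) h = Zer C X Z"
proof -
  have o: "Y \<in> Obj C" "X \<in> Obj C" using assms(1) ends_in_Obj by (auto simp: Hom_iff)
  have z: "Zer C Y Z \<in> Hom C Y Z" using group_facts(1) o assms by blast
  have "Add C (Comp C (Zer C Y Z) h) (Comp C (Zer C Y Z) h) = Comp C (Zer C Y Z) h"
    using Comp_Add_left[OF z z assms(1)] group_facts(8)[OF o(1) assms(2) z] by simp
  then show ?thesis using group_facts(8)[OF o(2) assms(2) Comp_in_Hom[OF assms(1) z]] by simp
qed

lemma Comp_neg_right:
  assumes f: "f \<in> Hom C X Y" and h: "h \<in> Hom C Y Z"
  shows "Comp C h (inv\<^bsub>Hom_group C X Y\<^esub> f) = inv\<^bsub>Hom_group C X Z\<^esub> (Comp C h f)"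
proof -
  have o: "Y \<in> Obj C" "X \<in> Obj C" "Z \<in> Obj C" using f h ends_in_Obj by (auto simp: Hom_iff)
  have n: "inv\<^bsub>Hom_group C X Y\<^esub> f \<in> Hom C X Y" using group_facts(3) o f by blast
  show ?thesis
    by (rule group_facts(9)[OF o(2,3) Comp_in_Hom[OF f h] Comp_in_Hom[OF n h]])
      (simp add: Comp_Add_right[OF f n h, symmetric] group_facts(4)[OF o(2,1) f] Comp_Zer_right[OF h o(2)])
qed

lemma Comp_neg_left:
  assumes f: "f \<in> Hom C X Y" and h: "h \<in> Hom C Y Z"
  shows "Comp C (inv\<^bsub>Hom_group C Y Z\<^esub> h) f = inv\<^bsub>Hom_group C X Z\<^esub> (Comp C h f)"
proof -
  have o: "Y \<in> Obj C" "X \<in> Obj C" "Z \<in> Obj C" using f h ends_in_Obj by (auto simp: Hom_iff)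
  have n: "inv\<^bsub>Hom_group C Y Z\<^esub> h \<in> Hom C Y Z" using group_facts(3) o h by blast
  show ?thesis
    by (rule group_facts(9)[OF o(2,3) Comp_in_Hom[OF f h] Comp_in_Hom[OF f n]])
      (simp add: Comp_Add_left[OF h n f, symmetric] group_facts(4)[OF o(1,3) h] Comp_Zer_left[OF f o(3)])
qed

lemma ocomp_Some: "g \<in> Hom C Y Z \<Longrightarrow> f \<in> Hom C X Y \<Longrightarrow> ocomp (Some g) (Some f) = Some (Comp C g f)"
  by (auto simp: ocomp_def Hom_iff)

lemma oadd_Some: "g \<in> Hom C X Y \<Longrightarrow> f \<in> Hom C X Y \<Longrightarrow> oadd (Some g) (Some f) = Some (Add C g f)"
  by (auto simp: oadd_def Hom_iff)

lemma zerop_Some: "f \<in> Hom C A B \<Longrightarrow> zerop oadd (Some f) \<longleftrightarrow> f = Zer C A B"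
  using group_facts(8)[of A B f] ends_in_Obj by (auto simp: zerop_def oadd_Some Hom_iff)

lemma ohm_iff: "x \<in> ohm A B \<longleftrightarrow> (\<exists>f\<in>Hom C A B. x = Some f)"
  by (auto simp: ohm_def)

lemma Hom_Obj: "f \<in> Hom C A B \<Longrightarrow> A \<in> Obj C" "f \<in> Hom C A B \<Longrightarrow> B \<in> Obj C"
  using ends_in_Obj by (auto simp: Hom_iff)

lemma kernel_lift:
  assumes k: "is_kernel C f k" and f: "f \<in> Hom C X Y"
  shows "kernelp ohm ocomp oadd (Dom C k) X Y (Some k) (Some f)"
proof -
  have kh: "k \<in> Hom C (Dom C k) X" using k f by (auto simp: is_kernel_def Hom_iff)
  note o = Hom_Obj[OF kh] Hom_Obj[OF f]
  have fk: "Comp C f k = Zer C (Dom C k) Y" using k f by (auto simp: is_kernel_def Hom_iff)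
  have u: "\<exists>!u. u \<in> Hom C U (Dom C k) \<and> Comp C k u = h" if "h \<in> Hom C U X" "Comp C f h = Zer C U Y" for U h
    using k f that Hom_Obj[OF that(1)] by (auto simp: is_kernel_def Hom_iff)
  show ?thesis
    unfolding kernelp_def monop_def
  proof (intro conjI allI impI)
    show "Some k \<in> ohm (Dom C k) X" "Some f \<in> ohm X Y" using kh f by (auto simp: ohm_iff)
    show "zerop oadd (ocomp (Some f) (Some k))"
      using zerop_Some[OF Comp_in_Hom[OF kh f]] fk by (simp add: ocomp_Some[OF f kh])
  next
    fix U z assume "z \<in> ohm U (Dom C k)" and z0: "zerop oadd (ocomp (Some k) z)"
    then obtain g where g: "z = Some g" "g \<in> Hom C U (Dom C k)" by (auto simp: ohm_iff)
    note oU = Hom_Obj[OF g(2)]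
    have kg: "Comp C k g = Zer C U X" using z0 g zerop_Some[OF Comp_in_Hom[OF g(2) kh]] by (simp add: ocomp_Some[OF kh g(2)])
    have "\<exists>!u. u \<in> Hom C U (Dom C k) \<and> Comp C k u = Zer C U X"
      by (rule u) (use group_facts(1) oU o Comp_Zer_right[OF f oU(1)] in auto)
    then have "g = Zer C U (Dom C k)"
      using kg g Comp_Zer_right[OF kh oU(1)] group_facts(1)[OF oU(1) o(1)] by blast
    then show "zerop oadd z" using g zerop_Some by simp
  next
    fix U x assume "x \<in> ohm U X" and z0: "zerop oadd (ocomp (Some f) x)"
    then obtain h where h: "x = Some h" "h \<in> Hom C U X" by (auto simp: ohm_iff)
    have "Comp C f h = Zer C U Y" using z0 h zerop_Some[OF Comp_in_Hom[OF h(2) f]] by (simp add: ocomp_Some[OF f h(2)])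
    then obtain v where v: "v \<in> Hom C U (Dom C k)" "Comp C k v = h" using u[OF h(2)] by blast
    then have "Some v \<in> ohm U (Dom C k)" "ocomp (Some k) (Some v) = x"
      using h by (auto simp: ohm_iff ocomp_Some[OF kh v(1)])
    then show "\<exists>z\<in>ohm U (Dom C k). ocomp (Some k) z = x" by blast
  qed
qed

lemma cokernel_lift:
  assumes k: "is_cokernel C f k" and f: "f \<in> Hom C X Y"
  shows "kernelp (\<lambda>A B. ohm B A) (\<lambda>g f. ocomp f g) oadd (Cod C k) Y X (Some k) (Some f)"
proof -
  have kh: "k \<in> Hom C Y (Cod C k)" using k f by (auto simp: is_cokernel_def Hom_iff)
  note o = Hom_Obj[OF kh] Hom_Obj[OF f]
  have fk: "Comp C k f = Zer C X (Cod C k)" using k f by (auto simp: is_cokernel_def Hom_iff)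
  have u: "\<exists>!u. u \<in> Hom C (Cod C k) U \<and> Comp C u k = h" if "h \<in> Hom C Y U" "Comp C h f = Zer C X U" for U h
    using k f that Hom_Obj[OF that(1)] by (auto simp: is_cokernel_def Hom_iff)
  show ?thesis
    unfolding kernelp_def monop_def
  proof (intro conjI allI impI)
    show "Some k \<in> ohm Y (Cod C k)" "Some f \<in> ohm X Y" using kh f by (auto simp: ohm_iff)
    show "zerop oadd (ocomp (Some k) (Some f))"
      using zerop_Some[OF Comp_in_Hom[OF f kh]] fk by (simp add: ocomp_Some[OF kh f])
  next
    fix U z assume "z \<in> ohm (Cod C k) U" and z0: "zerop oadd (ocomp z (Some k))"
    then obtain g where g: "z = Some g" "g \<in> Hom C (Cod C k) U" by (auto simp: ohm_iff)
    note oU = Hom_Obj[OF g(2)]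
    have kg: "Comp C g k = Zer C Y U" using z0 g zerop_Some[OF Comp_in_Hom[OF kh g(2)]] by (simp add: ocomp_Some[OF g(2) kh])
    have "\<exists>!u. u \<in> Hom C (Cod C k) U \<and> Comp C u k = Zer C Y U"
      by (rule u) (use group_facts(1) oU o Comp_Zer_left[OF f oU(2)] in auto)
    then have "g = Zer C (Cod C k) U"
      using kg g Comp_Zer_left[OF kh oU(2)] group_facts(1)[OF oU] by blast
    then show "zerop oadd z" using g zerop_Some by simp
  next
    fix U x assume "x \<in> ohm Y U" and z0: "zerop oadd (ocomp x (Some f))"
    then obtain h where h: "x = Some h" "h \<in> Hom C Y U" by (auto simp: ohm_iff)
    have "Comp C h f = Zer C X U" using z0 h zerop_Some[OF Comp_in_Hom[OF f h(2)]] by (simp add: ocomp_Some[OF h(2) f])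
    then obtain v where v: "v \<in> Hom C (Cod C k) U" "Comp C v k = h" using u[OF h(2)] by blast
    then have "Some v \<in> ohm (Cod C k) U" "ocomp (Some v) (Some k) = x"
      using h by (auto simp: ohm_iff ocomp_Some[OF v(1) kh])
    then show "\<exists>z\<in>ohm (Cod C k) U. ocomp z (Some k) = x" by blast
  qed
qed

lemma is_mono_iff:
  assumes f: "f \<in> Hom C A B"
  shows "is_mono C f \<longleftrightarrow> monop ohm ocomp oadd A B (Some f)"
proof
  assume m: "is_mono C f"
  show "monop ohm ocomp oadd A B (Some f)"
    unfolding monop_def
  proof (intro conjI allI impI)
    show "Some f \<in> ohm A B" using f by (auto simp: ohm_iff)
    fix U z assume "z \<in> ohm U A" and z0: "zerop oadd (ocomp (Some f) z)"
    then obtain g where g: "z = Some g" "g \<in> Hom C U A" by (auto simp: ohm_iff)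
    note oU = Hom_Obj[OF g(2)]
    have "Comp C f g = Zer C U B" using z0 g zerop_Some[OF Comp_in_Hom[OF g(2) f]] by (simp add: ocomp_Some[OF f g(2)])
    then have "Comp C f g = Comp C f (Zer C U A)" using Comp_Zer_right[OF f oU(1)] by simp
    then have "g = Zer C U A" using m g(2) f oU group_facts(1)[OF oU] by (auto simp: is_mono_def Hom_iff)
    then show "zerop oadd z" using g zerop_Some by simp
  qed
next
  assume m: "monop ohm ocomp oadd A B (Some f)"
  have "g = h" if gh: "g \<in> Hom C X A" "h \<in> Hom C X A" "Comp C f g = Comp C f h" for X g h
  proof -
    note oX = Hom_Obj[OF gh(1)]
    let ?n = "inv\<^bsub>Hom_group C X A\<^esub> h"
    have n: "?n \<in> Hom C X A" using group_facts(3)[OF oX gh(2)] .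
    have a: "Add C g ?n \<in> Hom C X A" using group_facts(2)[OF oX gh(1) n] .
    have "Comp C f (Add C g ?n) = Comp C f (Add C h ?n)"
      using Comp_Add_right[OF gh(1) n f] Comp_Add_right[OF gh(2) n f] gh(3) by simp
    also have "\<dots> = Zer C X B" using group_facts(4)[OF oX gh(2)] Comp_Zer_right[OF f oX(1)] by simp
    finally have "zerop oadd (ocomp (Some f) (Some (Add C g ?n)))"
      using zerop_Some[OF Comp_in_Hom[OF a f]] by (simp add: ocomp_Some[OF f a])
    then have "zerop oadd (Some (Add C g ?n))" using m a unfolding monop_def ohm_iff by blast
    then have e: "Add C g ?n = Zer C X A" using zerop_Some a by blast
    have "g = Add C g (Add C h ?n)" using group_facts(4,5)[OF oX] gh by simp
    also have "\<dots> = Add C (Add C g ?n) h" using group_facts(6,7)[OF oX] gh n by simp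
    also have "\<dots> = h" using e group_facts(5,6)[OF oX] gh(2) group_facts(1)[OF oX] by simp
    finally show ?thesis .
  qed
  then show "is_mono C f" using f unfolding is_mono_def by (auto simp: Hom_iff)
qed

lemma is_epi_iff:
  assumes f: "f \<in> Hom C A B"
  shows "is_epi C f \<longleftrightarrow> monop (\<lambda>A B. ohm B A) (\<lambda>g f. ocomp f g) oadd B A (Some f)"
proof
  assume m: "is_epi C f"
  show "monop (\<lambda>A B. ohm B A) (\<lambda>g f. ocomp f g) oadd B A (Some f)"
    unfolding monop_def
  proof (intro conjI allI impI)
    show "Some f \<in> ohm A B" using f by (auto simp: ohm_iff)
    fix U z assume "z \<in> ohm B U" and z0: "zerop oadd (ocomp z (Some f))"
    then obtain g where g: "z = Some g" "g \<in> Hom C B U" by (auto simp: ohm_iff)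
    note oU = Hom_Obj[OF g(2)]
    have "Comp C g f = Zer C A U" using z0 g zerop_Some[OF Comp_in_Hom[OF f g(2)]] by (simp add: ocomp_Some[OF g(2) f])
    then have "Comp C g f = Comp C (Zer C B U) f" using Comp_Zer_left[OF f oU(2)] by simp
    then have "g = Zer C B U" using m g(2) f oU group_facts(1)[OF oU] by (auto simp: is_epi_def Hom_iff)
    then show "zerop oadd z" using g zerop_Some by simp
  qed
next
  assume m: "monop (\<lambda>A B. ohm B A) (\<lambda>g f. ocomp f g) oadd B A (Some f)"
  have "g = h" if gh: "g \<in> Hom C B X" "h \<in> Hom C B X" "Comp C g f = Comp C h f" for X g h
  proof -
    note oX = Hom_Obj[OF gh(1)]
    let ?n = "inv\<^bsub>Hom_group C B X\<^esub> h"
    have n: "?n \<in> Hom C B X" using group_facts(3)[OF oX gh(2)] .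
    have a: "Add C g ?n \<in> Hom C B X" using group_facts(2)[OF oX gh(1) n] .
    have "Comp C (Add C g ?n) f = Comp C (Add C h ?n) f"
      using Comp_Add_left[OF gh(1) n f] Comp_Add_left[OF gh(2) n f] gh(3) by simp
    also have "\<dots> = Zer C A X" using group_facts(4)[OF oX gh(2)] Comp_Zer_left[OF f oX(2)] by simp
    finally have "zerop oadd (ocomp (Some (Add C g ?n)) (Some f))"
      using zerop_Some[OF Comp_in_Hom[OF f a]] by (simp add: ocomp_Some[OF a f])
    then have "zerop oadd (Some (Add C g ?n))" using m a unfolding monop_def ohm_iff by blast
    then have e: "Add C g ?n = Zer C B X" using zerop_Some a by blast
    have "g = Add C g (Add C h ?n)" using group_facts(4,5)[OF oX] gh by simp
    also have "\<dots> = Add C (Add C g ?n) h" using group_facts(6,7)[OF oX] gh n by simp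
    also have "\<dots> = h" using e group_facts(5,6)[OF oX] gh(2) group_facts(1)[OF oX] by simp
    finally show ?thesis .
  qed
  then show "is_epi C f" using f unfolding is_epi_def by (auto simp: Hom_iff)
qed

lemma lifted: "ab_cat (Obj C) ohm ocomp (\<lambda>A. Some (Idt C A)) oadd oneg (\<lambda>A B. Some (Zer C A B))"
proof
  show "f \<in> ohm A B \<Longrightarrow> A \<in> Obj C \<and> B \<in> Obj C" for f A B using Hom_Obj by (auto simp: ohm_iff)
  show "f \<in> ohm A B \<Longrightarrow> g \<in> ohm B D \<Longrightarrow> ocomp g f \<in> ohm A D" for f g A B D
    using Comp_in_Hom by (auto simp: ohm_iff ocomp_Some)
  show "ocomp (ocomp h g) f = ocomp h (ocomp g f)" for f g h
    using Comp_assoc[of f "Dom C f" "Cod C f" g "Cod C g" h "Cod C h" for f g h]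
    by (auto simp: ocomp_def Comp_Arr Hom_iff split: option.splits)
  show "A \<in> Obj C \<Longrightarrow> Some (Idt C A) \<in> ohm A A" for A using Idt_in_Hom by (auto simp: ohm_iff)
  show "f \<in> ohm A B \<Longrightarrow> ocomp (Some (Idt C B)) f = f" for f A B
    using Comp_Idt_left Idt_in_Hom Hom_Obj by (auto simp: ohm_iff) (metis ocomp_Some)
  show "f \<in> ohm A B \<Longrightarrow> ocomp f (Some (Idt C A)) = f" for f A B
    using Comp_Idt_right Idt_in_Hom Hom_Obj by (auto simp: ohm_iff) (metis ocomp_Some)
  show "f \<in> ohm A B \<Longrightarrow> g \<in> ohm A B \<Longrightarrow> oadd f g \<in> ohm A B" for f g A B
    using group_facts(2) Hom_Obj by (auto simp: ohm_iff oadd_Some)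
  show neg: "f \<in> ohm A B \<Longrightarrow> oneg f \<in> ohm A B" for f A B
    using neg_Arr by (auto simp: ohm_iff oneg_def Hom_iff)
  show "A \<in> Obj C \<Longrightarrow> B \<in> Obj C \<Longrightarrow> Some (Zer C A B) \<in> ohm A B" for A B using group_facts(1) by (auto simp: ohm_iff)
  show "oadd (oadd f g) h = oadd f (oadd g h)" for f g h
    using group_facts(7)[of "Dom C f" "Cod C f" f g h for f g h] ends_in_Obj
    by (auto simp: oadd_def Add_Arr Hom_iff split: option.splits)
  show "oadd f g = oadd g f" for f g
    using group_facts(6)[of "Dom C f" "Cod C f" f g for f g] ends_in_Obj
    by (auto simp: oadd_def Hom_iff split: option.splits)
  show "A \<in> Obj C \<Longrightarrow> B \<in> Obj C \<Longrightarrow> zerop oadd (Some (Zer C A B))" for A B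
    using zerop_Some group_facts(1) by blast
  show "f \<in> ohm A B \<Longrightarrow> z \<in> ohm A B \<Longrightarrow> zerop oadd z \<Longrightarrow> oadd f z = f" for f z A B
    using zerop_Some group_facts(5) Hom_Obj by (auto simp: ohm_iff oadd_Some)
  show "zerop oadd (oadd f (oneg f))" for f
  proof (cases "\<exists>g\<in>Arr C. f = Some g")
    case True
    then obtain g where g: "f = Some g" "g \<in> Arr C" by blast
    let ?A = "Dom C g" and ?B = "Cod C g"
    have h: "g \<in> Hom C ?A ?B" using g Arr_Hom by blast
    have o: "?A \<in> Obj C" "?B \<in> Obj C" using Hom_Obj h by blast+
    have "oadd f (oneg f) = Some (Zer C ?A ?B)"
      using g group_facts(3,4)[OF o h] oadd_Some[OF h] by (simp add: oneg_def)
    then show ?thesis using zerop_Some group_facts(1)[OF o] by simp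
  qed (auto simp: oadd_def oneg_def zerop_def split: option.splits)
  show "ocomp h (oadd f g) = oadd (ocomp h f) (ocomp h g)" for f g h
    using Comp_Add_right[of f "Dom C f" "Cod C f" g h "Cod C h" for f g h]
    by (auto simp: ocomp_def oadd_def Comp_Arr Add_Arr Hom_iff split: option.splits)
  show "ocomp (oadd f g) h = oadd (ocomp f h) (ocomp g h)" for f g h
    using Comp_Add_left[of f "Dom C f" "Cod C f" g h "Dom C h" for f g h]
    by (auto simp: ocomp_def oadd_def Comp_Arr Add_Arr Hom_iff split: option.splits)
  show "ocomp h (oneg f) = oneg (ocomp h f)" for f h
    using Comp_neg_right[of f "Dom C f" "Cod C f" h "Cod C h" for f h]
    by (auto simp: ocomp_def oneg_def Comp_Arr neg_Arr Hom_iff split: option.splits)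
  show "ocomp (oneg f) h = oneg (ocomp f h)" for f h
    using Comp_neg_left[of h "Dom C h" "Cod C h" f "Cod C f" for f h]
    by (auto simp: ocomp_def oneg_def Comp_Arr neg_Arr Hom_iff split: option.splits)
  show "\<exists>N\<in>Obj C. zerop oadd (Some (Idt C N))"
  proof -
    obtain N where N: "is_zero_object C N" using ex_zero_object by blast
    then have "N \<in> Obj C" "Idt C N = Zer C N N"
      using Idt_in_Hom group_facts(1)[of N N] unfolding is_zero_object_def by blast+
    then show ?thesis using zerop_Some group_facts(1) by metis
  qed
  show "\<exists>S i1 i2 p1 p2. i1 \<in> ohm A S \<and> i2 \<in> ohm B S \<and>
      p1 \<in> ohm S A \<and> p2 \<in> ohm S B \<and> ocomp p1 i1 = Some (Idt C A) \<and> ocomp p2 i2 = Some (Idt C B) \<and>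
      zerop oadd (ocomp p2 i1) \<and> zerop oadd (ocomp p1 i2) \<and> oadd (ocomp i1 p1) (ocomp i2 p2) = Some (Idt C S)"
    if o: "A \<in> Obj C" "B \<in> Obj C" for A B
  proof -
    obtain S where "is_biproduct C A B S" using ex_biproduct[OF o] by blast
    then obtain i1 i2 p1 p2 where b: "i1 \<in> Hom C A S" "i2 \<in> Hom C B S" "p1 \<in> Hom C S A" "p2 \<in> Hom C S B"
      "Comp C p1 i1 = Idt C A" "Comp C p2 i2 = Idt C B" "Comp C p2 i1 = Zer C A B" "Comp C p1 i2 = Zer C B A"
      "Add C (Comp C i1 p1) (Comp C i2 p2) = Idt C S" unfolding is_biproduct_def by blast
    have "zerop oadd (Some (Zer C A B))" "zerop oadd (Some (Zer C B A))" using zerop_Some group_facts(1) o by blast+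
    then show ?thesis using b
      by (intro exI[of _ S] exI[of _ "Some i1"] exI[of _ "Some i2"] exI[of _ "Some p1"] exI[of _ "Some p2"])
        (simp add: ohm_iff ocomp_Some[OF b(3,1)] ocomp_Some[OF b(4,2)] ocomp_Some[OF b(4,1)] ocomp_Some[OF b(3,2)]
          ocomp_Some[OF b(1,3)] ocomp_Some[OF b(2,4)] oadd_Some[OF Comp_in_Hom[OF b(3,1)] Comp_in_Hom[OF b(4,2)]])
  qed
  show "f \<in> ohm X Y \<Longrightarrow> \<exists>K k. kernelp ohm ocomp oadd K X Y k f" for f X Y
    using ex_kernel kernel_lift by (fastforce simp: ohm_iff Hom_iff)
  show "f \<in> ohm X Y \<Longrightarrow> \<exists>K k. kernelp (\<lambda>A B. ohm B A) (\<lambda>g f. ocomp f g) oadd K Y X k f" for f X Y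
    using ex_cokernel cokernel_lift by (fastforce simp: ohm_iff Hom_iff)
  show "\<exists>Y g. kernelp ohm ocomp oadd A B Y f g" if m: "monop ohm ocomp oadd A B f" for A B f
  proof -
    obtain f' where f: "f = Some f'" "f' \<in> Hom C A B" using m by (auto simp: monop_def ohm_iff)
    then obtain g where g: "is_kernel C g f'" using mono_is_kernel is_mono_iff m by blast
    then have "g \<in> Hom C B (Cod C g)" "Dom C f' = A" using f(2) by (auto simp: is_kernel_def Hom_iff)
    then show ?thesis using kernel_lift[OF g] f(1) by blast
  qed
  show "\<exists>Y g. kernelp (\<lambda>A B. ohm B A) (\<lambda>g f. ocomp f g) oadd A B Y f g"
    if m: "monop (\<lambda>A B. ohm B A) (\<lambda>g f. ocomp f g) oadd A B f" for A B f
  proof -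
    obtain f' where f: "f = Some f'" "f' \<in> Hom C B A" using m by (auto simp: monop_def ohm_iff)
    then obtain g where g: "is_cokernel C g f'" using epi_is_cokernel is_epi_iff m by blast
    then have "g \<in> Hom C (Dom C g) B" "Cod C f' = A" using f(2) by (auto simp: is_cokernel_def Hom_iff)
    then show ?thesis using cokernel_lift[OF g] f(1) by blast
  qed
qed

end

sublocale abelian_category \<subseteq> L: ab_cat "Obj C" ohm ocomp "\<lambda>A. Some (Idt C A)" oadd oneg "\<lambda>A B. Some (Zer C A B)"
  by (rule lifted)

context abelian_category
begin

lemma L_ses_SomeE:
  assumes "L.ses A B X f g"
  obtains i p where "f = Some i" "g = Some p" "i \<in> Hom C B X" "p \<in> Hom C X A"
  using L.sesD(4,5)[OF assms] by (auto simp: ohm_iff)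

lemma ses_kernel:
  assumes s: "L.ses A B X (Some i) (Some p)" and h: "i \<in> Hom C B X" "p \<in> Hom C X A"
  shows "is_kernel C p i"
proof -
  note s' = L.sesD[OF s]
  have "\<exists>!u. u \<in> Hom C U B \<and> Comp C i u = x" if x: "x \<in> Hom C U X" "Comp C p x = Zer C U A" for U x
  proof -
    have "Some x \<in> ohm U X" "zerop oadd (ocomp (Some p) (Some x))"
      using x zerop_Some[OF Comp_in_Hom[OF x(1) h(2)]] by (auto simp: ohm_iff ocomp_Some[OF h(2)])
    then obtain z where "z \<in> ohm U B" "ocomp (Some i) z = Some x" using s'(6) by blast
    then obtain u where u: "u \<in> Hom C U B" "Comp C i u = x" using ocomp_Some[OF h(1)] by (auto simp: ohm_iff)
    have "v = u" if v: "v \<in> Hom C U B" "Comp C i v = x" for v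
      using is_mono_iff[OF h(1)] s'(1) u v h Hom_Obj[OF v(1)] by (auto simp: is_mono_def Hom_iff)
    then show ?thesis using u by blast
  qed
  moreover have "Comp C p i = Zer C B A"
    using s'(3) zerop_Some[OF Comp_in_Hom[OF h]] by (simp add: ocomp_Some[OF h(2,1)])
  moreover have "Dom C i = B" "Cod C i = X" "Dom C p = X" "Cod C p = A" "i \<in> Arr C" "p \<in> Arr C"
    using h by (auto simp: Hom_iff)
  ultimately show ?thesis by (simp add: is_kernel_def)
qed

lemma exact_atE:
  assumes e: "exact_at C f g"
  obtains K e k where "e \<in> Hom C (Dom C f) K" "k \<in> Hom C K (Cod C f)" "L.epi (Dom C f) K (Some e)"
    "L.mono K (Cod C f) (Some k)" "f = Comp C k e" "is_kernel C g k"
    "L.kernel K (Cod C f) (Cod C g) (Some k) (Some g)" 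
proof -
  from e obtain e k where ek: "is_epi C e" "is_kernel C g k" "Dom C e = Dom C f" "Cod C e = Dom C k"
    "f = Comp C k e" "f \<in> Arr C" "g \<in> Arr C" "Cod C f = Dom C g" unfolding exact_at_def by blast
  have h: "e \<in> Hom C (Dom C f) (Dom C k)" "k \<in> Hom C (Dom C k) (Cod C f)" "g \<in> Hom C (Cod C f) (Cod C g)"
    using ek by (auto simp: is_epi_def is_kernel_def Hom_iff)
  have k: "L.kernel (Dom C k) (Cod C f) (Cod C g) (Some k) (Some g)" using kernel_lift[OF ek(2) h(3)] .
  show thesis
    using that[OF h(1,2) _ _ ek(5,2) k] is_epi_iff[OF h(1)] ek(1) L.kernelD(1)[OF k] by simp
qed

text \<open>In \<open>short_exact\<close> the kernel of \<open>p\<close> is known only as the target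
  of an epimorphism from \<open>B\<close>. That epimorphism is also mono, because \<open>i\<close>
  is, hence invertible, and so \<open>i\<close> itself is a kernel.\<close>

lemma ses_iff: "L.ses A B X (Some i) (Some p) \<longleftrightarrow> (i, p) \<in> short_exact C A B X"
proof
  assume s: "L.ses A B X (Some i) (Some p)"
  then have h: "i \<in> Hom C B X" "p \<in> Hom C X A" by (auto elim: L_ses_SomeE)
  note s' = L.sesD[OF s] and o = Hom_Obj[OF h(1)]
  have "is_epi C (Idt C B)" using is_epi_iff[OF Idt_in_Hom[OF o(1)]] L.epi_idn o by simp
  then have "exact_at C i p"
    unfolding exact_at_def using ses_kernel[OF s h] h Idt_in_Hom[OF o(1)] Comp_Idt_right[OF h(1)]
    by (intro conjI exI[of _ "Idt C B"] exI[of _ i]) (auto simp: Hom_iff)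
  then show "(i, p) \<in> short_exact C A B X"
    using h s'(1,2) is_mono_iff[OF h(1)] is_epi_iff[OF h(2)] by (simp add: short_exact_def)
next
  assume "(i, p) \<in> short_exact C A B X"
  then have h: "i \<in> Hom C B X" "p \<in> Hom C X A" and m: "L.mono B X (Some i)" "L.epi X A (Some p)"
    and e: "exact_at C i p" using is_mono_iff is_epi_iff by (auto simp: short_exact_def)
  have d: "Dom C i = B" "Cod C i = X" "Cod C p = A" using h by (auto simp: Hom_iff)
  obtain K q k where k: "q \<in> Hom C B K" "k \<in> Hom C K X" "L.epi B K (Some q)" "L.mono K X (Some k)"
    "i = Comp C k q" "L.kernel K X A (Some k) (Some p)" using exact_atE[OF e] d by metis
  note k' = L.kernelD[OF k(6)]
  have i: "Some i = ocomp (Some k) (Some q)" using k ocomp_Some by simp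
  have "L.mono B K (Some q)" using L.mono_left[of B X "Some k" "Some q" K] m(1) i k(1) by (simp add: ohm_iff)
  then obtain r where r: "(Some q, r) \<in> L.isop B K" using L.mono_epi_isop k(3) by blast
  show "L.ses A B X (Some i) (Some p)"
  proof (rule L.sesI[OF m])
    show "zerop oadd (ocomp (Some p) (Some i))" using k'(4) i L.assoc L.Z_right by metis
    fix U x assume "x \<in> ohm U X" "zerop oadd (ocomp (Some p) x)"
    then obtain z where z: "z \<in> ohm U K" "ocomp (Some k) z = x" using k'(5) by blast
    have "ocomp (Some i) (ocomp r z) = x"
      unfolding i using z L.isopD[OF r] by (simp add: L.assoc L.ra[OF L.isopD(4)[OF r]] L.idn_left)
    then show "\<exists>z\<in>ohm U B. ocomp (Some i) z = x" using L.comp_hom[OF z(1) L.isopD(2)[OF r]] by blast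
  qed
qed

lemma isop_iff: "(f, g) \<in> L.isop A B \<longleftrightarrow> (\<exists>h\<in>Hom C A B. \<exists>k\<in>Hom C B A. f = Some h \<and> g = Some k \<and>
    Comp C k h = Idt C A \<and> Comp C h k = Idt C B)"
  by (auto simp: L.isop_def ohm_iff ocomp_Some)

lemma isos_iff: "h \<in> isos C A B \<longleftrightarrow> (\<exists>k. (Some h, k) \<in> L.isop A B)"
  by (auto simp: isos_def isop_iff)

lemma isop_fst: "(f, g) \<in> L.isop A B \<Longrightarrow> \<exists>h\<in>isos C A B. f = Some h"
  by (auto simp: isop_iff isos_def)

lemma card_isop: "card (L.isop A B) = card (isos C A B)"
proof (rule bij_betw_same_card[of "\<lambda>x. the (fst x)"])
  show "bij_betw (\<lambda>x. the (fst x)) (L.isop A B) (isos C A B)"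
    unfolding bij_betw_def
  proof
    show "inj_on (\<lambda>x. the (fst x)) (L.isop A B)"
    proof (rule inj_onI)
      fix x y assume xy: "x \<in> L.isop A B" "y \<in> L.isop A B" "the (fst x) = the (fst y)"
      then have "fst x = fst y" by (cases x; cases y) (auto dest!: isop_fst)
      then show "x = y" using xy L.isop_unique by (cases x; cases y) auto
    qed
    show "(\<lambda>x. the (fst x)) ` L.isop A B = isos C A B"
    proof (intro equalityI subsetI)
      fix h assume "h \<in> isos C A B"
      then obtain k where "(Some h, k) \<in> L.isop A B" using isos_iff by blast
      then show "h \<in> (\<lambda>x. the (fst x)) ` L.isop A B" by (rule rev_image_eqI) simp
    qed (auto dest!: isop_fst)
  qed
qed

lemma isos_nonempty: "isos C A B \<noteq> {} \<longleftrightarrow> L.isop A B \<noteq> {}"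
proof
  assume "isos C A B \<noteq> {}"
  then obtain h where "h \<in> isos C A B" by blast
  then obtain k where "(Some h, k) \<in> L.isop A B" unfolding isos_iff ..
  then show "L.isop A B \<noteq> {}" by blast
next
  assume "L.isop A B \<noteq> {}"
  then obtain f g where "(f, g) \<in> L.isop A B" by fast
  from isop_fst[OF this] show "isos C A B \<noteq> {}" by blast
qed

lemma short_exact_image: "(\<lambda>(i, p). (Some i, Some p)) ` short_exact C A B X = {(i, p). L.ses A B X i p}"
proof (intro equalityI subsetI)
  fix z assume "z \<in> {(i, p). L.ses A B X i p}"
  then obtain f g where z: "z = (f, g)" "L.ses A B X f g" by auto
  from L_ses_SomeE[OF z(2)] obtain i p where "f = Some i" "g = Some p" by metis
  then show "z \<in> (\<lambda>(i, p). (Some i, Some p)) ` short_exact C A B X"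
    using z ses_iff[of A B X i p] by (intro image_eqI[of _ _ "(i, p)"]) auto
qed (use ses_iff in auto)

lemma card_short_exact: "card (short_exact C A B X) = card {(i, p). L.ses A B X i p}"
  unfolding short_exact_image[symmetric] by (rule card_image[symmetric]) (auto simp: inj_on_def)

lemma short_exact_nonempty: "short_exact C A B X \<noteq> {} \<longleftrightarrow> (\<exists>i p. L.ses A B X i p)"
  using short_exact_image[of A B X] by (metis (no_types, lifting) Collect_empty_eq case_prodE case_prodI2' image_is_empty prod.case)

section \<open>Yoneda extensions in degrees one and two\<close>

lemma extensions_1: "fs \<in> extensions C 1 M N \<longleftrightarrow>
   (\<exists>X i p. fs = [i, p] \<and> i \<in> Hom C N X \<and> p \<in> Hom C X M \<and> L.ses M N X (Some i) (Some p))"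
proof
  assume "fs \<in> extensions C 1 M N"
  then have fs: "length fs = 2" "set fs \<subseteq> Arr C" "Dom C (fs ! 0) = N" "Cod C (fs ! 1) = M"
    "is_mono C (fs ! 0)" "is_epi C (fs ! 1)" "exact_at C (fs ! 0) (fs ! 1)"
    by (auto simp: extensions_def)
  then obtain i p where ip: "fs = [i, p]"
    by (metis One_nat_def Suc_1 length_0_conv length_Suc_conv)
  have "(i, p) \<in> short_exact C M N (Cod C i)"
    using fs by (auto simp: ip short_exact_def Hom_iff exact_at_def)
  then show "\<exists>X i p. fs = [i, p] \<and> i \<in> Hom C N X \<and> p \<in> Hom C X M \<and> L.ses M N X (Some i) (Some p)"
    using ip ses_iff by (auto simp: short_exact_def)
next
  assume "\<exists>X i p. fs = [i, p] \<and> i \<in> Hom C N X \<and> p \<in> Hom C X M \<and> L.ses M N X (Some i) (Some p)"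
  then obtain X i p where f: "fs = [i, p]" "i \<in> Hom C N X" "p \<in> Hom C X M" "(i, p) \<in> short_exact C M N X"
    using ses_iff by blast
  then show "fs \<in> extensions C 1 M N" by (auto simp: extensions_def short_exact_def Hom_iff)
qed

lemma extension_maps_1:
  "([i, p], [i', p']) \<in> extension_maps C 1 M N \<longleftrightarrow>
    ((Cod C i, Some i, Some p), (Cod C i', Some i', Some p')) \<in>
      {((F, i, p), (F', i', p')). L.ses M N F i p \<and> L.ses M N F' i' p' \<and>
         (\<exists>h\<in>ohm F F'. ocomp h i = i' \<and> ocomp p' h = p)}" (is "?l \<longleftrightarrow> ?r")
proof
  assume ?l
  then obtain h where e: "[i, p] \<in> extensions C 1 M N" "[i', p'] \<in> extensions C 1 M N"
    and h: "h 0 = Idt C N" "h (Suc 1) = Idt C M" "\<And>j. j \<le> 1 \<Longrightarrow> h j \<in> Hom C (Dom C ([i, p] ! j)) (Dom C ([i', p'] ! j))"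
    "\<And>j. j \<le> 1 \<Longrightarrow> Comp C (h (Suc j)) ([i, p] ! j) = Comp C ([i', p'] ! j) (h j)"
    by (auto simp: extension_maps_def)
  obtain X X' where x: "i \<in> Hom C N X" "p \<in> Hom C X M" "L.ses M N X (Some i) (Some p)"
    "i' \<in> Hom C N X'" "p' \<in> Hom C X' M" "L.ses M N X' (Some i') (Some p')" using e unfolding extensions_1 by auto
  then have d: "Cod C i = X" "Cod C i' = X'" "Dom C p = X" "Dom C p' = X'" by (auto simp: Hom_iff)
  have h1: "h 1 \<in> Hom C X X'" using h(3)[of 1] d by simp
  have "Comp C (h 1) i = i'" using h(4)[of 0] h(1) Comp_Idt_right[OF x(4)] by simp
  moreover have "Comp C p' (h 1) = p" using h(4)[of 1] h(2) Comp_Idt_left[OF x(2)] by simp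
  ultimately show ?r using x d h1 ocomp_Some[OF h1 x(1)] ocomp_Some[OF x(5) h1] by (auto simp: ohm_iff)
next
  assume ?r
  then obtain h where x: "L.ses M N (Cod C i) (Some i) (Some p)" "L.ses M N (Cod C i') (Some i') (Some p')"
    "h \<in> Hom C (Cod C i) (Cod C i')" "ocomp (Some h) (Some i) = Some i'" "ocomp (Some p') (Some h) = Some p"
    by (auto simp: ohm_iff)
  have y: "i \<in> Hom C N (Cod C i)" "p \<in> Hom C (Cod C i) M" "i' \<in> Hom C N (Cod C i')" "p' \<in> Hom C (Cod C i') M"
    using x(1,2) by (auto elim: L_ses_SomeE)
  have e: "[i, p] \<in> extensions C 1 M N" "[i', p'] \<in> extensions C 1 M N" unfolding extensions_1 using x y by auto
  have c: "Comp C h i = i'" "Comp C p' h = p" using x(3-5) y ocomp_Some by fastforce+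
  have d: "Dom C i = N" "Dom C i' = N" "Dom C p = Cod C i" "Dom C p' = Cod C i'" using y by (auto simp: Hom_iff)
  have o: "N \<in> Obj C" "M \<in> Obj C" using Hom_Obj y by blast+
  \<comment> \<open>A map of 1-extensions has identities in positions 0 and 2, so its only free
    component is in position 1.\<close>
  let ?h = "\<lambda>j::nat. if j = 0 then Idt C N else if j = 1 then h else Idt C M"
  have "\<forall>j\<le>1. ?h j \<in> Hom C (Dom C ([i, p] ! j)) (Dom C ([i', p'] ! j))"
    using x(3) d Idt_in_Hom o by (auto simp: le_Suc_eq)
  moreover have "\<forall>j\<le>1. Comp C (?h (Suc j)) ([i, p] ! j) = Comp C ([i', p'] ! j) (?h j)"
    using c y Comp_Idt_left Comp_Idt_right by (auto simp: le_Suc_eq)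
  ultimately show ?l unfolding extension_maps_def using e
    by (auto intro!: exI[of _ ?h])
qed

end

lemma equiv_sym_rtrancl:
  assumes "equiv E m" "x \<in> E"
  shows "(m \<union> m\<inverse>)\<^sup>* `` {x} = m `` {x}"
proof -
  have s: "m\<inverse> = m" using assms(1) by (simp add: equiv_def sym_conv_converse_eq)
  have t: "(x, y) \<in> m" if "(x, y) \<in> m\<^sup>*" for y
    using that
  proof (induction rule: rtrancl_induct)
    case base
    then show ?case using assms by (simp add: equiv_def refl_on_def)
  next
    case (step y z)
    then show ?case using assms(1) unfolding equiv_def trans_def by blast
  qed
  show ?thesis unfolding s Un_absorb using t by auto
qed

lemma card_quotient_bij:
  assumes f: "bij_betw f E S" and s: "equiv S s"
    and m: "\<And>x y. (x, y) \<in> m \<longleftrightarrow> x \<in> E \<and> y \<in> E \<and> (f x, f y) \<in> s"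
  shows "equiv E m" and "card (E // m) = card (S // s)"
proof -
  have fE: "f x \<in> S" if "x \<in> E" for x using f that by (auto simp: bij_betw_def)
  show "equiv E m"
  proof (rule equivI)
    show "m \<subseteq> E \<times> E" using m by auto
    show "refl_on E m" using m s fE by (auto simp: refl_on_def equiv_def)
    show "sym m" using m s by (auto simp: sym_def equiv_def)
    show "trans m" using m s unfolding trans_def equiv_def by blast
  qed
  have im: "f ` (m `` {x}) = s `` {f x}" if x: "x \<in> E" for x
  proof (intro equalityI subsetI)
    fix z assume "z \<in> f ` (m `` {x})"
    then show "z \<in> s `` {f x}" using m by auto
  next
    fix z assume z: "z \<in> s `` {f x}"
    then have "z \<in> S" using s by (auto simp: equiv_def)
    then obtain y where "y \<in> E" "f y = z" using f by (auto simp: bij_betw_def)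
    then show "z \<in> f ` (m `` {x})" using m x z by auto
  qed
  have "bij_betw ((`) f) (E // m) (S // s)"
    unfolding bij_betw_def
  proof
    have "E // m \<subseteq> Pow E" using m by (auto simp: quotient_def)
    then show "inj_on ((`) f) (E // m)" using inj_on_image_Pow[of f E] f inj_on_subset by (metis bij_betw_def)
    show "(`) f ` (E // m) = S // s"
    proof -
      have "(`) f ` (E // m) = (\<lambda>x. f ` (m `` {x})) ` E" by (auto simp: quotient_def)
      also have "\<dots> = (\<lambda>x. s `` {f x}) ` E" using im by simp
      also have "\<dots> = (\<lambda>y. s `` {y}) ` (f ` E)" by (simp add: image_image)
      also have "\<dots> = S // s" using f by (auto simp: bij_betw_def quotient_def)
      finally show ?thesis .
    qed
  qed
  then show "card (E // m) = card (S // s)" by (rule bij_betw_same_card)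
qed

context abelian_category
begin

lemma card_Ext1: "card (Ext C 1 M N) = card (L.ext_seqs M N // L.ext_rel M N)"
proof -
  \<comment> \<open>A list of arrows determines its middle object as the codomain of the first
    arrow.\<close>
  let ?f = "\<lambda>fs. (Cod C (fs ! 0), Some (fs ! 0), Some (fs ! 1))"
  let ?E = "extensions C 1 M N" and ?m = "extension_maps C 1 M N"
  have E: "\<exists>i p. fs = [i, p] \<and> L.ses M N (Cod C i) (Some i) (Some p)" if "fs \<in> ?E" for fs
    using that unfolding extensions_1 by (auto simp: Hom_iff)
  have bij: "bij_betw ?f ?E (L.ext_seqs M N)"
    unfolding bij_betw_def
  proof
    show "inj_on ?f ?E"
    proof (rule inj_onI)
      fix x y assume xy: "x \<in> ?E" "y \<in> ?E" "?f x = ?f y"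
      obtain i p i' p' where "x = [i, p]" "y = [i', p']" using E[OF xy(1)] E[OF xy(2)] by blast
      then show "x = y" using xy(3) by simp
    qed
    show "?f ` ?E = L.ext_seqs M N"
    proof (intro equalityI subsetI)
      fix z assume "z \<in> ?f ` ?E"
      then obtain fs where fs: "fs \<in> ?E" "z = ?f fs" by blast
      obtain i p where "fs = [i, p]" "L.ses M N (Cod C i) (Some i) (Some p)" using E[OF fs(1)] by blast
      then show "z \<in> L.ext_seqs M N" using fs by (simp add: L.ext_seqs_def)
    next
      fix z assume "z \<in> L.ext_seqs M N"
      then obtain X f g where z: "z = (X, f, g)" "L.ses M N X f g" by (auto simp: L.ext_seqs_def)
      from L_ses_SomeE[OF z(2)] obtain i p where ip: "f = Some i" "g = Some p" "i \<in> Hom C N X" "p \<in> Hom C X M" by metis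
      then have "[i, p] \<in> ?E" unfolding extensions_1 using z by blast
      moreover have "z = ?f [i, p]" using z ip by (simp add: Hom_iff)
      ultimately show "z \<in> ?f ` ?E" by blast
    qed
  qed
  have m: "(x, y) \<in> ?m \<longleftrightarrow> x \<in> ?E \<and> y \<in> ?E \<and> (?f x, ?f y) \<in> L.ext_rel M N" for x y
  proof (cases "x \<in> ?E \<and> y \<in> ?E")
    case True
    then obtain i p i' p' where "x = [i, p]" "y = [i', p']" using E by meson
    then show ?thesis using True extension_maps_1[of i p i' p' M N] by (simp add: L.ext_rel_def)
  qed (auto simp: extension_maps_def)
  note q = card_quotient_bij[OF bij L.equiv_ext_rel m]
  have "Ext C 1 M N = ?E // ?m"
    unfolding Ext_def quotient_def using equiv_sym_rtrancl[OF q(1)] by auto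
  then show ?thesis using q(2) by simp
qed

text \<open>A list \<open>[d, c, q]\<close> is a sequence from \<open>N\<close> over
  \<open>S\<close> and \<open>T\<close> to \<open>M\<close>, so \<open>fs ! 1\<close> is the middle
  arrow. This is the invariant used to exploit the vanishing of Ext^2: it holds for the trivial
  extension and is constant along maps of extensions.\<close>

definition fillable where
  "fillable fs \<longleftrightarrow> (\<exists>E. L.fillings (Cod C (fs ! 2)) (Dom C (fs ! 1)) (Cod C (fs ! 1)) (Some (fs ! 1)) (Some (fs ! 2)) E \<noteq> {})"

text \<open>Exactness at the two inner places hands over the image \<open>I\<close> of the middle
  arrow, at which the sequence splits into two short ones.\<close>

lemma extensions_2E:
  assumes "fs \<in> extensions C 2 M N"
  obtains S T d c q I \<gamma> \<iota> where "fs = [d, c, q]" "d \<in> Hom C N S" "c \<in> Hom C S T" "q \<in> Hom C T M"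
    "L.ses I N S (Some d) \<gamma>" "L.ses M I T \<iota> (Some q)" "Some c = ocomp \<iota> \<gamma>"
proof -
  from assms have fs: "length fs = 3" "set fs \<subseteq> Arr C" "Dom C (fs ! 0) = N" "Cod C (fs ! 2) = M"
    "is_mono C (fs ! 0)" "is_epi C (fs ! 2)" "exact_at C (fs ! 0) (fs ! 1)" "exact_at C (fs ! 1) (fs ! 2)"
    by (auto simp: extensions_def numeral_2_eq_2 less_Suc_eq)
  then obtain d c q where l: "fs = [d, c, q]"
    by (auto simp: numeral_3_eq_3 length_Suc_conv)
  define S where "S = Cod C d"
  define T where "T = Cod C c"
  have h: "d \<in> Hom C N S" "c \<in> Hom C S T" "q \<in> Hom C T M"
    using fs by (auto simp: l Hom_iff exact_at_def S_def T_def)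
  then have D: "Dom C d = N" "Cod C d = S" "Dom C c = S" "Cod C c = T" "Cod C q = M" by (auto simp: Hom_iff)
  have m: "L.mono N S (Some d)" "L.epi T M (Some q)" using fs is_mono_iff[OF h(1)] is_epi_iff[OF h(3)] by (auto simp: l)
  have ex: "exact_at C d c" "exact_at C c q" using fs by (simp_all add: l numeral_2_eq_2)
  obtain K e k where k: "e \<in> Hom C N K" "k \<in> Hom C K S" "L.epi N K (Some e)" "d = Comp C k e"
    "L.kernel K S T (Some k) (Some c)" using exact_atE[OF ex(1), unfolded D] by metis
  obtain I g j where j: "g \<in> Hom C S I" "j \<in> Hom C I T" "L.epi S I (Some g)" "L.mono I T (Some j)" "c = Comp C j g"
    "L.kernel I T M (Some j) (Some q)" using exact_atE[OF ex(2), unfolded D] by metis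
  note k' = L.kernelD[OF k(5)] and j' = L.kernelD[OF j(6)]
  have c: "Some c = ocomp (Some j) (Some g)" using j ocomp_Some by simp
  have d: "Some d = ocomp (Some k) (Some e)" using k ocomp_Some by simp
  have "L.mono N K (Some e)" using L.mono_left[of N S "Some k" "Some e" K] m(1) d k(1) by (simp add: ohm_iff)
  then obtain r where r: "(Some e, r) \<in> L.isop N K" using L.mono_epi_isop k(3) by blast
  have s1: "L.ses M I T (Some j) (Some q)" by (rule L.sesI[OF j(4) m(2) j'(4,5)])
  have s2: "L.ses I N S (Some d) (Some g)"
  proof (rule L.sesI[OF m(1) j(3)])
    have "L.Z (ocomp (Some j) (ocomp (Some g) (Some d)))" using k'(4) c d L.assoc L.Z_right by metis
    then show "L.Z (ocomp (Some g) (Some d))"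
      using L.monoD[OF j(4) L.comp_hom] h(1) j(1) by (auto simp: ohm_iff)
    fix U x assume x: "x \<in> ohm U S" "L.Z (ocomp (Some g) x)"
    then have "L.Z (ocomp (Some c) x)" using c L.assoc L.Z_left by metis
    then obtain z where z: "z \<in> ohm U K" "ocomp (Some k) z = x" using k'(5) x by blast
    have "ocomp (Some d) (ocomp r z) = x"
      unfolding d using z L.isopD[OF r] by (simp add: L.assoc L.ra[OF L.isopD(4)[OF r]] L.idn_left)
    then show "\<exists>z\<in>ohm U N. ocomp (Some d) z = x" using L.comp_hom[OF z(1) L.isopD(2)[OF r]] by blast
  qed
  show thesis using that[OF l h s2 s1 c] .
qed

text \<open>Along the map the filling is pushed out. Against it, the filling is first read as an
  extension of \<open>T'\<close> by \<open>N\<close> and then pulled back, which is the push-forward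
  in the opposite category.\<close>

lemma fillable_maps:
  assumes "(fs, gs) \<in> extension_maps C 2 M N"
  shows "fillable fs \<longleftrightarrow> fillable gs"
proof -
  obtain h where e: "fs \<in> extensions C 2 M N" "gs \<in> extensions C 2 M N"
    and h: "h 0 = Idt C N" "h (Suc 2) = Idt C M" "\<And>j. j \<le> 2 \<Longrightarrow> h j \<in> Hom C (Dom C (fs ! j)) (Dom C (gs ! j))"
    "\<And>j. j \<le> 2 \<Longrightarrow> Comp C (h (Suc j)) (fs ! j) = Comp C (gs ! j) (h j)"
    using assms by (auto simp: extension_maps_def)
  obtain S T d c q I \<gamma> \<iota> where f: "fs = [d, c, q]" "d \<in> Hom C N S" "c \<in> Hom C S T" "q \<in> Hom C T M"
    "L.ses I N S (Some d) \<gamma>" "L.ses M I T \<iota> (Some q)" "Some c = ocomp \<iota> \<gamma>" using extensions_2E[OF e(1)] .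
  obtain S' T' d' c' q' I' \<gamma>' \<iota>' where g: "gs = [d', c', q']" "d' \<in> Hom C N S'" "c' \<in> Hom C S' T'" "q' \<in> Hom C T' M"
    "L.ses I' N S' (Some d') \<gamma>'" "L.ses M I' T' \<iota>' (Some q')" "Some c' = ocomp \<iota>' \<gamma>'" using extensions_2E[OF e(2)] .
  have D: "Dom C c = S" "Cod C c = T" "Cod C q = M" "Dom C q = T" "Dom C c' = S'" "Cod C c' = T'" "Cod C q' = M" "Dom C q' = T'"
    using f g by (auto simp: Hom_iff)
  have h1: "h 1 \<in> Hom C S S'" using h(3)[of 1] f(1) g(1) D by simp
  have h2: "h 2 \<in> Hom C T T'" using h(3)[of 2] f(1) g(1) D by simp
  have c0: "Comp C (h 1) d = d'" using h(4)[of 0] h(1) f(1) g(1) Comp_Idt_right[OF g(2)] by simp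
  have c1: "Comp C (h 2) c = Comp C c' (h 1)" using h(4)[of 1] f(1) g(1) by (simp add: numeral_2_eq_2)
  have c2: "Comp C q' (h 2) = q" using h(4)[of 2] h(2) f(1) g(1) Comp_Idt_left[OF f(4)] by simp
  have o0: "ocomp (Some (h 1)) (Some d) = Some d'" using c0 ocomp_Some[OF h1 f(2)] by simp
  have o1: "ocomp (Some c') (Some (h 1)) = ocomp (Some (h 2)) (Some c)" using c1 ocomp_Some[OF h2 f(3)] ocomp_Some[OF g(3) h1] by simp
  have o2: "ocomp (Some q') (Some (h 2)) = Some q" using c2 ocomp_Some[OF g(4) h2] by simp
  have ty: "Some (h 1) \<in> ohm S S'" "Some (h 2) \<in> ohm T T'" "Some c \<in> ohm S T" "Some c' \<in> ohm S' T'"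
    "Some q \<in> ohm T M" "Some q' \<in> ohm T' M" "Some d \<in> ohm N S" "Some d' \<in> ohm N S'" using h1 h2 f(2-4) g(2-4) by (auto simp: ohm_iff)
  have z: "L.Z (ocomp (Some q') (Some c'))" "L.Z (ocomp (Some c) (Some d))"
    using L.sesD(3)[OF g(6)] L.sesD(3)[OF f(5)] f(7) g(7) by (metis L.assoc L.Z_right, metis L.assoc L.Z_left)
  show ?thesis
  proof
    assume "fillable fs"
    then obtain E s t where st: "s \<in> ohm S E" "t \<in> ohm E T" "ocomp t s = Some c" "L.ses M S E s (ocomp (Some q) t)"
      using D by (auto simp: fillable_def f(1) L.fillings_def)
    have "\<exists>E' s' t'. s' \<in> ohm S' E' \<and> t' \<in> ohm E' T' \<and> ocomp t' s' = Some c' \<and> L.ses M S' E' s' (ocomp (Some q') t')"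
      by (rule L.filling_push[OF st(4,2) ty(1,2,4,6) _ o2 z(1)]) (simp only: o1 st(3))
    then show "fillable gs" using D by (auto simp: fillable_def g(1) L.fillings_def)
  next
    assume "fillable gs"
    then obtain E s t where st: "s \<in> ohm S' E" "t \<in> ohm E T'" "ocomp t s = Some c'" "L.ses M S' E s (ocomp (Some q') t)"
      using D by (auto simp: fillable_def g(1) L.fillings_def)
    have std: "L.ses T' N E (ocomp s (Some d')) t" using L.filling_dual[OF g(5,6) st(1,2)] st(3,4) g(7) by simp
    have "\<exists>E' s' t'. s' \<in> ohm E' T \<and> t' \<in> ohm S E' \<and> ocomp s' t' = Some c \<and>
      ab_cat.ses (\<lambda>A B. ohm B A) (\<lambda>g f. ocomp f g) oadd N T E' s' (ocomp t' (Some d))"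
      by (rule ab_cat.filling_push[OF L.op, of N T' E t s "Some d'" S' "Some (h 2)" T "Some (h 1)" S "Some c" "Some d"])
        (use std st ty o0 o1 z(2) in \<open>simp_all add: L.ses_op L.assoc[symmetric] del: One_nat_def\<close>)
    then obtain E' s' t' where "s' \<in> ohm E' T" "t' \<in> ohm S E'" "ocomp s' t' = Some c" "L.ses T N E' (ocomp t' (Some d)) s'"
      by (auto simp: L.ses_op)
    then have "L.ses M S E' t' (ocomp (Some q) s')" using L.filling_dual[OF f(5,6)] f(7) by simp
    then show "fillable fs" using D \<open>s' \<in> ohm E' T\<close> \<open>t' \<in> ohm S E'\<close> \<open>ocomp s' t' = Some c\<close>
      by (auto simp: fillable_def f(1) L.fillings_def)
  qed
qed

text \<open>Its middle arrow is zero, with the zero object as image, and it is filled by the direct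
  sum of \<open>M\<close> and \<open>N\<close>.\<close>

lemma trivial_extension:
  assumes o: "M \<in> Obj C" "N \<in> Obj C"
  shows "[Idt C N, Zer C N M, Idt C M] \<in> extensions C 2 M N" and "fillable [Idt C N, Zer C N M, Idt C M]"
proof -
  note i = Idt_in_Hom[OF o(1)] Idt_in_Hom[OF o(2)] and z = group_facts(1)[OF o(2,1)]
  have D: "Dom C (Idt C N) = N" "Cod C (Idt C N) = N" "Dom C (Idt C M) = M" "Cod C (Idt C M) = M"
    "Dom C (Zer C N M) = N" "Cod C (Zer C N M) = M" "Idt C N \<in> Arr C" "Idt C M \<in> Arr C" "Zer C N M \<in> Arr C"
    using i z by (auto simp: Hom_iff)
  have mono: "is_mono C (Idt C N)" "is_epi C (Idt C N)" "is_epi C (Idt C M)"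
    using is_mono_iff[OF i(2)] is_epi_iff i L.mono_idn L.epi_idn o by auto
  have "exact_at C (Idt C N) (Zer C N M)"
  proof -
    have "is_kernel C (Zer C N M) (Idt C N)"
      unfolding is_kernel_def D using D Comp_Idt_right[OF z] Comp_Idt_left by (auto intro!: ex1I)
    then show ?thesis unfolding exact_at_def using D mono(2) Comp_Idt_left[OF i(2)]
      by (intro conjI exI[of _ "Idt C N"]) auto
  qed
  moreover have "exact_at C (Zer C N M) (Idt C M)"
  proof -
    obtain W where W: "is_zero_object C W" using ex_zero_object by blast
    then have oO: "W \<in> Obj C" by (simp add: is_zero_object_def)
    note zz = group_facts(1)[OF oO o(1)] group_facts(1)[OF o(2) oO]
    have E: "Dom C (Zer C W M) = W" "Cod C (Zer C W M) = M" "Zer C W M \<in> Arr C" "Dom C (Zer C N W) = N" "Cod C (Zer C N W) = W" "Zer C N W \<in> Arr C"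
      using zz by (auto simp: Hom_iff)
    have "is_epi C (Zer C N W)" unfolding is_epi_def using W E by (auto simp: is_zero_object_def)
    moreover have "is_kernel C (Idt C M) (Zer C W M)"
      unfolding is_kernel_def D E
    proof (intro conjI ballI impI)
      show "Comp C (Idt C M) (Zer C W M) = Zer C W M" using Comp_Idt_left[OF zz(1)] .
      fix X h assume X: "X \<in> Obj C" and h: "h \<in> Hom C X M" "Comp C (Idt C M) h = Zer C X M"
      have "h = Zer C X M" using h Comp_Idt_left[OF h(1)] by simp
      moreover have "Comp C (Zer C W M) u = Zer C X M" if "u \<in> Hom C X W" for u using Comp_Zer_left[OF that o(1)] .
      moreover have "\<exists>!u. u \<in> Hom C X W" using W X by (simp add: is_zero_object_def)
      ultimately show "\<exists>!u. u \<in> Hom C X W \<and> Comp C (Zer C W M) u = h" by (metis (no_types, lifting))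
    qed (use D E in auto)
    moreover have "Zer C N M = Comp C (Zer C W M) (Zer C N W)" using Comp_Zer_left[OF zz(2) o(1)] by simp
    ultimately show ?thesis unfolding exact_at_def using D E
      by (intro conjI exI[of _ "Zer C N W"] exI[of _ "Zer C W M"]) auto
  qed
  ultimately show "[Idt C N, Zer C N M, Idt C M] \<in> extensions C 2 M N"
    unfolding extensions_def using D mono by (auto simp: less_Suc_eq numeral_2_eq_2)
  obtain S i1 i2 p1 p2 where b: "i2 \<in> ohm N S" "p1 \<in> ohm S M" "L.ses M N S i2 p1"
    using L.biproduct_ses[OF o] by metis
  have "ocomp (Some (Idt C M)) p1 = p1" using L.idn_left[OF b(2)] .
  moreover have "ocomp p1 i2 = Some (Zer C N M)"
    using L.Z_unique[OF L.sesD(3)[OF b(3)] L.zerop_zero[OF o(2,1)] L.comp_hom[OF b(1,2)] L.zero_hom[OF o(2,1)]] .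
  ultimately have "(i2, p1) \<in> L.fillings M N M (Some (Zer C N M)) (Some (Idt C M)) S"
    using b by (simp add: L.fillings_def)
  then show "fillable [Idt C N, Zer C N M, Idt C M]" unfolding fillable_def using D by auto
qed

text \<open>The two sequences splice to a 2-extension of \<open>A\<close> by \<open>D\<close>. Since
  Ext^2 has a single element, a zigzag of maps joins it to the trivial extension, and fillability
  travels along the zigzag.\<close>

lemma hereditary_fill:
  assumes her: "hereditary C" and s: "L.ses I D S \<delta> \<gamma>" and a: "L.ses A I T \<iota> q"
  shows "\<exists>E. L.fillings A S T (ocomp \<iota> \<gamma>) q E \<noteq> {}"
proof -
  note s' = L.sesD[OF s] and a' = L.sesD[OF a]
  obtain d g where d: "\<delta> = Some d" "\<gamma> = Some g" "d \<in> Hom C D S" "g \<in> Hom C S I" using L_ses_SomeE[OF s] by metis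
  obtain j r where j: "\<iota> = Some j" "q = Some r" "j \<in> Hom C I T" "r \<in> Hom C T A" using L_ses_SomeE[OF a] by metis
  have c: "ocomp \<iota> \<gamma> = Some (Comp C j g)" using d j ocomp_Some by simp
  have ch: "Comp C j g \<in> Hom C S T" using Comp_in_Hom d j by blast
  have Dd: "Dom C d = D" "Cod C d = S" "Dom C (Comp C j g) = S" "Cod C (Comp C j g) = T" "Cod C r = A" "Dom C r = T" "Dom C j = I" "Cod C g = I" "Dom C g = S"
    "d \<in> Arr C" "r \<in> Arr C" "Comp C j g \<in> Arr C" using d j ch by (auto simp: Hom_iff)
  let ?f = "[d, Comp C j g, r]"
  have kd: "is_kernel C (Comp C j g) d"
    unfolding is_kernel_def Dd
  proof (intro conjI ballI impI)
    have ki: "is_kernel C g d" using ses_kernel[OF s[unfolded d(1,2)] d(3,4)] .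
    then have gd: "Comp C g d = Zer C D I" and u: "\<And>X h. h \<in> Hom C X S \<Longrightarrow> Comp C g h = Zer C X I \<Longrightarrow> \<exists>!u. u \<in> Hom C X D \<and> Comp C d u = h"
      using Hom_Obj by (auto simp: is_kernel_def Dd)
    show "Comp C (Comp C j g) d = Zer C D T"
      using Comp_assoc[OF d(3,4) j(3)] gd Comp_Zer_right[OF j(3) Hom_Obj(1)[OF d(3)]] by simp
    fix X h assume X: "X \<in> Obj C" and h: "h \<in> Hom C X S" "Comp C (Comp C j g) h = Zer C X T"
    have gh: "Comp C g h \<in> Hom C X I" using Comp_in_Hom h d by blast
    have "Comp C j (Comp C g h) = Comp C j (Zer C X I)"
      using h(2) Comp_assoc[OF h(1) d(4) j(3)] Comp_Zer_right[OF j(3) X] by simp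
    then have "Comp C g h = Zer C X I"
      using is_mono_iff[OF j(3)] a'(1) j(1) gh X group_facts(1)[OF X Hom_Obj(1)[OF j(3)]] by (auto simp: is_mono_def Dd)
    then show "\<exists>!u. u \<in> Hom C X D \<and> Comp C d u = h" using u h by blast
  qed (use Dd in auto)
  have kj: "is_kernel C r j" using ses_kernel[OF a[unfolded j(1,2)] j(3,4)] .
  have m: "is_mono C d" "is_epi C r" "is_epi C g"
    using is_mono_iff[OF d(3)] is_epi_iff[OF j(4)] is_epi_iff[OF d(4)] s' a' d j by auto
  have iD: "Idt C D \<in> Hom C D D" "is_epi C (Idt C D)"
    using Idt_in_Hom[OF s'(9)] is_epi_iff[OF Idt_in_Hom[OF s'(9)]] L.epi_idn[OF s'(9)] by auto
  have e1: "exact_at C d (Comp C j g)"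
    unfolding exact_at_def using Dd kd iD Comp_Idt_right[OF d(3)]
    by (intro conjI exI[of _ "Idt C D"] exI[of _ d]) (auto simp: Hom_iff)
  have e2: "exact_at C (Comp C j g) r"
    unfolding exact_at_def using Dd kj m(3) by (intro conjI exI[of _ g] exI[of _ j]) auto
  have f: "?f \<in> extensions C 2 A D"
    unfolding extensions_def using Dd m e1 e2 by (auto simp: less_Suc_eq numeral_2_eq_2)
  let ?t = "[Idt C D, Zer C D A, Idt C A]"
  let ?r = "(extension_maps C 2 A D \<union> (extension_maps C 2 A D)\<inverse>)\<^sup>*"
  note t = trivial_extension[OF a'(8) s'(9)]
  have "is_singleton (Ext C 2 A D)" using her a'(8) s'(9) unfolding hereditary_def by simp
  then obtain \<xi> where \<xi>: "extensions C 2 A D // ?r = {\<xi>}" unfolding Ext_def by (rule is_singletonE)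
  have "?r `` {?f} = \<xi>" "?r `` {?t} = \<xi>"
    using quotientI[OF f, of ?r] quotientI[OF t(1), of ?r] unfolding \<xi> by (simp_all only: singleton_iff)
  then have "?r `` {?t} = ?r `` {?f}" by (simp only:)
  then have "(?t, ?f) \<in> ?r" by blast
  then have "fillable ?f"
  proof (induction rule: rtrancl_induct)
    case base
    show ?case using t(2) .
  next
    case (step y z)
    then show ?case using fillable_maps by blast
  qed
  then show ?thesis unfolding fillable_def using Dd c j by simp
qed

end

section \<open>Direct sums and isomorphism classes\<close>

context ab_cat
begin

definition bip where
  "bip A B S i1 i2 p1 p2 \<longleftrightarrow> i1 \<in> hm A S \<and> i2 \<in> hm B S \<and> p1 \<in> hm S A \<and> p2 \<in> hm S B \<and>
     p1 \<cdot> i1 = idn A \<and> p2 \<cdot> i2 = idn B \<and> Z (p2 \<cdot> i1) \<and> Z (p1 \<cdot> i2) \<and> i1 \<cdot> p1 \<boxplus> i2 \<cdot> p2 = idn S"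

lemma bipD:
  assumes "bip A B S i1 i2 p1 p2"
  shows "i1 \<in> hm A S" "i2 \<in> hm B S" "p1 \<in> hm S A" "p2 \<in> hm S B"
     "p1 \<cdot> i1 = idn A" "p2 \<cdot> i2 = idn B" "Z (p2 \<cdot> i1)" "Z (p1 \<cdot> i2)" "i1 \<cdot> p1 \<boxplus> i2 \<cdot> p2 = idn S"
  using assms by (auto simp: bip_def)

lemma bip_ex: "A \<in> obj \<Longrightarrow> B \<in> obj \<Longrightarrow> \<exists>S i1 i2 p1 p2. bip A B S i1 i2 p1 p2"
  using biproduct unfolding bip_def .

lemma bip_swap: "bip A B S i1 i2 p1 p2 \<Longrightarrow> bip B A S i2 i1 p2 p1"
  unfolding bip_def by (simp add: add_comm)

lemma bip_decomp:
  assumes b: "bip A B S i1 i2 p1 p2" and x: "x \<in> hm U S"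
  shows "i1 \<cdot> p1 \<cdot> x \<boxplus> i2 \<cdot> p2 \<cdot> x = x"
  using bipD(9)[OF b] idn_left[OF x] by (metis assoc distr)

lemma bip_ses:
  assumes b: "bip A B S i1 i2 p1 p2"
  shows "ses A B S i2 p1"
proof (rule sesI)
  note b' = bipD[OF b]
  have o: "A \<in> obj" "B \<in> obj" using b' hom_obj by blast+
  show "mono B S i2" using mono_left[of B B p2 i2 S] b' mono_idn[OF o(2)] by simp
  show "epi S A p1" using epi_right[of A A p1 i1 S] b' epi_idn[OF o(1)] by simp
  show "Z (p1 \<cdot> i2)" using b' by simp
  fix U x assume x: "x \<in> hm U S" "Z (p1 \<cdot> x)"
  have "i1 \<cdot> p1 \<cdot> x \<boxplus> i2 \<cdot> p2 \<cdot> x = i2 \<cdot> p2 \<cdot> x"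
    by (rule zero_add[OF comp_hom[OF comp_hom[OF x(1) b'(4)] b'(2)] comp_hom[OF comp_hom[OF x(1) b'(3)] b'(1)] Z_left[OF x(2)]])
  then have "i2 \<cdot> p2 \<cdot> x = x" using bip_decomp[OF b x(1)] by simp
  then show "\<exists>z\<in>hm U B. i2 \<cdot> z = x" using comp_hom[OF x(1) b'(4)] by metis
qed

lemma bip_unique:
  assumes b: "bip A B S i1 i2 p1 p2" and c: "bip A B S' j1 j2 q1 q2"
  shows "isop S S' \<noteq> {}"
proof -
  note b' = bipD[OF b] and c' = bipD[OF c]
  define h where "h = j1 \<cdot> p1 \<boxplus> j2 \<cdot> p2"
  have h: "h \<in> hm S S'" unfolding h_def using b' c' comp_hom add_hom by metis
  have "h \<cdot> i2 = j1 \<cdot> p1 \<cdot> i2 \<boxplus> j2" unfolding h_def using b' c' by (simp add: distr assoc idn_right)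
  also have "\<dots> = j2" by (rule zero_add[OF c'(2) comp_hom[OF comp_hom[OF b'(2,3)] c'(1)] Z_left[OF b'(8)]])
  finally have hi: "h \<cdot> i2 = j2" .
  have "q1 \<cdot> h = p1 \<boxplus> q1 \<cdot> j2 \<cdot> p2" unfolding h_def using b' c' by (simp add: distl ra[OF c'(5)] idn_left)
  also have "\<dots> = p1" by (rule add_zerop[OF b'(3) comp_hom[OF comp_hom[OF b'(4) c'(2)] c'(3)]]) (use Z_right[OF c'(8)] in \<open>simp add: assoc\<close>)
  finally have "q1 \<cdot> h = p1" .
  then obtain k where "(h, k) \<in> isop S S'" using short_five[OF bip_ses[OF b] bip_ses[OF c] h hi] by blast
  then show ?thesis by blast
qed

lemma bip_iso:
  assumes b: "bip A B S i1 i2 p1 p2" and i: "(\<alpha>, \<alpha>') \<in> isop A A'" "(\<beta>, \<beta>') \<in> isop B B'" "(\<sigma>, \<sigma>') \<in> isop S S'"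
  shows "bip A' B' S' (\<sigma> \<cdot> i1 \<cdot> \<alpha>') (\<sigma> \<cdot> i2 \<cdot> \<beta>') (\<alpha> \<cdot> p1 \<cdot> \<sigma>') (\<beta> \<cdot> p2 \<cdot> \<sigma>')"
proof -
  note b' = bipD[OF b] and a = isopD[OF i(1)] and c = isopD[OF i(2)] and s = isopD[OF i(3)]
  have idl: "\<sigma>' \<cdot> \<sigma> \<cdot> x = x" if "x \<in> hm U S" for U x using s(3) idn_left[OF that] by (metis assoc)
  show ?thesis
    unfolding bip_def
  proof (intro conjI)
    show "\<sigma> \<cdot> i1 \<cdot> \<alpha>' \<in> hm A' S'" using comp_hom[OF comp_hom[OF a(2) b'(1)] s(1)] .
    show "\<sigma> \<cdot> i2 \<cdot> \<beta>' \<in> hm B' S'" using comp_hom[OF comp_hom[OF c(2) b'(2)] s(1)] .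
    show "\<alpha> \<cdot> p1 \<cdot> \<sigma>' \<in> hm S' A'" using comp_hom[OF comp_hom[OF s(2) b'(3)] a(1)] .
    show "\<beta> \<cdot> p2 \<cdot> \<sigma>' \<in> hm S' B'" using comp_hom[OF comp_hom[OF s(2) b'(4)] c(1)] .
    show "(\<alpha> \<cdot> p1 \<cdot> \<sigma>') \<cdot> \<sigma> \<cdot> i1 \<cdot> \<alpha>' = idn A'"
      using idl[OF comp_hom[OF a(2) b'(1)]] a by (simp add: assoc ra[OF b'(5)] idn_left)
    show "(\<beta> \<cdot> p2 \<cdot> \<sigma>') \<cdot> \<sigma> \<cdot> i2 \<cdot> \<beta>' = idn B'"
      using idl[OF comp_hom[OF c(2) b'(2)]] c by (simp add: assoc ra[OF b'(6)] idn_left)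
    show "Z ((\<beta> \<cdot> p2 \<cdot> \<sigma>') \<cdot> \<sigma> \<cdot> i1 \<cdot> \<alpha>')"
      using idl[OF comp_hom[OF a(2) b'(1)]] Z_left[OF Z_right[OF b'(7)]] by (simp add: assoc)
    show "Z ((\<alpha> \<cdot> p1 \<cdot> \<sigma>') \<cdot> \<sigma> \<cdot> i2 \<cdot> \<beta>')"
      using idl[OF comp_hom[OF c(2) b'(2)]] Z_left[OF Z_right[OF b'(8)]] by (simp add: assoc)
    have "\<alpha>' \<cdot> \<alpha> \<cdot> p1 \<cdot> \<sigma>' = p1 \<cdot> \<sigma>'" "\<beta>' \<cdot> \<beta> \<cdot> p2 \<cdot> \<sigma>' = p2 \<cdot> \<sigma>'"
      using a(3) c(3) idn_left comp_hom[OF s(2) b'(3)] comp_hom[OF s(2) b'(4)] by (metis assoc)+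
    then have "(\<sigma> \<cdot> i1 \<cdot> \<alpha>') \<cdot> \<alpha> \<cdot> p1 \<cdot> \<sigma>' \<boxplus> (\<sigma> \<cdot> i2 \<cdot> \<beta>') \<cdot> \<beta> \<cdot> p2 \<cdot> \<sigma>' = \<sigma> \<cdot> (i1 \<cdot> p1 \<cdot> \<sigma>' \<boxplus> i2 \<cdot> p2 \<cdot> \<sigma>')"
      by (simp add: assoc distl)
    also have "\<dots> = idn S'" using bip_decomp[OF b s(2)] s(4) by simp
    finally show "(\<sigma> \<cdot> i1 \<cdot> \<alpha>') \<cdot> \<alpha> \<cdot> p1 \<cdot> \<sigma>' \<boxplus> (\<sigma> \<cdot> i2 \<cdot> \<beta>') \<cdot> \<beta> \<cdot> p2 \<cdot> \<sigma>' = idn S'" .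
  qed
qed

text \<open>Adds \<open>Y\<close> to the sub-object and to the middle term of an extension. Applied
  to two extensions with the same ends, it shows that the relation defining the Grothendieck monoid
  is compatible with sums.\<close>

lemma bip_add_ses:
  assumes s: "ses M N X i p" and b: "bip X Y S i1 i2 p1 p2" and c: "bip N Y P j1 j2 q1 q2"
  shows "ses M P S (i1 \<cdot> i \<cdot> q1 \<boxplus> i2 \<cdot> q2) (p \<cdot> p1)"
proof (rule sesI)
  note s' = sesD[OF s] and b' = bipD[OF b] and c' = bipD[OF c]
  let ?k = "i1 \<cdot> i \<cdot> q1 \<boxplus> i2 \<cdot> q2"
  have t: "i \<cdot> q1 \<in> hm P X" "i1 \<cdot> i \<cdot> q1 \<in> hm P S" "i2 \<cdot> q2 \<in> hm P S" using s'(4) b' c' comp_hom by metis+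
  have k: "?k \<in> hm P S" using t add_hom by blast
  have "p1 \<cdot> ?k = i \<cdot> q1 \<boxplus> p1 \<cdot> i2 \<cdot> q2" using t by (simp add: distl ra[OF b'(5)] idn_left)
  also have "\<dots> = i \<cdot> q1" by (rule add_zerop[OF t(1) comp_hom[OF t(3) b'(3)]]) (use Z_right[OF b'(8)] in \<open>simp add: assoc\<close>)
  finally have pk1: "p1 \<cdot> ?k = i \<cdot> q1" .
  have "p2 \<cdot> ?k = p2 \<cdot> i1 \<cdot> i \<cdot> q1 \<boxplus> q2" using c' by (simp add: distl ra[OF b'(6)] idn_left)
  also have "\<dots> = q2" by (rule zero_add[OF c'(4) comp_hom[OF t(2) b'(4)]]) (use Z_right[OF b'(7)] in \<open>simp add: assoc\<close>)
  finally have pk2: "p2 \<cdot> ?k = q2" .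
  show "mono P S ?k"
  proof (rule monoI[OF k])
    fix U z assume z: "z \<in> hm U P" "Z (?k \<cdot> z)"
    have "Z (i \<cdot> q1 \<cdot> z)" using Z_left[OF z(2), of p1] pk1 by (metis assoc)
    then have "Z (q1 \<cdot> z)" using monoD[OF s'(1) comp_hom[OF z(1) c'(3)]] by blast
    moreover have "Z (q2 \<cdot> z)" using Z_left[OF z(2), of p2] pk2 by (metis assoc)
    ultimately have "Z (j1 \<cdot> q1 \<cdot> z \<boxplus> j2 \<cdot> q2 \<cdot> z)" using Z_left Z_add by blast
    then show "Z z" using bip_decomp[OF c z(1)] by simp
  qed
  show "epi S M (p \<cdot> p1)" using epi_comp[OF s'(2) sesD(2)[OF bip_ses[OF b]]] .
  show "Z ((p \<cdot> p1) \<cdot> ?k)" using Z_right[OF s'(3), of q1] unfolding assoc pk1 by (simp add: assoc)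
  fix U x assume x: "x \<in> hm U S" "Z ((p \<cdot> p1) \<cdot> x)"
  then obtain w where w: "w \<in> hm U N" "i \<cdot> w = p1 \<cdot> x" using s'(6)[OF comp_hom[OF x(1) b'(3)]] by (auto simp: assoc)
  define z where "z = j1 \<cdot> w \<boxplus> j2 \<cdot> p2 \<cdot> x"
  have y: "p2 \<cdot> x \<in> hm U Y" "j1 \<cdot> w \<in> hm U P" "j2 \<cdot> p2 \<cdot> x \<in> hm U P" using x w b' c' comp_hom by metis+
  have z: "z \<in> hm U P" unfolding z_def using y add_hom by blast
  have "q1 \<cdot> z = w \<boxplus> q1 \<cdot> j2 \<cdot> p2 \<cdot> x" unfolding z_def using w by (simp add: distl ra[OF c'(5)] idn_left)
  also have "\<dots> = w" by (rule add_zerop[OF w(1) comp_hom[OF y(3) c'(3)]]) (use Z_right[OF c'(8)] in \<open>simp add: assoc\<close>)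
  finally have q1: "q1 \<cdot> z = w" .
  have "q2 \<cdot> z = q2 \<cdot> j1 \<cdot> w \<boxplus> p2 \<cdot> x" unfolding z_def using y by (simp add: distl ra[OF c'(6)] idn_left)
  also have "\<dots> = p2 \<cdot> x" by (rule zero_add[OF y(1) comp_hom[OF y(2) c'(4)]]) (use Z_right[OF c'(7)] in \<open>simp add: assoc\<close>)
  finally have q2: "q2 \<cdot> z = p2 \<cdot> x" .
  have "?k \<cdot> z = i1 \<cdot> p1 \<cdot> x \<boxplus> i2 \<cdot> p2 \<cdot> x" using q1 q2 w(2) by (simp add: distr assoc)
  then have "?k \<cdot> z = x" using bip_decomp[OF b x(1)] by simp
  then show "\<exists>z\<in>hm U P. ?k \<cdot> z = x" using z by blast
qed

text \<open>A direct summand is determined up to isomorphism by its idempotent endomorphism;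
  finiteness of the endomorphisms of \<open>S\<close> will therefore bound the decompositions of
  \<open>S\<close>.\<close>

lemma idempotent_iso:
  assumes "i \<in> hm A S" "p \<in> hm S A" "p \<cdot> i = idn A" "i' \<in> hm A' S" "p' \<in> hm S A'" "p' \<cdot> i' = idn A'"
    and e: "i \<cdot> p = i' \<cdot> p'"
  shows "(p' \<cdot> i, p \<cdot> i') \<in> isop A A'"
proof -
  have e1: "i' \<cdot> p' \<cdot> x = i \<cdot> p \<cdot> x" for x using e by (metis assoc)
  have "p \<cdot> i' \<cdot> p' \<cdot> i = idn A" using assms by (simp add: e1 ra[OF assms(3)] idn_right)
  moreover have "p' \<cdot> i \<cdot> p \<cdot> i' = idn A'" using assms by (simp add: e1[symmetric] ra[OF assms(6)] idn_right)
  ultimately show ?thesis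
    using comp_hom[OF assms(1,5)] comp_hom[OF assms(4,2)] by (simp add: isop_def assoc)
qed

text \<open>Makes the largest number of endomorphisms strictly monotone on the Grothendieck monoid.\<close>

lemma card_end_biproduct:
  assumes b: "bip A B S i1 i2 p1 p2" and fin: "finite (hm S S)"
  shows "card (hm A A) * card (hm B B) \<le> card (hm S S)"
proof -
  note b' = bipD[OF b]
  let ?f = "\<lambda>(x, y). i1 \<cdot> x \<cdot> p1 \<boxplus> i2 \<cdot> y \<cdot> p2"
  have "card (hm A A \<times> hm B B) \<le> card (hm S S)"
  proof (rule card_inj_on_le[OF _ _ fin])
    have t: "i1 \<cdot> x \<cdot> p1 \<in> hm S S" if "x \<in> hm A A" for x using comp_hom[OF comp_hom[OF b'(3) that] b'(1)] .
    have u: "i2 \<cdot> y \<cdot> p2 \<in> hm S S" if "y \<in> hm B B" for y using comp_hom[OF comp_hom[OF b'(4) that] b'(2)] .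
    show "?f ` (hm A A \<times> hm B B) \<subseteq> hm S S" using t u add_hom by auto
    have px: "p1 \<cdot> (i1 \<cdot> x \<cdot> p1 \<boxplus> i2 \<cdot> y \<cdot> p2) \<cdot> i1 = x" if x: "x \<in> hm A A" and y: "y \<in> hm B B" for x y
    proof -
      have "p1 \<cdot> (i1 \<cdot> x \<cdot> p1 \<boxplus> i2 \<cdot> y \<cdot> p2) \<cdot> i1 = x \<boxplus> p1 \<cdot> i2 \<cdot> y \<cdot> p2 \<cdot> i1"
        using x y b' by (simp add: distl distr assoc ra[OF b'(5)] idn_left idn_right)
      also have "\<dots> = x" by (rule add_zerop[OF x comp_hom[OF comp_hom[OF comp_hom[OF comp_hom[OF b'(1,4)] y] b'(2)] b'(3)]])
        (rule Z_left[OF Z_left[OF Z_left[OF b'(7)]]])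
      finally show ?thesis .
    qed
    have py: "p2 \<cdot> (i1 \<cdot> x \<cdot> p1 \<boxplus> i2 \<cdot> y \<cdot> p2) \<cdot> i2 = y" if x: "x \<in> hm A A" and y: "y \<in> hm B B" for x y
    proof -
      have "p2 \<cdot> (i1 \<cdot> x \<cdot> p1 \<boxplus> i2 \<cdot> y \<cdot> p2) \<cdot> i2 = p2 \<cdot> i1 \<cdot> x \<cdot> p1 \<cdot> i2 \<boxplus> y"
        using x y b' by (simp add: distl distr assoc ra[OF b'(6)] idn_left idn_right)
      also have "\<dots> = y" by (rule zero_add[OF y comp_hom[OF comp_hom[OF comp_hom[OF comp_hom[OF b'(2,3)] x] b'(1)] b'(4)]])
        (rule Z_left[OF Z_left[OF Z_left[OF b'(8)]]])
      finally show ?thesis .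
    qed
    show "inj_on ?f (hm A A \<times> hm B B)"
    proof (rule inj_onI)
      fix u v assume uv: "u \<in> hm A A \<times> hm B B" "v \<in> hm A A \<times> hm B B" "?f u = ?f v"
      obtain x y x' y' where e: "u = (x, y)" "v = (x', y')" by (cases u, cases v)
      have "x = x'" using px[of x y] px[of x' y'] uv unfolding e by simp
      moreover have "y = y'" using py[of x y] py[of x' y'] uv unfolding e by simp
      ultimately show "u = v" unfolding e by simp
    qed
  qed
  then show ?thesis by (simp add: card_cartesian_product)
qed

end

context abelian_category
begin

lemma iso_class_iff: "Y \<in> iso_class C X \<longleftrightarrow> Y \<in> Obj C \<and> L.isop X Y \<noteq> {}"
  by (auto simp: iso_class_def isos_nonempty)

lemma iso_class_self: "X \<in> Obj C \<Longrightarrow> X \<in> iso_class C X"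
  using L.isop_idn iso_class_iff by blast

lemma isop_ne_sym: "L.isop X Y \<noteq> {} \<Longrightarrow> L.isop Y X \<noteq> {}"
  using L.isop_sym by fast

lemma isop_ne_trans: "L.isop X Y \<noteq> {} \<Longrightarrow> L.isop Y W \<noteq> {} \<Longrightarrow> L.isop X W \<noteq> {}"
  using L.isop_comp by fast

lemma iso_class_eq:
  assumes "X \<in> Obj C" "Y \<in> Obj C"
  shows "iso_class C X = iso_class C Y \<longleftrightarrow> L.isop X Y \<noteq> {}"
proof
  assume "iso_class C X = iso_class C Y"
  then show "L.isop X Y \<noteq> {}" using iso_class_self[OF assms(2)] iso_class_iff by blast
next
  assume "L.isop X Y \<noteq> {}"
  then show "iso_class C X = iso_class C Y"
    unfolding set_eq_iff iso_class_iff using isop_ne_trans isop_ne_sym by blast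
qed

lemma rep_iso_class:
  assumes "X \<in> Obj C"
  shows "rep (iso_class C X) \<in> Obj C" "L.isop X (rep (iso_class C X)) \<noteq> {}"
  using someI[of "\<lambda>Y. Y \<in> iso_class C X", OF iso_class_self[OF assms]] iso_class_iff
  unfolding rep_def by blast+

lemma iso_class_rep:
  assumes "a \<in> Iso C"
  shows "iso_class C (rep a) = a" "rep a \<in> Obj C"
proof -
  obtain X where X: "X \<in> Obj C" "a = iso_class C X" using assms by (auto simp: Iso_def)
  show "rep a \<in> Obj C" using rep_iso_class(1)[OF X(1)] X(2) by simp
  show "iso_class C (rep a) = a"
    using iso_class_eq[OF X(1) rep_iso_class(1)[OF X(1)]] rep_iso_class(2)[OF X(1)] X(2) by metis
qed

lemma is_biproduct_iff:
  assumes "A \<in> Obj C" "B \<in> Obj C"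
  shows "is_biproduct C A B S \<longleftrightarrow> (\<exists>i1 i2 p1 p2. L.bip A B S i1 i2 p1 p2)"
proof
  assume "is_biproduct C A B S"
  then obtain i1 i2 p1 p2 where b: "i1 \<in> Hom C A S" "i2 \<in> Hom C B S" "p1 \<in> Hom C S A" "p2 \<in> Hom C S B"
    "Comp C p1 i1 = Idt C A" "Comp C p2 i2 = Idt C B" "Comp C p2 i1 = Zer C A B" "Comp C p1 i2 = Zer C B A"
    "Add C (Comp C i1 p1) (Comp C i2 p2) = Idt C S" unfolding is_biproduct_def by blast
  have "zerop oadd (Some (Zer C A B))" "zerop oadd (Some (Zer C B A))" using zerop_Some group_facts(1) assms by blast+
  then have "L.bip A B S (Some i1) (Some i2) (Some p1) (Some p2)" unfolding L.bip_def using b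
    by (simp add: ohm_iff ocomp_Some[OF b(3,1)] ocomp_Some[OF b(4,2)] ocomp_Some[OF b(4,1)] ocomp_Some[OF b(3,2)]
          ocomp_Some[OF b(1,3)] ocomp_Some[OF b(2,4)] oadd_Some[OF Comp_in_Hom[OF b(3,1)] Comp_in_Hom[OF b(4,2)]])
  then show "\<exists>i1 i2 p1 p2. L.bip A B S i1 i2 p1 p2" by blast
next
  assume "\<exists>i1 i2 p1 p2. L.bip A B S i1 i2 p1 p2"
  then obtain j1 j2 q1 q2 where bb: "L.bip A B S j1 j2 q1 q2" by blast
  note b' = L.bipD[OF bb]
  obtain i1 i2 p1 p2 where e: "j1 = Some i1" "j2 = Some i2" "q1 = Some p1" "q2 = Some p2" and
    b: "i1 \<in> Hom C A S" "i2 \<in> Hom C B S" "p1 \<in> Hom C S A" "p2 \<in> Hom C S B"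
    using b'(1-4) unfolding ohm_iff by blast
  have "S \<in> Obj C" using Hom_Obj b by blast
  moreover have "Comp C p1 i1 = Idt C A" using b'(5) ocomp_Some[OF b(3,1)] unfolding e by simp
  moreover have "Comp C p2 i2 = Idt C B" using b'(6) ocomp_Some[OF b(4,2)] unfolding e by simp
  moreover have "Comp C p2 i1 = Zer C A B"
    using b'(7) zerop_Some[OF Comp_in_Hom[OF b(1,4)]] ocomp_Some[OF b(4,1)] unfolding e by simp
  moreover have "Comp C p1 i2 = Zer C B A"
    using b'(8) zerop_Some[OF Comp_in_Hom[OF b(2,3)]] ocomp_Some[OF b(3,2)] unfolding e by simp
  moreover have "Add C (Comp C i1 p1) (Comp C i2 p2) = Idt C S"
    using b'(9) oadd_Some[OF Comp_in_Hom[OF b(3,1)] Comp_in_Hom[OF b(4,2)]] ocomp_Some[OF b(1,3)] ocomp_Some[OF b(2,4)]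
    unfolding e by simp
  ultimately show "is_biproduct C A B S" unfolding is_biproduct_def using b by blast
qed

lemma iso_sum_eq:
  assumes b: "L.bip A B S i1 i2 p1 p2"
  shows "iso_sum C (iso_class C A) (iso_class C B) = iso_class C S"
proof -
  have o: "A \<in> Obj C" "B \<in> Obj C" "S \<in> Obj C" using L.bipD[OF b] L.hom_obj by blast+
  show ?thesis
  proof (intro equalityI subsetI)
    fix S' assume "S' \<in> iso_sum C (iso_class C A) (iso_class C B)"
    then obtain A' B' where ab: "A' \<in> iso_class C A" "B' \<in> iso_class C B" "is_biproduct C A' B' S'"
      by (auto simp: iso_sum_def)
    have o': "A' \<in> Obj C" "B' \<in> Obj C" "S' \<in> Obj C" using ab by (auto simp: iso_class_iff is_biproduct_def)
    obtain j1 j2 q1 q2 where c: "L.bip A' B' S' j1 j2 q1 q2" using ab(3) is_biproduct_iff[OF o'(1,2)] by blast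
    obtain \<alpha> \<alpha>' \<beta> \<beta>' where i: "(\<alpha>, \<alpha>') \<in> L.isop A A'" "(\<beta>, \<beta>') \<in> L.isop B B'"
      using ab(1,2) unfolding iso_class_iff by fast
    show "S' \<in> iso_class C S"
      using L.bip_unique[OF L.bip_iso[OF b i L.isop_idn[OF o(3)]] c] o' by (simp add: iso_class_iff)
  next
    fix S' assume "S' \<in> iso_class C S"
    then obtain \<sigma> \<sigma>' where s: "(\<sigma>, \<sigma>') \<in> L.isop S S'" "S' \<in> Obj C" unfolding iso_class_iff by fast
    have "is_biproduct C A B S'"
      unfolding is_biproduct_iff[OF o(1,2)] using L.bip_iso[OF b L.isop_idn[OF o(1)] L.isop_idn[OF o(2)] s(1)] by blast
    then show "S' \<in> iso_sum C (iso_class C A) (iso_class C B)"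
      unfolding iso_sum_def using iso_class_self o by blast
  qed
qed

section \<open>The Grothendieck monoid\<close>

abbreviation gc where "gc \<equiv> groth_class C"
abbreviation \<Gamma> where "\<Gamma> \<equiv> groth_monoid C"

lemma Ext_classes_iff:
  assumes X: "X \<in> Obj C"
  shows "iso_class C X \<in> Ext_classes C M N \<longleftrightarrow> (\<exists>i p. L.ses M N X i p)"
proof
  assume "iso_class C X \<in> Ext_classes C M N"
  then obtain X' where x: "iso_class C X = iso_class C X'" "X' \<in> Obj C" "short_exact C M N X' \<noteq> {}"
    by (auto simp: Ext_classes_def)
  then obtain i p where s: "L.ses M N X' i p" using short_exact_nonempty by blast
  have "L.isop X' X \<noteq> {}" using iso_class_eq[OF x(2) X] x(1) by simp
  then obtain h k where "(h, k) \<in> L.isop X' X" by fast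
  from L.ses_iso_mid[OF s this] show "\<exists>i p. L.ses M N X i p" by blast
next
  assume "\<exists>i p. L.ses M N X i p"
  then show "iso_class C X \<in> Ext_classes C M N"
    unfolding Ext_classes_def using short_exact_nonempty X by blast
qed

lemma Ext_classes_Iso: "Ext_classes C M N \<subseteq> Iso C"
  by (auto simp: Ext_classes_def Iso_def)

lemma ses_zero:
  assumes X: "X \<in> Obj C" and N: "N \<in> Obj C" "L.Z (Some (Idt C N))"
  shows "L.ses X N X (Some (Zer C N X)) (Some (Idt C X))" "L.ses N X X (Some (Idt C X)) (Some (Zer C X N))"
proof -
  have a: "L.Z z" if "z \<in> ohm U N" for z U using L.Z_right[OF N(2), of z] L.idn_left[OF that] by simp
  have b: "L.Z z" if "z \<in> ohm N U" for z U using L.Z_left[OF N(2), of z] L.idn_right[OF that] by simp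
  show "L.ses X N X (Some (Zer C N X)) (Some (Idt C X))"
  proof (rule L.sesI)
    show "L.mono N X (Some (Zer C N X))" by (rule L.monoI[OF L.zero_hom[OF N(1) X]]) (use a in blast)
    show "L.epi X X (Some (Idt C X))" by (rule L.epi_idn[OF X])
    show "L.Z (ocomp (Some (Idt C X)) (Some (Zer C N X)))" using L.Z_left[OF L.zerop_zero[OF N(1) X]] .
    fix U x assume x: "x \<in> ohm U X" "L.Z (ocomp (Some (Idt C X)) x)"
    have U: "U \<in> Obj C" using x L.hom_obj by blast
    have "ocomp (Some (Zer C N X)) (Some (Zer C U N)) = x"
      by (rule L.Z_unique[OF L.Z_left[OF L.zerop_zero[OF U N(1)]] _ L.comp_hom[OF L.zero_hom[OF U N(1)] L.zero_hom[OF N(1) X]] x(1)])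
        (use x L.idn_left[OF x(1)] in simp)
    then show "\<exists>z\<in>ohm U N. ocomp (Some (Zer C N X)) z = x" using L.zero_hom[OF U N(1)] by blast
  qed
  show "L.ses N X X (Some (Idt C X)) (Some (Zer C X N))"
  proof (rule L.sesI)
    show "L.epi X N (Some (Zer C X N))" by (rule L.epiI[OF L.zero_hom[OF X N(1)]]) (use b in blast)
    show "L.mono X X (Some (Idt C X))" by (rule L.mono_idn[OF X])
    show "L.Z (ocomp (Some (Zer C X N)) (Some (Idt C X)))" using L.Z_right[OF L.zerop_zero[OF X N(1)]] .
    show "\<exists>z\<in>ohm U X. ocomp (Some (Idt C X)) z = x" if "x \<in> ohm U X" for U x
      using that L.idn_left by blast
  qed
qed

lemma is_zero_object_iff: "is_zero_object C N \<longleftrightarrow> N \<in> Obj C \<and> L.Z (Some (Idt C N))"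
proof
  assume N: "is_zero_object C N"
  then have "N \<in> Obj C" by (simp add: is_zero_object_def)
  moreover have "Idt C N = Zer C N N"
    using N Idt_in_Hom[OF calculation] group_facts(1)[OF calculation calculation] unfolding is_zero_object_def by blast
  ultimately show "N \<in> Obj C \<and> L.Z (Some (Idt C N))" using L.zerop_zero by simp
next
  assume N: "N \<in> Obj C \<and> L.Z (Some (Idt C N))"
  then have e: "Idt C N = Zer C N N" using zerop_Some Idt_in_Hom by blast
  have "f = Zer C N X" if "f \<in> Hom C N X" for f X
    using Comp_Idt_right[OF that] Comp_Zer_right[OF that] N unfolding e by simp
  moreover have "f = Zer C X N" if "f \<in> Hom C X N" for f X
    using Comp_Idt_left[OF that] Comp_Zer_left[OF that] N unfolding e by simp
  ultimately show "is_zero_object C N" unfolding is_zero_object_def using N group_facts(1) by blast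
qed

lemma zero_class_eq: "is_zero_object C N \<Longrightarrow> zero_class C = iso_class C N"
proof -
  assume N: "is_zero_object C N"
  note n = N[unfolded is_zero_object_iff]
  have "is_zero_object C X \<longleftrightarrow> X \<in> iso_class C N" for X
  proof
    assume "is_zero_object C X"
    then have x: "X \<in> Obj C" "L.Z (Some (Idt C X))" unfolding is_zero_object_iff by auto
    have "(Some (Zer C N X), Some (Zer C X N)) \<in> L.isop N X"
      unfolding L.isop_def using L.zero_hom x n
        L.Z_unique[OF L.Z_left[OF L.zerop_zero] _ L.comp_hom[OF L.zero_hom L.zero_hom] L.idn_hom] by auto
    then show "X \<in> iso_class C N" using x iso_class_iff by blast
  next
    assume "X \<in> iso_class C N"
    then obtain h k where i: "(h, k) \<in> L.isop N X" "X \<in> Obj C" unfolding iso_class_iff by fast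
    have "ocomp h (ocomp (Some (Idt C N)) k) = Some (Idt C X)" using L.isopD[OF i(1)] L.idn_left by simp
    then have "L.Z (Some (Idt C X))" using L.Z_left[OF L.Z_right] n by metis
    then show "is_zero_object C X" using i is_zero_object_iff by blast
  qed
  then show ?thesis by (auto simp: zero_class_def)
qed

lemma zero_ses:
  assumes "L.ses M N X i p"
  shows "L.Z (Some (Idt C X)) \<longleftrightarrow> L.Z (Some (Idt C M)) \<and> L.Z (Some (Idt C N))"
proof
  note s = L.sesD[OF assms]
  {
    assume x: "L.Z (Some (Idt C X))"
    have "L.Z (ocomp (Some (Idt C M)) p)" using L.Z_left[OF x, of p] L.idn_right[OF s(5)] L.idn_left[OF s(5)] by simp
    then have "L.Z (Some (Idt C M))" using L.epiD[OF s(2) L.idn_hom[OF s(8)]] by blast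
    moreover have "L.Z (ocomp i (Some (Idt C N)))" using L.Z_right[OF x, of i] L.idn_right[OF s(4)] L.idn_left[OF s(4)] by simp
    then have "L.Z (Some (Idt C N))" using L.monoD[OF s(1) L.idn_hom[OF s(9)]] by blast
    ultimately show "L.Z (Some (Idt C M)) \<and> L.Z (Some (Idt C N))" by blast
  next
    assume mn: "L.Z (Some (Idt C M)) \<and> L.Z (Some (Idt C N))"
    then have "L.Z p" using L.Z_right[of "Some (Idt C M)" p] L.idn_left[OF s(5)] by simp
    then have "L.Z (ocomp p (Some (Idt C X)))" using L.Z_right by blast
    then obtain z where z: "z \<in> ohm X N" "ocomp i z = Some (Idt C X)" using s(6)[OF L.idn_hom[OF s(10)]] by blast
    have "L.Z z" using mn L.Z_right[of "Some (Idt C N)" z] L.idn_left[OF z(1)] by simp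
    then show "L.Z (Some (Idt C X))" using L.Z_left z(2) by metis
  }
qed

definition ext_step where
  "ext_step = {(x, y). \<exists>M\<in>Obj C. \<exists>N\<in>Obj C. x \<in> Ext_classes C M N \<and> y \<in> Ext_classes C M N}"

lemma groth_rel_eq: "groth_rel C = ext_step\<^sup>+"
  unfolding groth_rel_def ext_step_def ..

lemma equiv_groth_rel: "equiv (Iso C) (groth_rel C)"
  unfolding groth_rel_eq
proof (rule equivI)
  have sub: "ext_step \<subseteq> Iso C \<times> Iso C" using Ext_classes_Iso by (fastforce simp: ext_step_def)
  then show "ext_step\<^sup>+ \<subseteq> Iso C \<times> Iso C" by (rule trancl_subset_Sigma)
  show "refl_on (Iso C) (ext_step\<^sup>+)"
  proof (rule refl_onI)
    fix a assume "a \<in> Iso C"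
    then obtain X where X: "X \<in> Obj C" "a = iso_class C X" by (auto simp: Iso_def)
    \<comment> \<open>Reflexivity: an object is an extension of itself by zero.\<close>
    obtain N where N: "N \<in> Obj C" "L.Z (Some (Idt C N))" using L.zero_object by blast
    have "a \<in> Ext_classes C X N" using Ext_classes_iff[OF X(1)] ses_zero(1)[OF X(1) N] X(2) by blast
    then show "(a, a) \<in> ext_step\<^sup>+" using X N by (auto simp: ext_step_def)
  qed
  show "sym (ext_step\<^sup>+)" by (rule sym_trancl) (auto simp: ext_step_def sym_def)
  show "trans (ext_step\<^sup>+)" by (rule trans_trancl)
qed

lemma gc_eq_iff:
  assumes "X \<in> Obj C" "Y \<in> Obj C"
  shows "gc X = gc Y \<longleftrightarrow> (iso_class C X, iso_class C Y) \<in> groth_rel C"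
  unfolding groth_class_def using eq_equiv_class_iff[OF equiv_groth_rel] assms by (auto simp: Iso_def)

text \<open>The universal property of the class map: constancy on the middle terms of extensions
  with common ends propagates along the transitive closure. It covers isomorphic objects, because an
  extension can be transported to an isomorphic middle term.\<close>

lemma gc_lift:
  assumes \<phi>: "\<And>M N X Y i p i' p'. L.ses M N X i p \<Longrightarrow> L.ses M N Y i' p' \<Longrightarrow> \<phi> X = \<phi> Y"
    and o: "X \<in> Obj C" "Y \<in> Obj C" and eq: "gc X = gc Y"
  shows "\<phi> X = \<phi> Y"
proof -
  have stp: "\<phi> X = \<phi> Y" if st: "X \<in> Obj C" "Y \<in> Obj C" "(iso_class C X, iso_class C Y) \<in> ext_step" for X Y
  proof -
    obtain M N where "iso_class C X \<in> Ext_classes C M N" "iso_class C Y \<in> Ext_classes C M N"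
      using st(3) by (auto simp: ext_step_def)
    then obtain i p i' p' where "L.ses M N X i p" "L.ses M N Y i' p'"
      unfolding Ext_classes_iff[OF st(1)] Ext_classes_iff[OF st(2)] by blast
    then show ?thesis by (rule \<phi>)
  qed
  have "(iso_class C X, iso_class C Y) \<in> ext_step\<^sup>+" using eq gc_eq_iff[OF o] groth_rel_eq by simp
  moreover have "\<forall>W\<in>Obj C. b = iso_class C W \<longrightarrow> \<phi> X = \<phi> W" if "(iso_class C X, b) \<in> ext_step\<^sup>+" for b
    using that
  proof (induction rule: trancl_induct)
    case (base b)
    then show ?case using stp[OF o(1)] by blast
  next
    case (step y z)
    from step(2) have "y \<in> Iso C" using Ext_classes_Iso by (auto simp: ext_step_def)
    then obtain V where V: "V \<in> Obj C" "y = iso_class C V" by (auto simp: Iso_def)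
    then show ?case using stp[OF V(1)] step(2,3) by metis
  qed
  ultimately show ?thesis using o by blast
qed

lemma gc_ses:
  assumes "L.ses M N X i p" "L.ses M N Y i' p'"
  shows "gc X = gc Y"
proof -
  have o: "X \<in> Obj C" "Y \<in> Obj C" "M \<in> Obj C" "N \<in> Obj C" using L.sesD(8-10) assms by blast+
  have "(iso_class C X, iso_class C Y) \<in> ext_step"
    unfolding ext_step_def using Ext_classes_iff o assms by blast
  then show ?thesis unfolding gc_eq_iff[OF o(1,2)] groth_rel_eq by (rule r_into_trancl)
qed

lemma gc_iso:
  assumes "(h, k) \<in> L.isop X Y"
  shows "gc X = gc Y"
proof -
  have "X \<in> Obj C" "Y \<in> Obj C" using L.isopD(1)[OF assms] L.hom_obj by blast+
  then have "iso_class C X = iso_class C Y" using iso_class_eq assms by blast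
  then show ?thesis by (simp add: groth_class_def)
qed

lemma gc_bip_left:
  assumes "gc X = gc X'" and b: "L.bip X Y S i1 i2 p1 p2" "L.bip X' Y S' j1 j2 q1 q2"
  shows "gc S = gc S'"
proof -
  \<comment> \<open>A sum with \<open>Y\<close> is defined only up to isomorphism, so the invariant
    is the set of classes of all sums.\<close>
  let ?\<phi> = "\<lambda>X. {gc S | S i1 i2 p1 p2. L.bip X Y S i1 i2 p1 p2}"
  have o: "X \<in> Obj C" "X' \<in> Obj C" "Y \<in> Obj C" using L.bipD[OF b(1)] L.bipD[OF b(2)] L.hom_obj by blast+
  have key: "gc S = gc S'"
    if s: "L.ses M N X i p" "L.ses M N X' i' p'" and c: "L.bip X Y S i1 i2 p1 p2" "L.bip X' Y S' j1 j2 q1 q2"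
    for M N X i p X' i' p' S S' i1 i2 p1 p2 j1 j2 q1 q2
  proof -
    obtain P r1 r2 s1 s2 where P: "L.bip N Y P r1 r2 s1 s2" using L.bip_ex L.sesD(9)[OF s(1)] o(3) by blast
    show ?thesis using gc_ses[OF L.bip_add_ses[OF s(1) c(1) P] L.bip_add_ses[OF s(2) c(2) P]] .
  qed
  have "?\<phi> X = ?\<phi> X'"
  proof (rule gc_lift[OF _ o(1,2) assms(1)])
    fix M N X X' i p i' p' assume s: "L.ses M N X i p" "L.ses M N X' i' p'"
    obtain S i1 i2 p1 p2 where c: "L.bip X Y S i1 i2 p1 p2" using L.bip_ex L.sesD(10)[OF s(1)] o(3) by blast
    obtain S' j1 j2 q1 q2 where d: "L.bip X' Y S' j1 j2 q1 q2" using L.bip_ex L.sesD(10)[OF s(2)] o(3) by blast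
    have SS: "gc S = gc S'" using key[OF s c d] .
    show "?\<phi> X = ?\<phi> X'"
    proof (intro equalityI subsetI)
      fix x assume "x \<in> ?\<phi> X"
      then have "x = gc S'" using key[OF s _ d] by blast
      then show "x \<in> ?\<phi> X'" using d by blast
    next
      fix x assume "x \<in> ?\<phi> X'"
      then have "x = gc S" using key[OF s c] by fastforce
      then show "x \<in> ?\<phi> X" using c by blast
    qed
  qed
  moreover have "gc S \<in> ?\<phi> X" using b(1) by blast
  ultimately obtain S2 k1 k2 r1 r2 where s2: "gc S = gc S2" "L.bip X' Y S2 k1 k2 r1 r2" by auto
  have "gc S2 = gc S'" using gc_ses[OF L.bip_ses[OF s2(2)] L.bip_ses[OF b(2)]] .
  then show ?thesis using s2(1) by simp
qed

lemma carrier_groth: "carrier \<Gamma> = gc ` Obj C"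
  by (auto simp: groth_monoid_def quotient_def groth_class_def Iso_def)

lemma gc_mult_bip:
  assumes b: "L.bip X Y S i1 i2 p1 p2"
  shows "gc X \<otimes>\<^bsub>\<Gamma>\<^esub> gc Y = gc S"
proof -
  have o: "X \<in> Obj C" "Y \<in> Obj C" "S \<in> Obj C" using L.bipD[OF b] L.hom_obj by blast+
  let ?T = "{iso_sum C x y | x y. x \<in> gc X \<and> y \<in> gc Y}"
  have "iso_class C X \<in> gc X" "iso_class C Y \<in> gc Y"
    unfolding groth_class_def using equiv_class_self[OF equiv_groth_rel] o by (auto simp: Iso_def)
  then have S: "iso_class C S \<in> ?T" using iso_sum_eq[OF b] by force
  have T: "groth_rel C `` {t} = gc S" if tT: "t \<in> ?T" for t
  proof -
    obtain x y where t: "t = iso_sum C x y" "x \<in> gc X" "y \<in> gc Y" using tT by blast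
    have xy: "(iso_class C X, x) \<in> groth_rel C" "(iso_class C Y, y) \<in> groth_rel C" using t by (auto simp: groth_class_def)
    then have "x \<in> Iso C" "y \<in> Iso C" using equiv_groth_rel by (auto simp: equiv_def)
    then obtain X' Y' where x': "X' \<in> Obj C" "x = iso_class C X'" "Y' \<in> Obj C" "y = iso_class C Y'" by (auto simp: Iso_def)
    have g: "gc X = gc X'" "gc Y = gc Y'"
      using gc_eq_iff o x' xy by auto
    obtain S' j1 j2 q1 q2 where c: "L.bip X' Y' S' j1 j2 q1 q2" using L.bip_ex x' by blast
    obtain S2 k1 k2 r1 r2 where d: "L.bip X' Y S2 k1 k2 r1 r2" using L.bip_ex x' o by blast
    have "gc S = gc S2" using gc_bip_left[OF g(1) b d] .
    also have "\<dots> = gc S'" using gc_bip_left[OF g(2) L.bip_swap[OF d] L.bip_swap[OF c]] .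
    also have "\<dots> = groth_rel C `` {t}" unfolding groth_class_def t(1) x' iso_sum_eq[OF c] ..
    finally show ?thesis by simp
  qed
  have "groth_rel C `` ?T = (\<Union>t\<in>?T. groth_rel C `` {t})" by blast
  also have "\<dots> = gc S" using T S by blast
  finally show ?thesis by (simp add: groth_monoid_def)
qed

text \<open>The extension and the direct sum of its ends are middle terms of sequences with the same
  ends.\<close>

lemma gc_mult:
  assumes s: "L.ses A B X i p"
  shows "gc X = gc A \<otimes>\<^bsub>\<Gamma>\<^esub> gc B"
proof -
  obtain S i1 i2 p1 p2 where b: "L.bip A B S i1 i2 p1 p2" using L.bip_ex L.sesD(8,9)[OF s] by blast
  show ?thesis using gc_mult_bip[OF b] gc_ses[OF s L.bip_ses[OF b]] by simp
qed

lemma one_groth: "is_zero_object C N \<Longrightarrow> \<one>\<^bsub>\<Gamma>\<^esub> = gc N"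
  using zero_class_eq by (simp add: groth_monoid_def groth_class_def)

lemma groth_comm_monoid: "comm_monoid (groth_monoid C)"
proof -
  obtain N where N: "is_zero_object C N" using ex_zero_object by blast
  note n = N[unfolded is_zero_object_iff]
  show ?thesis
  proof (rule comm_monoidI)
    show "x \<otimes>\<^bsub>\<Gamma>\<^esub> y \<in> carrier \<Gamma>" if xx: "x \<in> carrier \<Gamma>" "y \<in> carrier \<Gamma>" for x y
    proof -
      obtain X Y where X: "X \<in> Obj C" "x = gc X" "Y \<in> Obj C" "y = gc Y" using xx by (auto simp: carrier_groth)
      obtain S i1 i2 p1 p2 where b: "L.bip X Y S i1 i2 p1 p2" using L.bip_ex X by blast
      show ?thesis using gc_mult_bip[OF b] X L.bipD(1)[OF b] L.hom_obj by (auto simp: carrier_groth)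
    qed
    show "\<one>\<^bsub>\<Gamma>\<^esub> \<in> carrier \<Gamma>" using one_groth[OF N] n by (auto simp: carrier_groth)
    show "x \<otimes>\<^bsub>\<Gamma>\<^esub> y \<otimes>\<^bsub>\<Gamma>\<^esub> z = x \<otimes>\<^bsub>\<Gamma>\<^esub> (y \<otimes>\<^bsub>\<Gamma>\<^esub> z)"
      if xx: "x \<in> carrier \<Gamma>" "y \<in> carrier \<Gamma>" "z \<in> carrier \<Gamma>" for x y z
    proof -
      obtain X Y W where X: "X \<in> Obj C" "x = gc X" "Y \<in> Obj C" "y = gc Y" "W \<in> Obj C" "z = gc W"
        using xx by (auto simp: carrier_groth)
      obtain S i1 i2 p1 p2 where b: "L.bip X Y S i1 i2 p1 p2" using L.bip_ex X by blast
      have "S \<in> Obj C" using L.bipD(1)[OF b] L.hom_obj by blast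
      then obtain T j1 j2 q1 q2 where c: "L.bip S W T j1 j2 q1 q2" using L.bip_ex X by blast
      \<comment> \<open>Associativity is read off a flag: the triple sum contains an extension of
        \<open>Y\<close> by \<open>W\<close> with quotient \<open>X\<close>.\<close>
      obtain V m k l where v: "L.ses X V T m (ocomp p1 q1)" "L.ses Y W V k l"
        using L.flag_sub[OF L.bip_ses[OF c] L.bip_ses[OF b]] by metis
      show ?thesis unfolding X using gc_mult[OF v(1)] gc_mult[OF v(2)] gc_mult_bip[OF b] gc_mult_bip[OF c] by simp
    qed
    show "\<one>\<^bsub>\<Gamma>\<^esub> \<otimes>\<^bsub>\<Gamma>\<^esub> x = x" if xx: "x \<in> carrier \<Gamma>" for x
    proof -
      obtain X where X: "X \<in> Obj C" "x = gc X" using xx by (auto simp: carrier_groth)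
      show ?thesis using gc_mult[OF ses_zero(2)[OF X(1)]] n one_groth[OF N] X by auto
    qed
    show "x \<otimes>\<^bsub>\<Gamma>\<^esub> y = y \<otimes>\<^bsub>\<Gamma>\<^esub> x" if xx: "x \<in> carrier \<Gamma>" "y \<in> carrier \<Gamma>" for x y
    proof -
      obtain X Y where X: "X \<in> Obj C" "x = gc X" "Y \<in> Obj C" "y = gc Y" using xx by (auto simp: carrier_groth)
      obtain S i1 i2 p1 p2 where b: "L.bip X Y S i1 i2 p1 p2" using L.bip_ex X by blast
      show ?thesis using gc_mult_bip[OF b] gc_mult_bip[OF L.bip_swap[OF b]] X by simp
    qed
  qed
qed

text \<open>\<open>gc_lift\<close> applies to the property of being zero, since a middle term is
  zero exactly if both ends are.\<close>

lemma gc_one: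
  assumes X: "X \<in> Obj C" "gc X = \<one>\<^bsub>\<Gamma>\<^esub>"
  shows "is_zero_object C X"
proof -
  obtain N where N: "is_zero_object C N" using ex_zero_object by blast
  note n = N[unfolded is_zero_object_iff]
  have "L.Z (Some (Idt C X)) = L.Z (Some (Idt C N))"
    by (rule gc_lift[of "\<lambda>X. L.Z (Some (Idt C X))", OF _ X(1)]) (use zero_ses n X one_groth[OF N] in auto)
  then show ?thesis using n X is_zero_object_iff by blast
qed

end

section \<open>Finiteness conditions and the bicharacter\<close>

locale hall_cat = abelian_category +
  assumes prof: "profinitary C" and her: "hereditary C"
begin

definition rpc where "rpc X = rep (iso_class C X)"

lemma rpc_Obj: "X \<in> Obj C \<Longrightarrow> rpc X \<in> Obj C"
  using rep_iso_class(1) by (simp add: rpc_def)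

lemma rpc_iso: "X \<in> Obj C \<Longrightarrow> \<exists>h k. (h, k) \<in> L.isop X (rpc X)"
  using rep_iso_class(2) unfolding rpc_def by fast

lemma rpc_eq:
  assumes "(h, k) \<in> L.isop X Y"
  shows "rpc X = rpc Y"
proof -
  have "X \<in> Obj C" "Y \<in> Obj C" using L.isopD(1)[OF assms] L.hom_obj by blast+
  then have "iso_class C X = iso_class C Y" using iso_class_eq assms by blast
  then show ?thesis by (simp add: rpc_def)
qed

lemma rpc_rpc: "X \<in> rpc ` Obj C \<Longrightarrow> rpc X = X"
proof -
  assume "X \<in> rpc ` Obj C"
  then obtain Y where Y: "Y \<in> Obj C" "X = rpc Y" by blast
  obtain h k where "(h, k) \<in> L.isop Y (rpc Y)" using rpc_iso[OF Y(1)] by blast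
  from rpc_eq[OF this] show "rpc X = X" unfolding Y(2) by simp
qed

lemma finite_ohm: "finite (ohm A B)"
proof (cases "A \<in> Obj C \<and> B \<in> Obj C")
  case True
  then show ?thesis using prof by (auto simp: ohm_def profinitary_def)
next
  case False
  then have "Hom C A B = {}" using Hom_Obj by blast
  then show ?thesis by (simp add: ohm_def)
qed

lemma finite_gc: "finite {X \<in> rpc ` Obj C. gc X = \<gamma>}"
proof (cases "\<gamma> \<in> carrier \<Gamma>")
  case True
  have i1: "inj_on (iso_class C) {X \<in> rpc ` Obj C. gc X = \<gamma>}"
  proof (rule inj_onI)
    fix X Y assume "X \<in> {X \<in> rpc ` Obj C. gc X = \<gamma>}" "Y \<in> {X \<in> rpc ` Obj C. gc X = \<gamma>}"
      and e: "iso_class C X = iso_class C Y"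
    then have "rpc X = X" "rpc Y = Y" using rpc_rpc by blast+
    moreover have "rpc X = rpc Y" unfolding rpc_def e ..
    ultimately show "X = Y" by metis
  qed
  have i2: "iso_class C ` {X \<in> rpc ` Obj C. gc X = \<gamma>} \<subseteq> {iso_class C X | X. X \<in> Obj C \<and> gc X = \<gamma>}"
    using rpc_Obj by auto
  have i3: "finite {iso_class C X | X. X \<in> Obj C \<and> gc X = \<gamma>}"
    using prof True by (auto simp: profinitary_def)
  show ?thesis by (rule finite_imageD[OF finite_subset[OF i2 i3] i1])
next
  case False
  then have "{X \<in> rpc ` Obj C. gc X = \<gamma>} = {}" using rpc_Obj by (auto simp: carrier_groth)
  then show ?thesis by (simp only: finite.emptyI)
qed

text \<open>A decomposition of \<open>S\<close> is determined, up to isomorphism of the summands, by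
  its pair of idempotents, and \<open>S\<close> has only finitely many endomorphisms.\<close>

lemma finite_summands:
  "finite {(A, B). A \<in> rpc ` Obj C \<and> B \<in> rpc ` Obj C \<and> (\<exists>i1 i2 p1 p2. L.bip A B S i1 i2 p1 p2)}" (is "finite ?P")
proof -
  \<comment> \<open>One pair of summands may sit in \<open>S\<close> in many ways, so one pair of
    idempotents is chosen for it; \<open>uniq\<close> makes any such choice injective.\<close>
  define R where "R x e \<longleftrightarrow> (\<exists>i1 i2 p1 p2. L.bip (fst x) (snd x) S i1 i2 p1 p2 \<and> e = (ocomp i1 p1, ocomp i2 p2))" for x e
  have ex: "R x (SOME e. R x e)" if x: "x \<in> ?P" for x
  proof (rule someI_ex)
    obtain i1 i2 p1 p2 where "L.bip (fst x) (snd x) S i1 i2 p1 p2" using x by auto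
    then have "R x (ocomp i1 p1, ocomp i2 p2)" unfolding R_def by blast
    then show "\<exists>e. R x e" ..
  qed
  have uniq: "x = y" if x: "x \<in> ?P" "R x e" and y: "y \<in> ?P" "R y e" for x y e
  proof -
    obtain A B where xe: "x = (A, B)" by (cases x)
    obtain A' B' where ye: "y = (A', B')" by (cases y)
    obtain i1 i2 p1 p2 j1 j2 q1 q2 where b: "L.bip A B S i1 i2 p1 p2" "L.bip A' B' S j1 j2 q1 q2"
      and e: "ocomp i1 p1 = ocomp j1 q1" "ocomp i2 p2 = ocomp j2 q2" using x(2) y(2) by (auto simp: R_def xe ye)
    note b1 = L.bipD[OF b(1)] and b2 = L.bipD[OF b(2)]
    have "rpc A = rpc A'" using rpc_eq[OF L.idempotent_iso[OF b1(1,3,5) b2(1,3,5) e(1)]] .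
    moreover have "rpc B = rpc B'" using rpc_eq[OF L.idempotent_iso[OF b1(2,4,6) b2(2,4,6) e(2)]] .
    moreover have "A \<in> rpc ` Obj C" "B \<in> rpc ` Obj C" "A' \<in> rpc ` Obj C" "B' \<in> rpc ` Obj C"
      using x(1) y(1) unfolding xe ye by blast+
    ultimately show ?thesis unfolding xe ye by (metis rpc_rpc)
  qed
  have i1: "inj_on (\<lambda>x. SOME e. R x e) ?P"
  proof (rule inj_onI)
    fix x y assume x: "x \<in> ?P" and y: "y \<in> ?P" and e: "(SOME e. R x e) = (SOME e. R y e)"
    have "R y (SOME e. R x e)" unfolding e by (rule ex[OF y])
    then show "x = y" by (rule uniq[OF x ex[OF x] y])
  qed
  have i2: "(\<lambda>x. SOME e. R x e) ` ?P \<subseteq> ohm S S \<times> ohm S S"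
  proof
    fix e assume "e \<in> (\<lambda>x. SOME e. R x e) ` ?P"
    then obtain x where "x \<in> ?P" "e = (SOME e. R x e)" by blast
    then have "R x e" using ex by blast
    then obtain i1 i2 p1 p2 where b: "L.bip (fst x) (snd x) S i1 i2 p1 p2" and e: "e = (ocomp i1 p1, ocomp i2 p2)"
      unfolding R_def by blast
    note b' = L.bipD[OF b]
    show "e \<in> ohm S S \<times> ohm S S" unfolding e using L.comp_hom[OF b'(3,1)] L.comp_hom[OF b'(4,2)] by simp
  qed
  show ?thesis by (rule finite_imageD[OF finite_subset[OF i2 finite_cartesian_product[OF finite_ohm finite_ohm]] i1])
qed

sublocale H: her_cat "Obj C" ohm ocomp "\<lambda>A. Some (Idt C A)" oadd oneg "\<lambda>A B. Some (Zer C A B)" rpc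
proof
  show "finite (ohm A B)" for A B by (rule finite_ohm)
  show "A \<in> Obj C \<Longrightarrow> rpc A \<in> Obj C" for A by (rule rpc_Obj)
  show "A \<in> Obj C \<Longrightarrow> \<exists>h k. (h, k) \<in> L.isop A (rpc A)" for A by (rule rpc_iso)
  show "(h, k) \<in> L.isop A B \<Longrightarrow> rpc A = rpc B" for A B h k by (rule rpc_eq)
  \<comment> \<open>All middle terms have the class of the sum of the ends, and a class contains
    finitely many objects up to isomorphism.\<close>
  show "finite {X \<in> rpc ` Obj C. \<exists>i p. L.ses A B X i p}" for A B
    by (rule finite_subset[OF _ finite_gc[of "gc A \<otimes>\<^bsub>\<Gamma>\<^esub> gc B"]]) (use gc_mult in auto)
  \<comment> \<open>If \<open>X\<close> is an extension of \<open>A\<close> by \<open>B\<close>,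
    then the direct sum of \<open>A\<close> and \<open>B\<close> lies in the class of
    \<open>X\<close>. That class has finitely many members up to isomorphism, each with finitely
    many decompositions.\<close>
  show "finite {(A, B). A \<in> rpc ` Obj C \<and> B \<in> rpc ` Obj C \<and> (\<exists>i p. L.ses A B X i p)}" for X
  proof (rule finite_subset)
    let ?P = "\<lambda>S. {(A, B). A \<in> rpc ` Obj C \<and> B \<in> rpc ` Obj C \<and> (\<exists>i1 i2 p1 p2. L.bip A B S i1 i2 p1 p2)}"
    show "finite (\<Union>S\<in>{S \<in> rpc ` Obj C. gc S = gc X}. ?P S)"
      using finite_gc finite_summands by (intro finite_UN_I)
    show "{(A, B). A \<in> rpc ` Obj C \<and> B \<in> rpc ` Obj C \<and> (\<exists>i p. L.ses A B X i p)} \<subseteq>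
      (\<Union>S\<in>{S \<in> rpc ` Obj C. gc S = gc X}. ?P S)"
    proof (clarify)
      fix A B i p assume o: "A \<in> Obj C" "B \<in> Obj C" and s: "L.ses (rpc A) (rpc B) X i p"
      obtain S i1 i2 p1 p2 where b: "L.bip (rpc A) (rpc B) S i1 i2 p1 p2" using L.bip_ex rpc_Obj o by blast
      have S: "S \<in> Obj C" using L.bipD(1)[OF b] L.hom_obj by blast
      obtain h k where i: "(h, k) \<in> L.isop S (rpc S)" using rpc_iso[OF S] by blast
      have g1: "gc (rpc S) = gc X"
        using gc_iso[OF i] gc_ses[OF L.bip_ses[OF b] s] by simp
      have g2: "(rpc A, rpc B) \<in> ?P (rpc S)"
        using L.bip_iso[OF b L.isop_idn[OF rpc_Obj[OF o(1)]] L.isop_idn[OF rpc_Obj[OF o(2)]] i] o by blast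
      show "(rpc A, rpc B) \<in> (\<Union>S\<in>{S \<in> rpc ` Obj C. gc S = gc X}. ?P S)"
        by (rule UN_I[of "rpc S"], use S g1 in simp) (rule g2)
    qed
  qed
  show "\<exists>E. L.fillings A S T (ocomp \<iota> \<gamma>) q E \<noteq> {}"
    if "L.ses I D S \<delta> \<gamma>" "L.ses A I T \<iota> q" for I D S \<delta> \<gamma> A T \<iota> q
    using hereditary_fill[OF her that] .
qed

text \<open>Multiplicativity expresses the mass at a middle term through the ends of its sequence
  alone, so \<open>gc_lift\<close> applies in each variable. This is the well-definedness of
  \<open>chi\<close>.\<close>

lemma mass_gc:
  assumes o: "M \<in> Obj C" "N \<in> Obj C" "M' \<in> Obj C" "N' \<in> Obj C"
    and g: "gc M = gc M'" "gc N = gc N'"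
  shows "H.mass (H.SES M N) = H.mass (H.SES M' N')"
proof -
  have "H.mass (H.SES M N) = H.mass (H.SES M' N)"
    by (rule gc_lift[of "\<lambda>M. H.mass (H.SES M N)", OF _ o(1,3) g(1)]) (use H.mass_SES_left o in metis)
  also have "\<dots> = H.mass (H.SES M' N')"
    by (rule gc_lift[of "\<lambda>N. H.mass (H.SES M' N)", OF _ o(2,4) g(2)]) (use H.mass_SES_right o in metis)
  finally show ?thesis .
qed

lemma chi_eq:
  assumes o: "M \<in> Obj C" "N \<in> Obj C"
  shows "chi C (gc M) (gc N) = H.mass (H.SES M N)"
proof -
  have m: "H.mass (H.SES M N) = of_nat (card (Ext C 1 M N)) / of_nat (card (Hom C M N))"
    if "M \<in> Obj C" "N \<in> Obj C" for M N
    using H.mass_SES(1)[OF that] card_Ext1[of M N] by (simp add: ohm_def card_image)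
  show ?thesis
    unfolding chi_def
  proof (rule the_equality)
    show "\<exists>M'\<in>Obj C. \<exists>N'\<in>Obj C. gc M' = gc M \<and> gc N' = gc N \<and>
       H.mass (H.SES M N) = of_nat (card (Ext C 1 M' N')) / of_nat (card (Hom C M' N'))"
      using m o by blast
    fix q :: rat assume "\<exists>M'\<in>Obj C. \<exists>N'\<in>Obj C. gc M' = gc M \<and> gc N' = gc N \<and>
       q = of_nat (card (Ext C 1 M' N')) / of_nat (card (Hom C M' N'))"
    then obtain M' N' where n: "M' \<in> Obj C" "N' \<in> Obj C" "gc M' = gc M" "gc N' = gc N"
      "q = of_nat (card (Ext C 1 M' N')) / of_nat (card (Hom C M' N'))" by blast
    show "q = H.mass (H.SES M N)" unfolding n(5) m[OF n(1,2), symmetric] by (rule mass_gc[OF n(1,2) o n(3,4)])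
  qed
qed

lemma mass_nonzero:
  assumes o: "M \<in> Obj C" "N \<in> Obj C"
  shows "H.mass (H.SES M N) \<noteq> 0"
proof -
  obtain S i1 i2 p1 p2 where b: "L.bip M N S i1 i2 p1 p2" using L.bip_ex o by blast
  have "(S, i2, p1) \<in> L.ext_seqs M N" using L.bip_ses[OF b] by (simp add: L.ext_seqs_def)
  then have "L.ext_seqs M N // L.ext_rel M N \<noteq> {}" using quotientI by fast
  then have "card (L.ext_seqs M N // L.ext_rel M N) \<noteq> 0" using H.mass_SES(2)[OF o] by (simp add: card_eq_0_iff)
  moreover have "card (ohm M N) \<noteq> 0" using finite_ohm L.zero_hom[OF o] by (auto simp: card_eq_0_iff)
  ultimately show ?thesis using H.mass_SES(1)[OF o] by simp
qed

lemma chi_bicharacter: "bicharacter (groth_monoid C) (chi C)"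
proof (intro bicharacter.intro groth_comm_monoid bicharacter_axioms.intro)
  fix x y assume "x \<in> carrier \<Gamma>" "y \<in> carrier \<Gamma>"
  then obtain X Y where X: "X \<in> Obj C" "x = gc X" "Y \<in> Obj C" "y = gc Y" by (auto simp: carrier_groth)
  then show "chi C x y \<noteq> 0" using chi_eq mass_nonzero by simp
next
  fix x x' y assume "x \<in> carrier \<Gamma>" "x' \<in> carrier \<Gamma>" "y \<in> carrier \<Gamma>"
  then obtain X X' Y where X: "X \<in> Obj C" "x = gc X" "X' \<in> Obj C" "x' = gc X'" "Y \<in> Obj C" "y = gc Y"
    by (auto simp: carrier_groth)
  obtain S i1 i2 p1 p2 where b: "L.bip X X' S i1 i2 p1 p2" using L.bip_ex X by blast
  have S: "S \<in> Obj C" using L.bipD(1)[OF b] L.hom_obj by blast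
  show "chi C (x \<otimes>\<^bsub>\<Gamma>\<^esub> x') y = chi C x y * chi C x' y"
    unfolding X gc_mult_bip[OF b] using chi_eq X S H.mass_SES_left[OF L.bip_ses[OF b] X(5)] by simp
  show "chi C y (x \<otimes>\<^bsub>\<Gamma>\<^esub> x') = chi C y x * chi C y x'"
    unfolding X gc_mult_bip[OF b] using chi_eq X S H.mass_SES_right[OF L.bip_ses[OF b] X(5)] by simp
qed

end

section \<open>Tensor products\<close>

abbreviation coef :: "('a \<Rightarrow>\<^sub>0 'b::zero) \<Rightarrow> 'a \<Rightarrow> 'b" where "coef \<equiv> Poly_Mapping.lookup"
abbreviation supp :: "('a \<Rightarrow>\<^sub>0 'b::zero) \<Rightarrow> 'a set" where "supp \<equiv> Poly_Mapping.keys"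
type_synonym 'a rat_comb = "'a \<Rightarrow>\<^sub>0 rat"

definition lin :: "('u::rat_vector \<Rightarrow> 'v::rat_vector) \<Rightarrow> bool" where
  "lin f \<longleftrightarrow> (\<forall>x y. f (x + y) = f x + f y) \<and> (\<forall>c x. f (c *\<^sub>Q x) = c *\<^sub>Q f x)"

lemma linD: "lin f \<Longrightarrow> f (x + y) = f x + f y" "lin f \<Longrightarrow> f (c *\<^sub>Q x) = c *\<^sub>Q f x"
  by (simp_all add: lin_def)

lemma linI: "(\<And>x y. f (x + y) = f x + f y) \<Longrightarrow> (\<And>c x. f (c *\<^sub>Q x) = c *\<^sub>Q f x) \<Longrightarrow> lin f"
  by (simp add: lin_def)

lemma lin_linear: "lin f \<longleftrightarrow> Vector_Spaces.linear scaleQ scaleQ f"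
  unfolding lin_def Vector_Spaces.linear_def module_hom_def module_hom_axioms_def
  by (auto intro: Q.vector_space_axioms Q.module_axioms)

lemma lin_0: "lin f \<Longrightarrow> f 0 = 0"
  using linD(2)[of f 0 0] by simp

lemma lin_neg: "lin f \<Longrightarrow> f (- x) = - f x"
  using linD(2)[of f "-1" x] by simp

lemma lin_diff: "lin f \<Longrightarrow> f (x - y) = f x - f y"
  using linD(1)[of f x "- y"] lin_neg[of f y] by simp

lemma lin_sum: "lin f \<Longrightarrow> f (\<Sum>i\<in>A. h i) = (\<Sum>i\<in>A. f (h i))"
  by (induction A rule: infinite_finite_induct) (simp_all add: lin_0 linD)

lemma lin_compose: "lin f \<Longrightarrow> lin h \<Longrightarrow> lin (\<lambda>x. f (h x))"
  by (simp add: lin_def)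

lemma lin_zero: "lin (\<lambda>x. 0)"
  by (simp add: lin_def)

lemma lin_id: "lin (\<lambda>x. x)"
  by (simp add: lin_def)

lemma lin_add: "lin f \<Longrightarrow> lin h \<Longrightarrow> lin (\<lambda>x. f x + h x)"
  by (simp add: lin_def scaleQ_add_right add_ac)

lemma lin_scale: "lin f \<Longrightarrow> lin (\<lambda>x. c *\<^sub>Q f x)"
  by (simp add: lin_def scaleQ_add_right scaleQ_scaleQ mult.commute)

lemma lin_sum_fun: "(\<And>i. i \<in> A \<Longrightarrow> lin (f i)) \<Longrightarrow> lin (\<lambda>x. \<Sum>i\<in>A. f i x)"
  by (induction A rule: infinite_finite_induct) (auto simp: lin_add, auto simp: lin_def)

lemma lin_mult_right: "lin (\<lambda>x::rat. x * c)" "lin (\<lambda>x::rat. c * x)"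
  by (simp_all add: lin_def scaleQ_rat_def algebra_simps)

lemma lin_eq_on_span:
  assumes "lin f" "lin h" "\<And>x. x \<in> B \<Longrightarrow> f x = h x" "x \<in> Q.span B"
  shows "f x = h x"
  using assms(4)
proof (induction rule: Q.span_induct_alt)
  case base
  then show ?case using assms(1,2) lin_0 by metis
next
  case (step c x y)
  then show ?case using assms by (simp add: linD)
qed

lemma lin_span_image:
  assumes "lin f" "\<And>x. x \<in> B \<Longrightarrow> f x \<in> W" "Q.subspace W" "x \<in> Q.span B"
  shows "f x \<in> W"
  using assms(4)
proof (induction rule: Q.span_induct_alt)
  case base
  then show ?case using assms(1,3) lin_0 Q.subspace_0 by metis
next
  case (step c x y)
  then show ?case using assms by (simp add: linD Q.subspace_add Q.subspace_scale)
qed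

definition bilin :: "('u::rat_vector \<Rightarrow> 'v::rat_vector \<Rightarrow> 'w::rat_vector) \<Rightarrow> bool" where
  "bilin \<beta> \<longleftrightarrow> (\<forall>v. lin (\<lambda>u. \<beta> u v)) \<and> (\<forall>u. lin (\<beta> u))"

lemma bilinI: "(\<And>v. lin (\<lambda>u. \<beta> u v)) \<Longrightarrow> (\<And>u. lin (\<beta> u)) \<Longrightarrow> bilin \<beta>"
  by (simp add: bilin_def)

lemma bilinD: "bilin \<beta> \<Longrightarrow> lin (\<lambda>u. \<beta> u v)" "bilin \<beta> \<Longrightarrow> lin (\<beta> u)"
  by (simp_all add: bilin_def)

lemma bilin_eq_on_span:
  assumes "bilin f" "bilin h" "\<And>x y. x \<in> A \<Longrightarrow> y \<in> B \<Longrightarrow> f x y = h x y" "x \<in> Q.span A" "y \<in> Q.span B"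
  shows "f x y = h x y"
proof (rule lin_eq_on_span[OF bilinD(1)[OF assms(1)] bilinD(1)[OF assms(2)] _ assms(4)])
  fix a assume "a \<in> A"
  then show "f a y = h a y"
    using lin_eq_on_span[OF bilinD(2)[OF assms(1)] bilinD(2)[OF assms(2)] _ assms(5)] assms(3) by blast
qed

abbreviation bas :: "'a \<Rightarrow> ('a \<Rightarrow>\<^sub>0 rat)" where
  "bas a \<equiv> Poly_Mapping.single a 1"

text \<open>The linear map with prescribed values on the basis. Products, coproducts and forms below
  are brought into this shape, which makes their linearity automatic.\<close>

definition lext :: "('a \<Rightarrow> 'v::rat_vector) \<Rightarrow> ('a \<Rightarrow>\<^sub>0 rat) \<Rightarrow> 'v" where
  "lext f x = (\<Sum>a\<in>supp x. coef x a *\<^sub>Q f a)"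

lemma lext_superset:
  "finite J \<Longrightarrow> supp x \<subseteq> J \<Longrightarrow> lext f x = (\<Sum>a\<in>J. coef x a *\<^sub>Q f a)"
  unfolding lext_def by (rule sum.mono_neutral_left) (auto simp: in_keys_iff)

lemma lin_lext: "lin (lext f)"
proof (rule linI)
  fix x y :: "'a \<Rightarrow>\<^sub>0 rat" and c :: rat
  let ?J = "supp x \<union> supp y"
  have "supp (x + y) \<subseteq> ?J" by (rule Poly_Mapping.keys_add)
  then show "lext f (x + y) = lext f x + lext f y"
    by (simp add: lext_superset[of ?J] lookup_add scaleQ_add_left sum.distrib)
  have "supp (c *\<^sub>Q x) \<subseteq> supp x"
    by (auto simp: in_keys_iff lookup_scaleQ scaleQ_rat_def)
  then show "lext f (c *\<^sub>Q x) = c *\<^sub>Q lext f x"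
    by (simp add: lext_superset[of "supp x"] lookup_scaleQ scaleQ_rat_def Q.scale_sum_right scaleQ_scaleQ)
qed

lemma lext_basis: "lext f (bas a) = f a"
  by (simp add: lext_def scaleQ_one)

lemma lin_lookup: "lin (\<lambda>x::'a \<Rightarrow>\<^sub>0 rat. coef x a)"
  by (rule linI) (simp_all add: lookup_add lookup_scaleQ)

lemma poly_basis_sum: "(x :: 'a \<Rightarrow>\<^sub>0 rat) = (\<Sum>a\<in>supp x. coef x a *\<^sub>Q bas a)"
proof (rule poly_mapping_eqI)
  fix k
  have "coef (\<Sum>a\<in>supp x. coef x a *\<^sub>Q bas a) k =
    (\<Sum>a\<in>supp x. coef x a * (if a = k then 1 else 0))"
    by (simp add: lookup_sum lookup_scaleQ scaleQ_rat_def lookup_single when_def)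
  also have "\<dots> = coef x k" by (simp add: in_keys_iff if_distrib cong: if_cong)
  finally show "coef x k = coef (\<Sum>a\<in>supp x. coef x a *\<^sub>Q bas a) k" by simp
qed

lemma span_basis_iff: "x \<in> Q.span (bas ` J) \<longleftrightarrow> supp x \<subseteq> J"
proof
  assume "x \<in> Q.span (bas ` J)"
  then show "supp x \<subseteq> J"
  proof (induction rule: Q.span_induct_alt)
    case (step c x y)
    then obtain a where a: "a \<in> J" "x = bas a" by blast
    have "supp (c *\<^sub>Q x) \<subseteq> {a}"
      unfolding a by (auto simp: in_keys_iff lookup_scaleQ scaleQ_rat_def lookup_single when_def split: if_splits)
    then show ?case using step Poly_Mapping.keys_add[of "c *\<^sub>Q x" y] a by blast
  qed simp
next
  assume k: "supp x \<subseteq> J"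
  show "x \<in> Q.span (bas ` J)"
    by (subst poly_basis_sum, rule Q.span_sum, rule Q.span_scale, rule Q.span_base) (use k in blast)
qed

lemma bilin_lext: "bilin (\<lambda>x y. lext (\<lambda>a. lext (f a) y) x)"
proof (rule bilinI)
  show "lin (\<lambda>x. lext (\<lambda>a. lext (f a) y) x)" for y by (rule lin_lext)
  show "lin (\<lambda>y. lext (\<lambda>a. lext (f a) y) x)" for x
    unfolding lext_def[of _ x] by (intro lin_sum_fun lin_scale lin_lext)
qed

lemma pure_bilin: "bilin (pure_tensor :: 'c::rat_vector \<Rightarrow> 'd::rat_vector \<Rightarrow> _)"
proof -
  have "(u + u') \<otimes>\<^sub>Q v = u \<otimes>\<^sub>Q v + u' \<otimes>\<^sub>Q v" for u u' :: "'c::rat_vector" and v :: "'d::rat_vector"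
    by transfer (unfold tensor_eq_def diff_diff_eq[symmetric] tensor_relations_def, rule Q.span_base, blast)
  moreover have "u \<otimes>\<^sub>Q (v + v') = u \<otimes>\<^sub>Q v + u \<otimes>\<^sub>Q v'" for u :: "'c::rat_vector" and v v' :: "'d::rat_vector"
    by transfer (unfold tensor_eq_def diff_diff_eq[symmetric] tensor_relations_def, rule Q.span_base, blast)
  moreover have "(c *\<^sub>Q u) \<otimes>\<^sub>Q v = c *\<^sub>Q (u \<otimes>\<^sub>Q v)" for c and u :: "'c::rat_vector" and v :: "'d::rat_vector"
    by transfer (unfold tensor_eq_def tensor_relations_def, rule Q.span_base, blast)
  moreover have "u \<otimes>\<^sub>Q (c *\<^sub>Q v) = c *\<^sub>Q (u \<otimes>\<^sub>Q v)" for c and u :: "'c::rat_vector" and v :: "'d::rat_vector"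
    by transfer (unfold tensor_eq_def tensor_relations_def, rule Q.span_base, blast)
  ultimately show ?thesis by (simp add: bilin_def lin_def)
qed

lemmas pure_lin = bilinD[OF pure_bilin]

lemma lin_abs_tensor: "lin abs_tensor"
  by (rule linI) (simp_all add: plus_tensor.abs_eq scaleQ_tensor.abs_eq)

lemma abs_tensor_bas: "abs_tensor (bas (u, v)) = u \<otimes>\<^sub>Q v"
  by (simp add: pure_tensor.abs_eq)

lemma abs_tensor_surj: "\<exists>s. t = abs_tensor s"
  by (metis Quotient3_abs_rep Quotient3_tensor)

lemma tensor_span: "Q.span {u \<otimes>\<^sub>Q v | u v. True} = (UNIV :: ('u::rat_vector, 'v::rat_vector) tensor set)"
proof (intro equalityI subsetI UNIV_I)
  fix t :: "('u::rat_vector, 'v::rat_vector) tensor"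
  obtain s where s: "t = abs_tensor s" using abs_tensor_surj by blast
  have "t = (\<Sum>k\<in>supp s. coef s k *\<^sub>Q abs_tensor (bas k))"
    unfolding s by (subst poly_basis_sum[of s]) (simp add: lin_sum[OF lin_abs_tensor] linD[OF lin_abs_tensor])
  also have "\<dots> \<in> Q.span {u \<otimes>\<^sub>Q v | u v. True}"
  proof (intro Q.span_sum Q.span_scale Q.span_base)
    fix k :: "'u \<times> 'v"
    show "abs_tensor (bas k) \<in> {u \<otimes>\<^sub>Q v | u v. True}" using abs_tensor_bas[of "fst k" "snd k"] by auto
  qed
  finally show "t \<in> Q.span {u \<otimes>\<^sub>Q v | u v. True}" .
qed

lemma tensor_lin_eqI:
  assumes "lin f" "lin h" "\<And>u v. f (u \<otimes>\<^sub>Q v) = h (u \<otimes>\<^sub>Q v)"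
  shows "f t = h t"
  by (rule lin_eq_on_span[OF assms(1,2), of "{u \<otimes>\<^sub>Q v | u v. True}"]) (use assms(3) tensor_span in auto)

text \<open>The linear extension of \<open>\<beta>\<close> to formal combinations of pairs vanishes
  on the bilinearity relations, so it does not depend on the representative of a tensor.\<close>

lemma tensor_universal:
  fixes \<beta> :: "'u::rat_vector \<Rightarrow> 'v::rat_vector \<Rightarrow> 'w::rat_vector"
  assumes \<beta>: "bilin \<beta>"
  shows "\<exists>L. lin L \<and> (\<forall>u v. L (u \<otimes>\<^sub>Q v) = \<beta> u v)"
proof -
  let ?f = "lext (\<lambda>(u, v). \<beta> u v)"
  have rel: "?f r = 0" if "r \<in> tensor_relations" for r
    using that linD[OF bilinD(1)[OF \<beta>]] linD[OF bilinD(2)[OF \<beta>]]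
    unfolding tensor_relations_def
    by (auto simp: lin_diff[OF lin_lext] linD(2)[OF lin_lext] lext_basis)
  have "?f r = 0" if "r \<in> Q.span tensor_relations" for r
    by (rule lin_eq_on_span[OF lin_lext lin_zero rel that])
  then have eq: "?f s = ?f t" if "tensor_eq s t" for s t
    using that lin_diff[OF lin_lext] unfolding tensor_eq_def by (metis eq_iff_diff_eq_0)
  define L where "L t = ?f (rep_tensor t)" for t
  have L: "L (abs_tensor s) = ?f s" for s
  proof -
    have "tensor_eq (rep_tensor (abs_tensor s)) s"
      using Quotient3_tensor tensor.abs_eq_iff by (metis Quotient3_abs_rep)
    then show ?thesis unfolding L_def by (rule eq)
  qed
  have "lin L"
  proof (rule linI)
    fix x y :: "('u, 'v) tensor" and c
    obtain s r where x: "x = abs_tensor s" and y: "y = abs_tensor r" using abs_tensor_surj by meson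
    show "L (x + y) = L x + L y" unfolding x y linD(1)[OF lin_abs_tensor, symmetric] L by (rule linD(1)[OF lin_lext])
    show "L (c *\<^sub>Q x) = c *\<^sub>Q L x" unfolding x linD(2)[OF lin_abs_tensor, symmetric] L by (rule linD(2)[OF lin_lext])
  qed
  moreover have "L (u \<otimes>\<^sub>Q v) = \<beta> u v" for u v
    using L[of "bas (u, v)"] by (simp add: abs_tensor_bas lext_basis)
  ultimately show ?thesis by blast
qed

definition bilin_on where
  "bilin_on U V \<beta> \<longleftrightarrow> (\<forall>v\<in>V. linear_on U (\<lambda>u. \<beta> u v)) \<and> (\<forall>u\<in>U. linear_on V (\<beta> u))"

text \<open>Over a field the inclusion of a subspace has a linear left inverse. Composition with
  such projections is what extends maps from subspaces to the ambient spaces.\<close>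

lemma projection_ex:
  fixes U :: "'u::rat_vector set"
  assumes "Q.subspace U"
  shows "\<exists>p. lin p \<and> (\<forall>x. p x \<in> U) \<and> (\<forall>x\<in>U. p x = x)"
proof -
  have "Vector_Spaces.linear scaleQ scaleQ (\<lambda>x::'u. x)" using lin_id lin_linear by metis
  moreover have "vector_space_pair (scaleQ :: rat \<Rightarrow> 'u \<Rightarrow> 'u) (scaleQ :: rat \<Rightarrow> 'u \<Rightarrow> 'u)" by unfold_locales
  ultimately obtain p :: "'u \<Rightarrow> 'u" where "p ` UNIV \<subseteq> U" "Vector_Spaces.linear scaleQ scaleQ p" "\<forall>x\<in>U. p x = x"
    using vector_space_pair.linear_exists_left_inverse_on[of scaleQ scaleQ "\<lambda>x::'u. x" U] assms by (auto simp: inj_on_def)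
  then show ?thesis unfolding lin_linear by blast
qed

text \<open>A map that is bilinear on a pair of subspaces is the restriction of a globally bilinear one.\<close>

lemma tensor_lift_ex:
  assumes U: "Q.subspace U" and V: "Q.subspace V" and \<beta>: "bilin_on U V \<beta>"
  shows "\<exists>L. lin L \<and> (\<forall>u\<in>U. \<forall>v\<in>V. L (u \<otimes>\<^sub>Q v) = \<beta> u v) \<and> (\<forall>t\<in>tensor_space U V. tensor_lift U V \<beta> t = L t)"
proof -
  obtain p where p: "lin p" "\<And>x. p x \<in> U" "\<And>x. x \<in> U \<Longrightarrow> p x = x" using projection_ex[OF U] by blast
  obtain q where q: "lin q" "\<And>x. q x \<in> V" "\<And>x. x \<in> V \<Longrightarrow> q x = x" using projection_ex[OF V] by blast
  have "bilin (\<lambda>u v. \<beta> (p u) (q v))"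
    using \<beta> p q unfolding bilin_def bilin_on_def lin_def linear_on_def by simp
  then obtain L where L: "lin L" "\<And>u v. L (u \<otimes>\<^sub>Q v) = \<beta> (p u) (q v)" using tensor_universal by blast
  have Luv: "L (u \<otimes>\<^sub>Q v) = \<beta> u v" if "u \<in> U" "v \<in> V" for u v using L p q that by simp
  have Ls: "L (\<Sum>(u, v)\<leftarrow>ps. u \<otimes>\<^sub>Q v) = (\<Sum>(u, v)\<leftarrow>ps. \<beta> u v)" if "set ps \<subseteq> U \<times> V" for ps
    using that by (induction ps) (auto simp: lin_0[OF L(1)] linD(1)[OF L(1)] Luv)
  have "tensor_lift U V \<beta> t = L t" if t: "t \<in> tensor_space U V" for t
  proof -
    have ex: "\<exists>ps. set ps \<subseteq> U \<times> V \<and> t = (\<Sum>(u, v)\<leftarrow>ps. u \<otimes>\<^sub>Q v)"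
      using t unfolding tensor_space_def
    proof (induction rule: Q.span_induct_alt)
      case base
      show ?case by (rule exI[of _ "[]"]) simp
    next
      case (step c x y)
      then obtain u v ps where h: "x = u \<otimes>\<^sub>Q v" "u \<in> U" "v \<in> V" "set ps \<subseteq> U \<times> V" "y = (\<Sum>(u, v)\<leftarrow>ps. u \<otimes>\<^sub>Q v)" by blast
      have "c *\<^sub>Q x = (c *\<^sub>Q u) \<otimes>\<^sub>Q v" by (simp only: h linD(2)[OF pure_lin(1)])
      then show ?case using h Q.subspace_scale[OF U] by (intro exI[of _ "(c *\<^sub>Q u, v) # ps"]) simp
    qed
    show ?thesis
      unfolding tensor_lift_def
    proof (rule the_equality)
      show "\<exists>ps. set ps \<subseteq> U \<times> V \<and> t = (\<Sum>(u, v)\<leftarrow>ps. u \<otimes>\<^sub>Q v) \<and> L t = (\<Sum>(u, v)\<leftarrow>ps. \<beta> u v)" using ex Ls by metis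
      show "w = L t" if "\<exists>ps. set ps \<subseteq> U \<times> V \<and> t = (\<Sum>(u, v)\<leftarrow>ps. u \<otimes>\<^sub>Q v) \<and> w = (\<Sum>(u, v)\<leftarrow>ps. \<beta> u v)" for w
        using that Ls by metis
    qed
  qed
  then show ?thesis using L(1) Luv by blast
qed

lemma pure_in_tensor_space: "u \<in> U \<Longrightarrow> v \<in> V \<Longrightarrow> u \<otimes>\<^sub>Q v \<in> tensor_space U V"
  unfolding tensor_space_def by (blast intro: Q.span_base)

text \<open>The working rule for evaluating \<open>tensor_lift\<close>: a globally linear map with
  the right values on pure tensors computes it.\<close>

lemma tensor_lift_eq:
  assumes U: "Q.subspace U" and V: "Q.subspace V" and L: "lin L"
    and e: "\<And>u v. u \<in> U \<Longrightarrow> v \<in> V \<Longrightarrow> \<beta> u v = L (u \<otimes>\<^sub>Q v)" and t: "t \<in> tensor_space U V"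
  shows "tensor_lift U V \<beta> t = L t"
proof -
  have "bilin_on U V \<beta>"
    unfolding bilin_on_def linear_on_def using e U V
    by (simp add: Q.subspace_add Q.subspace_scale linD[OF pure_lin(1)] linD[OF pure_lin(2)] linD[OF L])
  from tensor_lift_ex[OF U V this] obtain L' where L': "lin L'" "\<And>u v. u \<in> U \<Longrightarrow> v \<in> V \<Longrightarrow> L' (u \<otimes>\<^sub>Q v) = \<beta> u v"
    "tensor_lift U V \<beta> t = L' t" using t by blast
  have "L' t = L t" by (rule lin_eq_on_span[OF L'(1) L]) (use e L'(2) t in \<open>auto simp: tensor_space_def\<close>)
  then show ?thesis using L'(3) by simp
qed

text \<open>Coordinate functionals for the tensors of basis vectors. The choice is harmless:
  existence is \<open>tensor_universal\<close>, and the values on pure tensors determine a linear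
  map.\<close>

definition tcoef :: "('a \<Rightarrow>\<^sub>0 rat, 'b \<Rightarrow>\<^sub>0 rat) tensor \<Rightarrow> 'a \<Rightarrow> 'b \<Rightarrow> rat" where
  "tcoef t a b = (SOME L. lin L \<and> (\<forall>u v. L (u \<otimes>\<^sub>Q v) = coef u a * coef v b)) t"

lemma tcoef: "lin (\<lambda>t. tcoef t a b)" "tcoef (u \<otimes>\<^sub>Q v) a b = coef u a * coef v b"
proof -
  have "bilin (\<lambda>(u :: _ \<Rightarrow>\<^sub>0 rat) (v :: _ \<Rightarrow>\<^sub>0 rat). coef u a * coef v b)"
    by (rule bilinI; rule linI) (simp_all add: lookup_add lookup_scaleQ scaleQ_rat_def algebra_simps)
  from someI_ex[OF tensor_universal[OF this]]
  show "lin (\<lambda>t. tcoef t a b)" "tcoef (u \<otimes>\<^sub>Q v) a b = coef u a * coef v b"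
    unfolding tcoef_def by blast+
qed

lemma tensor_basis_span: "Q.span {bas a \<otimes>\<^sub>Q bas b | a b. True} = (UNIV :: ('a \<Rightarrow>\<^sub>0 rat, 'b \<Rightarrow>\<^sub>0 rat) tensor set)"
proof -
  have "u \<otimes>\<^sub>Q v \<in> Q.span {bas a \<otimes>\<^sub>Q bas b | a b. True}" for u :: "'a \<Rightarrow>\<^sub>0 rat" and v :: "'b \<Rightarrow>\<^sub>0 rat"
  proof -
    have "u \<otimes>\<^sub>Q v = (\<Sum>a\<in>supp u. \<Sum>b\<in>supp v.
      coef u a *\<^sub>Q coef v b *\<^sub>Q (bas a \<otimes>\<^sub>Q bas b))"
      by (subst poly_basis_sum[of u], subst poly_basis_sum[of v],
        simp add: lin_sum[OF pure_lin(1)] lin_sum[OF pure_lin(2)] linD[OF pure_lin(1)] linD[OF pure_lin(2)] Q.scale_sum_right,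
        subst sum.swap, simp add: mult.commute)
    also have "\<dots> \<in> Q.span {bas a \<otimes>\<^sub>Q bas b | a b. True}"
      by (intro Q.span_sum Q.span_scale Q.span_base) blast
    finally show ?thesis .
  qed
  then have "{u \<otimes>\<^sub>Q v | (u :: 'a \<Rightarrow>\<^sub>0 rat) (v :: 'b \<Rightarrow>\<^sub>0 rat). True} \<subseteq> Q.span {bas a \<otimes>\<^sub>Q bas b | a b. True}" by blast
  then have "Q.span {u \<otimes>\<^sub>Q v | (u :: 'a \<Rightarrow>\<^sub>0 rat) (v :: 'b \<Rightarrow>\<^sub>0 rat). True} \<subseteq> Q.span {bas a \<otimes>\<^sub>Q bas b | (a::'a) (b::'b). True}"
    by (rule Q.span_minimal) simp
  then show ?thesis unfolding tensor_span by blast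
qed

text \<open>Tensors of basis vectors span, so every tensor is the finite sum of them weighted by its
  own coordinates.\<close>

lemma tensor_coef_eqI:
  assumes "\<And>a b. tcoef s a b = tcoef t a b"
  shows "s = t"
proof -
  have ex: "\<exists>J. finite J \<and> t = (\<Sum>(a, b)\<in>J. tcoef t a b *\<^sub>Q (bas a \<otimes>\<^sub>Q bas b)) \<and> (\<forall>a b. (a, b) \<notin> J \<longrightarrow> tcoef t a b = 0)"
    for t :: "('a \<Rightarrow>\<^sub>0 rat, 'b \<Rightarrow>\<^sub>0 rat) tensor"
  proof -
    have "t \<in> Q.span {bas a \<otimes>\<^sub>Q bas b | a b. True}" using tensor_basis_span by blast
    then show ?thesis
    proof (induction rule: Q.span_induct_alt)
      case base
      show ?case by (rule exI[of _ "{}"]) (simp add: lin_0[OF tcoef(1)])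
    next
      case (step c x y)
      then obtain a b J where x: "x = bas a \<otimes>\<^sub>Q bas b" and J: "finite J"
        "y = (\<Sum>(a, b)\<in>J. tcoef y a b *\<^sub>Q (bas a \<otimes>\<^sub>Q bas b))" "\<forall>a b. (a, b) \<notin> J \<longrightarrow> tcoef y a b = 0" by blast
      let ?J = "insert (a, b) J"
      have cx: "tcoef (c *\<^sub>Q x + y) a' b' = (if (a', b') = (a, b) then c else 0) + tcoef y a' b'" for a' b'
        by (simp add: linD[OF tcoef(1)] x tcoef(2) lookup_single when_def scaleQ_rat_def)
      have "(\<Sum>(a', b')\<in>?J. tcoef (c *\<^sub>Q x + y) a' b' *\<^sub>Q (bas a' \<otimes>\<^sub>Q bas b'))
        = (\<Sum>p\<in>?J. (if p = (a, b) then c *\<^sub>Q x else 0)) + (\<Sum>(a', b')\<in>?J. tcoef y a' b' *\<^sub>Q (bas a' \<otimes>\<^sub>Q bas b'))"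
        unfolding sum.distrib[symmetric] by (rule sum.cong) (auto simp: cx[unfolded x] scaleQ_add_left x split: if_splits)
      also have "(\<Sum>p\<in>?J. (if p = (a, b) then c *\<^sub>Q x else 0)) = c *\<^sub>Q x" using J(1) by simp
      also have "(\<Sum>(a', b')\<in>?J. tcoef y a' b' *\<^sub>Q (bas a' \<otimes>\<^sub>Q bas b')) = y"
        by (subst J(2), rule sum.mono_neutral_right) (use J in auto)
      finally show ?case using J cx by (intro exI[of _ ?J]) auto
    qed
  qed
  from ex[of s] obtain J where J: "finite J" "s = (\<Sum>(a, b)\<in>J. tcoef s a b *\<^sub>Q (bas a \<otimes>\<^sub>Q bas b))"
    "\<forall>a b. (a, b) \<notin> J \<longrightarrow> tcoef s a b = 0" by blast
  from ex[of t] obtain K where K: "finite K" "t = (\<Sum>(a, b)\<in>K. tcoef t a b *\<^sub>Q (bas a \<otimes>\<^sub>Q bas b))"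
    "\<forall>a b. (a, b) \<notin> K \<longrightarrow> tcoef t a b = 0" by blast
  have "s = (\<Sum>(a, b)\<in>J \<union> K. tcoef s a b *\<^sub>Q (bas a \<otimes>\<^sub>Q bas b))"
    by (subst J(2), rule sum.mono_neutral_left) (use J K in auto)
  moreover have "t = (\<Sum>(a, b)\<in>J \<union> K. tcoef t a b *\<^sub>Q (bas a \<otimes>\<^sub>Q bas b))"
    by (subst K(2), rule sum.mono_neutral_left) (use J K in auto)
  ultimately show ?thesis using assms by simp
qed

lemma lin_lext_comm: "lin L \<Longrightarrow> L (lext f x) = lext (\<lambda>a. L (f a)) x"
  unfolding lext_def by (simp add: lin_sum linD)

lemma lin_lext_fun: "(\<And>a. lin (f a)) \<Longrightarrow> lin (\<lambda>y. lext (\<lambda>a. f a y) x)"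
  unfolding lext_def by (intro lin_sum_fun lin_scale)

text \<open>Two applications of the universal property, one for each tensor. It extends the braided
  multiplication to the whole tensor square.\<close>

lemma tensor_universal4:
  fixes q :: "'u::rat_vector \<Rightarrow> 'v::rat_vector \<Rightarrow> 'w::rat_vector \<Rightarrow> 'x::rat_vector \<Rightarrow> 'y::rat_vector"
  assumes "\<And>b c d. lin (\<lambda>a. q a b c d)" "\<And>a c d. lin (\<lambda>b. q a b c d)"
    "\<And>a b d. lin (\<lambda>c. q a b c d)" "\<And>a b c. lin (\<lambda>d. q a b c d)"
  shows "\<exists>M. bilin M \<and> (\<forall>a b c d. M (a \<otimes>\<^sub>Q b) (c \<otimes>\<^sub>Q d) = q a b c d)"
proof -
  have "\<exists>L. lin L \<and> (\<forall>c d. L (c \<otimes>\<^sub>Q d) = q a b c d)" for a b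
    by (rule tensor_universal) (use assms in \<open>simp add: bilin_def\<close>)
  then obtain L where L: "\<And>a b. lin (L a b)" "\<And>a b c d. L a b (c \<otimes>\<^sub>Q d) = q a b c d" by metis
  have "bilin (\<lambda>a b. L a b t)" for t
  proof (rule bilinI; rule linI)
    fix a a' b b' r
    show "L (a + a') b t = L a b t + L a' b t"
      by (rule tensor_lin_eqI[OF L(1) lin_add[OF L(1) L(1)]]) (simp add: L(2) linD[OF assms(1)])
    show "L (r *\<^sub>Q a) b t = r *\<^sub>Q L a b t"
      by (rule tensor_lin_eqI[OF L(1) lin_scale[OF L(1)]]) (simp add: L(2) linD[OF assms(1)])
    show "L a (b + b') t = L a b t + L a b' t"
      by (rule tensor_lin_eqI[OF L(1) lin_add[OF L(1) L(1)]]) (simp add: L(2) linD[OF assms(2)])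
    show "L a (r *\<^sub>Q b) t = r *\<^sub>Q L a b t"
      by (rule tensor_lin_eqI[OF L(1) lin_scale[OF L(1)]]) (simp add: L(2) linD[OF assms(2)])
  qed
  then have "\<exists>K. lin K \<and> (\<forall>a b. K (a \<otimes>\<^sub>Q b) = L a b t)" for t by (rule tensor_universal)
  then obtain K where K: "\<And>t. lin (K t)" "\<And>t a b. K t (a \<otimes>\<^sub>Q b) = L a b t" by metis
  have "lin (\<lambda>t. K t s)" for s
  proof (rule linI)
    fix t t' r
    show "K (t + t') s = K t s + K t' s"
      by (rule tensor_lin_eqI[OF K(1) lin_add[OF K(1) K(1)]]) (simp add: K(2) linD[OF L(1)])
    show "K (r *\<^sub>Q t) s = r *\<^sub>Q K t s"
      by (rule tensor_lin_eqI[OF K(1) lin_scale[OF K(1)]]) (simp add: K(2) linD[OF L(1)])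
  qed
  then have "bilin (\<lambda>s t. K t s)" using K(1) by (simp add: bilin_def)
  then show ?thesis using K(2) L(2) by (intro exI[of _ "\<lambda>s t. K t s"]) simp
qed

lemma tensor_assoc_ex:
  fixes U :: "'u::rat_vector set" and V :: "'v::rat_vector set" and W :: "'w::rat_vector set"
  assumes U: "Q.subspace U" and V: "Q.subspace V" and W: "Q.subspace W"
  shows "\<exists>L :: (('u, 'v) tensor, 'w) tensor \<Rightarrow> ('u, ('v, 'w) tensor) tensor. lin L \<and> (\<forall>u v w. L ((u \<otimes>\<^sub>Q v) \<otimes>\<^sub>Q w) = u \<otimes>\<^sub>Q (v \<otimes>\<^sub>Q w)) \<and>
    (\<forall>t\<in>tensor_space (tensor_space U V) W. tensor_assoc U V W t = L t)"
proof -
  have "\<exists>K :: ('u, 'v) tensor \<Rightarrow> _. lin K \<and> (\<forall>u v. K (u \<otimes>\<^sub>Q v) = u \<otimes>\<^sub>Q (v \<otimes>\<^sub>Q w))" for w :: 'w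
    by (rule tensor_universal) (intro bilinI pure_lin lin_compose[OF pure_lin(2) pure_lin(1)])
  then obtain K :: "'w \<Rightarrow> ('u, 'v) tensor \<Rightarrow> ('u, ('v, 'w) tensor) tensor"
    where K: "\<And>w. lin (K w)" "\<And>w u v. K w (u \<otimes>\<^sub>Q v) = u \<otimes>\<^sub>Q (v \<otimes>\<^sub>Q w)" by metis
  have "lin (\<lambda>w. K w t)" for t
  proof (rule linI)
    fix w w' r
    show "K (w + w') t = K w t + K w' t"
      by (rule tensor_lin_eqI[OF K(1) lin_add[OF K(1) K(1)]]) (simp add: K(2) linD[OF pure_lin(2)])
    show "K (r *\<^sub>Q w) t = r *\<^sub>Q K w t"
      by (rule tensor_lin_eqI[OF K(1) lin_scale[OF K(1)]]) (simp add: K(2) linD[OF pure_lin(2)])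
  qed
  then have "bilin (\<lambda>t w. K w t)" using K(1) by (simp add: bilin_def)
  from tensor_universal[OF this] obtain L where L: "lin L" "\<And>t w. L (t \<otimes>\<^sub>Q w) = K w t" by blast
  have "tensor_assoc U V W t = L t" if t: "t \<in> tensor_space (tensor_space U V) W" for t
    unfolding tensor_assoc_def
  proof (rule tensor_lift_eq[OF _ W L(1) _ t])
    show "Q.subspace (tensor_space U V)" by (simp add: tensor_space_def)
    fix s w assume "s \<in> tensor_space U V" "w \<in> W"
    then show "tensor_lift U V (\<lambda>u v. u \<otimes>\<^sub>Q (v \<otimes>\<^sub>Q w)) s = L (s \<otimes>\<^sub>Q w)"
      unfolding L(2) by (intro tensor_lift_eq[OF U V K(1)]) (simp_all add: K(2))
  qed
  then show ?thesis using L K by auto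
qed

lemma components_eq:
  assumes gr: "graded_space G U" and f: "finite {\<gamma>. f \<gamma> \<noteq> 0}" "{\<gamma>. f \<gamma> \<noteq> 0} \<subseteq> carrier G"
    "\<And>\<gamma>. \<gamma> \<in> carrier G \<Longrightarrow> f \<gamma> \<in> U \<gamma>" "u = (\<Sum>\<gamma> | f \<gamma> \<noteq> 0. f \<gamma>)"
  shows "components G U u = f"
  unfolding components_def
proof (rule the_equality)
  show "finite {\<gamma>. f \<gamma> \<noteq> 0} \<and> {\<gamma>. f \<gamma> \<noteq> 0} \<subseteq> carrier G \<and> (\<forall>\<gamma>\<in>carrier G. f \<gamma> \<in> U \<gamma>) \<and> u = (\<Sum>\<gamma> | f \<gamma> \<noteq> 0. f \<gamma>)"
    using f by blast
  fix h assume h: "finite {\<gamma>. h \<gamma> \<noteq> 0} \<and> {\<gamma>. h \<gamma> \<noteq> 0} \<subseteq> carrier G \<and> (\<forall>\<gamma>\<in>carrier G. h \<gamma> \<in> U \<gamma>) \<and> u = (\<Sum>\<gamma> | h \<gamma> \<noteq> 0. h \<gamma>)"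
  let ?K = "{\<gamma>. f \<gamma> \<noteq> 0} \<union> {\<gamma>. h \<gamma> \<noteq> 0}"
  have fK: "finite ?K" "?K \<subseteq> carrier G" using f h by auto
  have "u = (\<Sum>\<gamma>\<in>?K. f \<gamma>)" unfolding f(4) by (rule sum.mono_neutral_left) (use fK in auto)
  moreover have "u = (\<Sum>\<gamma>\<in>?K. h \<gamma>)" using h by (subst conjunct2[OF conjunct2[OF conjunct2[OF h]]], intro sum.mono_neutral_left) (use fK in auto)
  ultimately have "(\<Sum>\<gamma>\<in>?K. h \<gamma> - f \<gamma>) = 0" by (simp add: sum_subtractf)
  then have s0: "(\<Sum>\<gamma>\<in>?K. h \<gamma> - f \<gamma>) = 0" .
  have s1: "\<forall>\<gamma>\<in>?K. h \<gamma> - f \<gamma> \<in> U \<gamma>"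
  proof
    fix \<gamma> assume "\<gamma> \<in> ?K"
    then have c: "\<gamma> \<in> carrier G" using fK by blast
    have "Q.subspace (U \<gamma>)" using gr c unfolding graded_space_def by blast
    moreover have "h \<gamma> \<in> U \<gamma>" using h c by blast
    ultimately show "h \<gamma> - f \<gamma> \<in> U \<gamma>" using f(3)[OF c] by (intro Q.subspace_diff)
  qed
  have "(\<forall>\<gamma>\<in>K. v \<gamma> = 0)" if "finite K" "K \<subseteq> carrier G" "\<forall>\<gamma>\<in>K. v \<gamma> \<in> U \<gamma>" "(\<Sum>\<gamma>\<in>K. v \<gamma>) = 0" for K v
    using gr that unfolding graded_space_def by meson
  note e = this[OF fK s1 s0]
  show "h = f"
  proof
    fix \<gamma> show "h \<gamma> = f \<gamma>"
    proof (cases "\<gamma> \<in> ?K")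
      case True
      with e have "h \<gamma> - f \<gamma> = 0" by (rule bspec)
      then show ?thesis by (rule eq_iff_diff_eq_0[THEN iffD2])
    qed simp
  qed
qed

section \<open>Hall algebras from structure constants\<close>

text \<open>Here \<open>I\<close> stands for the isomorphism classes and \<open>g a b c\<close> for the number of short exact sequences
  with quotient \<open>a\<close>, sub-object \<open>b\<close> and middle term \<open>c\<close>. All the sums are supported in the finite set
  \<open>low \<gamma>\<close> of the classes whose degree divides \<open>\<gamma>\<close>, and stating the identities for every larger \<open>J\<close>
  allows one index set per computation.\<close>

locale hall_data = bicharacter G \<chi> for G :: "'g monoid" (structure) and \<chi> +
  fixes I :: "'i set" and deg :: "'i \<Rightarrow> 'g" and au :: "'i \<Rightarrow> rat" and g :: "'i \<Rightarrow> 'i \<Rightarrow> 'i \<Rightarrow> rat"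
    and z :: 'i and ht :: "'g \<Rightarrow> nat" and low :: "'g \<Rightarrow> 'i set"
  defines low_def: "low \<gamma> \<equiv> {a \<in> I. \<exists>\<delta>\<in>carrier G. deg a \<otimes> \<delta> = \<gamma>}"
  assumes au_pos: "a \<in> I \<Longrightarrow> au a > 0"
    and carrier_eq: "carrier G = deg ` I"
    and z_in: "z \<in> I" and deg_z: "deg z = \<one>" and au_z: "au z = 1"
    and deg_one: "a \<in> I \<Longrightarrow> b \<in> I \<Longrightarrow> deg a \<otimes> deg b = \<one> \<Longrightarrow> a = z"
    and fin_low: "\<gamma> \<in> carrier G \<Longrightarrow> finite (low \<gamma>)"
    and g_deg: "a \<in> I \<Longrightarrow> b \<in> I \<Longrightarrow> c \<in> I \<Longrightarrow> g a b c \<noteq> 0 \<Longrightarrow> deg c = deg a \<otimes> deg b"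
    and g_z_right: "a \<in> I \<Longrightarrow> c \<in> I \<Longrightarrow> g a z c = (if a = c then au a else 0)"
    and g_z_left: "b \<in> I \<Longrightarrow> c \<in> I \<Longrightarrow> g z b c = (if b = c then au b else 0)"
    and g_assoc: "a \<in> I \<Longrightarrow> b \<in> I \<Longrightarrow> c \<in> I \<Longrightarrow> y \<in> I \<Longrightarrow> finite J \<Longrightarrow> J \<subseteq> I \<Longrightarrow> low (deg y) \<subseteq> J \<Longrightarrow>
      (\<Sum>x\<in>J. g x c y * g a b x / au x) = (\<Sum>x\<in>J. g a x y * g b c x / au x)"
    and g_green: "m \<in> I \<Longrightarrow> n \<in> I \<Longrightarrow> x \<in> I \<Longrightarrow> y \<in> I \<Longrightarrow> finite J \<Longrightarrow> J \<subseteq> I \<Longrightarrow> low (deg m \<otimes> deg n) \<subseteq> J \<Longrightarrow>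
      (\<Sum>e\<in>J. g m n e * g x y e / au e) = (\<Sum>a\<in>J. \<Sum>b\<in>J. \<Sum>c\<in>J. \<Sum>d\<in>J.
        \<chi> (deg a) (deg d) * (g c d n * g b d y * g a c x * g a b m) / (au a * au b * au c * au d))"
    and ht_less: "a \<in> I \<Longrightarrow> b \<in> I \<Longrightarrow> a \<noteq> z \<Longrightarrow> b \<noteq> z \<Longrightarrow> ht (deg a) < ht (deg a \<otimes> deg b)"
begin

definition num where "num a b c = g a b c / (au a * au b)"
definition conum where "conum a b c = au a * au b / au c * num b a c"
definition pr_basis where "pr_basis a b = (\<Sum>c | c \<in> I \<and> num a b c \<noteq> 0. num a b c *\<^sub>Q bas c)"
definition copr_basis where
  "copr_basis c = (\<Sum>(a, b) | a \<in> I \<and> b \<in> I \<and> conum a b c \<noteq> 0. conum a b c *\<^sub>Q (bas a \<otimes>\<^sub>Q bas b))"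

definition prd :: "'i rat_comb \<Rightarrow> 'i rat_comb \<Rightarrow> 'i rat_comb" where
  "prd x y = (\<Sum>a\<in>supp x. \<Sum>b\<in>supp y.
     (coef x a * coef y b) *\<^sub>Q pr_basis a b)"

definition coprd :: "'i rat_comb \<Rightarrow> ('i rat_comb, 'i rat_comb) tensor" where
  "coprd x = (\<Sum>c\<in>supp x. coef x c *\<^sub>Q copr_basis c)"

definition part where "part \<gamma> = Q.span {bas a | a. a \<in> I \<and> deg a = \<gamma>}"

definition hall :: "('g, 'i rat_comb) bialgebra" where
  "hall = \<lparr>Part = part, Prod = prd, Unit = bas z, Coprod = coprd, Counit = (\<lambda>x. coef x z)\<rparr>"

lemma hall_simps [simp]: "Part hall = part" "Prod hall = prd" "Unit hall = bas z" "Coprod hall = coprd"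
  "Counit hall = (\<lambda>x. coef x z)"
  by (simp_all add: hall_def)

definition S where "S = Q.span (bas ` I)"

lemma S_iff: "x \<in> S \<longleftrightarrow> supp x \<subseteq> I"
  unfolding S_def by (rule span_basis_iff)

lemma S_subspace: "Q.subspace S"
  unfolding S_def by simp

lemma bas_S: "a \<in> I \<Longrightarrow> bas a \<in> S"
  unfolding S_def by (blast intro: Q.span_base)

lemma part_iff: "x \<in> part \<gamma> \<longleftrightarrow> supp x \<subseteq> {a \<in> I. deg a = \<gamma>}"
proof -
  have "{bas a | a. a \<in> I \<and> deg a = \<gamma>} = bas ` {a \<in> I. deg a = \<gamma>}" by auto
  then show ?thesis unfolding part_def using span_basis_iff by simp
qed

lemma part_subspace: "Q.subspace (part \<gamma>)"
  unfolding part_def by simp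

lemma deg_carrier: "a \<in> I \<Longrightarrow> deg a \<in> carrier G"
  using carrier_eq by blast

lemma total_eq: "total_space G part = S"
proof
  show "total_space G part \<subseteq> S"
    unfolding total_space_def using S_subspace by (intro Q.span_minimal) (auto simp: part_iff S_iff)
  show "S \<subseteq> total_space G part"
    unfolding S_def
  proof (rule Q.span_minimal)
    show "Q.subspace (total_space G part)" by (simp add: total_space_def)
    show "bas ` I \<subseteq> total_space G part"
    proof
      fix x :: "'i rat_comb" assume "x \<in> bas ` I"
      then obtain a where a: "a \<in> I" "x = bas a" by blast
      then have "x \<in> part (deg a)" by (simp add: part_iff)
      then show "x \<in> total_space G part" unfolding total_space_def using deg_carrier[OF a(1)] by (blast intro: Q.span_base)
    qed
  qed
qed

lemma low_sub: "low \<gamma> \<subseteq> I"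
  by (auto simp: low_def)

lemma low_self: "a \<in> I \<Longrightarrow> a \<in> low (deg a)"
  using deg_carrier by (auto simp: low_def intro!: bexI[of _ \<one>])

lemma low_left: "a \<in> I \<Longrightarrow> b \<in> I \<Longrightarrow> a \<in> low (deg a \<otimes> deg b)"
  using deg_carrier by (auto simp: low_def)

lemma low_right: "a \<in> I \<Longrightarrow> b \<in> I \<Longrightarrow> b \<in> low (deg a \<otimes> deg b)"
  using low_left[of b a] deg_carrier m_comm by simp

lemma low_mono:
  assumes "\<alpha> \<in> carrier G" "\<delta> \<in> carrier G"
  shows "low \<alpha> \<subseteq> low (\<alpha> \<otimes> \<delta>)"
proof
  fix a assume "a \<in> low \<alpha>"
  then obtain \<beta> where b: "a \<in> I" "\<beta> \<in> carrier G" "deg a \<otimes> \<beta> = \<alpha>" by (auto simp: low_def)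
  then have "deg a \<otimes> (\<beta> \<otimes> \<delta>) = \<alpha> \<otimes> \<delta>" using assms deg_carrier m_assoc by metis
  then show "a \<in> low (\<alpha> \<otimes> \<delta>)" using b assms by (auto simp: low_def)
qed

lemma low_trans: "a \<in> low \<gamma> \<Longrightarrow> low (deg a) \<subseteq> low \<gamma>"
proof -
  assume "a \<in> low \<gamma>"
  then obtain \<delta> where "a \<in> I" "\<delta> \<in> carrier G" "\<gamma> = deg a \<otimes> \<delta>" by (auto simp: low_def)
  then show ?thesis using low_mono deg_carrier by simp
qed

lemma g_low: "a \<in> I \<Longrightarrow> b \<in> I \<Longrightarrow> c \<in> I \<Longrightarrow> g a b c \<noteq> 0 \<Longrightarrow> a \<in> low (deg c) \<and> b \<in> low (deg c)"
  using g_deg low_left low_right by metis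

lemma fin_low_deg: "a \<in> I \<Longrightarrow> finite (low (deg a))"
  using fin_low deg_carrier by blast

lemma fin_low_mult: "a \<in> I \<Longrightarrow> b \<in> I \<Longrightarrow> finite (low (deg a \<otimes> deg b))"
  using fin_low deg_carrier by blast

lemma z_right: "a \<in> I \<Longrightarrow> b \<in> I \<Longrightarrow> deg a \<otimes> deg b = \<one> \<Longrightarrow> a = z \<and> b = z"
  using deg_one[of a b] deg_one[of b a] deg_carrier m_comm by metis

lemma lookup_pr_basis:
  assumes "a \<in> I" "b \<in> I"
  shows "coef (pr_basis a b) c = (if c \<in> I then num a b c else 0)"
proof -
  have "{c. c \<in> I \<and> num a b c \<noteq> 0} \<subseteq> low (deg a \<otimes> deg b)"
    using g_deg[OF assms] low_self by (fastforce simp: num_def)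
  then have f: "finite {c. c \<in> I \<and> num a b c \<noteq> 0}" using fin_low_mult[OF assms] finite_subset by blast
  have "coef (pr_basis a b) c = (\<Sum>d | d \<in> I \<and> num a b d \<noteq> 0. num a b d * (if d = c then 1 else 0))"
    unfolding pr_basis_def by (simp add: lookup_sum lookup_scaleQ scaleQ_rat_def lookup_single when_def)
  also have "\<dots> = (if c \<in> I then num a b c else 0)" using f by (simp add: if_distrib cong: if_cong)
  finally show ?thesis .
qed

lemma keys_pr_basis:
  assumes "a \<in> I" "b \<in> I"
  shows "supp (pr_basis a b) \<subseteq> {c \<in> I. deg c = deg a \<otimes> deg b}"
  using g_deg[OF assms] by (auto simp: in_keys_iff lookup_pr_basis[OF assms] num_def split: if_splits)

lemma conum_eq: "a \<in> I \<Longrightarrow> b \<in> I \<Longrightarrow> conum a b c = g b a c / au c"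
  using au_pos[of a] au_pos[of b] by (simp add: conum_def num_def)

text \<open>The automorphism factors in \<open>conum\<close> cancel and leave
  \<open>g b a c / au c\<close>, in which \<open>b\<close> is the quotient and \<open>a\<close>, the
  left tensor factor, the sub-object. Pairs outside \<open>low (deg c)\<close> contribute zero,
  which allows any larger index set.\<close>

lemma copr_basis_eq:
  assumes c: "c \<in> I" and J: "finite J" "J \<subseteq> I" "low (deg c) \<subseteq> J"
  shows "copr_basis c = (\<Sum>a\<in>J. \<Sum>b\<in>J. (g b a c / au c) *\<^sub>Q (bas a \<otimes>\<^sub>Q bas b))"
proof -
  have "copr_basis c = (\<Sum>(a, b)\<in>J \<times> J. conum a b c *\<^sub>Q (bas a \<otimes>\<^sub>Q bas b))"
    unfolding copr_basis_def
  proof (rule sum.mono_neutral_left)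
    show "{(a, b). a \<in> I \<and> b \<in> I \<and> conum a b c \<noteq> 0} \<subseteq> J \<times> J"
      using g_low[OF _ _ c] J(3) by (auto simp: conum_eq)
  qed (use J in auto)
  also have "\<dots> = (\<Sum>a\<in>J. \<Sum>b\<in>J. conum a b c *\<^sub>Q (bas a \<otimes>\<^sub>Q bas b))"
    by (rule sum.cartesian_product[symmetric])
  also have "\<dots> = (\<Sum>a\<in>J. \<Sum>b\<in>J. (g b a c / au c) *\<^sub>Q (bas a \<otimes>\<^sub>Q bas b))"
    using J(2) by (intro sum.cong refl) (simp add: conum_eq subset_iff)
  finally show ?thesis .
qed

lemma sum_if_delta: "finite J \<Longrightarrow> (\<Sum>x\<in>J. f x * (if x = a then 1 else 0)) = (if a \<in> J then f a else (0::rat))"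
  by (simp add: if_distrib cong: if_cong)

lemma tcoef_copr_basis:
  assumes c: "c \<in> I"
  shows "tcoef (copr_basis c) a b = (if a \<in> I \<and> b \<in> I then g b a c / au c else 0)"
proof -
  let ?J = "low (deg c)"
  have f: "finite ?J" using fin_low_deg c by blast
  have "tcoef (copr_basis c) a b = (\<Sum>a'\<in>?J. (\<Sum>b'\<in>?J. g b' a' c / au c * (if b' = b then 1 else 0)) * (if a' = a then 1 else 0))"
    unfolding copr_basis_eq[OF c f low_sub order_refl]
    by (simp add: lin_sum[OF tcoef(1)] linD[OF tcoef(1)] tcoef(2) lookup_single when_def scaleQ_rat_def sum_distrib_right sum_distrib_left mult_ac)
  also have "\<dots> = (if a \<in> ?J \<and> b \<in> ?J then g b a c / au c else 0)"
    unfolding sum_if_delta[OF f] by simp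
  also have "\<dots> = (if a \<in> I \<and> b \<in> I then g b a c / au c else 0)"
    using g_low[OF _ _ c] low_sub by (auto simp: subset_iff)
  finally show ?thesis .
qed

lemma prd_lext: "prd x y = lext (\<lambda>a. lext (pr_basis a) y) x"
  unfolding prd_def lext_def by (simp add: Q.scale_sum_right scaleQ_scaleQ)

lemma prd_bilin: "bilin prd"
proof -
  have "prd = (\<lambda>x y. lext (\<lambda>a. lext (pr_basis a) y) x)" by (intro ext) (rule prd_lext)
  then show ?thesis using bilin_lext by simp
qed

lemmas prd_lin = bilinD[OF prd_bilin]

lemma prd_basis: "prd (bas a) (bas b) = pr_basis a b"
  by (simp add: prd_lext lext_basis)

lemma coprd_lext: "coprd = lext copr_basis"
  by (rule ext) (simp add: coprd_def lext_def)

lemma coprd_lin: "lin coprd"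
  unfolding coprd_lext by (rule lin_lext)

lemma coprd_basis: "coprd (bas c) = copr_basis c"
  by (simp add: coprd_lext lext_basis)

lemma prd_part:
  assumes x: "x \<in> part \<alpha>" and y: "y \<in> part \<beta>"
  shows "prd x y \<in> part (\<alpha> \<otimes> \<beta>)"
proof (rule lin_span_image[OF prd_lin(1) _ part_subspace x[unfolded part_def]])
  fix a' assume "a' \<in> {bas a |a. a \<in> I \<and> deg a = \<alpha>}"
  then obtain a where a: "a' = bas a" "a \<in> I" "deg a = \<alpha>" by blast
  show "prd a' y \<in> part (\<alpha> \<otimes> \<beta>)"
  proof (rule lin_span_image[OF prd_lin(2) _ part_subspace y[unfolded part_def]])
    fix b' assume "b' \<in> {bas a |a. a \<in> I \<and> deg a = \<beta>}"
    then obtain b where b: "b' = bas b" "b \<in> I" "deg b = \<beta>" by blast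
    show "prd a' b' \<in> part (\<alpha> \<otimes> \<beta>)" using keys_pr_basis[OF a(2) b(2)] a b by (simp add: prd_basis part_iff)
  qed
qed

lemma prd_S: "x \<in> S \<Longrightarrow> y \<in> S \<Longrightarrow> prd x y \<in> S"
proof -
  assume x: "x \<in> S" and y: "y \<in> S"
  show ?thesis
  proof (rule lin_span_image[OF prd_lin(1) _ S_subspace x[unfolded S_def]])
    fix a' :: "'i rat_comb" assume "a' \<in> bas ` I"
    then obtain a where a: "a' = bas a" "a \<in> I" by blast
    show "prd a' y \<in> S"
    proof (rule lin_span_image[OF prd_lin(2) _ S_subspace y[unfolded S_def]])
      fix b' :: "'i rat_comb" assume "b' \<in> bas ` I"
      then obtain b where b: "b' = bas b" "b \<in> I" by blast
      show "prd a' b' \<in> S" using keys_pr_basis[OF a(2) b(2)] a b by (auto simp: prd_basis S_iff)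
    qed
  qed
qed

lemma tensor_space_subspace: "Q.subspace (tensor_space U V)"
  by (simp add: tensor_space_def)

lemma coprd_S:
  assumes x: "x \<in> S"
  shows "coprd x \<in> tensor_space S S"
proof (rule lin_span_image[OF coprd_lin _ tensor_space_subspace x[unfolded S_def]])
  fix c' :: "'i rat_comb" assume "c' \<in> bas ` I"
  then obtain c where c: "c' = bas c" "c \<in> I" by blast
  show "coprd c' \<in> tensor_space S S"
    unfolding c(1) coprd_basis copr_basis_eq[OF c(2) fin_low_deg[OF c(2)] low_sub order_refl]
    using low_sub bas_S by (intro Q.subspace_sum[OF tensor_space_subspace] Q.subspace_scale[OF tensor_space_subspace] pure_in_tensor_space) blast+
qed

lemma part_graded: "graded_space G part"
  unfolding graded_space_def
proof (intro conjI allI impI ballI)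
  show "Q.subspace (part \<gamma>)" for \<gamma> by (rule part_subspace)
  fix K f \<gamma> assume K: "finite K" "\<forall>\<gamma>\<in>K. f \<gamma> \<in> part \<gamma>" "(\<Sum>\<gamma>\<in>K. f \<gamma>) = 0" "\<gamma> \<in> K"
  show "f \<gamma> = 0"
  proof (rule poly_mapping_eqI)
    fix a
    have "coef (f \<delta>) a = 0" if "\<delta> \<in> K" "\<delta> \<noteq> deg a" for \<delta>
      using K(2) that by (force simp: part_iff in_keys_iff)
    moreover have "0 = (\<Sum>\<delta>\<in>K. coef (f \<delta>) a)" using K(3) by (metis lookup_sum lookup_zero)
    moreover have "(\<Sum>\<delta>\<in>K. coef (f \<delta>) a) = (if deg a \<in> K then coef (f (deg a)) a else 0)"
      using K(1) calculation(1) by (subst sum.delta[symmetric, OF K(1)], intro sum.cong) auto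
    ultimately show "coef (f \<gamma>) a = coef 0 a" using K(4) by (cases "\<gamma> = deg a") auto
  qed
qed

lemma copr_basis_grading: "c \<in> I \<Longrightarrow> copr_basis c \<in> tensor_grading G part part (deg c)"
proof -
  assume c: "c \<in> I"
  show ?thesis
    unfolding copr_basis_eq[OF c fin_low_deg[OF c] low_sub order_refl]
  proof (rule Q.subspace_sum, simp add: tensor_grading_def, rule Q.subspace_sum, simp add: tensor_grading_def)
    fix a b assume ab: "a \<in> low (deg c)" "b \<in> low (deg c)"
    then have i: "a \<in> I" "b \<in> I" using low_sub by blast+
    show "(g b a c / au c) *\<^sub>Q (bas a \<otimes>\<^sub>Q bas b) \<in> tensor_grading G part part (deg c)"
    proof (cases "g b a c = 0")
      case False
      then have "deg a \<otimes> deg b = deg c" using g_deg[OF i(2,1) c] m_comm deg_carrier i by simp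
      then show ?thesis unfolding tensor_grading_def
        using i deg_carrier by (intro Q.span_scale Q.span_base) (force simp: part_iff)
    qed (simp add: tensor_grading_def Q.span_zero)
  qed
qed

lemma hall_structure_graded: "structure_graded hall G part"
  unfolding structure_graded_def
proof (intro conjI ballI impI; simp?)
  show "graded_space G part" by (rule part_graded)
  show "prd x y \<in> part (\<alpha> \<otimes> \<beta>)" if "x \<in> part \<alpha>" "y \<in> part \<beta>" for x y \<alpha> \<beta> using prd_part that .
  show "bas z \<in> part \<one>" using z_in deg_z by (simp add: part_iff)
  show "coprd x \<in> tensor_grading G part part \<gamma>" if "x \<in> part \<gamma>" for x \<gamma>
  proof (rule lin_span_image[OF coprd_lin _ _ that[unfolded part_def]])
    show "coprd y \<in> tensor_grading G part part \<gamma>" if "y \<in> {bas a |a. a \<in> I \<and> deg a = \<gamma>}" for y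
      using that copr_basis_grading by (auto simp: coprd_basis)
  qed (simp add: tensor_grading_def)
  show "coef x z = 0" if "\<gamma> \<noteq> \<one>" "x \<in> part \<gamma>" for x \<gamma>
    using that deg_z by (force simp: part_iff in_keys_iff)
qed

lemma prd_assoc:
  assumes x: "x \<in> S" and y: "y \<in> S" and w: "w \<in> S"
  shows "prd (prd x y) w = prd x (prd y w)"
proof (rule lin_eq_on_span[OF lin_compose[OF prd_lin(1) prd_lin(1)] prd_lin(1) _ x[unfolded S_def]])
  fix a' :: "'i rat_comb" assume "a' \<in> bas ` I"
  then obtain a where a: "a' = bas a" "a \<in> I" by blast
  show "prd (prd a' y) w = prd a' (prd y w)"
  proof (rule lin_eq_on_span[OF lin_compose[OF prd_lin(1) prd_lin(2)] lin_compose[OF prd_lin(2) prd_lin(1)] _ y[unfolded S_def]])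
    fix b' :: "'i rat_comb" assume "b' \<in> bas ` I"
    then obtain b where b: "b' = bas b" "b \<in> I" by blast
    show "prd (prd a' b') w = prd a' (prd b' w)"
    proof (rule lin_eq_on_span[OF prd_lin(2) lin_compose[OF prd_lin(2) prd_lin(2)] _ w[unfolded S_def]])
      fix c' :: "'i rat_comb" assume "c' \<in> bas ` I"
      then obtain c where c: "c' = bas c" "c \<in> I" by blast
      let ?\<gamma> = "deg a \<otimes> deg b \<otimes> deg c"
      let ?J = "low ?\<gamma>"
      have dc: "deg a \<in> carrier G" "deg b \<in> carrier G" "deg c \<in> carrier G" using deg_carrier a b c by blast+
      have f: "finite ?J" using fin_low dc by simp
      have k1: "supp (pr_basis a b) \<subseteq> ?J"
      proof
        fix x assume "x \<in> supp (pr_basis a b)"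
        then have "x \<in> I" "deg x = deg a \<otimes> deg b" using keys_pr_basis[OF a(2) b(2)] by auto
        then show "x \<in> ?J" using dc by (auto simp: low_def)
      qed
      have k2: "supp (pr_basis b c) \<subseteq> ?J"
      proof
        fix x assume "x \<in> supp (pr_basis b c)"
        then have "x \<in> I" "deg x = deg b \<otimes> deg c" using keys_pr_basis[OF b(2) c(2)] by auto
        moreover have "deg b \<otimes> deg c \<otimes> deg a = ?\<gamma>" using dc by (simp add: m_assoc m_comm m_lcomm)
        ultimately show "x \<in> ?J" using dc by (auto simp: low_def)
      qed
      have l: "prd (prd a' b') c' = (\<Sum>x\<in>?J. coef (pr_basis a b) x *\<^sub>Q pr_basis x c)"
        unfolding a b c prd_basis by (simp add: prd_lext lext_basis lext_superset[OF f k1])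
      have r: "prd a' (prd b' c') = (\<Sum>x\<in>?J. coef (pr_basis b c) x *\<^sub>Q pr_basis a x)"
        unfolding a b c prd_basis by (simp add: prd_lext lext_basis lext_superset[OF f k2])
      show "prd (prd a' b') c' = prd a' (prd b' c')"
      proof (rule poly_mapping_eqI)
        fix y
        have "coef (prd (prd a' b') c') y = (\<Sum>x\<in>?J. num a b x * (if y \<in> I then num x c y else 0))"
          unfolding l using low_sub a b c by (simp add: lookup_sum lookup_scaleQ scaleQ_rat_def lookup_pr_basis subset_iff)
        also have "\<dots> = (if y \<in> I then (\<Sum>x\<in>?J. g x c y * g a b x / au x) / (au a * au b * au c) else 0)"
          by (simp add: sum_divide_distrib num_def mult_ac)
        also have "\<dots> = (if y \<in> I then (\<Sum>x\<in>?J. g a x y * g b c x / au x) / (au a * au b * au c) else 0)"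
        proof (cases "y \<in> I")
          case y: True
          show ?thesis
          proof (cases "y \<in> ?J")
            case True
            then have "low (deg y) \<subseteq> ?J" by (rule low_trans)
            then show ?thesis using g_assoc[OF a(2) b(2) c(2) y f low_sub] by simp
          next
            \<comment> \<open>If \<open>y\<close> lies outside \<open>?J\<close>, its degree is not
              that of the triple product, and all summands on both sides vanish.\<close>
            case False
            then have ny: "deg y \<noteq> ?\<gamma>" using low_self[OF y] by auto
            have i: "x \<in> I" if "x \<in> ?J" for x using that low_sub by blast
            have "g x c y * g a b x = 0" if "x \<in> ?J" for x
              using ny g_deg[OF i[OF that] c(2) y] g_deg[OF a(2) b(2) i[OF that]] by (metis mult_eq_0_iff)
            moreover have "g a x y * g b c x = 0" if "x \<in> ?J" for x
              using ny g_deg[OF a(2) i[OF that] y] g_deg[OF b(2) c(2) i[OF that]] dc by (metis mult_eq_0_iff m_assoc)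
            ultimately have "(\<Sum>x\<in>?J. g x c y * g a b x / au x) = (\<Sum>x\<in>?J. g a x y * g b c x / au x)"
              by (intro sum.cong refl) (metis div_0)
            then show ?thesis by simp
          qed
        qed simp
        also have "\<dots> = (\<Sum>x\<in>?J. num b c x * (if y \<in> I then num a x y else 0))"
          by (simp add: sum_divide_distrib num_def mult_ac)
        also have "\<dots> = coef (prd a' (prd b' c')) y"
          unfolding r using low_sub a b c by (simp add: lookup_sum lookup_scaleQ scaleQ_rat_def lookup_pr_basis subset_iff)
        finally show "coef (prd (prd a' b') c') y = coef (prd a' (prd b' c')) y" .
      qed
    qed
  qed
qed

lemma pr_basis_z: 
  assumes a: "a \<in> I"
  shows "pr_basis z a = bas a" "pr_basis a z = bas a"
proof -
  have "num z a c = (if a = c then 1 else 0)" "num a z c = (if a = c then 1 else 0)" if "c \<in> I" for c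
    using that a g_z_left g_z_right au_z au_pos[OF a] by (auto simp: num_def)
  then show "pr_basis z a = bas a" "pr_basis a z = bas a"
    using a z_in by (auto intro!: poly_mapping_eqI simp: lookup_pr_basis lookup_single when_def)
qed

lemma prd_unit:
  assumes "x \<in> S" shows "prd (bas z) x = x" "prd x (bas z) = x"
  by (rule lin_eq_on_span[OF prd_lin(2) lin_id _ assms[unfolded S_def]], use pr_basis_z in \<open>auto simp: prd_basis\<close>)
    (rule lin_eq_on_span[OF prd_lin(1) lin_id _ assms[unfolded S_def]], use pr_basis_z in \<open>auto simp: prd_basis\<close>)

lemma low_one: "low \<one> = {z}"
proof
  show "{z} \<subseteq> low \<one>" using low_self[OF z_in] deg_z by simp
  show "low \<one> \<subseteq> {z}"
  proof
    fix a assume "a \<in> low \<one>"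
    then obtain \<delta> where d: "a \<in> I" "\<delta> \<in> carrier G" "deg a \<otimes> \<delta> = \<one>" by (auto simp: low_def)
    then obtain b where "b \<in> I" "\<delta> = deg b" unfolding carrier_eq by blast
    then show "a \<in> {z}" using deg_one d by simp
  qed
qed

lemma coprd_unit: "copr_basis z = bas z \<otimes>\<^sub>Q bas z"
proof -
  have "copr_basis z = (\<Sum>a\<in>{z}. \<Sum>b\<in>{z}. (g b a z / au z) *\<^sub>Q (bas a \<otimes>\<^sub>Q bas b))"
    by (rule copr_basis_eq) (use z_in low_one deg_z in auto)
  then show ?thesis using g_z_left[OF z_in z_in] au_z by (simp add: scaleQ_one)
qed

lemma counit_prd:
  assumes x: "x \<in> S" and y: "y \<in> S"
  shows "coef (prd x y) z = coef x z * coef y z"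
proof (rule bilin_eq_on_span[OF _ _ _ x[unfolded S_def] y[unfolded S_def]])
  show "bilin (\<lambda>x y. coef (prd x y) z)"
    by (intro bilinI lin_compose[OF lin_lookup prd_lin(1)] lin_compose[OF lin_lookup prd_lin(2)])
  show "bilin (\<lambda>(x :: 'i rat_comb) (y :: 'i rat_comb). coef x z * coef y z)"
    by (rule bilinI; rule linI) (simp_all add: lookup_add lookup_scaleQ scaleQ_rat_def algebra_simps)
  fix a' b' :: "'i rat_comb" assume "a' \<in> bas ` I" "b' \<in> bas ` I"
  then obtain a b where ab: "a' = bas a" "a \<in> I" "b' = bas b" "b \<in> I" by blast
  have "g a b z \<noteq> 0 \<Longrightarrow> a = z \<and> b = z" using g_deg[OF ab(2,4) z_in] z_right[OF ab(2,4)] deg_z by simp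
  moreover have "g z z z = 1" using g_z_left[OF z_in z_in] au_z by simp
  ultimately show "coef (prd a' b') z = coef a' z * coef b' z"
    using ab z_in au_z by (auto simp: prd_basis lookup_pr_basis num_def lookup_single when_def)
qed

lemma counit_coprd:
  assumes x: "x \<in> S"
  shows "tensor_lift S S (\<lambda>u v. coef u z *\<^sub>Q v) (coprd x) = x"
    and "tensor_lift S S (\<lambda>u v. coef v z *\<^sub>Q u) (coprd x) = x"
proof -
  have "bilin (\<lambda>(u :: 'i rat_comb) (v :: 'i rat_comb). coef u z *\<^sub>Q v)"
    by (rule bilinI; rule linI) (simp_all add: lookup_add lookup_scaleQ scaleQ_rat_def scaleQ_add_left scaleQ_add_right scaleQ_scaleQ mult.commute)
  from tensor_universal[OF this] obtain L where L: "lin L" "\<And>(u :: 'i rat_comb) (v :: 'i rat_comb). L (u \<otimes>\<^sub>Q v) = coef u z *\<^sub>Q v" by blast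
  have "bilin (\<lambda>(u :: 'i rat_comb) (v :: 'i rat_comb). coef v z *\<^sub>Q u)"
    by (rule bilinI; rule linI) (simp_all add: lookup_add lookup_scaleQ scaleQ_rat_def scaleQ_add_left scaleQ_add_right scaleQ_scaleQ mult.commute)
  from tensor_universal[OF this] obtain K where K: "lin K" "\<And>(u :: 'i rat_comb) (v :: 'i rat_comb). K (u \<otimes>\<^sub>Q v) = coef v z *\<^sub>Q u" by blast
  have b: "L (coprd (bas c)) = bas c" "K (coprd (bas c)) = bas c" if c: "c \<in> I" for c
  proof -
    \<comment> \<open>\<open>z\<close> is inserted so that the factor on which the counit is
      evaluated visibly occurs in the index set.\<close>
    let ?J = "insert z (low (deg c))"
    have J: "finite ?J" "?J \<subseteq> I" "low (deg c) \<subseteq> ?J" using fin_low_deg[OF c] low_sub z_in by auto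
    have cJ: "c \<in> ?J" using low_self[OF c] by blast
    note e = copr_basis_eq[OF c J]
    have "L (coprd (bas c)) = (\<Sum>a\<in>?J. \<Sum>b\<in>?J. if a = z then (g b a c / au c) *\<^sub>Q bas b else 0)"
      unfolding coprd_basis e by (simp add: lin_sum[OF L(1)] linD[OF L(1)] L(2) lookup_single when_def scaleQ_one if_distrib[of "\<lambda>x. _ *\<^sub>Q x"] cong: if_cong)
        (intro sum.cong refl, simp add: scaleQ_one)
    also have "\<dots> = (\<Sum>b\<in>?J. \<Sum>a\<in>?J. if a = z then (g b a c / au c) *\<^sub>Q bas b else 0)" by (rule sum.swap)
    also have "\<dots> = (\<Sum>b\<in>?J. (g b z c / au c) *\<^sub>Q bas b)" using J(1) by (intro sum.cong refl, subst sum.delta) auto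
    also have "\<dots> = (\<Sum>b\<in>?J. if b = c then bas b else 0)"
      using J(2) g_z_right[OF _ c] au_pos[OF c] by (intro sum.cong refl) (auto simp: scaleQ_one)
    also have "\<dots> = bas c" using J(1) cJ by (subst sum.delta) auto
    finally show "L (coprd (bas c)) = bas c" .
    have "K (coprd (bas c)) = (\<Sum>a\<in>?J. \<Sum>b\<in>?J. if b = z then (g b a c / au c) *\<^sub>Q bas a else 0)"
      unfolding coprd_basis e by (simp add: lin_sum[OF K(1)] linD[OF K(1)] K(2) lookup_single when_def)
        (intro sum.cong refl, simp add: scaleQ_one)
    also have "\<dots> = (\<Sum>a\<in>?J. (g z a c / au c) *\<^sub>Q bas a)" using J(1) by (intro sum.cong refl, subst sum.delta) auto
    also have "\<dots> = (\<Sum>b\<in>?J. if b = c then bas b else 0)"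
      using J(2) g_z_left[OF _ c] au_pos[OF c] by (intro sum.cong refl) (auto simp: scaleQ_one)
    also have "\<dots> = bas c" using J(1) cJ by (subst sum.delta) auto
    finally show "K (coprd (bas c)) = bas c" .
  qed
  have "tensor_lift S S (\<lambda>u v. coef u z *\<^sub>Q v) (coprd x) = L (coprd x)"
    by (rule tensor_lift_eq[OF S_subspace S_subspace L(1) _ coprd_S[OF x]]) (simp add: L(2))
  also have "\<dots> = x"
    by (rule lin_eq_on_span[OF lin_compose[OF L(1) coprd_lin] lin_id _ x[unfolded S_def]]) (use b in auto)
  finally show "tensor_lift S S (\<lambda>u v. coef u z *\<^sub>Q v) (coprd x) = x" .
  have "tensor_lift S S (\<lambda>u v. coef v z *\<^sub>Q u) (coprd x) = K (coprd x)"
    by (rule tensor_lift_eq[OF S_subspace S_subspace K(1) _ coprd_S[OF x]]) (simp add: K(2))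
  also have "\<dots> = x"
    by (rule lin_eq_on_span[OF lin_compose[OF K(1) coprd_lin] lin_id _ x[unfolded S_def]]) (use b in auto)
  finally show "tensor_lift S S (\<lambda>u v. coef v z *\<^sub>Q u) (coprd x) = x" .
qed

end

lemma sum_rotate3: "(\<Sum>b\<in>A. \<Sum>p\<in>B. \<Sum>q\<in>C. f b p q) = (\<Sum>p\<in>B. \<Sum>q\<in>C. \<Sum>b\<in>A. f b p q)"
  by (subst sum.swap, rule sum.cong[OF refl], rule sum.swap)

context hall_data
begin

text \<open>After exchanging sums, the coefficients of a triple tensor of basis vectors on the two
  sides are the two sides of \<open>g_assoc\<close>, with the three factors in reverse
  order.\<close>

lemma coprd_coassoc:
  assumes x: "x \<in> S"
  shows "tensor_assoc S S S (tensor_map S S coprd id (coprd x)) = tensor_map S S id coprd (coprd x)"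
proof -
  have "bilin (\<lambda>(u :: 'i rat_comb) (v :: 'i rat_comb). coprd u \<otimes>\<^sub>Q v)"
    by (intro bilinI lin_compose[OF pure_lin(1) coprd_lin] pure_lin(2))
  from tensor_universal[OF this] obtain L1
    where L1: "lin L1" "\<And>(u :: 'i rat_comb) (v :: 'i rat_comb). L1 (u \<otimes>\<^sub>Q v) = coprd u \<otimes>\<^sub>Q v" by blast
  have "bilin (\<lambda>(u :: 'i rat_comb) (v :: 'i rat_comb). u \<otimes>\<^sub>Q coprd v)"
    by (intro bilinI lin_compose[OF pure_lin(2) coprd_lin] pure_lin(1))
  from tensor_universal[OF this] obtain L2
    where L2: "lin L2" "\<And>(u :: 'i rat_comb) (v :: 'i rat_comb). L2 (u \<otimes>\<^sub>Q v) = u \<otimes>\<^sub>Q coprd v" by blast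
  obtain L3 :: "(('i rat_comb, 'i rat_comb) tensor, 'i rat_comb) tensor \<Rightarrow> _"
    where L3: "lin L3" "\<And>u v w. L3 ((u \<otimes>\<^sub>Q v) \<otimes>\<^sub>Q w) = u \<otimes>\<^sub>Q (v \<otimes>\<^sub>Q w)"
      "\<And>t. t \<in> tensor_space (tensor_space S S) S \<Longrightarrow> tensor_assoc S S S t = L3 t"
    using tensor_assoc_ex[OF S_subspace S_subspace S_subspace] by metis
  have "tensor_map S S coprd id (coprd x) = L1 (coprd x)"
    unfolding tensor_map_def by (rule tensor_lift_eq[OF S_subspace S_subspace L1(1) _ coprd_S[OF x]]) (simp add: L1(2))
  moreover have "tensor_map S S id coprd (coprd x) = L2 (coprd x)"
    unfolding tensor_map_def by (rule tensor_lift_eq[OF S_subspace S_subspace L2(1) _ coprd_S[OF x]]) (simp add: L2(2))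
  moreover have "tensor_assoc S S S (L1 (coprd x)) = L3 (L1 (coprd x))"
  proof (rule L3(3), rule lin_span_image[OF L1(1) _ tensor_space_subspace coprd_S[OF x, unfolded tensor_space_def]])
    fix t :: "('i rat_comb, 'i rat_comb) tensor" assume "t \<in> {u \<otimes>\<^sub>Q v |u v. u \<in> S \<and> v \<in> S}"
    then obtain u v where "t = u \<otimes>\<^sub>Q v" "u \<in> S" "v \<in> S" by blast
    then show "L1 t \<in> tensor_space (tensor_space S S) S"
      using coprd_S by (simp add: L1(2) pure_in_tensor_space)
  qed
  moreover have "L3 (L1 (coprd x)) = L2 (coprd x)"
  proof (rule lin_eq_on_span[OF lin_compose[OF L3(1) lin_compose[OF L1(1) coprd_lin]] lin_compose[OF L2(1) coprd_lin] _ x[unfolded S_def]])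
    fix c' :: "'i rat_comb" assume "c' \<in> bas ` I"
    then obtain c where c: "c' = bas c" "c \<in> I" by blast
    let ?J = "low (deg c)"
    have f: "finite ?J" using fin_low_deg[OF c(2)] .
    have i: "a \<in> I" if "a \<in> ?J" for a using that low_sub by blast
    have e: "copr_basis a = (\<Sum>p\<in>?J. \<Sum>q\<in>?J. (g q p a / au a) *\<^sub>Q (bas p \<otimes>\<^sub>Q bas q))" if "a \<in> ?J" for a
      by (rule copr_basis_eq[OF i[OF that] f low_sub low_trans[OF that]])
    let ?T = "\<lambda>p q b. bas p \<otimes>\<^sub>Q (bas q \<otimes>\<^sub>Q bas b)"
    have "L3 (L1 (coprd c')) = (\<Sum>a\<in>?J. \<Sum>b\<in>?J. (g b a c / au c) *\<^sub>Q L3 (copr_basis a \<otimes>\<^sub>Q bas b))"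
      unfolding c coprd_basis e[OF low_self[OF c(2)]]
      by (simp add: lin_sum[OF L1(1)] lin_sum[OF L3(1)] linD[OF L1(1)] linD[OF L3(1)] L1(2) coprd_basis)
    also have "\<dots> = (\<Sum>a\<in>?J. \<Sum>b\<in>?J. \<Sum>p\<in>?J. \<Sum>q\<in>?J. (g b a c / au c * (g q p a / au a)) *\<^sub>Q ?T p q b)"
      by (intro sum.cong refl) (simp add: e lin_sum[OF L3(1)] linD[OF L3(1)] L3(2) lin_sum[OF pure_lin(1)] linD[OF pure_lin(1)] Q.scale_sum_right scaleQ_scaleQ)
    also have "\<dots> = (\<Sum>a\<in>?J. \<Sum>p\<in>?J. \<Sum>q\<in>?J. \<Sum>b\<in>?J. (g b a c / au c * (g q p a / au a)) *\<^sub>Q ?T p q b)"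
      by (intro sum.cong refl sum_rotate3)
    also have "\<dots> = (\<Sum>p\<in>?J. \<Sum>q\<in>?J. \<Sum>a\<in>?J. \<Sum>b\<in>?J. (g b a c / au c * (g q p a / au a)) *\<^sub>Q ?T p q b)"
      by (rule sum_rotate3)
    also have "\<dots> = (\<Sum>p\<in>?J. \<Sum>q\<in>?J. \<Sum>b\<in>?J. \<Sum>a\<in>?J. (g b a c / au c * (g q p a / au a)) *\<^sub>Q ?T p q b)"
      by (intro sum.cong refl sum.swap)
    also have "\<dots> = (\<Sum>p\<in>?J. \<Sum>q\<in>?J. \<Sum>b\<in>?J. ((\<Sum>a\<in>?J. g b a c * g q p a / au a) / au c) *\<^sub>Q ?T p q b)"
      by (intro sum.cong refl) (simp add: Q.scale_sum_left[symmetric] sum_divide_distrib mult_ac)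
    also have "\<dots> = (\<Sum>p\<in>?J. \<Sum>q\<in>?J. \<Sum>b\<in>?J. ((\<Sum>a\<in>?J. g a p c * g b q a / au a) / au c) *\<^sub>Q ?T p q b)"
      using g_assoc[OF i i i c(2) f low_sub order_refl] by (intro sum.cong refl) (metis (no_types, lifting))
    also have "\<dots> = (\<Sum>p\<in>?J. \<Sum>q\<in>?J. \<Sum>b\<in>?J. \<Sum>a\<in>?J. (g a p c / au c * (g b q a / au a)) *\<^sub>Q ?T p q b)"
      by (intro sum.cong refl) (simp add: Q.scale_sum_left[symmetric] sum_divide_distrib mult_ac)
    also have "\<dots> = (\<Sum>p\<in>?J. \<Sum>a\<in>?J. \<Sum>q\<in>?J. \<Sum>b\<in>?J. (g a p c / au c * (g b q a / au a)) *\<^sub>Q ?T p q b)"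
      by (intro sum.cong refl sum_rotate3[symmetric])
    also have "\<dots> = (\<Sum>p\<in>?J. \<Sum>a\<in>?J. (g a p c / au c) *\<^sub>Q (bas p \<otimes>\<^sub>Q copr_basis a))"
      by (intro sum.cong refl) (simp add: e lin_sum[OF pure_lin(2)] linD[OF pure_lin(2)] Q.scale_sum_right scaleQ_scaleQ)
    also have "\<dots> = L2 (coprd c')"
      unfolding c coprd_basis e[OF low_self[OF c(2)]]
      by (simp add: lin_sum[OF L2(1)] linD[OF L2(1)] L2(2) coprd_basis)
    finally show "L3 (L1 (coprd c')) = L2 (coprd c')" .
  qed
  ultimately show ?thesis by simp
qed

definition homog :: "'g \<Rightarrow> 'i rat_comb \<Rightarrow> 'i rat_comb" where
  "homog \<gamma> = lext (\<lambda>a. if deg a = \<gamma> then bas a else 0)"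

lemma lookup_homog: "coef (homog \<gamma> x) a = (if deg a = \<gamma> then coef x a else 0)"
proof -
  have "coef (homog \<gamma> x) a = (\<Sum>b\<in>supp x. (if deg b = \<gamma> then coef x b else 0) * (if b = a then 1 else 0))"
    unfolding homog_def lext_def
    unfolding lookup_sum lookup_scaleQ scaleQ_rat_def by (intro sum.cong refl) (simp add: lookup_single when_def)
  also have "\<dots> = (if deg a = \<gamma> then coef x a else 0)"
    unfolding sum_if_delta[OF finite_keys] by (simp add: in_keys_iff)
  finally show ?thesis .
qed

lemma keys_homog: "supp (homog \<gamma> x) = {a \<in> supp x. deg a = \<gamma>}"
  by (auto simp: in_keys_iff lookup_homog split: if_splits)

lemma homog_lin: "lin (homog \<gamma>)"
  unfolding homog_def by (rule lin_lext)

lemma homog_part: "x \<in> S \<Longrightarrow> homog \<gamma> x \<in> part \<gamma>"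
  by (auto simp: part_iff keys_homog S_iff)

lemma homog_nonzero: "{\<gamma>. homog \<gamma> x \<noteq> 0} = deg ` supp x"
  using keys_homog[of _ x] by (auto simp: keys_eq_empty[symmetric])

lemma homog_sum:
  assumes "finite \<Gamma>" "deg ` supp x \<subseteq> \<Gamma>"
  shows "(\<Sum>\<gamma>\<in>\<Gamma>. homog \<gamma> x) = x"
proof (rule poly_mapping_eqI)
  fix a
  have "coef (\<Sum>\<gamma>\<in>\<Gamma>. homog \<gamma> x) a = (\<Sum>\<gamma>\<in>\<Gamma>. coef x a * (if \<gamma> = deg a then 1 else 0))"
    by (auto simp: lookup_sum lookup_homog intro!: sum.cong)
  then show "coef (\<Sum>\<gamma>\<in>\<Gamma>. homog \<gamma> x) a = coef x a"
    using assms by (simp add: sum_if_delta) (auto simp: in_keys_iff image_subset_iff)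
qed

lemma components_part:
  assumes x: "x \<in> S"
  shows "components G part x = (\<lambda>\<gamma>. homog \<gamma> x)"
proof (rule components_eq[OF part_graded])
  show "finite {\<gamma>. homog \<gamma> x \<noteq> 0}" "{\<gamma>. homog \<gamma> x \<noteq> 0} \<subseteq> carrier G"
    unfolding homog_nonzero using x deg_carrier by (auto simp: S_iff)
  show "homog \<gamma> x \<in> part \<gamma>" for \<gamma> by (rule homog_part[OF x])
  show "x = (\<Sum>\<gamma> | homog \<gamma> x \<noteq> 0. homog \<gamma> x)" unfolding homog_nonzero by (rule homog_sum[symmetric]) auto
qed

text \<open>The braiding written on basis vectors, where each vector is homogeneous;
  \<open>brd_components\<close> identifies it with the definition through homogeneous
  components.\<close>

definition brd :: "'i rat_comb \<Rightarrow> 'i rat_comb \<Rightarrow> ('i rat_comb, 'i rat_comb) tensor" where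
  "brd u v = lext (\<lambda>a. lext (\<lambda>b. \<chi> (deg a) (deg b) *\<^sub>Q (bas b \<otimes>\<^sub>Q bas a)) v) u"

lemma brd_bilin: "bilin brd"
proof -
  have "brd = (\<lambda>u v. lext (\<lambda>a. lext (\<lambda>b. \<chi> (deg a) (deg b) *\<^sub>Q (bas b \<otimes>\<^sub>Q bas a)) v) u)"
    by (intro ext) (rule brd_def)
  then show ?thesis using bilin_lext by simp
qed

lemma brd_components:
  assumes u: "u \<in> S" and v: "v \<in> S"
  shows "(\<Sum>\<gamma> | components G part u \<gamma> \<noteq> 0. \<Sum>\<delta> | components G part v \<delta> \<noteq> 0.
    \<chi> \<gamma> \<delta> *\<^sub>Q (components G part v \<delta> \<otimes>\<^sub>Q components G part u \<gamma>)) = brd u v"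
proof -
  let ?A = "deg ` supp u" and ?B = "deg ` supp v"
  \<comment> \<open>The index sets are frozen at the degrees occurring in \<open>u\<close> and
    \<open>v\<close>, so that the left side becomes bilinear and can be tested on basis vectors from
    the two supports.\<close>
  have "(\<Sum>\<gamma>\<in>?A. \<Sum>\<delta>\<in>?B. \<chi> \<gamma> \<delta> *\<^sub>Q (homog \<delta> v \<otimes>\<^sub>Q homog \<gamma> u)) = brd u v"
  proof (rule bilin_eq_on_span[OF _ brd_bilin, of "\<lambda>u v. (\<Sum>\<gamma>\<in>?A. \<Sum>\<delta>\<in>?B. \<chi> \<gamma> \<delta> *\<^sub>Q (homog \<delta> v \<otimes>\<^sub>Q homog \<gamma> u))"])
    show "bilin (\<lambda>u v. (\<Sum>\<gamma>\<in>?A. \<Sum>\<delta>\<in>?B. \<chi> \<gamma> \<delta> *\<^sub>Q (homog \<delta> v \<otimes>\<^sub>Q homog \<gamma> u)))"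
      by (intro bilinI lin_sum_fun lin_scale lin_compose[OF pure_lin(1) homog_lin] lin_compose[OF pure_lin(2) homog_lin])
    show "u \<in> Q.span (bas ` supp u)" "v \<in> Q.span (bas ` supp v)" by (simp_all add: span_basis_iff)
    fix a' b' :: "'i rat_comb" assume "a' \<in> bas ` supp u" "b' \<in> bas ` supp v"
    then obtain a b where a: "a' = bas a" "a \<in> supp u" and b: "b' = bas b" "b \<in> supp v" by blast
    have hb: "homog \<gamma> (bas i) = (if \<gamma> = deg i then bas i else 0)" for \<gamma> i by (auto simp: homog_def lext_basis)
    have "(\<Sum>\<gamma>\<in>?A. \<Sum>\<delta>\<in>?B. \<chi> \<gamma> \<delta> *\<^sub>Q (homog \<delta> b' \<otimes>\<^sub>Q homog \<gamma> a'))
      = (\<Sum>\<gamma>\<in>?A. if \<gamma> = deg a then (\<Sum>\<delta>\<in>?B. if \<delta> = deg b then \<chi> \<gamma> \<delta> *\<^sub>Q (bas b \<otimes>\<^sub>Q bas a) else 0) else 0)"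
    proof (intro sum.cong refl)
      fix \<gamma>
      have "\<chi> \<gamma> \<delta> *\<^sub>Q (homog \<delta> b' \<otimes>\<^sub>Q homog \<gamma> a') =
        (if \<gamma> = deg a then if \<delta> = deg b then \<chi> \<gamma> \<delta> *\<^sub>Q (bas b \<otimes>\<^sub>Q bas a) else 0 else 0)" for \<delta>
        unfolding a b hb by (simp add: lin_0[OF pure_lin(1)] lin_0[OF pure_lin(2)])
      then show "(\<Sum>\<delta>\<in>?B. \<chi> \<gamma> \<delta> *\<^sub>Q (homog \<delta> b' \<otimes>\<^sub>Q homog \<gamma> a')) =
        (if \<gamma> = deg a then (\<Sum>\<delta>\<in>?B. if \<delta> = deg b then \<chi> \<gamma> \<delta> *\<^sub>Q (bas b \<otimes>\<^sub>Q bas a) else 0) else 0)" by simp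
    qed
    also have "\<dots> = \<chi> (deg a) (deg b) *\<^sub>Q (bas b \<otimes>\<^sub>Q bas a)" using a b by simp
    finally show "(\<Sum>\<gamma>\<in>?A. \<Sum>\<delta>\<in>?B. \<chi> \<gamma> \<delta> *\<^sub>Q (homog \<delta> b' \<otimes>\<^sub>Q homog \<gamma> a')) = brd a' b'"
      by (simp add: brd_def a b lext_basis)
  qed
  then show ?thesis by (simp add: components_part u v homog_nonzero)
qed

lemma braiding_pure:
  assumes "u \<in> S" "v \<in> S"
  shows "braiding G \<chi> part part (u \<otimes>\<^sub>Q v) = brd u v"
proof -
  from tensor_universal[OF brd_bilin] obtain L where L: "lin L" "\<And>u v. L (u \<otimes>\<^sub>Q v) = brd u v" by blast
  have "braiding G \<chi> part part (u \<otimes>\<^sub>Q v) = L (u \<otimes>\<^sub>Q v)"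
    unfolding braiding_def total_eq
    by (rule tensor_lift_eq[OF S_subspace S_subspace L(1) _ pure_in_tensor_space[OF assms]]) (simp add: L(2) brd_components)
  then show ?thesis using L by simp
qed

lemma brd_in: "u \<in> S \<Longrightarrow> v \<in> S \<Longrightarrow> brd u v \<in> tensor_space S S"
  unfolding brd_def lext_def
  by (intro Q.subspace_sum[OF tensor_space_subspace] Q.subspace_scale[OF tensor_space_subspace] pure_in_tensor_space bas_S)
    (auto simp: S_iff)

text \<open>A globally bilinear stand-in for \<open>braided_prod\<close>, with which it agrees on
  the tensor square of \<open>S\<close>; bilinearity is then available without membership
  conditions.\<close>

definition sqprd :: "('i rat_comb, 'i rat_comb) tensor \<Rightarrow> ('i rat_comb, 'i rat_comb) tensor \<Rightarrow> ('i rat_comb, 'i rat_comb) tensor" where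
  "sqprd = (SOME M. bilin M \<and> (\<forall>a b c d. M (a \<otimes>\<^sub>Q b) (c \<otimes>\<^sub>Q d) =
     lext (\<lambda>i. lext (\<lambda>j. \<chi> (deg i) (deg j) *\<^sub>Q (prd a (bas j) \<otimes>\<^sub>Q prd (bas i) d)) c) b))"

lemma sqprd: "bilin sqprd"
  "sqprd (a \<otimes>\<^sub>Q b) (c \<otimes>\<^sub>Q d) = lext (\<lambda>i. lext (\<lambda>j. \<chi> (deg i) (deg j) *\<^sub>Q (prd a (bas j) \<otimes>\<^sub>Q prd (bas i) d)) c) b"
proof -
  have "\<exists>M. bilin M \<and> (\<forall>a b c d. M (a \<otimes>\<^sub>Q b) (c \<otimes>\<^sub>Q d) =
     lext (\<lambda>i. lext (\<lambda>j. \<chi> (deg i) (deg j) *\<^sub>Q (prd a (bas j) \<otimes>\<^sub>Q prd (bas i) d)) c) b)"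
    by (rule tensor_universal4)
      (intro lin_lext lin_lext_fun lin_scale lin_compose[OF pure_lin(1) prd_lin(1)] lin_compose[OF pure_lin(2) prd_lin(2)])+
  from someI_ex[OF this] show "bilin sqprd"
    "sqprd (a \<otimes>\<^sub>Q b) (c \<otimes>\<^sub>Q d) = lext (\<lambda>i. lext (\<lambda>j. \<chi> (deg i) (deg j) *\<^sub>Q (prd a (bas j) \<otimes>\<^sub>Q prd (bas i) d)) c) b"
    unfolding sqprd_def by blast+
qed

lemma braided_prod_eq:
  assumes s: "s \<in> tensor_space S S" and t: "t \<in> tensor_space S S"
  shows "braided_prod G \<chi> hall s t = sqprd s t"
proof -
  have 1: "tensor_lift S S (\<lambda>c' b'. prd a c' \<otimes>\<^sub>Q prd b' d) (braiding G \<chi> part part (b \<otimes>\<^sub>Q c)) = sqprd (a \<otimes>\<^sub>Q b) (c \<otimes>\<^sub>Q d)"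
    if "a \<in> S" "b \<in> S" "c \<in> S" "d \<in> S" for a b c d
  proof -
    have "bilin (\<lambda>c' b'. prd a c' \<otimes>\<^sub>Q prd b' d)"
      by (intro bilinI lin_compose[OF pure_lin(1) prd_lin(2)] lin_compose[OF pure_lin(2) prd_lin(1)])
    from tensor_universal[OF this] obtain K where K: "lin K" "\<And>u v. K (u \<otimes>\<^sub>Q v) = prd a u \<otimes>\<^sub>Q prd v d" by blast
    have "tensor_lift S S (\<lambda>c' b'. prd a c' \<otimes>\<^sub>Q prd b' d) (brd b c) = K (brd b c)"
      by (rule tensor_lift_eq[OF S_subspace S_subspace K(1) _ brd_in]) (use that K(2) in auto)
    also have "\<dots> = sqprd (a \<otimes>\<^sub>Q b) (c \<otimes>\<^sub>Q d)"
      unfolding brd_def sqprd by (simp add: lin_lext_comm[OF K(1)] linD[OF K(1)] K(2))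
    finally show ?thesis using that by (simp add: braiding_pure)
  qed
  have 2: "tensor_lift S S (\<lambda>c d. tensor_lift S S (\<lambda>c' b'. prd a c' \<otimes>\<^sub>Q prd b' d) (braiding G \<chi> part part (b \<otimes>\<^sub>Q c))) t = sqprd (a \<otimes>\<^sub>Q b) t"
    if "a \<in> S" "b \<in> S" for a b
    by (rule tensor_lift_eq[OF S_subspace S_subspace bilinD(2)[OF sqprd(1)] _ t]) (use that 1 in auto)
  show ?thesis
    unfolding braided_prod_def Let_def hall_simps total_eq
    by (rule tensor_lift_eq[OF S_subspace S_subspace bilinD(1)[OF sqprd(1)] _ s]) (use 2 in auto)
qed

text \<open>The coefficient at the pair \<open>p\<close>, \<open>q\<close> of the two sides is
  Green's formula for the quotient \<open>q\<close> and the sub-object \<open>p\<close>, divided by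
  \<open>au m * au n\<close>.\<close>

lemma coprd_prd:
  assumes x: "x \<in> S" and y: "y \<in> S"
  shows "coprd (prd x y) = sqprd (coprd x) (coprd y)"
proof (rule bilin_eq_on_span[OF _ _ _ x[unfolded S_def] y[unfolded S_def]])
  show "bilin (\<lambda>x y. coprd (prd x y))"
    by (intro bilinI lin_compose[OF coprd_lin prd_lin(1)] lin_compose[OF coprd_lin prd_lin(2)])
  show "bilin (\<lambda>x y. sqprd (coprd x) (coprd y))"
    by (intro bilinI lin_compose[OF bilinD(1)[OF sqprd(1)] coprd_lin] lin_compose[OF bilinD(2)[OF sqprd(1)] coprd_lin])
  fix m' n' :: "'i rat_comb" assume "m' \<in> bas ` I" "n' \<in> bas ` I"
  then obtain m n where m: "m' = bas m" "m \<in> I" and n: "n' = bas n" "n \<in> I" by blast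
  let ?\<gamma> = "deg m \<otimes> deg n"
  let ?J = "low ?\<gamma>"
  have dc: "deg m \<in> carrier G" "deg n \<in> carrier G" using deg_carrier m n by blast+
  have f: "finite ?J" using fin_low_mult m n by simp
  have i: "a \<in> I" if "a \<in> ?J" for a using that low_sub by blast
  have k: "supp (pr_basis m n) \<subseteq> ?J"
    using keys_pr_basis[OF m(2) n(2)] low_self by fastforce
  have lm: "low (deg m) \<subseteq> ?J" using low_mono[OF dc] .
  have ln: "low (deg n) \<subseteq> ?J" using low_mono[OF dc(2,1)] dc by (simp add: m_comm)
  have "coprd m' = (\<Sum>b\<in>?J. \<Sum>a\<in>?J. (g a b m / au m) *\<^sub>Q (bas b \<otimes>\<^sub>Q bas a))"
    unfolding m coprd_basis by (rule copr_basis_eq[OF m(2) f low_sub lm])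
  then have cm: "coprd m' = (\<Sum>a\<in>?J. \<Sum>b\<in>?J. (g a b m / au m) *\<^sub>Q (bas b \<otimes>\<^sub>Q bas a))"
    by (rule trans) (rule sum.swap)
  have "coprd n' = (\<Sum>d\<in>?J. \<Sum>c\<in>?J. (g c d n / au n) *\<^sub>Q (bas d \<otimes>\<^sub>Q bas c))"
    unfolding n coprd_basis by (rule copr_basis_eq[OF n(2) f low_sub ln])
  then have cn: "coprd n' = (\<Sum>c\<in>?J. \<Sum>d\<in>?J. (g c d n / au n) *\<^sub>Q (bas d \<otimes>\<^sub>Q bas c))"
    by (rule trans) (rule sum.swap)
  have sq: "sqprd (bas b \<otimes>\<^sub>Q bas a) (bas d \<otimes>\<^sub>Q bas c) = \<chi> (deg a) (deg d) *\<^sub>Q (pr_basis b d \<otimes>\<^sub>Q pr_basis a c)" for a b c d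
    by (simp add: sqprd lext_basis prd_basis)
  note M1 = bilinD(1)[OF sqprd(1)] and M2 = bilinD(2)[OF sqprd(1)]
  show "coprd (prd m' n') = sqprd (coprd m') (coprd n')"
  proof (rule tensor_coef_eqI)
    fix p q
    have "coprd (prd m' n') = (\<Sum>e\<in>?J. coef (pr_basis m n) e *\<^sub>Q copr_basis e)"
      unfolding m n prd_basis coprd_lext by (rule lext_superset[OF f k])
    then have l: "tcoef (coprd (prd m' n')) p q = (\<Sum>e\<in>?J. num m n e * (if p \<in> I \<and> q \<in> I then g q p e / au e else 0))"
      using i by (simp add: lin_sum[OF tcoef(1)] linD[OF tcoef(1)] tcoef_copr_basis lookup_pr_basis m n scaleQ_rat_def)
    have "sqprd (coprd m') (coprd n') = (\<Sum>a\<in>?J. \<Sum>b\<in>?J. (g a b m / au m) *\<^sub>Q (\<Sum>c\<in>?J. \<Sum>d\<in>?J. (g c d n / au n) *\<^sub>Q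
        \<chi> (deg a) (deg d) *\<^sub>Q (pr_basis b d \<otimes>\<^sub>Q pr_basis a c)))"
      by (subst cm, simp only: lin_sum[OF M1] linD[OF M1], subst cn, simp only: lin_sum[OF M2] linD[OF M2] sq)
    then have r: "tcoef (sqprd (coprd m') (coprd n')) p q = (\<Sum>a\<in>?J. \<Sum>b\<in>?J. (g a b m / au m) * (\<Sum>c\<in>?J. \<Sum>d\<in>?J. (g c d n / au n) *
        (\<chi> (deg a) (deg d) * (coef (pr_basis b d) p * coef (pr_basis a c) q))))"
      by (simp only: lin_sum[OF tcoef(1)] linD[OF tcoef(1)] tcoef(2) scaleQ_rat_def)
    show "tcoef (coprd (prd m' n')) p q = tcoef (sqprd (coprd m') (coprd n')) p q"
    proof (cases "p \<in> I \<and> q \<in> I")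
      case True
      have "tcoef (coprd (prd m' n')) p q = (\<Sum>e\<in>?J. g m n e * g q p e / au e) / (au m * au n)"
        unfolding l using True by (simp add: num_def sum_divide_distrib mult_ac)
      also have "\<dots> = (\<Sum>a\<in>?J. \<Sum>b\<in>?J. \<Sum>c\<in>?J. \<Sum>d\<in>?J.
        \<chi> (deg a) (deg d) * (g c d n * g b d p * g a c q * g a b m) / (au a * au b * au c * au d)) / (au m * au n)"
        using g_green[OF m(2) n(2) _ _ f low_sub order_refl, of q p] True by simp
      also have "\<dots> = tcoef (sqprd (coprd m') (coprd n')) p q"
        unfolding r sum_divide_distrib sum_distrib_left
        by (intro sum.cong refl) (use True i in \<open>simp add: lookup_pr_basis num_def mult_ac\<close>)
      finally show ?thesis .
    next
      case False
      have "coef (pr_basis b d) p * coef (pr_basis a c) q = 0" 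
        if "a \<in> ?J" "b \<in> ?J" "c \<in> ?J" "d \<in> ?J" for a b c d
        using False that i by (auto simp: lookup_pr_basis)
      then have "(\<Sum>c\<in>?J. \<Sum>d\<in>?J. (g c d n / au n) *
        (\<chi> (deg a) (deg d) * (coef (pr_basis b d) p * coef (pr_basis a c) q))) = 0"
        if "a \<in> ?J" "b \<in> ?J" for a b
        using that by (intro sum.neutral ballI) (simp only: mult_zero_right)
      then have "tcoef (sqprd (coprd m') (coprd n')) p q = 0"
        unfolding r by (intro sum.neutral ballI) (simp only: mult_zero_right)
      moreover have "tcoef (coprd (prd m' n')) p q = 0"
        unfolding l using False by (intro sum.neutral ballI) auto
      ultimately show ?thesis by simp
    qed
  qed
qed

lemma hall_braided_bialgebra: "braided_bialgebra G \<chi> hall"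
proof (intro braided_bialgebra.intro braided_bialgebra_axioms.intro; (simp only: hall_simps total_eq)?)
  show "bicharacter G \<chi>" by (rule bicharacter_axioms)
  show "structure_graded hall G part" by (rule hall_structure_graded)
  show "linear_on S (\<lambda>x. prd x y)" "linear_on S (prd y)" "linear_on S coprd" "linear_on S (\<lambda>x. coef x z)" for y
    using prd_lin coprd_lin by (auto simp: linear_on_def lin_def lookup_add lookup_scaleQ)
  show "prd (prd x y) w = prd x (prd y w)" if "x \<in> S" "y \<in> S" "w \<in> S" for x y w using prd_assoc that .
  show "prd (bas z) x = x" "prd x (bas z) = x" if "x \<in> S" for x using prd_unit that by auto
  show "tensor_assoc S S S (tensor_map S S coprd id (coprd x)) = tensor_map S S id coprd (coprd x)" if "x \<in> S" for x
    using coprd_coassoc that .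
  show "tensor_lift S S (\<lambda>u v. coef u z *\<^sub>Q v) (coprd x) = x"
    "tensor_lift S S (\<lambda>u v. coef v z *\<^sub>Q u) (coprd x) = x" if "x \<in> S" for x
    using counit_coprd that by auto
  show "coprd (prd x y) = braided_prod G \<chi> hall (coprd x) (coprd y)" if "x \<in> S" "y \<in> S" for x y
    using coprd_prd that braided_prod_eq coprd_S by simp
  show "coprd (bas z) = bas z \<otimes>\<^sub>Q bas z" by (simp add: coprd_basis coprd_unit)
  show "coef (prd x y) z = coef x z * coef y z" if "x \<in> S" "y \<in> S" for x y
    using counit_prd that .
  show "coef (bas z) z = (1::rat)" by simp
qed

end

section \<open>Primitive elements\<close>

lemma tcoef_outside:
  fixes t :: "('a \<Rightarrow>\<^sub>0 rat, 'b \<Rightarrow>\<^sub>0 rat) tensor"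
  assumes t: "t \<in> tensor_space U V" and "\<And>u. u \<in> U \<Longrightarrow> coef u a = 0 \<or> (\<forall>v\<in>V. coef v b = 0)"
  shows "tcoef t a b = 0"
proof (rule lin_eq_on_span[OF tcoef(1) lin_zero _ t[unfolded tensor_space_def]])
  fix s :: "('a \<Rightarrow>\<^sub>0 rat, 'b \<Rightarrow>\<^sub>0 rat) tensor" assume "s \<in> {u \<otimes>\<^sub>Q v | u v. u \<in> U \<and> v \<in> V}"
  then obtain u v where "s = u \<otimes>\<^sub>Q v" "u \<in> U" "v \<in> V" by blast
  then show "tcoef s a b = 0" using assms(2)[of u] by (auto simp: tcoef(2))
qed

context hall_data
begin

definition ip :: "'i rat_comb \<Rightarrow> 'i rat_comb \<Rightarrow> rat" where
  "ip x y = lext (\<lambda>a. coef y a / au a) x"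

lemma lin_lookup_div: "lin (\<lambda>y::'i rat_comb. coef y a / r)"
  using lin_compose[OF lin_mult_right(1)[of "inverse r"] lin_lookup[of a]] by (simp add: divide_inverse)

lemma ip_lin: "lin (\<lambda>x. ip x y)" "lin (ip x)"
  unfolding ip_def by (rule lin_lext) (intro lin_lext_fun lin_lookup_div)

lemma ip_bilin: "bilin ip"
  by (intro bilinI ip_lin)

lemma ip_basis: "ip (bas a) y = coef y a / au a"
  by (simp add: ip_def lext_basis)

lemma span_range_bas: "x \<in> Q.span (range bas)"
  by (simp add: span_basis_iff)

lemma ip_sym: "ip x y = ip y x"
proof (rule bilin_eq_on_span[OF ip_bilin _ _ span_range_bas span_range_bas])
  show "bilin (\<lambda>x y. ip y x)" by (intro bilinI ip_lin)
  show "ip a' b' = ip b' a'" if "a' \<in> range bas" "b' \<in> range bas" for a' b'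
    using that by (auto simp: ip_basis lookup_single when_def)
qed

text \<open>A sum of squares with positive weights; the order of the rational numbers is used
  here.\<close>

lemma ip_pos:
  assumes "x \<in> S" "ip x x = 0"
  shows "x = 0"
proof -
  have k: "0 < au a" if "a \<in> supp x" for a using that assms(1) au_pos by (auto simp: S_iff)
  have "(\<Sum>a\<in>supp x. coef x a * (coef x a / au a)) = 0"
    using assms(2) by (simp add: ip_def lext_def scaleQ_rat_def)
  then have "\<forall>a\<in>supp x. coef x a * (coef x a / au a) = 0"
    by (subst (asm) sum_nonneg_eq_0_iff) (use k in \<open>auto intro: divide_nonneg_pos\<close>)
  then have "a \<notin> supp x" for a using k[of a] in_keys_iff[of a x] by fastforce
  then have "supp x = {}" by blast
  then show ?thesis by simp
qed

text \<open>The form induced on the tensor square, with \<open>v \<otimes>\<^sub>Q u\<close> as its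
  first argument, given through coordinates so that linearity in \<open>t\<close> is
  immediate.\<close>

definition tip :: "'i rat_comb \<Rightarrow> 'i rat_comb \<Rightarrow> ('i rat_comb, 'i rat_comb) tensor \<Rightarrow> rat" where
  "tip v u t = lext (\<lambda>a. lext (\<lambda>b. tcoef t a b / (au a * au b)) u) v"

lemma lin_tcoef_div: "lin (\<lambda>t. tcoef t a b / r)"
  using lin_compose[OF lin_mult_right(1)[of "inverse r"] tcoef(1)[of a b]] by (simp add: divide_inverse)

lemma tip_lin: "lin (\<lambda>v. tip v u t)" "lin (\<lambda>u. tip v u t)" "lin (tip v u)"
  unfolding tip_def by (rule lin_lext) (intro lin_lext_fun lin_lext, intro lin_lext_fun lin_tcoef_div)

lemma tip_pure: "tip v u (p \<otimes>\<^sub>Q q) = ip v p * ip u q"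
  unfolding tip_def ip_def lext_def scaleQ_rat_def sum_product
  by (simp add: tcoef(2) sum_distrib_left mult_ac)

text \<open>On basis vectors both sides equal \<open>g a b c\<close> divided by the three
  automorphism orders. The factors appear in reverse order because the product takes the quotient
  first while the coproduct puts the sub-object first.\<close>

lemma ip_prd:
  assumes u: "u \<in> S" and v: "v \<in> S" and w: "w \<in> S"
  shows "ip (prd u v) w = tip v u (coprd w)"
proof (rule bilin_eq_on_span[OF _ _ _ u[unfolded S_def] v[unfolded S_def]])
  show "bilin (\<lambda>u v. ip (prd u v) w)"
    by (intro bilinI lin_compose[OF ip_lin(1) prd_lin(1)] lin_compose[OF ip_lin(1) prd_lin(2)])
  show "bilin (\<lambda>u v. tip v u (coprd w))" by (intro bilinI tip_lin)
  fix a' b' :: "'i rat_comb" assume "a' \<in> bas ` I" "b' \<in> bas ` I"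
  then obtain a b where ab: "a' = bas a" "a \<in> I" "b' = bas b" "b \<in> I" by blast
  show "ip (prd a' b') w = tip b' a' (coprd w)"
  proof (rule lin_eq_on_span[OF ip_lin(2) lin_compose[OF tip_lin(3) coprd_lin] _ w[unfolded S_def]])
    fix c' :: "'i rat_comb" assume "c' \<in> bas ` I"
    then obtain c where c: "c' = bas c" "c \<in> I" by blast
    have "ip (prd a' b') c' = g a b c / (au a * au b) / au c"
      using ab c by (subst ip_sym) (simp add: prd_basis ip_basis lookup_pr_basis num_def)
    also have "\<dots> = tip b' a' (coprd c')"
      using ab c by (simp add: tip_def lext_basis coprd_basis tcoef_copr_basis mult_ac)
    finally show "ip (prd a' b') c' = tip b' a' (coprd c')" .
  qed
qed

lemma tcoef_coprd:
  assumes "v \<in> S" "a \<in> I" "b \<in> I"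
  shows "tcoef (coprd v) a b = au a * au b * ip (prd (bas b) (bas a)) v"
  using ip_prd[OF bas_S[OF assms(3)] bas_S[OF assms(2)] assms(1)] au_pos[OF assms(2)] au_pos[OF assms(3)]
  by (simp add: tip_def lext_basis)

definition Prim where "Prim = primitives G hall"

lemma Prim_iff: "v \<in> Prim \<longleftrightarrow> v \<in> S \<and> coprd v = v \<otimes>\<^sub>Q bas z + bas z \<otimes>\<^sub>Q v"
  by (simp add: Prim_def primitives_def total_eq)

lemma Prim_S: "v \<in> Prim \<Longrightarrow> v \<in> S"
  by (simp add: Prim_iff)

lemma z_S: "bas z \<in> S"
  using bas_S z_in .

lemma ip_z: "ip (bas z) x = coef x z" "ip x (bas z) = coef x z"
  by (simp_all add: ip_sym[of x] ip_basis au_z)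

lemma Prim_z:
  assumes v: "v \<in> Prim" shows "coef v z = 0"
proof -
  \<comment> \<open>Evaluation at the pair \<open>z\<close>, \<open>z\<close> gives
    \<open>coef v z\<close> once from the pairing and twice from primitivity.\<close>
  have "coef v z = tcoef (coprd v) z z"
    using tcoef_coprd[OF Prim_S[OF v] z_in z_in] by (simp add: au_z prd_unit z_S ip_z)
  also have "\<dots> = coef v z + coef v z"
    using v by (simp add: Prim_iff linD[OF tcoef(1)] tcoef(2))
  finally show ?thesis by simp
qed

lemma ip_prd_Prim:
  assumes "x \<in> S" "y \<in> S" "v \<in> Prim"
  shows "ip (prd x y) v = ip y v * coef x z + coef y z * ip x v"
  using ip_prd[OF assms(1,2) Prim_S[OF assms(3)]] assms(3)
  by (simp add: Prim_iff linD[OF tip_lin(3)] tip_pure ip_z)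

text \<open>By \<open>tcoef_coprd\<close> the coefficients of the coproduct are values of the form
  on products. Those with a factor \<open>z\<close> are fixed by the unit, all others vanish by
  hypothesis.\<close>

lemma PrimI:
  assumes v: "v \<in> S" and vz: "coef v z = 0"
    and o: "\<And>a b. a \<in> I \<Longrightarrow> b \<in> I \<Longrightarrow> a \<noteq> z \<Longrightarrow> b \<noteq> z \<Longrightarrow> ip (prd (bas a) (bas b)) v = 0"
  shows "v \<in> Prim"
proof -
  have v0: "coef v a = 0" if "a \<notin> I" for a using v that by (auto simp: S_iff in_keys_iff)
  have "coprd v = v \<otimes>\<^sub>Q bas z + bas z \<otimes>\<^sub>Q v"
  proof (rule tensor_coef_eqI)
    fix a b
    have r: "tcoef (v \<otimes>\<^sub>Q bas z + bas z \<otimes>\<^sub>Q v) a b =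
      (if b = z then coef v a else 0) + (if a = z then coef v b else 0)"
      by (simp add: linD[OF tcoef(1)] tcoef(2) lookup_single when_def)
    show "tcoef (coprd v) a b = tcoef (v \<otimes>\<^sub>Q bas z + bas z \<otimes>\<^sub>Q v) a b"
    proof (cases "a \<in> I \<and> b \<in> I")
      case True
      then show ?thesis
        unfolding r using o[of b a] vz au_pos[of a] au_pos[of b]
        by (cases "a = z"; cases "b = z") (simp_all add: tcoef_coprd[OF v] au_z prd_unit bas_S ip_z ip_basis)
    next
      case False
      have "coef u c = 0" if "u \<in> S" "c \<notin> I" for u c using that by (auto simp: S_iff in_keys_iff)
      then have "tcoef (coprd v) a b = 0" using tcoef_outside[OF coprd_S[OF v]] False by blast
      then show ?thesis unfolding r using False v0 z_in by auto
    qed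
  qed
  then show ?thesis using v by (simp add: Prim_iff)
qed

lemma Prim_subspace: "Q.subspace Prim"
proof (rule Q.subspaceI)
  show "0 \<in> Prim"
    by (simp add: Prim_iff lin_0[OF coprd_lin] lin_0[OF pure_lin(1)] lin_0[OF pure_lin(2)] Q.subspace_0[OF S_subspace])
  show "x + y \<in> Prim" if "x \<in> Prim" "y \<in> Prim" for x y
    using that by (simp add: Prim_iff linD[OF coprd_lin] linD[OF pure_lin(1)] linD[OF pure_lin(2)] Q.subspace_add[OF S_subspace])
  show "c *\<^sub>Q x \<in> Prim" if "x \<in> Prim" for c x
    using that by (simp add: Prim_iff linD[OF coprd_lin] linD[OF pure_lin(1)] linD[OF pure_lin(2)] Q.subspace_scale[OF S_subspace] Q.scale_right_distrib)
qed

lemma part_S: "x \<in> part \<gamma> \<Longrightarrow> x \<in> S"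
  by (auto simp: part_iff S_iff)

lemma homog_of_part: "x \<in> part \<delta> \<Longrightarrow> homog \<gamma> x = (if \<gamma> = \<delta> then x else 0)"
  by (rule poly_mapping_eqI) (auto simp: lookup_homog part_iff in_keys_iff)

lemma ip_part:
  assumes "x \<in> part \<delta>"
  shows "ip x (homog \<gamma> y) = (if \<gamma> = \<delta> then ip x y else 0)"
  unfolding ip_def lext_def using assms by (auto simp: part_iff lookup_homog intro!: sum.cong sum.neutral)

text \<open>Primitivity amounts to a zero constant term and orthogonality to products of nonunit
  basis vectors. These products are homogeneous, so every homogeneous component satisfies the
  condition separately.\<close>

lemma Prim_homog:
  assumes v: "v \<in> Prim" shows "homog \<gamma> v \<in> Prim"
proof (rule PrimI)
  show "homog \<gamma> v \<in> S" using homog_part[OF Prim_S[OF v]] part_S by blast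
  show "coef (homog \<gamma> v) z = 0" using Prim_z[OF v] by (simp add: lookup_homog)
  fix a b assume ab: "a \<in> I" "b \<in> I" "a \<noteq> z" "b \<noteq> z"
  have "bas a \<in> part (deg a)" "bas b \<in> part (deg b)" using ab by (simp_all add: part_iff)
  then have "prd (bas a) (bas b) \<in> part (deg a \<otimes> deg b)" by (rule prd_part)
  moreover have "ip (prd (bas a) (bas b)) v = 0"
    using ab ip_prd_Prim[OF bas_S[OF ab(1)] bas_S[OF ab(2)] v] by (simp add: lookup_single when_def)
  ultimately show "ip (prd (bas a) (bas b)) (homog \<gamma> v) = 0" by (simp add: ip_part)
qed

text \<open>Products are built by multiplying with one primitive element on the left, so that
  inductions split off a single primitive factor, whose coproduct is explicit.\<close>

primrec N :: "nat \<Rightarrow> 'i rat_comb set" where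
  "N 0 = Q.span {bas z}"
| "N (Suc n) = Q.span {prd v x | v x. v \<in> Prim \<and> x \<in> N n}"

lemma N_subspace: "Q.subspace (N n)"
  by (cases n) simp_all

lemma N_Suc: "v \<in> Prim \<Longrightarrow> x \<in> N n \<Longrightarrow> prd v x \<in> N (Suc n)"
  by (auto intro: Q.span_base)

lemma N_S: "x \<in> N n \<Longrightarrow> x \<in> S"
proof (induction n arbitrary: x)
  case 0
  then show ?case using Q.span_minimal[of "{bas z}" S] S_subspace z_S by auto
next
  case (Suc n)
  have "Q.span {prd v x | v x. v \<in> Prim \<and> x \<in> N n} \<subseteq> S"
    by (rule Q.span_minimal) (use Suc.IH prd_S Prim_S S_subspace in auto)
  then show ?case using Suc.prems by auto
qed

lemma N_1: "N 1 = Prim"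
proof
  show "Prim \<subseteq> N 1"
  proof
    fix v assume v: "v \<in> Prim"
    have "bas z \<in> N 0" by (simp add: Q.span_base)
    from N_Suc[OF v this] show "v \<in> N 1" using prd_unit(2)[OF Prim_S[OF v]] by simp
  qed
  have "prd v x \<in> Prim" if v: "v \<in> Prim" and x: "x \<in> Q.span {bas z}" for v x
    by (rule lin_span_image[OF prd_lin(2) _ Prim_subspace x]) (use v prd_unit(2)[OF Prim_S[OF v]] in auto)
  then show "N 1 \<subseteq> Prim"
    unfolding One_nat_def N.simps by (intro Q.span_minimal Prim_subspace) auto
qed

lemma N_prd: "x \<in> N i \<Longrightarrow> y \<in> N j \<Longrightarrow> prd x y \<in> N (i + j)"
proof (induction i arbitrary: x)
  case 0
  show ?case
    by (rule lin_span_image[OF prd_lin(1) _ N_subspace 0(1)[unfolded N.simps]]) (use 0(2) prd_unit(1)[OF N_S[OF 0(2)]] in auto)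
next
  case (Suc i)
  show ?case
  proof (rule lin_span_image[OF prd_lin(1) _ N_subspace Suc.prems(1)[unfolded N.simps]])
    fix w assume "w \<in> {prd v x | v x. v \<in> Prim \<and> x \<in> N i}"
    then obtain v x where w: "w = prd v x" "v \<in> Prim" "x \<in> N i" by blast
    then have "prd w y = prd v (prd x y)" using prd_assoc N_S Prim_S Suc.prems(2) by blast
    then show "prd w y \<in> N (Suc i + j)" using N_Suc[OF w(2) Suc.IH[OF w(3) Suc.prems(2)]] by simp
  qed
qed

lemma homog_prd:
  assumes "x \<in> S" "y \<in> S"
  shows "homog \<gamma> (prd x y) = (\<Sum>\<alpha>\<in>deg ` supp x. \<Sum>\<beta>\<in>deg ` supp y.
    if \<gamma> = \<alpha> \<otimes> \<beta> then prd (homog \<alpha> x) (homog \<beta> y) else 0)"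
proof -
  let ?A = "deg ` supp x" and ?B = "deg ` supp y"
  have "prd x y = prd (\<Sum>\<alpha>\<in>?A. homog \<alpha> x) (\<Sum>\<beta>\<in>?B. homog \<beta> y)" by (simp add: homog_sum)
  also have "\<dots> = (\<Sum>\<alpha>\<in>?A. \<Sum>\<beta>\<in>?B. prd (homog \<alpha> x) (homog \<beta> y))"
    by (simp only: lin_sum[OF prd_lin(1)], simp only: lin_sum[OF prd_lin(2)])
  finally have "homog \<gamma> (prd x y) = (\<Sum>\<alpha>\<in>?A. \<Sum>\<beta>\<in>?B. homog \<gamma> (prd (homog \<alpha> x) (homog \<beta> y)))"
    by (simp only: lin_sum[OF homog_lin])
  then show ?thesis using homog_of_part[OF prd_part[OF homog_part[OF assms(1)] homog_part[OF assms(2)]]] by simp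
qed

lemma N_homog: "x \<in> N n \<Longrightarrow> homog \<gamma> x \<in> N n"
proof (induction n arbitrary: x \<gamma>)
  case 0
  have "bas z \<in> part (deg z)" using z_in by (simp add: part_iff)
  then show ?case
    by (intro lin_span_image[OF homog_lin _ N_subspace 0[unfolded N.simps]]) (auto simp: homog_of_part Q.span_base Q.span_zero)
next
  case (Suc n)
  show ?case
  proof (rule lin_span_image[OF homog_lin _ N_subspace Suc.prems[unfolded N.simps]])
    fix w assume "w \<in> {prd v x | v x. v \<in> Prim \<and> x \<in> N n}"
    then obtain v x where w: "w = prd v x" "v \<in> Prim" "x \<in> N n" by blast
    show "homog \<gamma> w \<in> N (Suc n)"
      unfolding w(1) homog_prd[OF Prim_S[OF w(2)] N_S[OF w(3)]]
      using N_Suc[OF Prim_homog[OF w(2)] Suc.IH[OF w(3)]] Q.subspace_0[OF N_subspace]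
      by (intro Q.subspace_sum[OF N_subspace]) (auto simp del: N.simps)
  qed
qed

lemma N_graded: "graded_subspace G part (N n)"
  unfolding graded_subspace_def
proof (intro conjI N_subspace equalityI subsetI)
  fix x assume x: "x \<in> N n"
  have "x = (\<Sum>\<gamma>\<in>deg ` supp x. homog \<gamma> x)" by (simp add: homog_sum)
  also have "\<dots> \<in> total_space G (\<lambda>\<gamma>. N n \<inter> part \<gamma>)"
    unfolding total_space_def
  proof (intro Q.span_sum Q.span_base)
    fix \<gamma> assume "\<gamma> \<in> deg ` supp x"
    then have "\<gamma> \<in> carrier G" using N_S[OF x] deg_carrier by (auto simp: S_iff)
    then show "homog \<gamma> x \<in> (\<Union>\<gamma>\<in>carrier G. N n \<inter> part \<gamma>)" using N_homog[OF x] homog_part[OF N_S[OF x]] by blast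
  qed
  finally show "x \<in> total_space G (\<lambda>\<gamma>. N n \<inter> part \<gamma>)" .
next
  fix x assume "x \<in> total_space G (\<lambda>\<gamma>. N n \<inter> part \<gamma>)"
  moreover have "total_space G (\<lambda>\<gamma>. N n \<inter> part \<gamma>) \<subseteq> N n"
    unfolding total_space_def by (rule Q.span_minimal[OF _ N_subspace]) auto
  ultimately show "x \<in> N n" by blast
qed

abbreviation TN where "TN \<equiv> tensor_grading nat_monoid N N"

lemma TN_subspace: "Q.subspace (TN n)"
  by (simp add: tensor_grading_def)

lemma TN_pure: "p \<in> N i \<Longrightarrow> q \<in> N j \<Longrightarrow> p \<otimes>\<^sub>Q q \<in> TN (i + j)"
  unfolding tensor_grading_def by (rule Q.span_base) auto

text \<open>With homogeneous inner factors the braiding is a scalar times the flip.\<close>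

lemma sqprd_homog:
  assumes b: "b \<in> part \<gamma>" and c: "c \<in> part \<delta>"
  shows "sqprd (a \<otimes>\<^sub>Q b) (c \<otimes>\<^sub>Q d) = \<chi> \<gamma> \<delta> *\<^sub>Q (prd a c \<otimes>\<^sub>Q prd b d)"
proof (rule bilin_eq_on_span[OF _ _ _ b[unfolded part_def] c[unfolded part_def]])
  show "bilin (\<lambda>b c. sqprd (a \<otimes>\<^sub>Q b) (c \<otimes>\<^sub>Q d))"
    by (intro bilinI lin_compose[OF bilinD(1)[OF sqprd(1)] pure_lin(2)] lin_compose[OF bilinD(2)[OF sqprd(1)] pure_lin(1)])
  show "bilin (\<lambda>b c. \<chi> \<gamma> \<delta> *\<^sub>Q (prd a c \<otimes>\<^sub>Q prd b d))"
    by (intro bilinI lin_scale lin_compose[OF pure_lin(2) prd_lin(1)] lin_compose[OF pure_lin(1) prd_lin(2)])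
  show "sqprd (a \<otimes>\<^sub>Q b) (c \<otimes>\<^sub>Q d) = \<chi> \<gamma> \<delta> *\<^sub>Q (prd a c \<otimes>\<^sub>Q prd b d)"
    if "b \<in> {bas a |a. a \<in> I \<and> deg a = \<gamma>}" "c \<in> {bas a |a. a \<in> I \<and> deg a = \<delta>}" for b c
    using that by (auto simp: sqprd(2) lext_basis)
qed

lemma sqprd_N:
  assumes "a \<in> N i" "b \<in> N j" "c \<in> N k" "d \<in> N l"
  shows "sqprd (a \<otimes>\<^sub>Q b) (c \<otimes>\<^sub>Q d) \<in> TN (i + j + k + l)"
proof -
  let ?B = "deg ` supp b" and ?C = "deg ` supp c"
  note M1 = bilinD(1)[OF sqprd(1)] and M2 = bilinD(2)[OF sqprd(1)]
  have "sqprd (a \<otimes>\<^sub>Q b) (c \<otimes>\<^sub>Q d) = sqprd (a \<otimes>\<^sub>Q (\<Sum>\<beta>\<in>?B. homog \<beta> b)) ((\<Sum>\<gamma>\<in>?C. homog \<gamma> c) \<otimes>\<^sub>Q d)"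
    by (simp add: homog_sum)
  also have "\<dots> = (\<Sum>\<beta>\<in>?B. \<Sum>\<gamma>\<in>?C. sqprd (a \<otimes>\<^sub>Q homog \<beta> b) (homog \<gamma> c \<otimes>\<^sub>Q d))"
    by (simp only: lin_sum[OF pure_lin(2)] lin_sum[OF M1], simp only: lin_sum[OF pure_lin(1)] lin_sum[OF M2])
  also have "\<dots> = (\<Sum>\<beta>\<in>?B. \<Sum>\<gamma>\<in>?C. \<chi> \<beta> \<gamma> *\<^sub>Q (prd a (homog \<gamma> c) \<otimes>\<^sub>Q prd (homog \<beta> b) d))"
    using sqprd_homog[OF homog_part[OF N_S[OF assms(2)]] homog_part[OF N_S[OF assms(3)]]] by simp
  also have "\<dots> \<in> TN ((i + k) + (j + l))"
    by (intro Q.subspace_sum[OF TN_subspace] Q.subspace_scale[OF TN_subspace] TN_pure N_prd N_homog assms)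
  finally show ?thesis by (simp add: add_ac)
qed

lemma sqprd_TN:
  assumes s: "s \<in> TN m" and t: "t \<in> TN n"
  shows "sqprd s t \<in> TN (m + n)"
proof (rule lin_span_image[OF bilinD(1)[OF sqprd(1)] _ TN_subspace s[unfolded tensor_grading_def]])
  fix s' assume "s' \<in> {u \<otimes>\<^sub>Q v |u v. \<exists>\<alpha>\<in>carrier nat_monoid. \<exists>\<beta>\<in>carrier nat_monoid. \<alpha> \<otimes>\<^bsub>nat_monoid\<^esub> \<beta> = m \<and> u \<in> N \<alpha> \<and> v \<in> N \<beta>}"
  then obtain a b i j where s': "s' = a \<otimes>\<^sub>Q b" "a \<in> N i" "b \<in> N j" "m = i + j" by auto
  show "sqprd s' t \<in> TN (m + n)"
  proof (rule lin_span_image[OF bilinD(2)[OF sqprd(1)] _ TN_subspace t[unfolded tensor_grading_def]])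
    fix t' assume "t' \<in> {u \<otimes>\<^sub>Q v |u v. \<exists>\<alpha>\<in>carrier nat_monoid. \<exists>\<beta>\<in>carrier nat_monoid. \<alpha> \<otimes>\<^bsub>nat_monoid\<^esub> \<beta> = n \<and> u \<in> N \<alpha> \<and> v \<in> N \<beta>}"
    then obtain c d k l where t': "t' = c \<otimes>\<^sub>Q d" "c \<in> N k" "d \<in> N l" "n = k + l" by auto
    show "sqprd s' t' \<in> TN (m + n)" using sqprd_N[OF s'(2,3) t'(2,3)] s' t' by (simp add: add_ac)
  qed
qed

text \<open>The coproduct of a primitive element lies in degree one of the tensor square, and the
  braided product adds degrees; multiplicativity of the coproduct carries this over to
  products.\<close>

lemma N_coprd: "x \<in> N n \<Longrightarrow> coprd x \<in> TN n"
proof (induction n arbitrary: x)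
  case 0
  have z0: "bas z \<in> N 0" by (simp add: Q.span_base)
  show ?case
    by (rule lin_span_image[OF coprd_lin _ TN_subspace 0[unfolded N.simps]])
      (use TN_pure[OF z0 z0] in \<open>simp add: coprd_basis coprd_unit\<close>)
next
  case (Suc n)
  show ?case
  proof (rule lin_span_image[OF coprd_lin _ TN_subspace Suc.prems[unfolded N.simps]])
    fix w assume "w \<in> {prd v x | v x. v \<in> Prim \<and> x \<in> N n}"
    then obtain v x where w: "w = prd v x" "v \<in> Prim" "x \<in> N n" by blast
    have z0: "bas z \<in> N 0" by (simp add: Q.span_base)
    have v1: "v \<in> N 1" using w N_1 by simp
    have "coprd v \<in> TN 1"
      using w(2) TN_pure[OF v1 z0] TN_pure[OF z0 v1] Q.subspace_add[OF TN_subspace] by (simp add: Prim_iff)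
    from sqprd_TN[OF this Suc.IH[OF w(3)]]
    show "coprd w \<in> TN (Suc n)" using coprd_prd[OF Prim_S[OF w(2)] N_S[OF w(3)]] w(1) by simp
  qed
qed

lemma N_z: "x \<in> N (Suc n) \<Longrightarrow> coef x z = 0"
proof -
  assume "x \<in> N (Suc n)"
  then have x: "x \<in> Q.span {prd v x | v x. v \<in> Prim \<and> x \<in> N n}" by simp
  show ?thesis
  proof (rule lin_eq_on_span[OF lin_lookup lin_zero _ x])
    fix w assume "w \<in> {prd v x | v x. v \<in> Prim \<and> x \<in> N n}"
    then obtain v x where w: "w = prd v x" "v \<in> Prim" "x \<in> N n" by blast
    then show "coef w z = 0" using counit_prd[OF Prim_S N_S] Prim_z by simp
  qed
qed

lemma ip_N0: "x \<in> N 0 \<Longrightarrow> y \<in> N (Suc n) \<Longrightarrow> ip x y = 0"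
  by (rule lin_eq_on_span[OF ip_lin(1) lin_zero, of "{bas z}"]) (auto simp del: N.simps(2) simp: ip_z N_z)

text \<open>In degree at least two an element is a combination of products of factors without
  constant term, and primitive elements are orthogonal to those. Degree zero consists of constants,
  to which \<open>v\<close> is orthogonal as well.\<close>

lemma ip_Prim_N:
  assumes v: "v \<in> Prim" and y: "y \<in> N j" and j: "j \<noteq> 1"
  shows "ip v y = 0"
proof -
  have v1: "v \<in> N (Suc 0)" using v N_1 by simp
  consider "j = 0" | k where "j = Suc (Suc k)" using j by (metis One_nat_def not0_implies_Suc)
  then show ?thesis
  proof cases
    case 1
    then show ?thesis using ip_N0[OF _ v1] y ip_sym by metis
  next
    case (2 k)
    have y: "y \<in> Q.span {prd v x | v x. v \<in> Prim \<and> x \<in> N (Suc k)}" using y unfolding 2 N.simps(2)[of "Suc k"] .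
    show ?thesis
    proof (rule lin_eq_on_span[OF ip_lin(2) lin_zero _ y])
      fix w assume "w \<in> {prd v x | v x. v \<in> Prim \<and> x \<in> N (Suc k)}"
      then obtain u x where w: "w = prd u x" "u \<in> Prim" "x \<in> N (Suc k)" by blast
      then show "ip v w = 0"
        using ip_prd_Prim[OF Prim_S[OF w(2)] N_S[OF w(3)] v] Prim_z N_z ip_sym[of v] by simp
    qed
  qed
qed

text \<open>Moving the product of \<open>v\<close> and \<open>x\<close> to the other side of the
  form turns its pairing with \<open>y\<close> into pairings of \<open>x\<close> with
  \<open>N i\<close> and of \<open>v\<close> with \<open>N j\<close>, where
  \<open>i + j = m\<close>. By induction these survive only for \<open>i = n\<close> and
  \<open>j = 1\<close>, which is excluded.\<close>

lemma N_orthogonal: "x \<in> N n \<Longrightarrow> y \<in> N m \<Longrightarrow> n \<noteq> m \<Longrightarrow> ip x y = 0"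
proof (induction n arbitrary: x y m)
  case 0
  then show ?case using ip_N0 not0_implies_Suc by metis
next
  case (Suc n)
  show ?case
  proof (rule lin_eq_on_span[OF ip_lin(1) lin_zero _ Suc.prems(1)[unfolded N.simps]])
    fix w assume "w \<in> {prd v x | v x. v \<in> Prim \<and> x \<in> N n}"
    then obtain v x where w: "w = prd v x" "v \<in> Prim" "x \<in> N n" by blast
    have "tip x v (coprd y) = 0"
    proof (rule lin_eq_on_span[OF tip_lin(3) lin_zero _ N_coprd[OF Suc.prems(2), unfolded tensor_grading_def]])
      fix t assume "t \<in> {u \<otimes>\<^sub>Q v |u v. \<exists>\<alpha>\<in>carrier nat_monoid. \<exists>\<beta>\<in>carrier nat_monoid. \<alpha> \<otimes>\<^bsub>nat_monoid\<^esub> \<beta> = m \<and> u \<in> N \<alpha> \<and> v \<in> N \<beta>}"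
      then obtain p q i j where t: "t = p \<otimes>\<^sub>Q q" "p \<in> N i" "q \<in> N j" "m = i + j" by auto
      have "ip x p = 0 \<or> ip v q = 0"
      proof (cases "n = i")
        case True
        then have "j \<noteq> 1" using Suc.prems(3) t(4) by auto
        then show ?thesis using ip_Prim_N[OF w(2) t(3)] by blast
      next
        case False
        then show ?thesis using Suc.IH[OF w(3) t(2)] by blast
      qed
      then show "tip x v t = 0" using t(1) tip_pure by auto
    qed
    then show "ip w y = 0" using ip_prd[OF Prim_S[OF w(2)] N_S[OF w(3)] N_S[OF Suc.prems(2)]] w(1) by simp
  qed
qed

lemma N_graded_space: "graded_space nat_monoid N"
  unfolding graded_space_def
proof (intro conjI allI impI ballI)
  show "Q.subspace (N n)" for n by (rule N_subspace)
  fix K f n assume K: "finite K" "\<forall>n\<in>K. f n \<in> N n" "(\<Sum>n\<in>K. f n) = 0" "n \<in> K"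
  have "0 = ip (f n) (\<Sum>n\<in>K. f n)" using K(3) lin_0[OF ip_lin(2)] by simp
  also have "\<dots> = (\<Sum>m\<in>K. ip (f n) (f m))" by (rule lin_sum[OF ip_lin(2)])
  also have "\<dots> = (\<Sum>m\<in>K. if m = n then ip (f n) (f n) else 0)"
  proof (intro sum.cong refl)
    fix m assume "m \<in> K"
    then show "ip (f n) (f m) = (if m = n then ip (f n) (f n) else 0)"
      using K(2,4) N_orthogonal[of "f n" n "f m" m] by auto
  qed
  also have "\<dots> = ip (f n) (f n)" using K by simp
  finally have "ip (f n) (f n) = 0" by simp
  moreover have "f n \<in> S" using K N_S by blast
  ultimately show "f n = 0" using ip_pos by blast
qed

text \<open>The Gram-Schmidt process, one vector at a time. No normalisation is made, so it stays
  over the rational numbers.\<close>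

lemma orthogonal_projection:
  assumes "finite D" "D \<subseteq> S" "x \<in> S"
  shows "\<exists>u\<in>Q.span D. \<forall>d\<in>Q.span D. ip d (x - u) = 0"
  using assms
proof (induction D arbitrary: x rule: finite_induct)
  case empty
  then show ?case by (auto simp: lin_0[OF ip_lin(1)])
next
  case (insert d D)
  obtain d' where d': "d' \<in> Q.span D" "\<And>f. f \<in> Q.span D \<Longrightarrow> ip f (d - d') = 0" using insert.IH[of d] insert.prems by auto
  obtain u where u: "u \<in> Q.span D" "\<And>f. f \<in> Q.span D \<Longrightarrow> ip f (x - u) = 0" using insert.IH[of x] insert.prems by auto
  define e where "e = d - d'"
  \<comment> \<open>If \<open>d\<close> already lies in the span of \<open>D\<close>, then
    \<open>e = 0\<close>, and division by zero gives the harmless value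
    \<open>c = 0\<close>.\<close>
  define c where "c = ip e x / ip e e"
  have DS: "Q.span D \<subseteq> S" using Q.span_minimal[OF _ S_subspace] insert.prems by simp
  have eS: "e \<in> S" unfolding e_def using insert.prems d'(1) DS Q.subspace_diff[OF S_subspace] by blast
  have mono: "Q.span D \<subseteq> Q.span (insert d D)" by (rule Q.span_mono) auto
  have e_in: "e \<in> Q.span (insert d D)" unfolding e_def using d'(1) mono by (intro Q.span_diff) (auto intro: Q.span_base)
  let ?u = "u + c *\<^sub>Q e"
  have fe: "ip f e = 0" if "f \<in> Q.span D" for f using d'(2)[OF that] by (simp add: e_def)
  have oD: "ip f (x - ?u) = 0" if "f \<in> Q.span D" for f
  proof -
    have "x - ?u = (x - u) - c *\<^sub>Q e" by simp
    then show ?thesis using u(2)[OF that] fe[OF that] by (simp only: lin_diff[OF ip_lin(2)] linD[OF ip_lin(2)]) (simp add: scaleQ_rat_def)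
  qed
  have "ip e (x - ?u) = ip e x - ip e u - c * ip e e"
    by (simp add: lin_diff[OF ip_lin(2)] linD[OF ip_lin(2)] scaleQ_rat_def)
  also have "ip e u = 0" using fe[OF u(1)] ip_sym by metis
  also have "ip e x - 0 - c * ip e e = 0"
    using ip_pos[OF eS] lin_0[OF ip_lin(1)] by (cases "ip e e = 0") (auto simp: c_def)
  finally have oe: "ip e (x - ?u) = 0" .
  have "ip d (x - ?u) = ip d' (x - ?u) + ip e (x - ?u)"
    using linD(1)[OF ip_lin(1), of d' e "x - ?u"] by (simp add: e_def)
  then have od: "ip d (x - ?u) = 0" using oe oD[OF d'(1)] by simp
  have "ip f (x - ?u) = 0" if "f \<in> Q.span (insert d D)" for f
    by (rule lin_eq_on_span[OF ip_lin(1) lin_zero _ that]) (use od oD Q.span_base in auto)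
  moreover have "?u \<in> Q.span (insert d D)" using u(1) mono e_in by (intro Q.span_add Q.span_scale) auto
  ultimately show ?case by blast
qed

text \<open>The component of a basis vector orthogonal to the decomposable elements is primitive.\<close>

lemma generated:
  assumes T: "Q.subspace T" "bas z \<in> T" "Prim \<subseteq> T" "\<And>x y. x \<in> T \<Longrightarrow> y \<in> T \<Longrightarrow> prd x y \<in> T"
  shows "S \<subseteq> T"
proof -
  have "bas c \<in> T" if "c \<in> I" for c
    using that
  proof (induction "ht (deg c)" arbitrary: c rule: less_induct)
    case less
    show ?case
    proof (cases "c = z")
      case True
      then show ?thesis using T(2) by simp
    next
      case c: False
      \<comment> \<open>Only products of degree \<open>deg c\<close> enter, so that \<open>D\<close>
        is finite and a projection exists; products of other degrees are orthogonal to the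
        homogeneous vector \<open>bas c - u\<close> for reasons of degree.\<close>
      let ?P = "{(a, b). a \<in> low (deg c) \<and> b \<in> low (deg c) \<and> a \<noteq> z \<and> b \<noteq> z \<and> deg a \<otimes> deg b = deg c}"
      define D where "D = (\<lambda>(a, b). prd (bas a) (bas b)) ` ?P"
      have "finite ?P"
        by (rule finite_subset[of _ "low (deg c) \<times> low (deg c)"]) (use fin_low_deg[OF less.prems] in auto)
      then have fD: "finite D" unfolding D_def by (rule finite_imageI)
      have DE: thesis if "d \<in> D"
        "\<And>a b. d = prd (bas a) (bas b) \<Longrightarrow> a \<in> I \<Longrightarrow> b \<in> I \<Longrightarrow> a \<noteq> z \<Longrightarrow> b \<noteq> z \<Longrightarrow> deg a \<otimes> deg b = deg c \<Longrightarrow> thesis" for d thesis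
        using that(1) low_sub[of "deg c"] unfolding D_def by (auto intro: that(2))
      have DT: "D \<subseteq> T"
      proof
        fix d assume "d \<in> D"
        then obtain a b where d: "d = prd (bas a) (bas b)" "a \<in> I" "b \<in> I" "a \<noteq> z" "b \<noteq> z" "deg a \<otimes> deg b = deg c"
          by (rule DE)
        have "ht (deg a) < ht (deg c)" using ht_less[OF d(2-5)] d(6) by simp
        moreover have "ht (deg b) < ht (deg c)" using ht_less[OF d(3,2,5,4)] d(6) m_comm deg_carrier d(2,3) by simp
        ultimately show "d \<in> T" using less.hyps d T(4) by simp
      qed
      have Dp: "D \<subseteq> part (deg c)"
      proof
        fix d assume "d \<in> D"
        then obtain a b where d: "d = prd (bas a) (bas b)" "a \<in> I" "b \<in> I" "a \<noteq> z" "b \<noteq> z" "deg a \<otimes> deg b = deg c"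
          by (rule DE)
        then show "d \<in> part (deg c)" using prd_part[of "bas a" "deg a" "bas b" "deg b"] by (simp add: part_iff)
      qed
      have Dz: "coef d z = 0" if "d \<in> D" for d
        by (rule DE[OF that]) (simp add: counit_prd bas_S lookup_single when_def)
      have cp: "bas c \<in> part (deg c)" using less.prems by (simp add: part_iff)
      have DS: "D \<subseteq> S" using Dp part_S by blast
      obtain u where u: "u \<in> Q.span D" "\<And>d. d \<in> Q.span D \<Longrightarrow> ip d (bas c - u) = 0"
        using orthogonal_projection[OF fD DS bas_S[OF less.prems]] by blast
      have up: "u \<in> part (deg c)" using Q.span_minimal[OF Dp part_subspace] u(1) by blast
      have vp: "bas c - u \<in> part (deg c)" using Q.subspace_diff[OF part_subspace cp up] .
      have "bas c - u \<in> Prim"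
      proof (rule PrimI)
        show "bas c - u \<in> S" using vp part_S by blast
        have "coef u z = 0" by (rule lin_eq_on_span[OF lin_lookup lin_zero Dz u(1)])
        then show "coef (bas c - u) z = 0" using c by (simp add: lookup_minus lookup_single when_def)
        fix a b assume ab: "a \<in> I" "b \<in> I" "a \<noteq> z" "b \<noteq> z"
        show "ip (prd (bas a) (bas b)) (bas c - u) = 0"
        proof (cases "deg a \<otimes> deg b = deg c")
          case True
          then have "(a, b) \<in> ?P" using ab low_left[of a b] low_right[of a b] by auto
          then have "prd (bas a) (bas b) \<in> D" unfolding D_def by force
          then show ?thesis using u(2) Q.span_base by blast
        next
          case False
          have "prd (bas a) (bas b) \<in> part (deg a \<otimes> deg b)" using ab by (intro prd_part) (simp_all add: part_iff)
          then have "ip (prd (bas a) (bas b)) (homog (deg c) (bas c - u)) = 0" using False by (simp add: ip_part)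
          then show ?thesis using homog_of_part[OF vp, of "deg c"] by simp
        qed
      qed
      moreover have "u \<in> T" using Q.span_minimal[OF DT T(1)] u(1) by blast
      ultimately have "(bas c - u) + u \<in> T" using T(1,3) by (intro Q.subspace_add) auto
      then show ?thesis by simp
    qed
  qed
  then show ?thesis unfolding S_def by (intro Q.span_minimal T(1)) auto
qed

lemma generated_Prim: "generated_subalgebra hall Prim = S"
proof
  show "generated_subalgebra hall Prim \<subseteq> S"
    unfolding generated_subalgebra_def using S_subspace z_S Prim_S prd_S by (intro Inter_lower) auto
  show "S \<subseteq> generated_subalgebra hall Prim"
    unfolding generated_subalgebra_def by (intro Inter_greatest generated) auto
qed

lemma N_total: "total_space nat_monoid N = S"
proof
  show "total_space nat_monoid N \<subseteq> S"
    unfolding total_space_def by (intro Q.span_minimal S_subspace) (auto dest: N_S)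
  show "S \<subseteq> total_space nat_monoid N"
  proof (rule generated)
    have sub: "N n \<subseteq> total_space nat_monoid N" for n unfolding total_space_def by (auto intro: Q.span_base)
    show sp: "Q.subspace (total_space nat_monoid N)" by (simp add: total_space_def)
    have "bas z \<in> N 0" by (simp add: Q.span_base)
    then show "bas z \<in> total_space nat_monoid N" using sub by blast
    show "Prim \<subseteq> total_space nat_monoid N" using sub[of 1] N_1 by simp
    fix x y assume x: "x \<in> total_space nat_monoid N" and y: "y \<in> total_space nat_monoid N"
    show "prd x y \<in> total_space nat_monoid N"
    proof (rule lin_span_image[OF prd_lin(1) _ sp x[unfolded total_space_def]])
      fix x' assume "x' \<in> (\<Union>n\<in>carrier nat_monoid. N n)"
      then obtain i where i: "x' \<in> N i" by blast
      show "prd x' y \<in> total_space nat_monoid N"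
        by (rule lin_span_image[OF prd_lin(2) _ sp y[unfolded total_space_def]]) (use N_prd[OF i] sub in blast)
    qed
  qed
qed

theorem hall_nichols: "nichols_algebra G \<chi> hall (primitives G hall)"
  unfolding nichols_algebra_def
proof (intro conjI exI[of _ N] allI)
  show "braided_bialgebra G \<chi> hall" by (rule hall_braided_bialgebra)
  show "structure_graded hall nat_monoid N"
    unfolding structure_graded_def
  proof (intro conjI ballI impI)
    show "graded_space nat_monoid N" by (rule N_graded_space)
    show "Prod hall x y \<in> N (i \<otimes>\<^bsub>nat_monoid\<^esub> j)" if "x \<in> N i" "y \<in> N j" for x y i j using N_prd that by simp
    show "Unit hall \<in> N \<one>\<^bsub>nat_monoid\<^esub>" by (simp add: Q.span_base)
    show "Coprod hall x \<in> TN n" if "x \<in> N n" for x n using N_coprd that by simp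
    show "Counit hall x = 0" if "n \<noteq> \<one>\<^bsub>nat_monoid\<^esub>" "x \<in> N n" for x n
      using that N_z not0_implies_Suc[of n] by auto
  qed
  show "total_space nat_monoid N = total_space G (Part hall)" by (simp add: N_total total_eq)
  show "graded_subspace G (Part hall) (N n)" for n using N_graded by simp
  show "N 0 = Q.span {Unit hall}" by simp
  show "N 1 = primitives G hall" "N 1 = primitives G hall" using N_1 Prim_def by simp_all
  show "generated_subalgebra hall (N 1) = total_space G (Part hall)"
    unfolding N_1 by (simp add: generated_Prim total_eq)
qed

end

section \<open>The Hall algebra of a category\<close>

context hall_cat
begin

text \<open>With zero sub-object the epimorphism is an isomorphism, and the inclusion is the zero
  arrow.\<close>

lemma card_ses_zero_sub:
  assumes N: "N \<in> Obj C" "L.Z (Some (Idt C N))" and X: "X \<in> Obj C"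
  shows "card (H.SES A N X) = card (L.isop X A)"
proof -
  have i1: "inj_on (\<lambda>(h, k). (Some (Zer C N X), h)) (L.isop X A)"
    by (rule inj_onI) (auto dest: L.isop_unique)
  have "(\<lambda>(h, k). (Some (Zer C N X), h)) ` L.isop X A = H.SES A N X"
  proof (intro equalityI subsetI)
    fix s assume "s \<in> (\<lambda>(h, k). (Some (Zer C N X), h)) ` L.isop X A"
    then obtain h k where s: "(h, k) \<in> L.isop X A" "s = (Some (Zer C N X), h)" by fast
    from L.ses_iso_quot[OF ses_zero(1)[OF X N] s(1)] L.idn_right[OF L.isopD(1)[OF s(1)]]
    show "s \<in> H.SES A N X" using s(2) by (simp add: H.SES_def)
  next
    fix s assume "s \<in> H.SES A N X"
    then obtain i p where s: "s = (i, p)" "L.ses A N X i p" by (auto simp: H.SES_def)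
    note s' = L.sesD[OF s(2)]
    have "i = Some (Zer C N X)"
      by (rule L.Z_unique[OF _ L.zerop_zero[OF N(1) X] s'(4) L.zero_hom[OF N(1) X]])
        (use L.Z_left[OF N(2), of i] L.idn_right[OF s'(4)] in simp)
    moreover have "L.mono X A p"
    proof (rule L.monoI[OF s'(5)])
      fix U x assume "x \<in> ohm U X" "L.Z (ocomp p x)"
      then obtain w where w: "w \<in> ohm U N" "ocomp i w = x" using s'(6) by blast
      have "L.Z w" using L.Z_right[OF N(2), of w] L.idn_left[OF w(1)] by simp
      then show "L.Z x" using w(2) L.Z_left by blast
    qed
    then obtain k where "(p, k) \<in> L.isop X A" using L.mono_epi_isop s'(2) by blast
    ultimately show "s \<in> (\<lambda>(h, k). (Some (Zer C N X), h)) ` L.isop X A" using s(1) by force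
  qed
  then show ?thesis using card_image[OF i1] by simp
qed

lemma card_ses_zero_quot:
  assumes N: "N \<in> Obj C" "L.Z (Some (Idt C N))" and X: "X \<in> Obj C"
  shows "card (H.SES N B X) = card (L.isop X B)"
proof -
  have i1: "inj_on (\<lambda>(h, k). (k, Some (Zer C X N))) (L.isop X B)"
    by (rule inj_onI) (auto dest: L.isop_unique L.isop_sym)
  have "(\<lambda>(h, k). (k, Some (Zer C X N))) ` L.isop X B = H.SES N B X"
  proof (intro equalityI subsetI)
    fix s assume "s \<in> (\<lambda>(h, k). (k, Some (Zer C X N))) ` L.isop X B"
    then obtain h k where s: "(h, k) \<in> L.isop X B" "s = (k, Some (Zer C X N))" by fast
    from L.ses_iso_sub[OF ses_zero(2)[OF X N] s(1)] L.idn_left[OF L.isopD(2)[OF s(1)]]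
    show "s \<in> H.SES N B X" using s(2) by (simp add: H.SES_def)
  next
    fix s assume "s \<in> H.SES N B X"
    then obtain i p where s: "s = (i, p)" "L.ses N B X i p" by (auto simp: H.SES_def)
    note s' = L.sesD[OF s(2)]
    have "p = Some (Zer C X N)"
      by (rule L.Z_unique[OF _ L.zerop_zero[OF X N(1)] s'(5) L.zero_hom[OF X N(1)]])
        (use L.Z_right[OF N(2), of p] L.idn_left[OF s'(5)] in simp)
    moreover have "L.epi B X i"
    proof (rule L.epiI[OF s'(4)])
      fix U x assume "x \<in> ohm X U" "L.Z (ocomp x i)"
      then obtain w where w: "w \<in> ohm N U" "ocomp w p = x" using s'(7) by blast
      have "L.Z w" using L.Z_left[OF N(2), of w] L.idn_right[OF w(1)] by simp
      then show "L.Z x" using w(2) L.Z_right by blast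
    qed
    then obtain h where "(i, h) \<in> L.isop B X" using L.mono_epi_isop s'(1) by blast
    then have "(h, i) \<in> L.isop X B" by (rule L.isop_sym)
    ultimately show "s \<in> (\<lambda>(h, k). (k, Some (Zer C X N))) ` L.isop X B" using s(1) by force
  qed
  then show ?thesis using card_image[OF i1] by simp
qed

definition dg where "dg a = gc (rep a)"
definition aut :: "'a set \<Rightarrow> rat" where "aut a = of_nat (card (isos C (rep a) (rep a)))"
definition hn :: "'a set \<Rightarrow> 'a set \<Rightarrow> 'a set \<Rightarrow> rat" where "hn a b c = of_nat (card (short_exact C (rep a) (rep b) (rep c)))"
definition lw where "lw \<gamma> = {a \<in> Iso C. \<exists>\<delta>\<in>carrier \<Gamma>. dg a \<otimes>\<^bsub>\<Gamma>\<^esub> \<delta> = \<gamma>}"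
text \<open>Its maximum is the height \<open>ht\<close> of \<open>hall_data\<close>. All
  representatives in the class are taken, since objects of one class can have different numbers of
  endomorphisms.\<close>

definition ends where "ends \<gamma> = (\<lambda>X. card (ohm X X)) ` {X \<in> rpc ` Obj C. gc X = \<gamma>}"

lemma aut_au: "aut a = H.au (rep a)"
  by (simp add: aut_def H.au_def card_isop)

lemma hn_SES: "hn a b c = of_nat (card (H.SES (rep a) (rep b) (rep c)))"
  by (simp add: hn_def H.SES_def card_short_exact)

lemma hn_ses: "hn a b c \<noteq> 0 \<Longrightarrow> \<exists>i p. L.ses (rep a) (rep b) (rep c) i p"
  using short_exact_nonempty by (force simp: hn_def)

lemma rep_Obj: "a \<in> Iso C \<Longrightarrow> rep a \<in> Obj C"
  by (rule iso_class_rep(2))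

lemma rep_reps: "a \<in> Iso C \<Longrightarrow> rep a \<in> H.reps"
  using rev_image_eqI[OF iso_class_rep(2)[of a], of "rep a" rpc] iso_class_rep(1)[of a] by (simp add: H.reps_def rpc_def)

lemma reps_rep: "X \<in> H.reps \<Longrightarrow> X = rep (iso_class C X) \<and> iso_class C X \<in> Iso C"
  using H.rp_id H.reps_obj unfolding rpc_def Iso_def by fastforce

lemma rep_inj: "inj_on rep (Iso C)"
  using iso_class_rep(1) by (metis inj_onI)

lemma rep_inj_sub: "J \<subseteq> Iso C \<Longrightarrow> inj_on rep J"
  using rep_inj inj_on_subset by blast

lemma gc_rpc: "X \<in> Obj C \<Longrightarrow> gc (rpc X) = gc X"
  using rpc_iso gc_iso by metis

lemma carrier_dg: "carrier \<Gamma> = dg ` Iso C"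
  unfolding carrier_groth dg_def Iso_def using gc_rpc by (force simp: rpc_def)

lemma gc_carrier: "X \<in> Obj C \<Longrightarrow> gc X \<in> carrier \<Gamma>"
  using carrier_groth by blast

lemma zero_obj: "zero_class C \<in> Iso C" "is_zero_object C (rep (zero_class C))"
proof -
  obtain N where N: "is_zero_object C N" using ex_zero_object by blast
  then have "N \<in> Obj C" by (simp add: is_zero_object_def)
  then show i: "zero_class C \<in> Iso C" using zero_class_eq[OF N] by (simp add: Iso_def)
  show "is_zero_object C (rep (zero_class C))"
    using iso_class_self[OF rep_Obj[OF i]] iso_class_rep(1)[OF i] by (auto simp: zero_class_def)
qed

lemma zero_classI: "a \<in> Iso C \<Longrightarrow> is_zero_object C (rep a) \<Longrightarrow> a = zero_class C"
  using zero_class_eq iso_class_rep(1) by metis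

lemma hn_dg: "hn a b c \<noteq> 0 \<Longrightarrow> dg c = dg a \<otimes>\<^bsub>\<Gamma>\<^esub> dg b"
  unfolding dg_def using hn_ses gc_mult by metis

lemma card_isop_rep:
  assumes "a \<in> Iso C" "c \<in> Iso C"
  shows "of_nat (card (L.isop (rep c) (rep a))) = (if a = c then aut a else 0)"
proof (cases "a = c")
  case True
  then show ?thesis by (simp add: aut_au H.au_def)
next
  case False
  then have "L.isop (rep c) (rep a) = {}" using iso_class_eq[of "rep c" "rep a"] iso_class_rep assms by metis
  then show ?thesis using False by simp
qed

lemma hn_zero:
  assumes "a \<in> Iso C" "c \<in> Iso C"
  shows "hn a (zero_class C) c = (if a = c then aut a else 0)" "hn (zero_class C) a c = (if a = c then aut a else 0)"
  using card_ses_zero_sub[of "rep (zero_class C)" "rep c" "rep a"] card_ses_zero_quot[of "rep (zero_class C)" "rep c" "rep a"]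
    zero_obj(2)[unfolded is_zero_object_iff] rep_Obj[OF assms(2)] card_isop_rep[OF assms] by (simp_all add: hn_SES)

lemma aut_zero: "aut (zero_class C) = 1"
proof -
  let ?N = "rep (zero_class C)"
  have o: "?N \<in> Obj C" using zero_obj(2) by (simp add: is_zero_object_def)
  have "isos C ?N ?N = {Idt C ?N}"
  proof
    have i: "Idt C ?N \<in> Hom C ?N ?N" by (rule Idt_in_Hom[OF o])
    then show "{Idt C ?N} \<subseteq> isos C ?N ?N" using Comp_Idt_left[OF i] by (auto simp: isos_def)
    show "isos C ?N ?N \<subseteq> {Idt C ?N}" using zero_obj(2) i o unfolding is_zero_object_def isos_def by blast
  qed
  then show ?thesis by (simp add: aut_def)
qed

lemma dg_one:
  assumes "a \<in> Iso C" "b \<in> Iso C" "dg a \<otimes>\<^bsub>\<Gamma>\<^esub> dg b = \<one>\<^bsub>\<Gamma>\<^esub>"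
  shows "a = zero_class C"
proof -
  obtain S i1 i2 p1 p2 where b: "L.bip (rep a) (rep b) S i1 i2 p1 p2" using L.bip_ex rep_Obj assms by blast
  have S: "S \<in> Obj C" using L.bipD(1)[OF b] L.hom_obj by blast
  have "gc S = \<one>\<^bsub>\<Gamma>\<^esub>" using gc_mult_bip[OF b] assms(3) by (simp add: dg_def)
  then have "is_zero_object C S" by (rule gc_one[OF S])
  then have "is_zero_object C (rep a)"
    using zero_ses[OF L.bip_ses[OF b]] rep_Obj[OF assms(1)] by (simp add: is_zero_object_iff)
  then show ?thesis by (rule zero_classI[OF assms(1)])
qed

lemma bip_reps:
  assumes "A \<in> Obj C" "B \<in> Obj C"
  obtains S i1 i2 p1 p2 where "S \<in> rpc ` Obj C" "L.bip A B S i1 i2 p1 p2"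
proof -
  obtain S i1 i2 p1 p2 where b: "L.bip A B S i1 i2 p1 p2" using L.bip_ex assms by blast
  have S: "S \<in> Obj C" using L.bipD(1)[OF b] L.hom_obj by blast
  obtain h k where "(h, k) \<in> L.isop S (rpc S)" using rpc_iso[OF S] by blast
  from L.bip_iso[OF b L.isop_idn[OF assms(1)] L.isop_idn[OF assms(2)] this] S that show thesis by blast
qed

text \<open>An object whose degree divides \<open>\<gamma>\<close> is a direct summand of an object
  of degree \<open>\<gamma>\<close>. Up to isomorphism there are finitely many of the latter, each
  with finitely many summands.\<close>

lemma finite_lw: "finite (lw \<gamma>)"
proof (rule finite_imageD[OF _ rep_inj_sub])
  show "lw \<gamma> \<subseteq> Iso C" by (auto simp: lw_def)
  let ?P = "\<lambda>S. {(A, B). A \<in> rpc ` Obj C \<and> B \<in> rpc ` Obj C \<and> (\<exists>i1 i2 p1 p2. L.bip A B S i1 i2 p1 p2)}"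
  show "finite (rep ` lw \<gamma>)"
  proof (rule finite_subset)
    show "finite (\<Union>S\<in>{S \<in> rpc ` Obj C. gc S = \<gamma>}. fst ` ?P S)"
      using finite_gc finite_summands by (intro finite_UN_I finite_imageI)
    show "rep ` lw \<gamma> \<subseteq> (\<Union>S\<in>{S \<in> rpc ` Obj C. gc S = \<gamma>}. fst ` ?P S)"
    proof
      fix A assume "A \<in> rep ` lw \<gamma>"
      then obtain a b where a: "a \<in> Iso C" "b \<in> Iso C" "dg a \<otimes>\<^bsub>\<Gamma>\<^esub> dg b = \<gamma>" "A = rep a"
        unfolding lw_def carrier_dg by blast
      obtain S i1 i2 p1 p2 where S: "S \<in> rpc ` Obj C" and b: "L.bip (rep a) (rep b) S i1 i2 p1 p2"
        using bip_reps[OF rep_Obj[OF a(1)] rep_Obj[OF a(2)]] .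
      have "gc S = \<gamma>" using gc_mult_bip[OF b] a(3) by (simp add: dg_def)
      moreover have "(rep a, rep b) \<in> ?P S" using rep_reps[OF a(1)] rep_reps[OF a(2)] b by (auto simp: H.reps_def)
      ultimately show "A \<in> (\<Union>S\<in>{S \<in> rpc ` Obj C. gc S = \<gamma>}. fst ` ?P S)" using S a(4) by force
    qed
  qed
qed

text \<open>Converts sums over chosen representatives into sums over isomorphism classes, which
  index the basis of the Hall algebra.\<close>

lemma mass_J:
  assumes J: "finite J" "J \<subseteq> Iso C" and T: "\<And>X. X \<in> H.reps \<Longrightarrow> T X \<noteq> {} \<Longrightarrow> iso_class C X \<in> J"
  shows "H.mass T = (\<Sum>x\<in>J. of_nat (card (T (rep x))) / aut x)"
proof -
  have "H.mass T = (\<Sum>X\<in>rep ` J. of_nat (card (T X)) / H.au X)"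
  proof (rule H.mass_eq)
    show "finite (rep ` J)" using J(1) by simp
    show "rep ` J \<subseteq> H.reps" using J(2) rep_reps by blast
    show "X \<in> rep ` J" if "X \<in> H.reps" "T X \<noteq> {}" for X using T[OF that] reps_rep[OF that(1)] by blast
  qed
  also have "\<dots> = (\<Sum>x\<in>J. of_nat (card (T (rep x))) / aut x)"
    by (subst sum.reindex[OF rep_inj_sub[OF J(2)]]) (simp add: aut_au)
  finally show ?thesis .
qed

lemma lwI: "A \<in> H.reps \<Longrightarrow> \<delta> \<in> carrier \<Gamma> \<Longrightarrow> gc A \<otimes>\<^bsub>\<Gamma>\<^esub> \<delta> = \<gamma> \<Longrightarrow> iso_class C A \<in> lw \<gamma>"
  using reps_rep[of A] by (auto simp: lw_def dg_def)

lemma SES_gc: "H.SES A B X \<noteq> {} \<Longrightarrow> gc X = gc A \<otimes>\<^bsub>\<Gamma>\<^esub> gc B"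
  using gc_mult by (auto simp: H.SES_def)

lemma hn_assoc:
  assumes "a \<in> Iso C" "b \<in> Iso C" "c \<in> Iso C" "y \<in> Iso C" and J: "finite J" "J \<subseteq> Iso C" "lw (dg y) \<subseteq> J"
  shows "(\<Sum>x\<in>J. hn x c y * hn a b x / aut x) = (\<Sum>x\<in>J. hn a x y * hn b c x / aut x)"
proof -
  interpret G: comm_monoid \<Gamma> by (rule groth_comm_monoid)
  note o = rep_Obj[OF assms(1)] rep_Obj[OF assms(2)] rep_Obj[OF assms(3)] rep_Obj[OF assms(4)]
  have "(\<Sum>x\<in>J. hn x c y * hn a b x / aut x) = H.mass (\<lambda>X. H.SES X (rep c) (rep y) \<times> H.SES (rep a) (rep b) X)"
  proof (subst mass_J[OF J(1,2)])
    fix X assume X: "X \<in> H.reps" "H.SES X (rep c) (rep y) \<times> H.SES (rep a) (rep b) X \<noteq> {}"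
    have "gc X \<otimes>\<^bsub>\<Gamma>\<^esub> gc (rep c) = dg y" using SES_gc[of X "rep c" "rep y"] X(2) by (auto simp: dg_def)
    from lwI[OF X(1) gc_carrier[OF o(3)] this] show "iso_class C X \<in> J" using J(3) by blast
  qed (simp add: hn_SES card_cartesian_product)
  also have "\<dots> = H.mass (\<lambda>V. H.SES (rep a) V (rep y) \<times> H.SES (rep b) (rep c) V)" by (rule H.assoc_mass[OF o])
  also have "\<dots> = (\<Sum>x\<in>J. hn a x y * hn b c x / aut x)"
  proof (subst mass_J[OF J(1,2)])
    fix X assume X: "X \<in> H.reps" "H.SES (rep a) X (rep y) \<times> H.SES (rep b) (rep c) X \<noteq> {}"
    have "gc X \<otimes>\<^bsub>\<Gamma>\<^esub> gc (rep a) = dg y"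
      using SES_gc[of "rep a" X "rep y"] X(2) G.m_comm[OF gc_carrier[OF H.reps_obj[OF X(1)]] gc_carrier[OF o(1)]] by (auto simp: dg_def)
    from lwI[OF X(1) gc_carrier[OF o(1)] this] show "iso_class C X \<in> J" using J(3) by blast
  qed (simp add: hn_SES card_cartesian_product)
  finally show ?thesis .
qed

lemma hn_green:
  assumes "m \<in> Iso C" "n \<in> Iso C" "x \<in> Iso C" "y \<in> Iso C" and J: "finite J" "J \<subseteq> Iso C" "lw (dg m \<otimes>\<^bsub>\<Gamma>\<^esub> dg n) \<subseteq> J"
  shows "(\<Sum>e\<in>J. hn m n e * hn x y e / aut e) = (\<Sum>a\<in>J. \<Sum>b\<in>J. \<Sum>c\<in>J. \<Sum>d\<in>J.
    chi C (dg a) (dg d) * (hn c d n * hn b d y * hn a c x * hn a b m) / (aut a * aut b * aut c * aut d))"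
proof -
  interpret G: comm_monoid \<Gamma> by (rule groth_comm_monoid)
  note o = rep_Obj[OF assms(1)] rep_Obj[OF assms(2)] rep_Obj[OF assms(3)] rep_Obj[OF assms(4)]
  let ?fr = "H.frames (rep n) (rep y) (rep x) (rep m)"
  let ?w = "\<lambda>q. (case q of (A, B, C, D) \<Rightarrow> H.mass (H.SES A D)) * of_nat (card (?fr q)) / (case q of (A, B, C, D) \<Rightarrow> H.au A * H.au B * H.au C * H.au D)"
  let ?r = "\<lambda>(a, b, c, d). (rep a, rep b, rep c, rep d)"
  have one: "gc E \<otimes>\<^bsub>\<Gamma>\<^esub> \<one>\<^bsub>\<Gamma>\<^esub> = gc E" if "E \<in> H.reps" for E
    using gc_carrier[OF H.reps_obj[OF that]] by simp
  have "(\<Sum>e\<in>J. hn m n e * hn x y e / aut e) = H.mass (\<lambda>E. H.SES (rep m) (rep n) E \<times> H.SES (rep x) (rep y) E)"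
  proof (subst mass_J[OF J(1,2)])
    fix E assume E: "E \<in> H.reps" "H.SES (rep m) (rep n) E \<times> H.SES (rep x) (rep y) E \<noteq> {}"
    have "gc E \<otimes>\<^bsub>\<Gamma>\<^esub> \<one>\<^bsub>\<Gamma>\<^esub> = dg m \<otimes>\<^bsub>\<Gamma>\<^esub> dg n"
      using SES_gc[of "rep m" "rep n" E] E(2) one[OF E(1)] by (auto simp: dg_def)
    from lwI[OF E(1) G.one_closed this] show "iso_class C E \<in> J" using J(3) by blast
  qed (simp add: hn_SES card_cartesian_product)
  also have "\<dots> = (\<Sum>q | q \<in> H.quads \<and> ?fr q \<noteq> {}. ?w q)" by (rule H.green[OF o])
  also have "\<dots> = (\<Sum>q\<in>?r ` (J \<times> J \<times> J \<times> J). ?w q)"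
  proof (rule sum.mono_neutral_left)
    show "finite (?r ` (J \<times> J \<times> J \<times> J))" using J(1) by simp
    show "{q. q \<in> H.quads \<and> ?fr q \<noteq> {}} \<subseteq> ?r ` (J \<times> J \<times> J \<times> J)"
    proof
      fix q assume q: "q \<in> {q. q \<in> H.quads \<and> ?fr q \<noteq> {}}"
      obtain A B C' D where qe: "q = (A, B, C', D)" by (cases q)
      have r: "A \<in> H.reps" "B \<in> H.reps" "C' \<in> H.reps" "D \<in> H.reps" using q by (auto simp: qe H.quads_def)
      have ne: "H.SES C' D (rep n) \<noteq> {}" "H.SES A B (rep m) \<noteq> {}" using q by (auto simp: qe H.frames_def)
      note k = gc_carrier[OF H.reps_obj[OF r(1)]] gc_carrier[OF H.reps_obj[OF r(2)]]
        gc_carrier[OF H.reps_obj[OF r(3)]] gc_carrier[OF H.reps_obj[OF r(4)]]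
      let ?g = "gc"
      \<comment> \<open>All four corners divide the degree of the central object, hence their
        classes lie in \<open>J\<close>, and the summation range of Green's formula can be
        enlarged.\<close>
      have e: "dg m \<otimes>\<^bsub>\<Gamma>\<^esub> dg n = (?g A \<otimes>\<^bsub>\<Gamma>\<^esub> ?g B) \<otimes>\<^bsub>\<Gamma>\<^esub> (?g C' \<otimes>\<^bsub>\<Gamma>\<^esub> ?g D)"
        using SES_gc[OF ne(1)] SES_gc[OF ne(2)] by (simp add: dg_def)
      have "iso_class C A \<in> J"
        by (rule subsetD[OF J(3)], rule lwI[OF r(1), of "?g B \<otimes>\<^bsub>\<Gamma>\<^esub> (?g C' \<otimes>\<^bsub>\<Gamma>\<^esub> ?g D)"]) (use e k G.m_assoc in simp_all)
      moreover have "iso_class C B \<in> J"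
        by (rule subsetD[OF J(3)], rule lwI[OF r(2), of "?g A \<otimes>\<^bsub>\<Gamma>\<^esub> (?g C' \<otimes>\<^bsub>\<Gamma>\<^esub> ?g D)"]) (use e k in \<open>simp_all add: G.m_ac\<close>)
      moreover have "iso_class C C' \<in> J"
        by (rule subsetD[OF J(3)], rule lwI[OF r(3), of "?g A \<otimes>\<^bsub>\<Gamma>\<^esub> (?g B \<otimes>\<^bsub>\<Gamma>\<^esub> ?g D)"]) (use e k in \<open>simp_all add: G.m_ac\<close>)
      moreover have "iso_class C D \<in> J"
        by (rule subsetD[OF J(3)], rule lwI[OF r(4), of "?g A \<otimes>\<^bsub>\<Gamma>\<^esub> (?g B \<otimes>\<^bsub>\<Gamma>\<^esub> ?g C')"]) (use e k in \<open>simp_all add: G.m_ac\<close>)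
      ultimately have "(iso_class C A, iso_class C B, iso_class C C', iso_class C D) \<in> J \<times> J \<times> J \<times> J" by blast
      moreover have "q = ?r (iso_class C A, iso_class C B, iso_class C C', iso_class C D)"
        using reps_rep r unfolding qe by auto
      ultimately show "q \<in> ?r ` (J \<times> J \<times> J \<times> J)" by (rule rev_image_eqI)
    qed
    have "q \<in> H.quads" if "q \<in> ?r ` (J \<times> J \<times> J \<times> J)" for q
      using that rep_reps J(2) by (auto simp: H.quads_def)
    then show "\<forall>q\<in>?r ` (J \<times> J \<times> J \<times> J) - {q. q \<in> H.quads \<and> ?fr q \<noteq> {}}. ?w q = 0" by auto
  qed
  also have "\<dots> = (\<Sum>q\<in>J \<times> J \<times> J \<times> J. ?w (?r q))"
  proof (rule sum.reindex_cong[OF _ refl refl])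
    show "inj_on ?r (J \<times> J \<times> J \<times> J)"
      by (rule inj_onI) (use inj_onD[OF rep_inj_sub[OF J(2)]] in \<open>auto split: prod.splits\<close>)
  qed
  also have "\<dots> = (\<Sum>(a, b, c, d)\<in>J \<times> J \<times> J \<times> J.
    chi C (dg a) (dg d) * (hn c d n * hn b d y * hn a c x * hn a b m) / (aut a * aut b * aut c * aut d))"
    using J(2) rep_Obj chi_eq
    by (intro sum.cong refl) (auto simp: H.frames_def card_cartesian_product hn_SES aut_au dg_def subset_iff)
  also have "\<dots> = (\<Sum>a\<in>J. \<Sum>b\<in>J. \<Sum>c\<in>J. \<Sum>d\<in>J.
    chi C (dg a) (dg d) * (hn c d n * hn b d y * hn a c x * hn a b m) / (aut a * aut b * aut c * aut d))"
    by (simp only: sum.cartesian_product)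
  finally show ?thesis .
qed

lemma finite_ends: "finite (ends \<gamma>)"
  unfolding ends_def by (intro finite_imageI finite_gc)

text \<open>The summand \<open>rep b\<close> is added to an object of maximal endomorphism count in
  degree \<open>dg a\<close>. Being nonzero, \<open>rep b\<close> has two distinct endomorphisms,
  zero and the identity, so the count at least doubles.\<close>

lemma ends_less:
  assumes "a \<in> Iso C" "b \<in> Iso C" "b \<noteq> zero_class C"
  shows "Max (ends (dg a)) < Max (ends (dg a \<otimes>\<^bsub>\<Gamma>\<^esub> dg b))"
proof -
  have "card (ohm (rep a) (rep a)) \<in> ends (dg a)"
    unfolding ends_def using rep_reps[OF assms(1)] by (auto simp: H.reps_def dg_def)
  then have "Max (ends (dg a)) \<in> ends (dg a)" using Max_in finite_ends by blast
  then obtain X where X: "X \<in> rpc ` Obj C" "gc X = dg a" "Max (ends (dg a)) = card (ohm X X)"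
    by (auto simp: ends_def)
  have Xo: "X \<in> Obj C" using X(1) rpc_Obj by blast
  let ?B = "rep b"
  have Bo: "?B \<in> Obj C" using rep_Obj[OF assms(2)] .
  obtain S i1 i2 p1 p2 where S: "S \<in> rpc ` Obj C" and bp: "L.bip X ?B S i1 i2 p1 p2" using bip_reps[OF Xo Bo] .
  have "gc S = dg a \<otimes>\<^bsub>\<Gamma>\<^esub> dg b" using gc_mult_bip[OF bp] X(2) by (simp add: dg_def)
  then have "card (ohm S S) \<le> Max (ends (dg a \<otimes>\<^bsub>\<Gamma>\<^esub> dg b))"
    using S finite_ends by (intro Max_ge) (auto simp: ends_def)
  moreover have "card (ohm X X) * card (ohm ?B ?B) \<le> card (ohm S S)" using L.card_end_biproduct[OF bp finite_ohm] .
  moreover have "card (ohm X X) > 0" using L.idn_hom[OF Xo] finite_ohm by (auto simp: card_gt_0_iff)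
  moreover have "card (ohm ?B ?B) \<ge> 2"
  proof -
    have "\<not> L.Z (Some (Idt C ?B))" using zero_classI[OF assms(2)] assms(3) Bo by (auto simp: is_zero_object_iff)
    then have "Some (Idt C ?B) \<noteq> Some (Zer C ?B ?B)" using L.zerop_zero[OF Bo Bo] by metis
    then have "card {Some (Idt C ?B), Some (Zer C ?B ?B)} = 2" by simp
    moreover have "{Some (Idt C ?B), Some (Zer C ?B ?B)} \<subseteq> ohm ?B ?B" using L.idn_hom[OF Bo] L.zero_hom[OF Bo Bo] by blast
    ultimately show ?thesis using card_mono[OF finite_ohm] by metis
  qed
  ultimately show ?thesis unfolding X(3)
    by (metis (no_types, lifting) le_trans less_le_trans mult_le_mono2 mult_2_right add.commute less_add_same_cancel1 mult_2)
qed

lemma hall_data: "hall_data \<Gamma> (chi C) (Iso C) dg aut hn (zero_class C) (\<lambda>\<gamma>. Max (ends \<gamma>))"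
proof (intro hall_data.intro chi_bicharacter hall_data_axioms.intro; (unfold lw_def[symmetric])?)
  show "0 < aut a" if "a \<in> Iso C" for a using H.au_pos[OF rep_Obj[OF that]] by (simp add: aut_au)
  show "carrier \<Gamma> = dg ` Iso C" by (rule carrier_dg)
  show "zero_class C \<in> Iso C" by (rule zero_obj(1))
  show "dg (zero_class C) = \<one>\<^bsub>\<Gamma>\<^esub>" using one_groth[OF zero_obj(2)] by (simp add: dg_def)
  show "aut (zero_class C) = 1" by (rule aut_zero)
  show "a = zero_class C" if "a \<in> Iso C" "b \<in> Iso C" "dg a \<otimes>\<^bsub>\<Gamma>\<^esub> dg b = \<one>\<^bsub>\<Gamma>\<^esub>" for a b using dg_one that .
  show "finite (lw \<gamma>)" for \<gamma> by (rule finite_lw)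
  show "dg c = dg a \<otimes>\<^bsub>\<Gamma>\<^esub> dg b" if "hn a b c \<noteq> 0" for a b c using hn_dg that .
  show "hn a (zero_class C) c = (if a = c then aut a else 0)" if "a \<in> Iso C" "c \<in> Iso C" for a c using hn_zero(1) that .
  show "hn (zero_class C) b c = (if b = c then aut b else 0)" if "b \<in> Iso C" "c \<in> Iso C" for b c using hn_zero(2) that .
  show "(\<Sum>x\<in>J. hn x c y * hn a b x / aut x) = (\<Sum>x\<in>J. hn a x y * hn b c x / aut x)"
    if "a \<in> Iso C" "b \<in> Iso C" "c \<in> Iso C" "y \<in> Iso C" "finite J" "J \<subseteq> Iso C" "lw (dg y) \<subseteq> J" for a b c y J
    using hn_assoc that .
  show "(\<Sum>e\<in>J. hn m n e * hn x y e / aut e) = (\<Sum>a\<in>J. \<Sum>b\<in>J. \<Sum>c\<in>J. \<Sum>d\<in>J.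
      chi C (dg a) (dg d) * (hn c d n * hn b d y * hn a c x * hn a b m) / (aut a * aut b * aut c * aut d))"
    if "m \<in> Iso C" "n \<in> Iso C" "x \<in> Iso C" "y \<in> Iso C" "finite J" "J \<subseteq> Iso C" "lw (dg m \<otimes>\<^bsub>\<Gamma>\<^esub> dg n) \<subseteq> J" for m n x y J
    using hn_green that .
  show "Max (ends (dg a)) < Max (ends (dg a \<otimes>\<^bsub>\<Gamma>\<^esub> dg b))" if "a \<in> Iso C" "b \<in> Iso C" "b \<noteq> zero_class C" for a b
    using ends_less that .
qed

lemma hall_algebra_eq: "hall_algebra C = hall_data.hall (Iso C) dg aut hn (zero_class C)"
proof -
  have n: "hall_data.num aut hn a b c = hall_number C (rep a) (rep b) (rep c)" for a b c
    by (simp add: hall_data.num_def[OF hall_data] hall_number_def hn_def aut_def)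
  have cn: "hall_data.conum aut hn a b c = hall_conumber C (rep a) (rep b) (rep c)" for a b c
    by (simp add: hall_data.conum_def[OF hall_data] n hall_conumber_def aut_def)
  have "hall_data.prd (Iso C) aut hn = hall_prod C"
    by (intro ext) (simp add: hall_data.prd_def[OF hall_data] hall_data.pr_basis_def[OF hall_data] n hall_prod_def)
  moreover have "hall_data.coprd (Iso C) aut hn = hall_coprod C"
    by (intro ext) (simp add: hall_data.coprd_def[OF hall_data] hall_data.copr_basis_def[OF hall_data] cn hall_coprod_def)
  moreover have "hall_data.part (Iso C) dg = (\<lambda>\<gamma>. Q.span {basis (iso_class C M) | M. M \<in> Obj C \<and> gc M = \<gamma>})"
  proof
    fix \<gamma>
    have g: "gc (rep (iso_class C M)) = gc M" if "M \<in> Obj C" for M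
      using gc_rpc[OF that] by (simp add: rpc_def)
    have "{bas a | a. a \<in> Iso C \<and> dg a = \<gamma>} = {basis (iso_class C M) | M. M \<in> Obj C \<and> gc M = \<gamma>}"
      unfolding dg_def Iso_def using g by blast
    then show "hall_data.part (Iso C) dg \<gamma> = Q.span {basis (iso_class C M) | M. M \<in> Obj C \<and> gc M = \<gamma>}"
      by (simp add: hall_data.part_def[OF hall_data])
  qed
  ultimately show ?thesis by (simp add: hall_data.hall_def[OF hall_data] hall_algebra_def)
qed

end

theorem theorem1p7:
  fixes \<A> :: "('o, 'm) cat"
  assumes "abelian_category \<A>"
    and "profinitary \<A>"
    and "hereditary \<A>"
  shows "nichols_algebra (groth_monoid \<A>) (chi \<A>) (hall_algebra \<A>)
           (primitives (groth_monoid \<A>) (hall_algebra \<A>))"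
proof -
  interpret hall_cat \<A> using assms by (intro hall_cat.intro hall_cat_axioms.intro)
  show ?thesis using hall_data.hall_nichols[OF hall_data] by (simp add: hall_algebra_eq)
qed

end
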